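(* Let $M=(M_k)$ be a weakly log-convex weight sequence with moderate growth, let $p\in[1,\infty)$, and let $\ell,m,n$ be positive integers. Then the mapping $f\mapsto f^\vee$, $f^\vee(x)(y)=f(x,y)$, gives bornological isomorphisms \begin{align*} W^{\infty,p}(\mathbb R^\ell\times\mathbb R^m,\mathbb R^n)&\cong W^{\infty,p}(\mathbb R^\ell,W^{\infty,p}(\mathbb R^m,\mathbb R^n)),\\ W^{[M],p}(\mathbb R^\ell\times\mathbb R^m,\mathbb R^n)&\cong W^{[M],p}(\mathbb R^\ell,W^{[M],p}(\mathbb R^m,\mathbb R^n)), \end{align*} where the right-hand sides carry the topologies specified in the context and $[M]$ stands either for $(M)$ throughout or for $\{M\}$ throughout (the statement holds in both cases). For $W^{\infty,p}$ and $W^{(M),p}$ the isomorphisms are even topological.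
   Context: A bornological isomorphism is a linear bijection which, together with its inverse, maps bounded sets to bounded sets. A weight sequence is a sequence $M=(M_k)_{k\in\mathbb N}$, $\mathbb N=\{0,1,\dots\}$, of positive reals with $M_0=1\le M_1$. It is weakly log-convex if $(k!M_k)_k$ is log-convex, and has moderate growth if $\sup_{j,k\ge1}\big(\tfrac{M_{j+k}}{M_jM_k}\big)^{1/(j+k)}<\infty$. Scalar spaces: $W^{\infty,p}(\mathbb R^m)=\{f\in C^\infty(\mathbb R^m):\|f^{(\alpha)}\|_{L^p(\mathbb R^m)}<\infty\ \forall\alpha\in\mathbb N^m\}$ with its natural Fréchet topology. For $\rho>0$, $W^{M,p}_\rho(\mathbb R^m)$ is the Banach space of $f\in C^\infty(\mathbb R^m)$ with norm $\sup_{\alpha\in\mathbb N^m}\frac{\|f^{(\alpha)}\|_{L^p(\mathbb R^m)}}{\rho^{|\alpha|}|\alpha|!M_{|\alpha|}}<\infty$; $W^{(M),p}(\mathbb R^m):=\varprojlim_nW^{M,p}_{1/n}(\mathbb R^m)$ and $W^{\{M\},p}(\mathbb R^m):=\varinjlim_nW^{M,p}_n(\mathbb R^m)$ (locally convex limits, $n\ge1$). For values in $\mathbb R^n$ take $n$-fold products. Vector-valued spaces: for a locally convex space $F$, $W^{\infty,p}(\mathbb R^\ell,F)$ is the set of $f\in C^\infty(\mathbb R^\ell,F)$ with $\|s\circ f^{(\alpha)}\|_{L^p(\mathbb R^\ell)}<\infty$ for all $\alpha\in\mathbb N^\ell$ and all continuous seminorms $s$ on $F$; $W^{(M),p}(\mathbb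 R^\ell,F)$ (resp. $W^{\{M\},p}(\mathbb R^\ell,F)$) is the set of $f\in C^\infty(\mathbb R^\ell,F)$ such that for every continuous seminorm $s$ on $F$ and for all $\sigma>0$ (resp. there exists $\sigma>0$ such that) $\sup_{\alpha\in\mathbb N^\ell}\frac{\|s\circ f^{(\alpha)}\|_{L^p(\mathbb R^\ell)}}{\sigma^{|\alpha|}|\alpha|!M_{|\alpha|}}<\infty$. Topologies on the right-hand sides. For $g:\mathbb R^\ell\to C^\infty(\mathbb R^m,\mathbb R^n)$, $\alpha\in\mathbb N^\ell$, $\beta\in\mathbb N^m$ put $N_{\alpha,\beta}(g):=\big(\int_{\mathbb R^\ell}\|\partial_2^\beta(g^{(\alpha)}(x))\|_{L^p(\mathbb R^m)}^p\,dx\big)^{1/p}$, where $\partial_2^\beta$ is differentiation in the $\mathbb R^m$-variable. Let $\mathscr R$ be the set of sequences $(r_k)_{k\in\mathbb N}$ of positive reals with $r_k\sigma^k\to0$ for all $\sigma>0$. - $W^{\infty,p}(\mathbb R^\ell,W^{\infty,p}(\mathbb R^m,\mathbb R^n))$: the Fréchet topology with fundamental system of seminorms $N_{\alpha,\beta}$, $\alpha\in\mathbb N^\ell,\beta\in\mathbb N^m$. - $W^{(M),p}(\mathbb R^\ell,W^{(M),p}(\mathbb R^m,\mathbb R^n))$: the Fréchet topology with fundamental system of seminorms $g\mapsto\sup_{\alpha,\beta}\frac{N_{\alpha,\beta}(g)}{\tau^{|\beta|}\sigma^{|\alpha|}|\beta|!|\alpha|!M_{|\beta|}M_{|\alpha|}}$,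 $\sigma,\tau>0$. - $W^{\{M\},p}(\mathbb R^\ell,W^{\{M\},p}(\mathbb R^m,\mathbb R^n))$: the locally convex topology with fundamental system of seminorms $g\mapsto\sup_{\alpha,\beta}t_{|\beta|}r_{|\alpha|}\frac{N_{\alpha,\beta}(g)}{|\beta|!|\alpha|!M_{|\beta|}M_{|\alpha|}}$, $(r_k),(t_k)\in\mathscr R$. *)

theory Defs
  imports "HOL-Analysis.Analysis" "HOL-Library.Function_Algebras"
begin

instantiation "fun" :: (type, real_vector) real_vector
begin

definition scaleR_fun :: "real \<Rightarrow> ('a \<Rightarrow> 'b) \<Rightarrow> 'a \<Rightarrow> 'b" where
  "scaleR_fun c f = (\<lambda>x. c *\<^sub>R f x)"

instance
  by standard (auto simp: scaleR_fun_def fun_eq_iff scaleR_add_right scaleR_add_left)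

end

text \<open>
  A locally convex space is given by a topology on a type of class real vector space, whose
  \<^const>\<open>topspace\<close> is the underlying linear subspace. The topology that the type class
  system assigns to function types (pointwise convergence) is never used.
\<close>

definition seminorm_on :: "'v::real_vector set \<Rightarrow> ('v \<Rightarrow> real) \<Rightarrow> bool" where
  "seminorm_on V s \<longleftrightarrow>
     (\<forall>x\<in>V. 0 \<le> s x) \<and>
     (\<forall>x\<in>V. \<forall>y\<in>V. s (x + y) \<le> s x + s y) \<and>
     (\<forall>c. \<forall>x\<in>V. s (c *\<^sub>R x) = \<bar>c\<bar> * s x)"

definition continuous_seminorm :: "'v::real_vector topology \<Rightarrow> ('v \<Rightarrow> real) \<Rightarrow> bool" where
  "continuous_seminorm X s \<longleftrightarrow> seminorm_on (topspace X) s \<and> continuous_map X euclideanreal s"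

definition seminorm_topology ::
    "'v::real_vector set \<Rightarrow> ('v \<Rightarrow> real) set \<Rightarrow> 'v topology" where
  "seminorm_topology V P =
     topology_generated_by (insert V {{y \<in> V. q (y - x) < e} | q x e. q \<in> P \<and> x \<in> V \<and> 0 < e})"

text \<open>
  The two locally convex limits are only needed for families of subspaces of one vector space,
  with inclusions as connecting maps. The projective limit carries the coarsest topology making
  all inclusions into the steps continuous, the inductive limit the finest locally convex
  topology making all inclusions of the steps continuous: a seminorm on the union is continuous
  iff its restriction to every step is.
\<close>

definition projective_limit :: "'i set \<Rightarrow> ('i \<Rightarrow> 'v topology) \<Rightarrow> 'v topology" where
  "projective_limit I X =
     (let V = (\<Inter>i\<in>I. topspace (X i)) in
      topology_generated_by (insert V {U \<inter> V | i U. i \<in> I \<and> openin (X i) U}))"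

definition lc_inductive_limit :: "'i set \<Rightarrow> ('i \<Rightarrow> 'v::real_vector topology) \<Rightarrow> 'v topology" where
  "lc_inductive_limit I X =
     (let V = (\<Union>i\<in>I. topspace (X i)) in
      seminorm_topology V {s. seminorm_on V s \<and> (\<forall>i\<in>I. continuous_map (X i) euclideanreal s)})"

text \<open>
  The \<open>n\<close>-fold product of a space of scalar functions, its elements being regarded as
  functions with values in \<open>\<real>\<^sup>n\<close>.
\<close>

definition vec_valued :: "('a \<Rightarrow> real) topology \<Rightarrow> ('a \<Rightarrow> real ^ 'n) topology" where
  "vec_valued X = pullback_topology UNIV (\<lambda>f i x. f x $ i) (product_topology (\<lambda>_::'n. X) UNIV)"

definition vn_bounded :: "'v::real_vector topology \<Rightarrow> 'v set \<Rightarrow> bool" where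
  "vn_bounded X B \<longleftrightarrow>
     B \<subseteq> topspace X \<and>
     (\<forall>U. openin X U \<and> 0 \<in> U \<longrightarrow> (\<exists>s>0. \<forall>t>s. B \<subseteq> (\<lambda>x. t *\<^sub>R x) ` U))"

definition linear_on_space ::
    "'v::real_vector topology \<Rightarrow> ('v \<Rightarrow> 'w::real_vector) \<Rightarrow> bool" where
  "linear_on_space X \<phi> \<longleftrightarrow>
     (\<forall>x\<in>topspace X. \<forall>y\<in>topspace X. \<phi> (x + y) = \<phi> x + \<phi> y) \<and>
     (\<forall>c. \<forall>x\<in>topspace X. \<phi> (c *\<^sub>R x) = c *\<^sub>R \<phi> x)"

definition bornological_isomorphism ::
    "'v::real_vector topology \<Rightarrow> 'w::real_vector topology \<Rightarrow> ('v \<Rightarrow> 'w) \<Rightarrow> bool" where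
  "bornological_isomorphism X Y \<phi> \<longleftrightarrow>
     linear_on_space X \<phi> \<and> bij_betw \<phi> (topspace X) (topspace Y) \<and>
     (\<forall>B. vn_bounded X B \<longrightarrow> vn_bounded Y (\<phi> ` B)) \<and>
     (\<forall>B. vn_bounded Y B \<longrightarrow> vn_bounded X (inv_into (topspace X) \<phi> ` B))"

text \<open>
  The domain is a Euclidean space with its standard coordinates; for \<open>\<real>\<^sup>\<ell> \<times> \<real>\<^sup>m\<close> these are the
  coordinates of both factors. The parameter \<open>X\<close> is the (Hausdorff) target space in
  which difference quotients converge.
\<close>

definition partial_at ::
    "'v::real_vector topology \<Rightarrow> 'a::euclidean_space \<Rightarrow> ('a \<Rightarrow> 'v) \<Rightarrow> 'a \<Rightarrow> 'v \<Rightarrow> bool" where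
  "partial_at X b f x d \<longleftrightarrow>
     limitin X (\<lambda>h::real. inverse h *\<^sub>R (f (x + h *\<^sub>R b) - f x)) d (at 0)"

definition pderivative ::
    "'v::real_vector topology \<Rightarrow> 'a::euclidean_space \<Rightarrow> ('a \<Rightarrow> 'v) \<Rightarrow> 'a \<Rightarrow> 'v" where
  "pderivative X b f = (\<lambda>x. SOME d. partial_at X b f x d)"

definition smooth_into ::
    "'v::real_vector topology \<Rightarrow> ('a::euclidean_space \<Rightarrow> 'v) \<Rightarrow> bool" where
  "smooth_into X f \<longleftrightarrow>
     (\<forall>bs. set bs \<subseteq> Basis \<longrightarrow>
        continuous_map euclidean X (foldr (pderivative X) bs f) \<and>
        (\<forall>b\<in>Basis. \<forall>x. \<exists>d. partial_at X b (foldr (pderivative X) bs f) x d))"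

text \<open>
  A multi-index is a function \<open>\<alpha>\<close> on the basis vectors (its values elsewhere are irrelevant).
  The derivative of order \<open>\<alpha>\<close> is taken in a fixed but arbitrary order of the coordinates; for
  smooth maps the order does not matter.
\<close>

definition basis_list :: "'a::euclidean_space list" where
  "basis_list = (SOME bs. distinct bs \<and> set bs = Basis)"

definition mi_deriv ::
    "'v::real_vector topology \<Rightarrow> ('a::euclidean_space \<Rightarrow> nat) \<Rightarrow> ('a \<Rightarrow> 'v) \<Rightarrow> 'a \<Rightarrow> 'v" where
  "mi_deriv X \<alpha> f = foldr (\<lambda>b. pderivative X b ^^ \<alpha> b) basis_list f"

definition mi_order :: "('a::euclidean_space \<Rightarrow> nat) \<Rightarrow> nat" where
  "mi_order \<alpha> = (\<Sum>b\<in>Basis. \<alpha> b)"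

text \<open>Powers with positive exponent \<open>a\<close> in \<open>[0, \<infinity>]\<close>.\<close>

definition epowr :: "ennreal \<Rightarrow> real \<Rightarrow> ennreal" where
  "epowr x a = (if x = \<infinity> then \<infinity> else ennreal (enn2real x powr a))"

definition eLp_norm :: "real \<Rightarrow> ('a::euclidean_space \<Rightarrow> 'b::real_normed_vector) \<Rightarrow> ennreal" where
  "eLp_norm p f = epowr (\<integral>\<^sup>+x. epowr (ennreal (norm (f x))) p \<partial>lborel) (1 / p)"

definition weight_sequence :: "(nat \<Rightarrow> real) \<Rightarrow> bool" where
  "weight_sequence M \<longleftrightarrow> (\<forall>k. 0 < M k) \<and> M 0 = 1 \<and> 1 \<le> M 1"

definition log_convex :: "(nat \<Rightarrow> real) \<Rightarrow> bool" where
  "log_convex a \<longleftrightarrow> (\<forall>k\<ge>1. (a k)\<^sup>2 \<le> a (k - 1) * a (k + 1))"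

definition weakly_log_convex :: "(nat \<Rightarrow> real) \<Rightarrow> bool" where
  "weakly_log_convex M \<longleftrightarrow> log_convex (\<lambda>k. fact k * M k)"

definition moderate_growth :: "(nat \<Rightarrow> real) \<Rightarrow> bool" where
  "moderate_growth M \<longleftrightarrow>
     bdd_above {(M (j + k) / (M j * M k)) powr (1 / real (j + k)) | j k. 1 \<le> j \<and> 1 \<le> k}"

definition W_inf :: "real \<Rightarrow> ('a::euclidean_space \<Rightarrow> real) topology" where
  "W_inf p =
     seminorm_topology {f. smooth_into euclidean f \<and> (\<forall>\<alpha>. eLp_norm p (mi_deriv euclidean \<alpha> f) < \<infinity>)}
       {\<lambda>f. enn2real (eLp_norm p (mi_deriv euclidean \<alpha> f)) | \<alpha>. True}"

definition ultra_norm ::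
    "(nat \<Rightarrow> real) \<Rightarrow> real \<Rightarrow> real \<Rightarrow> ('a::euclidean_space \<Rightarrow> real) \<Rightarrow> ennreal" where
  "ultra_norm M p \<rho> f =
     (SUP \<alpha>. eLp_norm p (mi_deriv euclidean \<alpha> f) /
        ennreal (\<rho> ^ mi_order \<alpha> * fact (mi_order \<alpha>) * M (mi_order \<alpha>)))"

definition W_step :: "(nat \<Rightarrow> real) \<Rightarrow> real \<Rightarrow> real \<Rightarrow> ('a::euclidean_space \<Rightarrow> real) topology" where
  "W_step M p \<rho> =
     seminorm_topology {f. smooth_into euclidean f \<and> ultra_norm M p \<rho> f < \<infinity>}
       {\<lambda>f. enn2real (ultra_norm M p \<rho> f)}"

definition W_beurling :: "(nat \<Rightarrow> real) \<Rightarrow> real \<Rightarrow> ('a::euclidean_space \<Rightarrow> real) topology" where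
  "W_beurling M p = projective_limit {1..} (\<lambda>n::nat. W_step M p (1 / real n))"

definition W_roumieu :: "(nat \<Rightarrow> real) \<Rightarrow> real \<Rightarrow> ('a::euclidean_space \<Rightarrow> real) topology" where
  "W_roumieu M p = lc_inductive_limit {1..} (\<lambda>n::nat. W_step M p (real n))"

definition LW_inf ::
    "real \<Rightarrow> 'v::real_vector topology \<Rightarrow> ('a::euclidean_space \<Rightarrow> 'v) set" where
  "LW_inf p X =
     {f. smooth_into X f \<and>
         (\<forall>\<alpha> s. continuous_seminorm X s \<longrightarrow> eLp_norm p (s \<circ> mi_deriv X \<alpha> f) < \<infinity>)}"

definition ultra_seminorm ::
    "(nat \<Rightarrow> real) \<Rightarrow> real \<Rightarrow> 'v::real_vector topology \<Rightarrow> ('v \<Rightarrow> real) \<Rightarrow> real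
       \<Rightarrow> ('a::euclidean_space \<Rightarrow> 'v) \<Rightarrow> ennreal" where
  "ultra_seminorm M p X s \<sigma> f =
     (SUP \<alpha>. eLp_norm p (s \<circ> mi_deriv X \<alpha> f) /
        ennreal (\<sigma> ^ mi_order \<alpha> * fact (mi_order \<alpha>) * M (mi_order \<alpha>)))"

definition LW_beurling ::
    "(nat \<Rightarrow> real) \<Rightarrow> real \<Rightarrow> 'v::real_vector topology \<Rightarrow> ('a::euclidean_space \<Rightarrow> 'v) set" where
  "LW_beurling M p X =
     {f. smooth_into X f \<and>
         (\<forall>s. continuous_seminorm X s \<longrightarrow> (\<forall>\<sigma>>0. ultra_seminorm M p X s \<sigma> f < \<infinity>))}"

definition LW_roumieu ::
    "(nat \<Rightarrow> real) \<Rightarrow> real \<Rightarrow> 'v::real_vector topology \<Rightarrow> ('a::euclidean_space \<Rightarrow> 'v) set" where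
  "LW_roumieu M p X =
     {f. smooth_into X f \<and>
         (\<forall>s. continuous_seminorm X s \<longrightarrow> (\<exists>\<sigma>>0. ultra_seminorm M p X s \<sigma> f < \<infinity>))}"

text \<open>
  The quantity \<open>N\<^sub>\<alpha>\<^sub>,\<^sub>\<beta>(g)\<close>: the outer derivative is taken in the locally convex space \<open>X\<close> of
  functions of the inner variable, the inner derivative is the usual partial derivative.
\<close>

definition mixed_norm ::
    "real \<Rightarrow> ('b::euclidean_space \<Rightarrow> real ^ 'n) topology \<Rightarrow> ('a::euclidean_space \<Rightarrow> nat) \<Rightarrow> ('b \<Rightarrow> nat)
       \<Rightarrow> ('a \<Rightarrow> 'b \<Rightarrow> real ^ 'n) \<Rightarrow> ennreal" where
  "mixed_norm p X \<alpha> \<beta> g =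
     epowr (\<integral>\<^sup>+x. epowr (eLp_norm p (mi_deriv euclidean \<beta> (mi_deriv X \<alpha> g x))) p \<partial>lborel) (1 / p)"

definition WW_inf ::
    "real \<Rightarrow> ('a::euclidean_space \<Rightarrow> 'b::euclidean_space \<Rightarrow> real ^ 'n) topology" where
  "WW_inf p =
     (let X = vec_valued (W_inf p) in
      seminorm_topology (LW_inf p X) {\<lambda>g. enn2real (mixed_norm p X \<alpha> \<beta> g) | \<alpha> \<beta>. True})"

definition WW_beurling ::
    "(nat \<Rightarrow> real) \<Rightarrow> real
       \<Rightarrow> ('a::euclidean_space \<Rightarrow> 'b::euclidean_space \<Rightarrow> real ^ 'n) topology" where
  "WW_beurling M p =
     (let X = vec_valued (W_beurling M p) in
      seminorm_topology (LW_beurling M p X)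
        {\<lambda>g. enn2real (SUP (\<alpha>, \<beta>). mixed_norm p X \<alpha> \<beta> g /
            ennreal (\<tau> ^ mi_order \<beta> * \<sigma> ^ mi_order \<alpha> * fact (mi_order \<beta>) * fact (mi_order \<alpha>) *
              M (mi_order \<beta>) * M (mi_order \<alpha>)))
         | \<sigma> \<tau>. 0 < \<sigma> \<and> 0 < \<tau>})"

definition rapid_sequences :: "(nat \<Rightarrow> real) set" where
  "rapid_sequences = {r. (\<forall>k. 0 < r k) \<and> (\<forall>\<sigma>>0. (\<lambda>k. r k * \<sigma> ^ k) \<longlonglongrightarrow> 0)}"

definition WW_roumieu ::
    "(nat \<Rightarrow> real) \<Rightarrow> real
       \<Rightarrow> ('a::euclidean_space \<Rightarrow> 'b::euclidean_space \<Rightarrow> real ^ 'n) topology" where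
  "WW_roumieu M p =
     (let X = vec_valued (W_roumieu M p) in
      seminorm_topology (LW_roumieu M p X)
        {\<lambda>g. enn2real (SUP (\<alpha>, \<beta>). ennreal (t (mi_order \<beta>) * r (mi_order \<alpha>)) *
            (mixed_norm p X \<alpha> \<beta> g /
             ennreal (fact (mi_order \<beta>) * fact (mi_order \<alpha>) * M (mi_order \<beta>) * M (mi_order \<alpha>))))
         | r t. r \<in> rapid_sequences \<and> t \<in> rapid_sequences})"

end

theory Submission
  imports Defs
begin

text \<open>
  Each of the spaces is given by a family of weights \<open>w\<close> through the norms
  \<open>sup\<^sub>\<alpha> w\<^sub>|\<^sub>\<alpha>\<^sub>| \<parallel>f\<^sup>(\<^sup>\<alpha>\<^sup>)\<parallel>\<^sub>p\<close>: indicators of \<open>{0..k}\<close> for \<open>W\<^sup>\<infinity>\<close>, the weights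
  \<open>1 / (\<sigma>\<^sup>k k! M\<^sub>k)\<close> in the Beurling case, and \<open>r\<^sub>k / (k! M\<^sub>k)\<close> with \<open>r\<close> rapidly decreasing in the
  Roumieu case. By Fubini the mixed norms of \<open>f\<^sup>\<or>\<close> are the \<open>L\<^sup>p\<close> norms of the partial derivatives of \<open>f\<close>,
  and weak log-convexity and moderate growth allow to split weights at \<open>j + k\<close> into weights
  at \<open>j\<close> and \<open>k\<close> and back. A Sobolev-type estimate bounds the \<open>L\<^sup>p\<close> norm in the inner variable, uniformly
  in the outer one, by \<open>L\<^sup>p\<close> norms of finitely many more derivatives; this makes \<open>f\<^sup>\<or>\<close> smooth into the
  space of functions of the inner variable. Conversely, point evaluations are continuous on that
  space, so a smooth map into it uncurries to a smooth function. The inductive limit in the Roumieu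
  case may be finer than the topology of the rapidly decreasing weights, but both have
  the same bounded sets.
\<close>

section \<open>Topologies generated by seminorms\<close>

text \<open>Two obstacles shape the proof. First, the outer condition on the curried function
  concerns all continuous seminorms of the inner space, and in the Roumieu case those of an
  inductive limit are not given by a formula. The exponential law is therefore proved once, for a
  set \<open>W\<close> of weights and a set \<open>P\<close> of seminorms on the same space, under
  two hypotheses: \<open>admissible\<close> (the topology of \<open>P\<close> is at least as fine as
  that of \<open>W\<close>) and \<open>controlled\<close> (every seminorm in \<open>P\<close> is
  bounded by a weighted norm adapted to the given \<open>f\<close>). Second, the inner norm is a
  supremum over derivatives, which cannot be pulled out of the outer integral. It is replaced by a
  sum of p-th powers over lists of basis vectors. There are \<open>DIM('b) ^ k\<close> lists of
  length \<open>k\<close>, so convergence is bought with a factor \<open>(2 * DIM('b)) ^ k\<close>.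
  This is the origin of \<open>K ^ k\<close> in \<open>weight_system\<close> and
  \<open>controlled\<close>; such geometric factors are harmless for all three kinds of
  weights.\<close>

lemma seminorm_onD:
  assumes "seminorm_on V s"
  shows seminorm_on_nonneg: "x \<in> V \<Longrightarrow> 0 \<le> s x"
    and seminorm_on_add: "x \<in> V \<Longrightarrow> y \<in> V \<Longrightarrow> s (x + y) \<le> s x + s y"
    and seminorm_on_scale: "x \<in> V \<Longrightarrow> s (c *\<^sub>R x) = \<bar>c\<bar> * s x"
  using assms by (auto simp: seminorm_on_def)

lemma seminorm_on_zero:
  assumes "seminorm_on V s" "subspace V"
  shows "s 0 = 0"
  using seminorm_on_scale[OF assms(1), of 0 0] subspace_0[OF assms(2)] by simp

lemma seminorm_on_minus_commute:
  assumes "seminorm_on V s" "subspace V" "x \<in> V" "y \<in> V"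
  shows "s (x - y) = s (y - x)"
  using seminorm_on_scale[OF assms(1), of "y - x" "-1"] subspace_diff[OF assms(2)] assms by simp

lemma seminorm_on_triangle:
  assumes "seminorm_on V s" "subspace V" "x \<in> V" "y \<in> V" "z \<in> V"
  shows "s (x - z) \<le> s (x - y) + s (y - z)"
  using seminorm_on_add[OF assms(1), of "x - y" "y - z"] subspace_diff[OF assms(2)] assms by simp

lemma seminorm_on_abs_diff:
  assumes "seminorm_on V s" "subspace V" "x \<in> V" "y \<in> V"
  shows "\<bar>s x - s y\<bar> \<le> s (x - y)"
  using seminorm_on_add[OF assms(1), of "x - y" y] seminorm_on_add[OF assms(1), of "y - x" x]
    seminorm_on_minus_commute[OF assms] subspace_diff[OF assms(2)] assms by simp

lemma seminorm_on_subset: "seminorm_on V s \<Longrightarrow> U \<subseteq> V \<Longrightarrow> seminorm_on U s"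
  by (simp add: seminorm_on_def subset_iff)

definition seminorm_family :: "'v::real_vector set \<Rightarrow> ('v \<Rightarrow> real) set \<Rightarrow> bool" where
  "seminorm_family V P \<longleftrightarrow> subspace V \<and> (\<forall>q\<in>P. seminorm_on V q)"

lemma topspace_seminorm_topology [simp]: "topspace (seminorm_topology V P) = V"
  by (auto simp: seminorm_topology_def)

lemma openin_seminorm_topology_ball:
  assumes "q \<in> P" "x \<in> V" "0 < e"
  shows "openin (seminorm_topology V P) {y \<in> V. q (y - x) < e}"
  unfolding seminorm_topology_def
  by (rule topology_generated_by_Basis, rule insertI2, rule CollectI) (use assms in metis)

text \<open>Subbasic balls have arbitrary centres. The triangle inequality recentres such a ball at
  any of its points \<open>z\<close>, with radius \<open>e - q (z - x)\<close>; for a finite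
  intersection one unites the finite sets and takes the smaller radius.\<close>

lemma openin_seminorm_topology:
  assumes "seminorm_family V P"
  shows "openin (seminorm_topology V P) U \<longleftrightarrow>
    U \<subseteq> V \<and> (\<forall>x\<in>U. \<exists>F e. finite F \<and> F \<subseteq> P \<and> 0 < e \<and> {y\<in>V. \<forall>q\<in>F. q (y - x) < e} \<subseteq> U)"
    (is "_ \<longleftrightarrow> ?nbhd U")
proof
  have V: "subspace V" and P: "\<And>q. q \<in> P \<Longrightarrow> seminorm_on V q"
    using assms by (auto simp: seminorm_family_def)
  let ?S = "insert V {{y \<in> V. q (y - x) < e} | q x e. q \<in> P \<and> x \<in> V \<and> 0 < e}"
  assume "openin (seminorm_topology V P) U"
  then have "generate_topology_on ?S U"
    unfolding seminorm_topology_def by (rule openin_topology_generated_by)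
  then show "?nbhd U"
  proof induction
    case Empty
    then show ?case by simp
  next
    case (Int A B)
    have "\<exists>F e. finite F \<and> F \<subseteq> P \<and> 0 < e \<and> {y\<in>V. \<forall>q\<in>F. q (y - x) < e} \<subseteq> A \<inter> B"
      if x: "x \<in> A \<inter> B" for x
    proof -
      obtain F e where F: "finite F" "F \<subseteq> P" "0 < e" "{y\<in>V. \<forall>q\<in>F. q (y - x) < e} \<subseteq> A"
        using Int x by blast
      obtain G d where G: "finite G" "G \<subseteq> P" "0 < d" "{y\<in>V. \<forall>q\<in>G. q (y - x) < d} \<subseteq> B"
        using Int x by blast
      show ?thesis
        by (rule exI[of _ "F \<union> G"], rule exI[of _ "min e d"]) (use F G in auto)
    qed
    then show ?case using Int by blast
  next
    case (UN K)
    show ?case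
    proof (intro conjI ballI)
      show "\<Union>K \<subseteq> V" using UN by blast
      fix x assume "x \<in> \<Union>K"
      then obtain k where k: "k \<in> K" "x \<in> k" by blast
      then obtain F e where "finite F \<and> F \<subseteq> P \<and> 0 < e \<and> {y\<in>V. \<forall>q\<in>F. q (y - x) < e} \<subseteq> k"
        using UN.IH[OF k(1)] k(2) by meson
      then show "\<exists>F e. finite F \<and> F \<subseteq> P \<and> 0 < e \<and> {y\<in>V. \<forall>q\<in>F. q (y - x) < e} \<subseteq> \<Union>K"
        using k by blast
    qed
  next
    case (Basis s)
    then consider "s = V" | q x e where "s = {y \<in> V. q (y - x) < e}" "q \<in> P" "x \<in> V" "0 < e"
      by blast
    then show ?case
    proof cases
      case 1
      then show ?thesis by (auto intro!: exI[of _ "{}"] exI[of _ "1::real"])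
    next
      case 2
      have "\<exists>F e. finite F \<and> F \<subseteq> P \<and> 0 < e \<and> {y\<in>V. \<forall>q\<in>F. q (y - z) < e} \<subseteq> s"
        if z: "z \<in> s" for z
      proof (rule exI[of _ "{q}"], rule exI[of _ "e - q (z - x)"], intro conjI)
        show "{y \<in> V. \<forall>q'\<in>{q}. q' (y - z) < e - q (z - x)} \<subseteq> s"
          using z 2 seminorm_on_triangle[OF P V, of q _ z x] by fastforce
      qed (use 2 z in auto)
      then show ?thesis using 2 by auto
    qed
  qed
next
  have V: "subspace V" and P: "\<And>q. q \<in> P \<Longrightarrow> seminorm_on V q"
    using assms by (auto simp: seminorm_family_def)
  assume U: "?nbhd U"
  show "openin (seminorm_topology V P) U"
  proof (subst openin_subopen, intro ballI)
    fix x assume x: "x \<in> U"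
    then obtain F e where F: "finite F" "F \<subseteq> P" "0 < e" "{y\<in>V. \<forall>q\<in>F. q (y - x) < e} \<subseteq> U"
      using U by blast
    have xV: "x \<in> V" using x U by blast
    have "openin (seminorm_topology V P) (V \<inter> (\<Inter>q\<in>F. {y \<in> V. q (y - x) < e}))"
    proof (cases "F = {}")
      case True
      then show ?thesis using openin_topspace[of "seminorm_topology V P"] by simp
    next
      case False
      have "openin (seminorm_topology V P) {y \<in> V. q (y - x) < e}" if "q \<in> F" for q
        by (rule openin_seminorm_topology_ball) (use that F xV in auto)
      then have "openin (seminorm_topology V P) (\<Inter>q\<in>F. {y \<in> V. q (y - x) < e})"
        using F False by (intro openin_Inter) auto
      from openin_Int[OF openin_topspace this] show ?thesis by simp
    qed
    moreover have "V \<inter> (\<Inter>q\<in>F. {y \<in> V. q (y - x) < e}) \<subseteq> U" using F by blast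
    moreover have "q (x - x) < e" if "q \<in> F" for q
      using that F(2,3) seminorm_on_zero[OF P V, of q] by auto
    then have "x \<in> V \<inter> (\<Inter>q\<in>F. {y \<in> V. q (y - x) < e})"
      using xV by blast
    ultimately show "\<exists>T. openin (seminorm_topology V P) T \<and> x \<in> T \<and> T \<subseteq> U" by blast
  qed
qed

lemma openin_seminorm_topologyE:
  assumes "seminorm_family V P" "openin (seminorm_topology V P) U" "x \<in> U"
  obtains F e where "finite F" "F \<subseteq> P" "0 < e" "{y\<in>V. \<forall>q\<in>F. q (y - x) < e} \<subseteq> U"
  using assms(2,3) unfolding openin_seminorm_topology[OF assms(1)] by meson

lemma limitin_seminorm_topology:
  assumes "seminorm_family V P"
  shows "limitin (seminorm_topology V P) f l G \<longleftrightarrow>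
    l \<in> V \<and> eventually (\<lambda>x. f x \<in> V) G \<and> (\<forall>q\<in>P. ((\<lambda>x. q (f x - l)) \<longlongrightarrow> 0) G)"
proof
  have V: "subspace V" and P: "\<And>q. q \<in> P \<Longrightarrow> seminorm_on V q"
    using assms by (auto simp: seminorm_family_def)
  {
    assume L: "limitin (seminorm_topology V P) f l G"
    then have l: "l \<in> V" using limitin_topspace by fastforce
    have f: "eventually (\<lambda>x. f x \<in> V) G"
      by (metis L limitinD openin_topspace topspace_seminorm_topology l)
    have "((\<lambda>x. q (f x - l)) \<longlongrightarrow> 0) G" if q: "q \<in> P" for q
    proof (rule tendstoI)
      fix e :: real assume e: "0 < e"
      have "openin (seminorm_topology V P) {y \<in> V. q (y - l) < e}"
        by (rule openin_seminorm_topology_ball) (use q e l in auto)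
      then have "eventually (\<lambda>x. f x \<in> {y \<in> V. q (y - l) < e}) G"
        by (rule limitinD[OF L]) (use l e seminorm_on_zero[OF P[OF q] V] in simp)
      then show "eventually (\<lambda>x. dist (q (f x - l)) 0 < e) G"
        by eventually_elim
          (use seminorm_on_nonneg[OF P[OF q]] subspace_diff[OF V] l in \<open>auto simp: dist_real_def\<close>)
    qed
    then show "l \<in> V \<and> eventually (\<lambda>x. f x \<in> V) G \<and> (\<forall>q\<in>P. ((\<lambda>x. q (f x - l)) \<longlongrightarrow> 0) G)"
      using l f by blast
  }
  {
    assume R: "l \<in> V \<and> eventually (\<lambda>x. f x \<in> V) G \<and> (\<forall>q\<in>P. ((\<lambda>x. q (f x - l)) \<longlongrightarrow> 0) G)"
    show "limitin (seminorm_topology V P) f l G"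
      unfolding limitin_def
    proof (intro conjI allI impI)
      show "l \<in> topspace (seminorm_topology V P)" using R by simp
      fix U assume U: "openin (seminorm_topology V P) U \<and> l \<in> U"
      obtain F e where F: "finite F" "F \<subseteq> P" "0 < e" "{y\<in>V. \<forall>q\<in>F. q (y - l) < e} \<subseteq> U"
        by (rule openin_seminorm_topologyE[OF assms U[THEN conjunct1] U[THEN conjunct2]])
      have "eventually (\<lambda>x. \<forall>q\<in>F. q (f x - l) < e) G"
        using F R by (intro eventually_ball_finite) (auto intro: order_tendstoD(2))
      then show "eventually (\<lambda>x. f x \<in> U) G"
        using R[THEN conjunct2, THEN conjunct1] by eventually_elim (use F(4) in blast)
    qed
  }
qed

lemma atin_euclidean: "atin euclidean x = at x"
  by (rule filter_eqI) (auto simp: eventually_atin eventually_at_topological)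

lemma continuous_map_euclidean_iff_limitin:
  "continuous_map euclidean X f \<longleftrightarrow> (\<forall>x. limitin X f (f x) (at x))"
  by (simp add: continuous_map_atin atin_euclidean)

lemma continuous_map_into_seminorm_topology:
  assumes "seminorm_family V P"
  shows "continuous_map euclidean (seminorm_topology V P) f \<longleftrightarrow>
     (\<forall>x. f x \<in> V) \<and> (\<forall>x. \<forall>q\<in>P. ((\<lambda>y. q (f y - f x)) \<longlongrightarrow> 0) (at x))"
  unfolding continuous_map_euclidean_iff_limitin limitin_seminorm_topology[OF assms] by auto

section \<open>Domination of seminorms and continuity of linear maps\<close>

definition seminorm_dominated :: "'v set \<Rightarrow> ('v \<Rightarrow> real) set \<Rightarrow> ('v \<Rightarrow> real) \<Rightarrow> bool" where
  "seminorm_dominated V P s \<longleftrightarrow> (\<exists>F C. finite F \<and> F \<subseteq> P \<and> 0 \<le> C \<and> (\<forall>x\<in>V. s x \<le> C * (\<Sum>q\<in>F. q x)))"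

lemma seminorm_dominatedI:
  assumes "finite F" "F \<subseteq> P" "0 \<le> C" "\<And>x. x \<in> V \<Longrightarrow> s x \<le> C * (\<Sum>q\<in>F. q x)"
  shows "seminorm_dominated V P s"
  using assms by (auto simp: seminorm_dominated_def)

lemma seminorm_dominated_single:
  assumes "q \<in> P" "0 \<le> C" "\<And>x. x \<in> V \<Longrightarrow> s x \<le> C * q x"
  shows "seminorm_dominated V P s"
  by (rule seminorm_dominatedI[of "{q}" P C]) (use assms in auto)

lemma seminorm_dominated_member: "s \<in> P \<Longrightarrow> seminorm_dominated V P s"
  by (rule seminorm_dominated_single[of s P 1]) auto

lemma seminorm_sum_small:
  assumes "finite F" "0 \<le> C" "0 < e"
  obtains d :: real where "0 < d" "\<And>y. (\<forall>q\<in>F. q y < d) \<Longrightarrow> C * (\<Sum>q\<in>F. q y) < e"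
proof
  \<comment> \<open>The summand 1 keeps the denominator positive when \<open>C = 0\<close> or
    \<open>F\<close> is empty, and makes the final inequality strict.\<close>
  define d where "d = e / (C * card F + 1)"
  have pos: "0 < C * card F + 1" using assms by (simp add: add_nonneg_pos)
  show "0 < d" using assms pos by (simp add: d_def)
  fix y assume "\<forall>q\<in>F. q y < d"
  then have "(\<Sum>q\<in>F. q y) \<le> card F * d"
    using sum_bounded_above[of F "\<lambda>q. q y" d] by (simp add: less_imp_le)
  then have "C * (\<Sum>q\<in>F. q y) \<le> C * (card F * d)"
    using assms by (intro mult_left_mono) auto
  also have "\<dots> < (C * card F + 1) * d" using \<open>0 < d\<close> by (simp add: algebra_simps)
  also have "\<dots> = e" using pos by (simp add: d_def)
  finally show "C * (\<Sum>q\<in>F. q y) < e" .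
qed

text \<open>Balls are translates of balls around 0, and a difference of images is the image of a
  difference, to which the domination applies. Inclusions, coordinate maps, \<open>curry\<close> and
  \<open>case_prod\<close> are all handled by this lemma.\<close>

lemma continuous_map_seminorm_linear:
  assumes "seminorm_family V P" "seminorm_family W Q"
    and maps: "\<And>x. x \<in> V \<Longrightarrow> \<phi> x \<in> W"
    and diff: "\<And>x y. x \<in> V \<Longrightarrow> y \<in> V \<Longrightarrow> \<phi> x - \<phi> y = \<phi> (x - y)"
    and dom: "\<And>q. q \<in> Q \<Longrightarrow> seminorm_dominated V P (\<lambda>x. q (\<phi> x))"
  shows "continuous_map (seminorm_topology V P) (seminorm_topology W Q) \<phi>"
  unfolding continuous_map_def
proof (intro conjI allI impI)
  show "\<phi> \<in> topspace (seminorm_topology V P) \<rightarrow> topspace (seminorm_topology W Q)"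
    using maps by auto
  fix U assume U: "openin (seminorm_topology W Q) U"
  show "openin (seminorm_topology V P) {x \<in> topspace (seminorm_topology V P). \<phi> x \<in> U}"
    unfolding openin_seminorm_topology[OF assms(1)]
  proof (intro conjI ballI)
    fix x assume "x \<in> {x \<in> topspace (seminorm_topology V P). \<phi> x \<in> U}"
    then have x: "x \<in> V" "\<phi> x \<in> U" by auto
    obtain F e where F: "finite F" "F \<subseteq> Q" "0 < e" "{y\<in>W. \<forall>q\<in>F. q (y - \<phi> x) < e} \<subseteq> U"
      by (rule openin_seminorm_topologyE[OF assms(2) U x(2)])
    have "\<exists>G d. finite G \<and> G \<subseteq> P \<and> 0 < d \<and> (\<forall>y\<in>V. (\<forall>p\<in>G. p y < d) \<longrightarrow> q (\<phi> y) < e)"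
      if q: "q \<in> F" for q
    proof -
      obtain G C where G: "finite G" "G \<subseteq> P" "0 \<le> C" "\<forall>y\<in>V. q (\<phi> y) \<le> C * (\<Sum>p\<in>G. p y)"
        using dom[of q] q F unfolding seminorm_dominated_def by blast
      obtain d :: real where d: "0 < d" "\<And>y. (\<forall>p\<in>G. p y < d) \<Longrightarrow> C * (\<Sum>p\<in>G. p y) < e"
        using seminorm_sum_small[OF G(1) G(3) F(3)] by blast
      show ?thesis using G d by (intro exI[of _ G] exI[of _ d]) force
    qed
    then obtain G d where Gd: "\<And>q. q \<in> F \<Longrightarrow> finite (G q) \<and> G q \<subseteq> P \<and> 0 < (d q :: real) \<and>
        (\<forall>y\<in>V. (\<forall>p\<in>G q. p y < d q) \<longrightarrow> q (\<phi> y) < e)"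
      by metis
    define \<delta> where "\<delta> = Min (insert 1 (d ` F))"
    have \<delta>: "0 < \<delta>" "\<And>q. q \<in> F \<Longrightarrow> \<delta> \<le> d q"
      unfolding \<delta>_def using F Gd by (auto simp: Min_gr_iff)
    show "\<exists>F e. finite F \<and> F \<subseteq> P \<and> 0 < e \<and>
        {y \<in> V. \<forall>q\<in>F. q (y - x) < e} \<subseteq> {x \<in> topspace (seminorm_topology V P). \<phi> x \<in> U}"
    proof (intro exI[of _ "\<Union>(G ` F)"] exI[of _ \<delta>] conjI)
      show "{y \<in> V. \<forall>q\<in>\<Union>(G ` F). q (y - x) < \<delta>} \<subseteq> {x \<in> topspace (seminorm_topology V P). \<phi> x \<in> U}"
      proof
      fix y assume "y \<in> {y \<in> V. \<forall>q\<in>\<Union>(G ` F). q (y - x) < \<delta>}"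
      then have y: "y \<in> V" "\<And>q p. q \<in> F \<Longrightarrow> p \<in> G q \<Longrightarrow> p (y - x) < d q"
        using \<delta> by force+
      have "y - x \<in> V" using assms(1) x y by (simp add: seminorm_family_def subspace_diff)
      then have "q (\<phi> y - \<phi> x) < e" if "q \<in> F" for q
        using Gd[OF that] y(2)[OF that] diff[OF y(1) x(1)] by auto
      then show "y \<in> {x \<in> topspace (seminorm_topology V P). \<phi> x \<in> U}"
        using F(4) maps y by auto
      qed
      show "\<Union> (G ` F) \<subseteq> P" using Gd by blast
    qed (use F Gd \<delta> in auto)
  qed auto
qed

lemma topology_eqI_continuous_map:
  assumes "continuous_map X Y (\<lambda>x. x)" "continuous_map Y X (\<lambda>x. x)"
  shows "X = Y"
proof -
  have top: "topspace X = topspace Y"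
    using continuous_map_image_subset_topspace[OF assms(1)]
      continuous_map_image_subset_topspace[OF assms(2)] by auto
  have "openin X S \<longleftrightarrow> openin Y S" for S
    using topology_finer_continuous_id[OF top] topology_finer_continuous_id[OF top[symmetric]]
      assms by (auto simp: id_def)
  then show ?thesis by (simp add: topology_eq)
qed

lemma seminorm_topology_cong:
  assumes "seminorm_family V P" "seminorm_family V Q"
    and "\<And>p. p \<in> P \<Longrightarrow> seminorm_dominated V Q p" "\<And>q. q \<in> Q \<Longrightarrow> seminorm_dominated V P q"
  shows "seminorm_topology V P = seminorm_topology V Q"
proof -
  have "continuous_map (seminorm_topology V P) (seminorm_topology V Q) (\<lambda>x. x)"
    using assms by (intro continuous_map_seminorm_linear) auto
  moreover have "continuous_map (seminorm_topology V Q) (seminorm_topology V P) (\<lambda>x. x)"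
    using assms by (intro continuous_map_seminorm_linear) auto
  ultimately show ?thesis by (rule topology_eqI_continuous_map)
qed

text \<open>The set where \<open>s < 1\<close> contains a ball for finitely many seminorms and some
  radius \<open>e\<close>; scaling \<open>x\<close> into this ball bounds \<open>s x\<close>. The
  bound is a finite sum because \<open>P\<close> need not be directed.\<close>

lemma continuous_seminorm_dominated:
  assumes "seminorm_family V P" "continuous_seminorm (seminorm_topology V P) s"
  shows "seminorm_dominated V P s"
proof -
  have V: "subspace V" and P: "\<And>q. q \<in> P \<Longrightarrow> seminorm_on V q"
    using assms by (auto simp: seminorm_family_def)
  have s: "seminorm_on V s" "continuous_map (seminorm_topology V P) euclideanreal s"
    using assms(2) by (auto simp: continuous_seminorm_def)
  have "openin (seminorm_topology V P) {x \<in> V. s x \<in> {..<1}}"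
    using s(2) unfolding continuous_map_def
    by (metis open_lessThan open_openin topspace_seminorm_topology)
  from openin_seminorm_topologyE[OF assms(1) this, of 0]
    subspace_0[OF V] seminorm_on_zero[OF s(1) V]
  obtain F e where F: "finite F" "F \<subseteq> P" "0 < e"
      "{y\<in>V. \<forall>q\<in>F. q (y - 0) < e} \<subseteq> {x \<in> V. s x \<in> {..<1}}"
    by auto
  have "s x \<le> (2 / e) * (\<Sum>q\<in>F. q x)" if x: "x \<in> V" for x
  proof (rule field_le_epsilon)
    fix d :: real assume d: "0 < d"
    \<comment> \<open>The extra \<open>e * d / 2\<close> keeps \<open>c\<close> positive when every
      seminorm in \<open>F\<close> vanishes at \<open>x\<close>; it contributes exactly
      \<open>d\<close> to the bound \<open>2 * c / e\<close>.\<close>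
    define c where "c = (\<Sum>q\<in>F. q x) + e * d / 2"
    have nn: "0 \<le> q x" if "q \<in> F" for q using seminorm_on_nonneg[OF P] that F x by auto
    then have "0 \<le> (\<Sum>q\<in>F. q x)" by (rule sum_nonneg)
    then have c: "0 < c" using F d by (simp add: c_def add_nonneg_pos)
    have "q x \<le> (\<Sum>q\<in>F. q x)" if "q \<in> F" for q
      using member_le_sum[of q F "\<lambda>q. q x"] that F nn by auto
    then have le: "q x \<le> c" if "q \<in> F" for q using that F d by (fastforce simp: c_def intro: add_increasing2)
    let ?a = "e / (2 * c)"
    have "?a *\<^sub>R x \<in> V" using subspace_scale[OF V x] .
    moreover have "q (?a *\<^sub>R x) < e" if "q \<in> F" for q
    proof -
      have "q (?a *\<^sub>R x) = ?a * q x"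
        using seminorm_on_scale[OF P x, of q ?a] that F c by auto
      also have "\<dots> \<le> ?a * c" using le[OF that] c F by (intro mult_left_mono) auto
      also have "\<dots> < e" using c F by simp
      finally show ?thesis .
    qed
    ultimately have "s (?a *\<^sub>R x) < 1" using F(4) by force
    then have "?a * s x < 1" using seminorm_on_scale[OF s(1) x, of ?a] c F by auto
    then have "s x < 2 * c / e" using c F by (simp add: field_simps)
    then show "s x \<le> 2 / e * (\<Sum>q\<in>F. q x) + d" using F by (simp add: c_def field_simps)
  qed
  then show ?thesis using F by (intro seminorm_dominatedI[of F P "2 / e"]) auto
qed

text \<open>Factor through the topology of \<open>s\<close> alone: the identity into it is
  continuous by domination, and there \<open>s\<close> is 1-Lipschitz.\<close>

lemma continuous_seminormI:
  assumes "seminorm_family V P" "seminorm_on V s" "seminorm_dominated V P s"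
  shows "continuous_seminorm (seminorm_topology V P) s"
  unfolding continuous_seminorm_def
proof
  show "seminorm_on (topspace (seminorm_topology V P)) s" using assms by simp
  have V: "subspace V" using assms by (auto simp: seminorm_family_def)
  have "continuous_map (seminorm_topology V P) (seminorm_topology V {s}) (\<lambda>x. x)"
    using assms V by (intro continuous_map_seminorm_linear) (auto simp: seminorm_family_def)
  moreover have "continuous_map (seminorm_topology V {s}) euclideanreal s"
    unfolding continuous_map_def
  proof (intro conjI allI impI)
    have fam: "seminorm_family V {s}" using assms V by (simp add: seminorm_family_def)
    fix U :: "real set" assume "openin euclideanreal U"
    then have U: "open U" by simp
    show "openin (seminorm_topology V {s}) {x \<in> topspace (seminorm_topology V {s}). s x \<in> U}"
      unfolding openin_seminorm_topology[OF fam]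
    proof (intro conjI ballI)
      fix x assume "x \<in> {x \<in> topspace (seminorm_topology V {s}). s x \<in> U}"
      then have x: "x \<in> V" "s x \<in> U" by auto
      obtain e where e: "0 < e" "ball (s x) e \<subseteq> U" using U x openE by blast
      show "\<exists>F e. finite F \<and> F \<subseteq> {s} \<and> 0 < e \<and> {y \<in> V. \<forall>q\<in>F. q (y - x) < e} \<subseteq>
          {x \<in> topspace (seminorm_topology V {s}). s x \<in> U}"
        by (rule exI[of _ "{s}"], rule exI[of _ e])
          (use e x seminorm_on_abs_diff[OF assms(2) V] in
            \<open>force simp: subset_iff dist_real_def abs_minus_commute\<close>)
    qed auto
  qed auto
  ultimately have "continuous_map (seminorm_topology V P) euclideanreal (s \<circ> (\<lambda>x. x))"
    by (rule continuous_map_compose)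
  then show "continuous_map (seminorm_topology V P) euclideanreal s" by (simp add: o_def)
qed

lemma Hausdorff_space_seminorm_topology:
  assumes "seminorm_family V P" "\<And>x. x \<in> V \<Longrightarrow> \<forall>q\<in>P. q x = 0 \<Longrightarrow> x = 0"
  shows "Hausdorff_space (seminorm_topology V P)"
  unfolding Hausdorff_space_def
proof (intro allI impI)
  have V: "subspace V" and P: "\<And>q. q \<in> P \<Longrightarrow> seminorm_on V q"
    using assms by (auto simp: seminorm_family_def)
  fix x y assume xy: "x \<in> topspace (seminorm_topology V P) \<and> y \<in> topspace (seminorm_topology V P) \<and> x \<noteq> y"
  then have "x \<in> V" "y \<in> V" "x - y \<in> V" "x - y \<noteq> 0" using subspace_diff[OF V] by auto
  then obtain q where q: "q \<in> P" "q (x - y) \<noteq> 0" using assms(2) by blast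
  then have qpos: "0 < q (x - y)" using seminorm_on_nonneg[OF P] \<open>x - y \<in> V\<close> by force
  define e where "e = q (x - y) / 2"
  let ?B = "\<lambda>z. {w \<in> V. q (w - z) < e}"
  have op: "openin (seminorm_topology V P) (?B z)" if "z \<in> V" for z
    by (rule openin_seminorm_topology_ball) (use q qpos that in \<open>auto simp: e_def\<close>)
  have "q (x - y) < 2 * e" if "w \<in> ?B x" "w \<in> ?B y" for w
    using that seminorm_on_triangle[OF P[OF q(1)] V \<open>x \<in> V\<close>, of w y]
      seminorm_on_minus_commute[OF P[OF q(1)] V \<open>x \<in> V\<close>, of w] \<open>y \<in> V\<close> by auto
  then have "disjnt (?B x) (?B y)" by (force simp: disjnt_iff e_def)
  moreover have "x \<in> ?B x" "y \<in> ?B y"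
    using \<open>x \<in> V\<close> \<open>y \<in> V\<close> qpos seminorm_on_zero[OF P[OF q(1)] V] by (auto simp: e_def)
  ultimately show "\<exists>U W. openin (seminorm_topology V P) U \<and> openin (seminorm_topology V P) W \<and>
      x \<in> U \<and> y \<in> W \<and> disjnt U W"
    using op \<open>x \<in> V\<close> \<open>y \<in> V\<close> by blast
qed

lemma vn_bounded_seminorm_topology:
  assumes "seminorm_family V P"
  shows "vn_bounded (seminorm_topology V P) B \<longleftrightarrow> B \<subseteq> V \<and> (\<forall>q\<in>P. \<exists>C. \<forall>x\<in>B. q x \<le> C)"
proof
  have V: "subspace V" and P: "\<And>q. q \<in> P \<Longrightarrow> seminorm_on V q"
    using assms by (auto simp: seminorm_family_def)
  {
    assume B: "vn_bounded (seminorm_topology V P) B"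
    then have BV: "B \<subseteq> V" by (simp add: vn_bounded_def)
    have "\<exists>C. \<forall>x\<in>B. q x \<le> C" if q: "q \<in> P" for q
    proof -
      let ?U = "{y \<in> V. q (y - 0) < 1}"
      have "openin (seminorm_topology V P) ?U"
        by (rule openin_seminorm_topology_ball) (use q subspace_0[OF V] zero_less_one in auto)
      moreover have "0 \<in> ?U" using subspace_0[OF V] seminorm_on_zero[OF P[OF q] V] by simp
      ultimately obtain s where s: "s > 0" "\<forall>t>s. B \<subseteq> (\<lambda>x. t *\<^sub>R x) ` ?U"
        using B unfolding vn_bounded_def by blast
      have "q x \<le> s + 1" if "x \<in> B" for x
      proof -
        have "x \<in> (\<lambda>x. (s + 1) *\<^sub>R x) ` ?U" using s that by (meson less_add_one subsetD)
        then obtain y where y: "y \<in> ?U" "x = (s + 1) *\<^sub>R y" by blast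
        then have "q x = (s + 1) * q y" using seminorm_on_scale[OF P[OF q]] s by auto
        also have "\<dots> \<le> (s + 1) * 1" using y s by (intro mult_left_mono) auto
        finally show ?thesis by simp
      qed
      then show ?thesis by blast
    qed
    then show "B \<subseteq> V \<and> (\<forall>q\<in>P. \<exists>C. \<forall>x\<in>B. q x \<le> C)" using BV by blast
  }
  {
    assume B: "B \<subseteq> V \<and> (\<forall>q\<in>P. \<exists>C. \<forall>x\<in>B. q x \<le> C)"
    then obtain c where c: "\<And>q x. q \<in> P \<Longrightarrow> x \<in> B \<Longrightarrow> q x \<le> c q" by metis
    show "vn_bounded (seminorm_topology V P) B"
      unfolding vn_bounded_def
    proof (intro conjI allI impI)
      show "B \<subseteq> topspace (seminorm_topology V P)" using B by simp
      fix U assume U: "openin (seminorm_topology V P) U \<and> 0 \<in> U"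
      obtain F e where F: "finite F" "F \<subseteq> P" "0 < e" "{y\<in>V. \<forall>q\<in>F. q (y - 0) < e} \<subseteq> U"
        by (rule openin_seminorm_topologyE[OF assms U[THEN conjunct1] U[THEN conjunct2]])
      define s where "s = Max (insert 1 ((\<lambda>q. c q / e) ` F))"
      have s: "s \<ge> 1" "\<And>q. q \<in> F \<Longrightarrow> c q / e \<le> s" using F by (auto simp: s_def)
      have "x \<in> (\<lambda>x. t *\<^sub>R x) ` U" if t: "t > s" and x: "x \<in> B" for t x
      proof (rule image_eqI)
        show "x = t *\<^sub>R (inverse t *\<^sub>R x)" using t s by simp
        have "q (inverse t *\<^sub>R x) < e" if q: "q \<in> F" for q
        proof -
          have "q (inverse t *\<^sub>R x) = q x / t"
            using seminorm_on_scale[OF P, of q x "inverse t"] q F x B t s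
            by (auto simp: divide_inverse mult.commute)
          also have "\<dots> \<le> c q / t" using c q F x t s by (intro divide_right_mono) auto
          also have "\<dots> < e"
          proof -
            have "c q \<le> e * s" using s(2)[OF q] F(3) by (simp add: field_simps)
            also have "\<dots> < e * t" using t F(3) by simp
            finally show ?thesis using t s(1) by (simp add: field_simps)
          qed
          finally show ?thesis .
        qed
        then show "inverse t *\<^sub>R x \<in> U" using F(4) x B subspace_scale[OF V] by force
      qed
      then show "\<exists>s>0. \<forall>t>s. B \<subseteq> (\<lambda>x. t *\<^sub>R x) ` U"
        using s(1) by (intro exI[of _ s]) auto
    qed
  }
qed

section \<open>Products, projective limits and images of bounded sets\<close>

lemma seminorm_family_vec:
  fixes V :: "('a \<Rightarrow> real) set"
  assumes "seminorm_family V P"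
  shows "seminorm_family {f :: 'a \<Rightarrow> real ^ 'c. \<forall>i. (\<lambda>x. f x $ i) \<in> V} {\<lambda>f. q (\<lambda>x. f x $ i) | q i. q \<in> P}"
proof -
  have V: "subspace V" and P: "\<And>q. q \<in> P \<Longrightarrow> seminorm_on V q"
    using assms by (auto simp: seminorm_family_def)
  have comp: "(\<lambda>x. (f + g) x $ i) = (\<lambda>x. f x $ i) + (\<lambda>x. g x $ i)"
    "(\<lambda>x. (c *\<^sub>R f) x $ i) = c *\<^sub>R (\<lambda>x. f x $ i)"
    for f g :: "'a \<Rightarrow> real ^ 'c" and c i
    by (auto simp: scaleR_fun_def)
  have V0: "(\<lambda>x. 0) \<in> V" using subspace_0[OF V] by (simp add: zero_fun_def)
  have Vadd: "(\<lambda>x. f x + g x) \<in> V" if "f \<in> V" "g \<in> V" for f g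
    using subspace_add[OF V that] by (simp add: plus_fun_def)
  have Vscale: "(\<lambda>x. c * f x) \<in> V" if "f \<in> V" for f c
    using subspace_scale[OF V that, of c] by (simp add: scaleR_fun_def)
  show ?thesis
    unfolding seminorm_family_def
  proof (intro conjI ballI)
    show "subspace {f::'a\<Rightarrow>real^'c. \<forall>i. (\<lambda>x. f x $ i) \<in> V}"
      using V0 Vadd Vscale by (auto simp: subspace_def scaleR_fun_def)
    fix s :: "('a \<Rightarrow> real^'c) \<Rightarrow> real"
    assume "s \<in> {\<lambda>f. q (\<lambda>x. f x $ i) | q i. q \<in> P}"
    then obtain q i where q: "s = (\<lambda>f. q (\<lambda>x. f x $ i))" "q \<in> P" by blast
    show "seminorm_on {f. \<forall>i. (\<lambda>x. f x $ i) \<in> V} s"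
      unfolding seminorm_on_def q comp
      using seminorm_onD[OF P[OF q(2)]] by blast
  qed
qed

lemma topspace_vec_valued:
  "topspace (vec_valued X) = {f. \<forall>i. (\<lambda>x. f x $ i) \<in> topspace X}"
  by (auto simp: vec_valued_def topspace_pullback_topology PiE_iff)

lemma vec_valued_seminorm_topology:
  fixes V :: "('a \<Rightarrow> real) set"
  assumes "seminorm_family V P"
  shows "vec_valued (seminorm_topology V P) =
    seminorm_topology {f :: 'a \<Rightarrow> real ^ 'c. \<forall>i. (\<lambda>x. f x $ i) \<in> V} {\<lambda>f. q (\<lambda>x. f x $ i) | q i. q \<in> P}"
    (is "_ = seminorm_topology ?W ?Q")
proof -
  let ?f = "\<lambda>(f::'a \<Rightarrow> real^'c) i x. f x $ i"
  let ?T = "product_topology (\<lambda>_::'c. seminorm_topology V P) UNIV"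
  note fam = seminorm_family_vec[OF assms]
  have "continuous_map (seminorm_topology ?W ?Q) (seminorm_topology V P) (\<lambda>f. ?f f i)" for i
    by (rule continuous_map_seminorm_linear[OF fam assms])
      (auto intro!: seminorm_dominated_member)
  then have cm: "continuous_map (seminorm_topology ?W ?Q) ?T ?f"
    by (simp add: continuous_map_componentwise_UNIV)
  have cm': "continuous_map (vec_valued (seminorm_topology V P)) (seminorm_topology V P) (\<lambda>f. ?f f i)" for i
  proof -
    have "continuous_map ?T (seminorm_topology V P) (\<lambda>z. z i)"
      by (rule continuous_map_product_projection) simp
    from continuous_map_pullback[OF this, of UNIV ?f] show ?thesis
      unfolding vec_valued_def by (simp add: o_def)
  qed
  have "continuous_map (seminorm_topology ?W ?Q) (vec_valued (seminorm_topology V P)) (\<lambda>x. x)"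
    unfolding vec_valued_def
    by (rule continuous_map_pullback') (use cm in \<open>auto simp: o_def\<close>)
  moreover have "continuous_map (vec_valued (seminorm_topology V P)) (seminorm_topology ?W ?Q) (\<lambda>x. x)"
    unfolding seminorm_topology_def[of ?W]
  proof (rule continuous_on_generated_topo)
    show "(\<lambda>x. x) ` topspace (vec_valued (seminorm_topology V P)) \<subseteq>
        \<Union> (insert ?W {{y \<in> ?W. q (y - x) < e} |q x e. q \<in> ?Q \<and> x \<in> ?W \<and> 0 < e})"
      by (auto simp: topspace_vec_valued)
    fix A assume "A \<in> insert ?W {{y \<in> ?W. q (y - x) < e} |q x e. q \<in> ?Q \<and> x \<in> ?W \<and> 0 < e}"
    then consider "A = ?W" | q i x e where "A = {y \<in> ?W. q (?f (y - x) i) < e}" "q \<in> P" "x \<in> ?W" "0 < e"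
      by blast
    then show "openin (vec_valued (seminorm_topology V P))
        ((\<lambda>x. x) -` A \<inter> topspace (vec_valued (seminorm_topology V P)))"
    proof cases
      case 1
      then have "(\<lambda>x. x) -` A \<inter> topspace (vec_valued (seminorm_topology V P)) =
          topspace (vec_valued (seminorm_topology V P))"
        by (auto simp: topspace_vec_valued)
      then show ?thesis by simp
    next
      case 2
      have "openin (seminorm_topology V P) {y \<in> V. q (y - ?f x i) < e}"
        by (rule openin_seminorm_topology_ball) (use 2 in auto)
      then have "openin (vec_valued (seminorm_topology V P))
          {y \<in> topspace (vec_valued (seminorm_topology V P)). ?f y i \<in> {y \<in> V. q (y - ?f x i) < e}}"
        using cm'[of i] unfolding continuous_map_def by blast
      also have "{y \<in> topspace (vec_valued (seminorm_topology V P)). ?f y i \<in> {y \<in> V. q (y - ?f x i) < e}} =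
          (\<lambda>x. x) -` A \<inter> topspace (vec_valued (seminorm_topology V P))"
        using 2 by (auto simp: topspace_vec_valued fun_diff_def)
      finally show ?thesis .
    qed
  qed
  ultimately show ?thesis by (rule topology_eqI_continuous_map[OF _ _, symmetric])
qed

lemma projective_limit_seminorm_topology:
  assumes "\<And>i. i \<in> I \<Longrightarrow> seminorm_family (V i) (P i)" "I \<noteq> {}"
  shows "projective_limit I (\<lambda>i. seminorm_topology (V i) (P i)) =
    seminorm_topology (\<Inter>i\<in>I. V i) (\<Union>i\<in>I. P i)"
    (is "?L = seminorm_topology ?W ?Q")
proof -
  have fam: "seminorm_family ?W ?Q"
    unfolding seminorm_family_def
  proof (intro conjI ballI)
    show "subspace ?W"
      using assms(1) by (auto simp: seminorm_family_def subspace_def)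
    fix q assume "q \<in> ?Q"
    then obtain i where "i \<in> I" "q \<in> P i" by blast
    then show "seminorm_on ?W q"
      using assms(1)[of i] by (rule_tac seminorm_on_subset[of "V i" q ?W]) (auto simp: seminorm_family_def)
  qed
  let ?S = "insert ?W {U \<inter> ?W | i U. i \<in> I \<and> openin (seminorm_topology (V i) (P i)) U}"
  have L: "?L = topology_generated_by ?S"
    by (simp add: projective_limit_def Let_def)
  have "continuous_map (seminorm_topology ?W ?Q) ?L (\<lambda>x. x)"
    unfolding L
  proof (rule continuous_on_generated_topo)
    show "(\<lambda>x. x) ` topspace (seminorm_topology ?W ?Q) \<subseteq> \<Union> ?S" by auto
    fix A assume A: "A \<in> ?S"
    have cm: "continuous_map (seminorm_topology ?W ?Q) (seminorm_topology (V i) (P i)) (\<lambda>x. x)"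
      if "i \<in> I" for i
      by (rule continuous_map_seminorm_linear[OF fam assms(1)[OF that]])
        (use that in \<open>auto intro!: seminorm_dominated_member\<close>)
    from A consider "A = ?W" | i U where "A = U \<inter> ?W" "i \<in> I" "openin (seminorm_topology (V i) (P i)) U"
      by blast
    then show "openin (seminorm_topology ?W ?Q) ((\<lambda>x. x) -` A \<inter> topspace (seminorm_topology ?W ?Q))"
    proof cases
      case 1
      then show ?thesis using openin_topspace[of "seminorm_topology ?W ?Q"] by simp
    next
      case 2
      then have "openin (seminorm_topology ?W ?Q) {x \<in> topspace (seminorm_topology ?W ?Q). x \<in> U}"
        using cm[of i] unfolding continuous_map_def by blast
      moreover have "{x \<in> topspace (seminorm_topology ?W ?Q). x \<in> U} = A"
        using 2 by auto
      ultimately show ?thesis using 2 by (simp add: Int_absorb2)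
    qed
  qed
  moreover have "continuous_map ?L (seminorm_topology ?W ?Q) (\<lambda>x. x)"
    unfolding seminorm_topology_def[of ?W]
  proof (rule continuous_on_generated_topo)
    have top: "topspace ?L = ?W" unfolding L by (auto simp: topology_generated_by_topspace)
    show "(\<lambda>x. x) ` topspace ?L \<subseteq>
        \<Union> (insert ?W {{y \<in> ?W. q (y - x) < e} |q x e. q \<in> ?Q \<and> x \<in> ?W \<and> 0 < e})"
      unfolding top by blast
    fix A assume "A \<in> insert ?W {{y \<in> ?W. q (y - x) < e} |q x e. q \<in> ?Q \<and> x \<in> ?W \<and> 0 < e}"
    then consider "A = ?W" | q x e i where "A = {y \<in> ?W. q (y - x) < e}" "q \<in> P i" "i \<in> I" "x \<in> ?W" "0 < e"
      by blast
    then show "openin ?L ((\<lambda>x. x) -` A \<inter> topspace ?L)"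
    proof cases
      case 1
      then show ?thesis using top openin_topspace[of ?L] by simp
    next
      case 2
      have "openin (seminorm_topology (V i) (P i)) {y \<in> V i. q (y - x) < e}"
        by (rule openin_seminorm_topology_ball) (use 2 in auto)
      then have "openin ?L ({y \<in> V i. q (y - x) < e} \<inter> ?W)"
        unfolding L by (intro topology_generated_by_Basis) (use 2 in blast)
      moreover have "{y \<in> V i. q (y - x) < e} \<inter> ?W = (\<lambda>x. x) -` A \<inter> topspace ?L"
        using 2 unfolding top by auto
      ultimately show ?thesis by simp
    qed
  qed
  ultimately show ?thesis by (rule topology_eqI_continuous_map[OF _ _, symmetric])
qed

lemma vn_bounded_image_continuous_linear:
  assumes "linear_on_space X \<phi>" "continuous_map X Y \<phi>" "0 \<in> topspace X" "vn_bounded X B"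
  shows "vn_bounded Y (\<phi> ` B)"
  unfolding vn_bounded_def
proof (intro conjI allI impI)
  have B: "B \<subseteq> topspace X" using assms(4) by (simp add: vn_bounded_def)
  then show "\<phi> ` B \<subseteq> topspace Y" using assms(2) continuous_map_image_subset_topspace by fastforce
  fix U assume U: "openin Y U \<and> 0 \<in> U"
  let ?U = "{x \<in> topspace X. \<phi> x \<in> U}"
  have "\<phi> (0 *\<^sub>R 0) = 0 *\<^sub>R \<phi> 0" using assms(1,3) unfolding linear_on_space_def by blast
  then have "0 \<in> ?U" using U assms(3) by simp
  moreover have "openin X ?U" using assms(2) U unfolding continuous_map_def by blast
  ultimately obtain s where s: "s > 0" "\<forall>t>s. B \<subseteq> (\<lambda>x. t *\<^sub>R x) ` ?U"
    using assms(4) unfolding vn_bounded_def by blast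
  have "\<phi> ` B \<subseteq> (\<lambda>x. t *\<^sub>R x) ` U" if "t > s" for t
  proof
    fix y assume "y \<in> \<phi> ` B"
    then obtain z where z: "z \<in> B" "y = \<phi> z" by blast
    then have "z \<in> (\<lambda>x. t *\<^sub>R x) ` ?U" using s that by blast
    then obtain x where "x \<in> ?U" "y = \<phi> (t *\<^sub>R x)" using z by blast
    then show "y \<in> (\<lambda>x. t *\<^sub>R x) ` U" using assms(1) unfolding linear_on_space_def by auto
  qed
  then show "\<exists>s>0. \<forall>t>s. \<phi> ` B \<subseteq> (\<lambda>x. t *\<^sub>R x) ` U" using s by blast
qed

section \<open>Iterated partial derivatives\<close>

text \<open>Lists of basis vectors stand in for multi-indices: they are what
  \<open>smooth_into\<close> quantifies over, and concatenation composes derivatives without any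
  appeal to their symmetry.\<close>

definition pderivs ::
    "'v::real_vector topology \<Rightarrow> 'a::euclidean_space list \<Rightarrow> ('a \<Rightarrow> 'v) \<Rightarrow> 'a \<Rightarrow> 'v" where
  "pderivs X bs f = foldr (pderivative X) bs f"

lemma pderivs_simps [simp]:
  "pderivs X [] f = f"
  "pderivs X (b # bs) f = pderivative X b (pderivs X bs f)"
  "pderivs X (as @ bs) f = pderivs X as (pderivs X bs f)"
  by (simp_all add: pderivs_def)

lemma partial_at_unique:
  assumes "Hausdorff_space X" "partial_at X b f x d" "partial_at X b f x d'"
  shows "d = d'"
  using assms unfolding partial_at_def
  by (intro limitin_Hausdorff_unique[of X _ d "at 0" d']) (auto simp: trivial_limit_at)

lemma pderivative_eqI:
  assumes "Hausdorff_space X" "\<And>x. partial_at X b f x (f' x)"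
  shows "pderivative X b f = f'"
proof
  fix x
  show "pderivative X b f x = f' x"
    unfolding pderivative_def
    by (rule some1_equality[of "partial_at X b f x"])
      (use assms partial_at_unique[OF assms(1)] in blast)+
qed

lemma smooth_into_iff_pderivs:
  "smooth_into X f \<longleftrightarrow> (\<forall>bs. set bs \<subseteq> Basis \<longrightarrow> continuous_map euclidean X (pderivs X bs f) \<and>
        (\<forall>b\<in>Basis. \<forall>x. \<exists>d. partial_at X b (pderivs X bs f) x d))"
  by (simp add: smooth_into_def pderivs_def)

lemma smooth_into_continuous:
  "smooth_into X f \<Longrightarrow> set bs \<subseteq> Basis \<Longrightarrow> continuous_map euclidean X (pderivs X bs f)"
  by (simp add: smooth_into_iff_pderivs)

lemma smooth_into_partial_at:
  assumes "smooth_into X f" "set bs \<subseteq> Basis" "b \<in> Basis"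
  shows "partial_at X b (pderivs X bs f) x (pderivs X (b # bs) f x)"
proof -
  have "\<exists>d. partial_at X b (pderivs X bs f) x d"
    using assms by (simp add: smooth_into_iff_pderivs)
  then show ?thesis by (simp add: pderivative_def) (rule someI_ex)
qed

lemma smooth_into_pderivs:
  assumes "smooth_into X f" "set as \<subseteq> Basis"
  shows "smooth_into X (pderivs X as f)"
  unfolding smooth_into_iff_pderivs
proof (intro allI impI)
  fix bs :: "'b list" assume "set bs \<subseteq> Basis"
  then have "set (bs @ as) \<subseteq> Basis" using assms by simp
  then show "continuous_map euclidean X (pderivs X bs (pderivs X as f)) \<and>
      (\<forall>b\<in>Basis. \<forall>x. \<exists>d. partial_at X b (pderivs X bs (pderivs X as f)) x d)"
    using assms(1) unfolding smooth_into_iff_pderivs by (metis pderivs_simps(3))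
qed

text \<open>Smoothness concerns all iterated derivatives simultaneously, so candidates
  \<open>\<Phi> bs\<close> are supplied for all lists at once. Uniqueness of limits in a Hausdorff
  space then forces the choice operator in \<open>pderivative\<close> to return them.\<close>

lemma smooth_into_family:
  assumes "Hausdorff_space X" "\<Phi> [] = f"
    and cont: "\<And>bs. set bs \<subseteq> Basis \<Longrightarrow> continuous_map euclidean X (\<Phi> bs)"
    and part: "\<And>bs b x. set bs \<subseteq> Basis \<Longrightarrow> b \<in> Basis \<Longrightarrow> partial_at X b (\<Phi> bs) x (\<Phi> (b # bs) x)"
  shows "smooth_into X f" and "\<And>bs. set bs \<subseteq> Basis \<Longrightarrow> pderivs X bs f = \<Phi> bs"
proof -
  show *: "pderivs X bs f = \<Phi> bs" if "set bs \<subseteq> Basis" for bs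
    using that
  proof (induction bs)
    case (Cons b bs)
    then show ?case using part[of bs b] pderivative_eqI[OF assms(1), of b "\<Phi> bs" "\<Phi> (b # bs)"]
      by simp
  qed (simp add: assms(2))
  show "smooth_into X f"
    unfolding smooth_into_iff_pderivs using * cont part by (metis (no_types, lifting))
qed

text \<open>
  The target \<open>X\<close> is a finite product of copies of \<open>Y\<close> with coordinate maps \<open>\<pi> i\<close>. This covers both
  \<open>\<real>\<^sup>n\<close> and \<^const>\<open>vec_valued\<close> spaces.
\<close>

lemma smooth_into_componentwise:
  fixes f :: "'a::euclidean_space \<Rightarrow> 'v::real_vector" and \<pi> :: "'i \<Rightarrow> 'v \<Rightarrow> 'w::real_vector"
  assumes haus: "Hausdorff_space X" "Hausdorff_space Y"
    and lim: "\<And>f l (G :: 'a filter). limitin X f l G \<longleftrightarrow> (\<forall>i. limitin Y (\<lambda>x. \<pi> i (f x)) (\<pi> i l) G)"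
      "\<And>f l (G :: real filter). limitin X f l G \<longleftrightarrow> (\<forall>i. limitin Y (\<lambda>x. \<pi> i (f x)) (\<pi> i l) G)"
    and lin: "\<And>i c u v. \<pi> i (c *\<^sub>R (u - v)) = c *\<^sub>R (\<pi> i u - \<pi> i v)"
    and surj: "\<And>d. \<exists>v. \<forall>i. \<pi> i v = d i"
    and inj: "\<And>u v. (\<And>i. \<pi> i u = \<pi> i v) \<Longrightarrow> u = v"
  shows "smooth_into X f \<longleftrightarrow> (\<forall>i. smooth_into Y (\<lambda>x. \<pi> i (f x)))"
    and "smooth_into X f \<Longrightarrow> set bs \<subseteq> Basis \<Longrightarrow>
      pderivs Y bs (\<lambda>x. \<pi> i (f x)) = (\<lambda>x. \<pi> i (pderivs X bs f x))"
proof -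
  have cont: "continuous_map euclidean X g \<longleftrightarrow> (\<forall>i. continuous_map euclidean Y (\<lambda>x. \<pi> i (g x)))"
    for g :: "'a \<Rightarrow> 'v"
    unfolding continuous_map_euclidean_iff_limitin lim by blast
  have part: "partial_at X b g x d \<longleftrightarrow> (\<forall>i. partial_at Y b (\<lambda>x. \<pi> i (g x)) x (\<pi> i d))"
    for g :: "'a \<Rightarrow> 'v" and b x d
    unfolding partial_at_def lim lin by blast
  have 1: "smooth_into Y (\<lambda>x. \<pi> i (f x))"
    "set bs \<subseteq> Basis \<Longrightarrow> pderivs Y bs (\<lambda>x. \<pi> i (f x)) = (\<lambda>x. \<pi> i (pderivs X bs f x))"
    if "smooth_into X f" for i bs
    using smooth_into_family[of Y "\<lambda>bs x. \<pi> i (pderivs X bs f x)" "\<lambda>x. \<pi> i (f x)"]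
      smooth_into_continuous[OF that] smooth_into_partial_at[OF that] haus
    unfolding cont part by auto
  then show "smooth_into X f \<Longrightarrow> set bs \<subseteq> Basis \<Longrightarrow>
      pderivs Y bs (\<lambda>x. \<pi> i (f x)) = (\<lambda>x. \<pi> i (pderivs X bs f x))" by blast
  have "smooth_into X f" if sm: "\<And>i. smooth_into Y (\<lambda>x. \<pi> i (f x))"
  proof -
    \<comment> \<open>The derivatives of the coordinates are glued, via \<open>surj\<close>, to
      candidates for the derivatives of \<open>f\<close>.\<close>
    obtain \<Phi> where \<Phi>: "\<And>bs x i. \<pi> i (\<Phi> bs x) = pderivs Y bs (\<lambda>x. \<pi> i (f x)) x"
      using surj[of "\<lambda>i. pderivs Y bs (\<lambda>x. \<pi> i (f x)) x" for bs x] by metis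
    show ?thesis
    proof (rule smooth_into_family(1)[OF haus(1), of \<Phi>])
      show "\<Phi> [] = f" by (rule ext, rule inj) (simp add: \<Phi>)
      show "continuous_map euclidean X (\<Phi> bs)" if "set bs \<subseteq> Basis" for bs
        unfolding cont \<Phi> using smooth_into_continuous[OF sm that] by auto
      show "partial_at X b (\<Phi> bs) x (\<Phi> (b # bs) x)" if "set bs \<subseteq> Basis" "b \<in> Basis" for bs b x
        unfolding part \<Phi> using smooth_into_partial_at[OF sm that] by auto
    qed
  qed
  with 1 show "smooth_into X f \<longleftrightarrow> (\<forall>i. smooth_into Y (\<lambda>x. \<pi> i (f x)))" by blast
qed

lemma partial_at_real_iff:
  fixes f :: "'a::euclidean_space \<Rightarrow> real"
  shows "partial_at euclidean b f x d \<longleftrightarrow> ((\<lambda>t. f (x + t *\<^sub>R b)) has_real_derivative d) (at 0)"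
  by (simp add: partial_at_def DERIV_def divide_inverse mult.commute)

lemma smooth_has_derivative:
  fixes f :: "'a::euclidean_space \<Rightarrow> real"
  assumes "smooth_into euclidean f" "set bs \<subseteq> Basis" "b \<in> Basis"
  shows "((\<lambda>t. pderivs euclidean bs f (x + t *\<^sub>R b)) has_real_derivative
           pderivs euclidean (b # bs) f (x + t *\<^sub>R b)) (at t)"
proof -
  have "((\<lambda>s. pderivs euclidean bs f ((x + t *\<^sub>R b) + s *\<^sub>R b)) has_real_derivative
           pderivs euclidean (b # bs) f (x + t *\<^sub>R b)) (at 0)"
    using smooth_into_partial_at[OF assms] unfolding partial_at_real_iff .
  then have "((\<lambda>s. pderivs euclidean bs f (x + (s + t) *\<^sub>R b)) has_real_derivative
           pderivs euclidean (b # bs) f (x + t *\<^sub>R b)) (at 0)"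
    by (simp add: algebra_simps)
  then show ?thesis
    using DERIV_shift[of "\<lambda>s. pderivs euclidean bs f (x + s *\<^sub>R b)" _ 0 t] by simp
qed

lemma smooth_continuous_on:
  fixes f :: "'a::euclidean_space \<Rightarrow> real"
  assumes "smooth_into euclidean f" "set bs \<subseteq> Basis"
  shows "continuous_on S (pderivs euclidean bs f)"
  using smooth_into_continuous[OF assms] continuous_on_subset by auto

lemma smooth_borel_measurable:
  fixes f :: "'a::euclidean_space \<Rightarrow> real"
  assumes "smooth_into euclidean f" "set bs \<subseteq> Basis"
  shows "pderivs euclidean bs f \<in> borel_measurable borel"
  using smooth_continuous_on[OF assms] by (rule borel_measurable_continuous_onI)

lemma smooth_real_family:
  fixes f :: "'a::euclidean_space \<Rightarrow> real"
  assumes "\<Phi> [] = f"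
    and "\<And>bs. set bs \<subseteq> Basis \<Longrightarrow> continuous_on UNIV (\<Phi> bs)"
    and "\<And>bs b x. set bs \<subseteq> Basis \<Longrightarrow> b \<in> Basis \<Longrightarrow>
      ((\<lambda>t. \<Phi> bs (x + t *\<^sub>R b)) has_real_derivative \<Phi> (b # bs) x) (at 0)"
  shows "smooth_into euclidean f" and "\<And>bs. set bs \<subseteq> Basis \<Longrightarrow> pderivs euclidean bs f = \<Phi> bs"
proof -
  have H: "Hausdorff_space (euclidean :: real topology)" by simp
  show "smooth_into euclidean f"
    by (rule smooth_into_family(1)[where \<Phi> = \<Phi>, OF H assms(1)]) (use assms in \<open>auto simp: partial_at_real_iff\<close>)
  show "pderivs euclidean bs f = \<Phi> bs" if "set bs \<subseteq> Basis" for bs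
    by (rule smooth_into_family(2)[where \<Phi> = \<Phi>, OF H assms(1) _ _ that])
      (use assms in \<open>auto simp: partial_at_real_iff\<close>)
qed

lemma smooth_lincomb:
  fixes f g :: "'a::euclidean_space \<Rightarrow> real"
  assumes "smooth_into euclidean f" "smooth_into euclidean g"
  shows "smooth_into euclidean (\<lambda>x. c * f x + d * g x)"
    and "set bs \<subseteq> Basis \<Longrightarrow> pderivs euclidean bs (\<lambda>x. c * f x + d * g x) =
      (\<lambda>x. c * pderivs euclidean bs f x + d * pderivs euclidean bs g x)"
proof -
  let ?\<Phi> = "\<lambda>bs x. c * pderivs euclidean bs f x + d * pderivs euclidean bs g x"
  have 1: "continuous_on UNIV (?\<Phi> bs)" if "set bs \<subseteq> Basis" for bs
    by (intro continuous_intros smooth_continuous_on assms that)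
  have 2: "((\<lambda>t. ?\<Phi> bs (x + t *\<^sub>R b)) has_real_derivative ?\<Phi> (b # bs) x) (at 0)"
    if "set bs \<subseteq> Basis" "b \<in> Basis" for bs b x
    using smooth_has_derivative[OF assms(1) that, of x 0]
      smooth_has_derivative[OF assms(2) that, of x 0]
    by (auto intro!: derivative_eq_intros)
  show "smooth_into euclidean (\<lambda>x. c * f x + d * g x)"
    by (rule smooth_real_family(1)[of ?\<Phi>]) (use 1 2 in auto)
  show "set bs \<subseteq> Basis \<Longrightarrow> pderivs euclidean bs (\<lambda>x. c * f x + d * g x) = ?\<Phi> bs"
    by (rule smooth_real_family(2)[of ?\<Phi>]) (use 1 2 in auto)
qed

lemma smooth_zero:
  "smooth_into euclidean (\<lambda>x::'a::euclidean_space. 0 :: real)"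
  "set bs \<subseteq> Basis \<Longrightarrow> pderivs euclidean bs (\<lambda>x::'a::euclidean_space. 0 :: real) = (\<lambda>x. 0)"
  by (rule smooth_real_family[of "\<lambda>bs x. 0"]; simp)+

section \<open>Slices of functions on a product\<close>

lemma Pair_in_Basis:
  "(b, 0) \<in> (Basis :: ('a::euclidean_space \<times> 'b::euclidean_space) set) \<longleftrightarrow> b \<in> Basis"
  "(0, c) \<in> (Basis :: ('a::euclidean_space \<times> 'b::euclidean_space) set) \<longleftrightarrow> c \<in> Basis"
  using nonzero_Basis by (auto simp: Basis_prod_def)

abbreviation inl :: "'a::euclidean_space list \<Rightarrow> ('a \<times> 'b::euclidean_space) list" where
  "inl \<equiv> map (\<lambda>a. (a, 0))"

abbreviation inr :: "'b::euclidean_space list \<Rightarrow> ('a::euclidean_space \<times> 'b) list" where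
  "inr \<equiv> map (\<lambda>b. (0, b))"

lemma set_inl_inr [simp]:
  "set (inl as :: ('a::euclidean_space \<times> 'b::euclidean_space) list) \<subseteq> Basis \<longleftrightarrow> set as \<subseteq> Basis"
  "set (inr bs :: ('a::euclidean_space \<times> 'b::euclidean_space) list) \<subseteq> Basis \<longleftrightarrow> set bs \<subseteq> Basis"
  by (auto simp: Pair_in_Basis)

lemma smooth_slice:
  fixes F :: "'a::euclidean_space \<times> 'b::euclidean_space \<Rightarrow> real"
  assumes "smooth_into euclidean F"
  shows smooth_slice_fst: "smooth_into euclidean (\<lambda>x. F (x, y))"
    and pderivs_slice_fst: "set as \<subseteq> Basis \<Longrightarrow>
      pderivs euclidean as (\<lambda>x. F (x, y)) = (\<lambda>x. pderivs euclidean (inl as) F (x, y))"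
    and smooth_slice_snd: "smooth_into euclidean (\<lambda>y. F (x, y))"
    and pderivs_slice_snd: "set bs \<subseteq> Basis \<Longrightarrow>
      pderivs euclidean bs (\<lambda>y. F (x, y)) = (\<lambda>y. pderivs euclidean (inr bs) F (x, y))"
proof -
  let ?\<Phi> = "\<lambda>as x. pderivs euclidean (inl as) F (x, y)"
  have 1: "continuous_on UNIV (?\<Phi> as)" if "set as \<subseteq> Basis" for as
    by (rule continuous_on_compose2[OF smooth_continuous_on[OF assms, of "inl as" UNIV]])
      (use that in \<open>auto intro!: continuous_intros simp: Pair_in_Basis\<close>)
  have 2: "((\<lambda>t. ?\<Phi> as (x + t *\<^sub>R a)) has_real_derivative ?\<Phi> (a # as) x) (at 0)"
    if "set as \<subseteq> Basis" "a \<in> Basis" for as a x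
    using smooth_has_derivative[OF assms set_inl_inr(1)[THEN iffD2, OF that(1)]
        Pair_in_Basis(1)[THEN iffD2, OF that(2)], of "(x, y)" 0] by simp
  show "smooth_into euclidean (\<lambda>x. F (x, y))"
    by (rule smooth_real_family(1)[of ?\<Phi>]) (use 1 2 in auto)
  show "set as \<subseteq> Basis \<Longrightarrow> pderivs euclidean as (\<lambda>x. F (x, y)) = ?\<Phi> as"
    by (rule smooth_real_family(2)[of ?\<Phi>]) (use 1 2 in auto)
next
  let ?\<Phi> = "\<lambda>bs y. pderivs euclidean (inr bs) F (x, y)"
  have 1: "continuous_on UNIV (?\<Phi> bs)" if "set bs \<subseteq> Basis" for bs
    by (rule continuous_on_compose2[OF smooth_continuous_on[OF assms, of "inr bs" UNIV]])
      (use that in \<open>auto intro!: continuous_intros simp: Pair_in_Basis\<close>)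
  have 2: "((\<lambda>t. ?\<Phi> bs (y + t *\<^sub>R b)) has_real_derivative ?\<Phi> (b # bs) y) (at 0)"
    if "set bs \<subseteq> Basis" "b \<in> Basis" for bs b y
    using smooth_has_derivative[OF assms set_inl_inr(2)[THEN iffD2, OF that(1)]
        Pair_in_Basis(2)[THEN iffD2, OF that(2)], of "(x, y)" 0] by simp
  show "smooth_into euclidean (\<lambda>y. F (x, y))"
    by (rule smooth_real_family(1)[of ?\<Phi>]) (use 1 2 in auto)
  show "set bs \<subseteq> Basis \<Longrightarrow> pderivs euclidean bs (\<lambda>y. F (x, y)) = ?\<Phi> bs"
    by (rule smooth_real_family(2)[of ?\<Phi>]) (use 1 2 in auto)
qed

text \<open>
  Differentiating \<open>f (x + h a + t b) - f (x + t b) = \<integral>\<^sub>0\<^sup>h \<partial>\<^sub>a f (x + s a + t b) ds\<close> in \<open>t\<close> under the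
  integral and then in \<open>h\<close>, both at \<open>0\<close>, interchanges the partial derivatives.
\<close>

lemma pderivative_commute:
  fixes f :: "'a::euclidean_space \<Rightarrow> real"
  assumes sm: "smooth_into euclidean f" and ab: "a \<in> Basis" "b \<in> Basis"
  shows "pderivs euclidean [a, b] f = pderivs euclidean [b, a] f"
proof
  fix x
  let ?D = "\<lambda>bs. pderivs euclidean bs f"
  have cont: "continuous_on UNIV (\<lambda>z. ?D bs (g z))"
    if "set bs \<subseteq> Basis" "continuous_on UNIV g" for bs and g :: "'c::topological_space \<Rightarrow> 'a"
    by (rule continuous_on_compose2[OF smooth_continuous_on[OF sm that(1), of UNIV] that(2)]) auto
  have eq: "?D [b] (x + h *\<^sub>R a) - ?D [b] x = integral {0..h} (\<lambda>s. ?D [b, a] (x + s *\<^sub>R a))"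
    if h: "0 \<le> h" for h
  proof -
    have ftc: "f (x + h *\<^sub>R a + t *\<^sub>R b) - f (x + t *\<^sub>R b) =
        integral {0..h} (\<lambda>s. ?D [a] (x + s *\<^sub>R a + t *\<^sub>R b))" for t
    proof -
      have "((\<lambda>s. f (x + t *\<^sub>R b + s *\<^sub>R a)) has_real_derivative ?D [a] (x + t *\<^sub>R b + s *\<^sub>R a)) (at s)" for s
        using smooth_has_derivative[OF sm, of "[]" a] ab by simp
      then have "((\<lambda>s. ?D [a] (x + t *\<^sub>R b + s *\<^sub>R a)) has_integral
          f (x + t *\<^sub>R b + h *\<^sub>R a) - f (x + t *\<^sub>R b + 0 *\<^sub>R a)) {0..h}"
        by (intro fundamental_theorem_of_calculus[OF h])
          (auto simp: has_real_derivative_iff_has_vector_derivative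
            intro: has_vector_derivative_at_within)
      then show ?thesis by (simp add: integral_unique add.commute add.left_commute)
    qed
    have "((\<lambda>t. integral (cbox 0 h) (\<lambda>s. ?D [a] (x + s *\<^sub>R a + t *\<^sub>R b))) has_field_derivative
        integral (cbox 0 h) (\<lambda>s. ?D [b, a] (x + s *\<^sub>R a + 0 *\<^sub>R b))) (at 0 within UNIV)"
    proof (rule leibniz_rule_field_derivative)
      show "((\<lambda>t. ?D [a] (x + s *\<^sub>R a + t *\<^sub>R b)) has_field_derivative
          ?D [b, a] (x + s *\<^sub>R a + t *\<^sub>R b)) (at t within UNIV)" for s t
        using smooth_has_derivative[OF sm, of "[a]" b "x + s *\<^sub>R a" t] ab by simp
      show "(\<lambda>s. ?D [a] (x + s *\<^sub>R a + t *\<^sub>R b)) integrable_on cbox 0 h" for t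
        by (intro integrable_continuous continuous_on_subset[OF cont[of "[a]"]])
          (use ab in \<open>auto intro!: continuous_intros\<close>)
      have "continuous_on UNIV (\<lambda>z. ?D [b, a] (x + snd z *\<^sub>R a + fst z *\<^sub>R b))"
        by (rule cont) (use ab in \<open>auto intro!: continuous_intros\<close>)
      then show "continuous_on (UNIV \<times> cbox 0 h) (\<lambda>(t, s). ?D [b, a] (x + s *\<^sub>R a + t *\<^sub>R b))"
        by (auto simp: split_beta intro: continuous_on_subset)
    qed auto
    then have "((\<lambda>t. f (x + h *\<^sub>R a + t *\<^sub>R b) - f (x + t *\<^sub>R b)) has_real_derivative
        integral {0..h} (\<lambda>s. ?D [b, a] (x + s *\<^sub>R a))) (at 0)"
      unfolding ftc by simp
    moreover have "((\<lambda>t. f (x + h *\<^sub>R a + t *\<^sub>R b) - f (x + t *\<^sub>R b)) has_real_derivative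
        ?D [b] (x + h *\<^sub>R a) - ?D [b] x) (at 0)"
      using smooth_has_derivative[OF sm, of "[]" b "x + h *\<^sub>R a" 0]
        smooth_has_derivative[OF sm, of "[]" b x 0] ab
      by (auto intro!: derivative_eq_intros)
    ultimately show ?thesis using DERIV_unique by blast
  qed
  \<comment> \<open>\<open>eq\<close> is available for \<open>h \<ge> 0\<close>, so the two
    derivatives are compared as one-sided derivatives within \<open>{0..1}\<close>, where they are
    unique.\<close>
  have "((\<lambda>h. integral {0..h} (\<lambda>s. ?D [b, a] (x + s *\<^sub>R a))) has_real_derivative
      ?D [b, a] (x + 0 *\<^sub>R a)) (at 0 within {0..1})"
    by (rule integral_has_real_derivative)
      (use ab in \<open>auto intro!: continuous_on_subset[OF cont[of "[b, a]", simplified]] continuous_intros\<close>)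
  then have "((\<lambda>h. ?D [b] (x + h *\<^sub>R a) - ?D [b] x) has_real_derivative ?D [b, a] x) (at 0 within {0..1})"
    by (subst has_field_derivative_cong_eventually[where g = "\<lambda>h. integral {0..h} (\<lambda>s. ?D [b, a] (x + s *\<^sub>R a))"])
      (use eq in \<open>auto simp: eventually_at_filter simp del: pderivs_simps intro!: always_eventually\<close>)
  moreover have "((\<lambda>h. ?D [b] (x + h *\<^sub>R a) - ?D [b] x) has_real_derivative ?D [a, b] x) (at 0 within {0..1})"
    using DERIV_diff[OF smooth_has_derivative[OF sm, of "[b]" a x 0] DERIV_const] ab
    by (rule_tac has_field_derivative_at_within) simp
  moreover have "at (0::real) within {0..1} \<noteq> bot"
    by (simp add: at_within_Icc_at_right)
  ultimately show "?D [a, b] x = ?D [b, a] x"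
    unfolding has_real_derivative_iff_has_vector_derivative
    by (metis vector_derivative_unique_within)
qed

lemma pderivs_snoc:
  fixes f :: "'a::euclidean_space \<Rightarrow> real"
  assumes "smooth_into euclidean f" "set bs \<subseteq> Basis" "b \<in> Basis"
  shows "pderivs euclidean (bs @ [b]) f = pderivs euclidean (b # bs) f"
  using assms(2)
proof (induction bs)
  case (Cons c bs)
  then show ?case
    using pderivative_commute[OF smooth_into_pderivs[OF assms(1), of bs], of c b] assms(3) by simp
qed simp

text \<open>The head of \<open>bs\<close> occurs somewhere in \<open>cs\<close> and is moved to the
  front there by \<open>pderivs_snoc\<close>; then induct.\<close>

lemma pderivs_mset:
  fixes f :: "'a::euclidean_space \<Rightarrow> real"
  assumes "smooth_into euclidean f" "set bs \<subseteq> Basis" "mset bs = mset cs"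
  shows "pderivs euclidean bs f = pderivs euclidean cs f"
  using assms(2,3)
proof (induction bs arbitrary: cs)
  case (Cons b bs)
  then have "b \<in> set cs" by (metis list.set_intros(1) mset_eq_setD)
  then obtain xs ys where cs: "cs = xs @ b # ys" by (meson split_list)
  have sub: "set xs \<subseteq> Basis" "set ys \<subseteq> Basis" "b \<in> Basis"
    using mset_eq_setD[OF Cons.prems(2)] Cons.prems(1) cs by auto
  have "pderivs euclidean cs f = pderivs euclidean (xs @ [b]) (pderivs euclidean ys f)"
    by (simp add: cs)
  also have "\<dots> = pderivs euclidean (b # xs) (pderivs euclidean ys f)"
    by (rule pderivs_snoc[OF smooth_into_pderivs[OF assms(1)]]) (use sub in auto)
  also have "\<dots> = pderivative euclidean b (pderivs euclidean (xs @ ys) f)" by simp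
  also have "pderivs euclidean (xs @ ys) f = pderivs euclidean bs f"
    by (rule Cons.IH[symmetric]) (use Cons.prems cs in auto)
  finally show ?case by simp
qed simp

subsection \<open>Multi-indices and lists of basis vectors\<close>

lemma basis_list:
  "distinct (basis_list :: 'a::euclidean_space list)" "set (basis_list :: 'a list) = Basis"
  using someI_ex[OF finite_distinct_list[OF finite_Basis]] unfolding basis_list_def
  by (auto simp: conj_commute)

definition mi_list :: "('a::euclidean_space \<Rightarrow> nat) \<Rightarrow> 'a list" where
  "mi_list \<alpha> = concat (map (\<lambda>b. replicate (\<alpha> b) b) basis_list)"

lemma mi_deriv_eq_pderivs: "mi_deriv X \<alpha> f = pderivs X (mi_list \<alpha>) f"
proof -
  have "foldr (\<lambda>b. pderivative X b ^^ \<alpha> b) bs f =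
      foldr (pderivative X) (concat (map (\<lambda>b. replicate (\<alpha> b) b) bs)) f" for bs
    by (induction bs) (simp_all add: foldr_replicate)
  then show ?thesis by (simp add: mi_deriv_def pderivs_def mi_list_def)
qed

lemma set_mi_list [simp]: "set (mi_list \<alpha>) \<subseteq> Basis"
  unfolding mi_list_def by (auto simp: basis_list)

lemma length_mi_list [simp]: "length (mi_list \<alpha>) = mi_order \<alpha>"
proof -
  have "length (mi_list \<alpha>) = (\<Sum>b\<leftarrow>basis_list. \<alpha> b)"
    by (simp add: mi_list_def length_concat o_def)
  also have "\<dots> = mi_order \<alpha>"
    by (simp add: mi_order_def sum_list_distinct_conv_sum_set basis_list)
  finally show ?thesis .
qed

text \<open>The multiplicities of a list form a multi-index whose canonical list is a permutation of
  the given one. With \<open>pderivs_mset\<close> this translates between norms indexed by lists and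
  norms indexed by multi-indices.\<close>

lemma mset_mi_list_count:
  assumes "set bs \<subseteq> Basis"
  shows "mset (mi_list (count (mset bs))) = mset bs"
proof -
  have "mset (concat (map (\<lambda>b. replicate (\<alpha> b) b) cs)) = (\<Sum>b\<in>set cs. replicate_mset (\<alpha> b) b)"
    if "distinct cs" for \<alpha> and cs :: "'a list"
    using that by (induction cs) auto
  from this[OF basis_list(1)] have "mset (mi_list (count (mset bs))) =
      (\<Sum>b\<in>Basis. replicate_mset (count (mset bs) b) b)"
    by (simp add: mi_list_def basis_list)
  also have "\<dots> = mset bs"
  proof (rule multiset_eqI)
    fix x
    show "count (\<Sum>b\<in>Basis. replicate_mset (count (mset bs) b) b) x = count (mset bs) x"
    proof (cases "x \<in> Basis")
      case True
      then show ?thesis by (simp add: count_sum)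
    next
      case False
      have "count (\<Sum>b\<in>Basis. replicate_mset (count (mset bs) b) b) x =
          (\<Sum>b\<in>Basis. count (replicate_mset (count (mset bs) b) b) x)"
        by (rule count_sum)
      also have "\<dots> = 0" using False by (intro sum.neutral) auto
      also have "\<dots> = count (mset bs) x"
        using False assms by (metis count_mset_0_iff subsetD)
      finally show ?thesis .
    qed
  qed
  finally show ?thesis .
qed

lemma split_list_prod_Basis:
  fixes ds :: "('a::euclidean_space \<times> 'b::euclidean_space) list"
  assumes "set ds \<subseteq> Basis"
  obtains as bs where "set as \<subseteq> Basis" "set bs \<subseteq> Basis" "mset ds = mset (inl as @ inr bs)"
proof -
  have "\<exists>as bs. set as \<subseteq> Basis \<and> set bs \<subseteq> Basis \<and> mset ds = mset (inl as @ inr bs)"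
    using assms
  proof (induction ds)
    case Nil
    then show ?case by (intro exI[of _ "[]"]) simp
  next
    case (Cons d ds)
    then obtain as bs where IH: "set as \<subseteq> Basis" "set bs \<subseteq> Basis" "mset ds = mset (inl as @ inr bs)"
      by auto
    from Cons have "d \<in> Basis" by simp
    then consider a where "d = (a, 0)" "a \<in> Basis" | b where "d = (0, b)" "b \<in> Basis"
      by (auto simp: Basis_prod_def)
    then show ?case
    proof cases
      case 1
      then show ?thesis using IH by (intro exI[of _ "a # as"] exI[of _ bs]) auto
    next
      case 2
      then show ?thesis using IH by (intro exI[of _ as] exI[of _ "b # bs"]) auto
    qed
  qed
  then show ?thesis using that by blast
qed

section \<open>\<open>L\<^sup>p\<close> norms\<close>

lemma epowr_ennreal: "0 \<le> c \<Longrightarrow> epowr (ennreal c) a = ennreal (c powr a)"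
  by (simp add: epowr_def)

lemma epowr_top [simp]: "epowr top a = top"
  by (simp add: epowr_def)

lemma epowr_0 [simp]: "epowr 0 a = 0"
  by (simp add: epowr_def)

lemma epowr_1 [simp]: "epowr x 1 = x"
  by (cases x rule: ennreal_cases) (simp_all add: epowr_ennreal)

lemma epowr_mono: "0 \<le> a \<Longrightarrow> x \<le> y \<Longrightarrow> epowr x a \<le> epowr y a"
  by (cases x rule: ennreal_cases; cases y rule: ennreal_cases)
    (auto simp: epowr_ennreal top_unique intro!: ennreal_leI powr_mono2)

text \<open>Valid for every exponent: the convention \<open>0 powr a = 0\<close> matches
  \<open>0 * top = 0\<close>.\<close>

lemma epowr_mult: "epowr (x * y) a = epowr x a * epowr y a"
proof (cases "x = top \<or> y = top")
  case True
  have "ennreal (c powr a) = 0 \<longleftrightarrow> c = 0" if "0 \<le> c" for c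
    using that by (simp add: ennreal_eq_0_iff)
  then show ?thesis
    using True by (cases x rule: ennreal_cases; cases y rule: ennreal_cases)
      (auto simp: epowr_ennreal ennreal_top_mult ennreal_mult_top)
next
  case False
  then obtain u v where "x = ennreal u" "y = ennreal v" "0 \<le> u" "0 \<le> v"
    by (metis ennreal_cases)
  then show ?thesis
    by (simp add: epowr_ennreal ennreal_mult[symmetric] powr_mult)
qed

lemma epowr_epowr: "epowr (epowr x a) b = epowr x (a * b)"
  by (cases x rule: ennreal_cases) (simp_all add: epowr_ennreal powr_powr)

lemma epowr_inverse [simp]:
  assumes "p \<noteq> 0"
  shows "epowr (epowr x p) (1 / p) = x" "epowr (epowr x (1 / p)) p = x"
  using assms by (simp_all add: epowr_epowr)

lemma epowr_le_cancel:
  assumes "0 < p" "epowr x p \<le> epowr y p"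
  shows "x \<le> y"
proof -
  have p0: "p \<noteq> 0" using assms(1) by simp
  have "epowr (epowr x p) (1 / p) \<le> epowr (epowr y p) (1 / p)"
    by (rule epowr_mono) (use assms in simp_all)
  then show ?thesis unfolding epowr_inverse(1)[OF p0] .
qed

lemma measurable_epowr [measurable (raw)]:
  assumes [measurable]: "f \<in> borel_measurable N"
  shows "(\<lambda>x. epowr (f x) a) \<in> borel_measurable N"
  unfolding epowr_def infinity_ennreal_def by measurable

text \<open>Functions take values in \<open>[0, \<infinity>]\<close> so that an inner norm, finite
  or not, can serve as the integrand of an outer one.\<close>

definition LpE :: "real \<Rightarrow> ('a::euclidean_space \<Rightarrow> ennreal) \<Rightarrow> ennreal" where
  "LpE p u = epowr (\<integral>\<^sup>+x. epowr (u x) p \<partial>lborel) (1 / p)"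

lemma eLp_norm_eq_LpE: "eLp_norm p f = LpE p (\<lambda>x. ennreal (norm (f x)))"
  by (simp add: eLp_norm_def LpE_def)

lemma epowr_LpE: "p \<noteq> 0 \<Longrightarrow> epowr (LpE p u) p = (\<integral>\<^sup>+x. epowr (u x) p \<partial>lborel)"
  by (simp add: LpE_def)

lemma LpE_mono: "0 \<le> p \<Longrightarrow> (\<And>x. u x \<le> v x) \<Longrightarrow> LpE p u \<le> LpE p v"
  unfolding LpE_def by (intro epowr_mono nn_integral_mono) auto

lemma LpE_cmult:
  assumes [measurable]: "u \<in> borel_measurable borel" and "p \<noteq> 0"
  shows "LpE p (\<lambda>x. c * u x) = c * LpE p u"
  using assms(2) by (simp add: LpE_def epowr_mult nn_integral_cmult)

lemma LpE_0 [simp]: "LpE p (\<lambda>x. 0) = 0"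
  by (simp add: LpE_def)

text \<open>Convexity of the p-th power. The tangent argument runs on the open half-line, which
  leaves out \<open>x = 0\<close>; there the left-hand side equals
  \<open>(1 - p) * a powr p\<close>.\<close>

lemma powr_above_tangent:
  fixes a x p :: real
  assumes "1 \<le> p" "0 < a" "0 \<le> x"
  shows "a powr p + p * a powr (p - 1) * (x - a) \<le> x powr p"
proof (cases "x = 0")
  case True
  have "a powr (p - 1) * a = a powr p" using assms by (simp add: powr_mult_base mult.commute)
  then have "a powr p + p * a powr (p - 1) * (x - a) = (1 - p) * a powr p"
    using True by (simp add: algebra_simps)
  also have "\<dots> \<le> 0" using assms by (simp add: mult_nonpos_nonneg)
  finally show ?thesis by (rule order_trans) simp
next
  case False
  have "x powr p - a powr p \<ge> (p * a powr (p - 1)) * (x - a)"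
    using assms False
    by (intro convex_on_imp_above_tangent[of "{0<..}"] powr_convex)
      (auto simp: interior_open intro!: derivative_eq_intros)
  then show ?thesis by simp
qed

text \<open>\<open>s = (u + v) / (a + b)\<close> is the convex combination of \<open>u / a\<close>
  and \<open>v / b\<close> with coefficients \<open>a / (a + b)\<close> and
  \<open>b / (a + b)\<close>. Averaging the tangent inequality at \<open>s\<close> over these two
  points cancels the linear terms.\<close>

lemma powr_convex_combination:
  fixes u v a b p :: real
  assumes "1 \<le> p" "0 \<le> u" "0 \<le> v" "0 < a" "0 < b"
  shows "(u + v) powr p \<le>
    (a + b) powr p * (a / (a + b) * (u / a) powr p + b / (a + b) * (v / b) powr p)"
proof (cases "u + v = 0")
  case True
  then show ?thesis using assms by (auto intro!: mult_nonneg_nonneg add_nonneg_nonneg)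
next
  case False
  define s where "s = (u + v) / (a + b)"
  have s: "0 < s" using False assms by (auto simp: s_def intro!: divide_pos_pos)
  define k where "k = p * s powr (p - 1)"
  have "a / (a + b) * (s powr p + k * (u / a - s)) + b / (a + b) * (s powr p + k * (v / b - s)) =
      (a / (a + b) + b / (a + b)) * (s powr p - k * s) + k * ((a / (a + b)) * (u / a) + (b / (a + b)) * (v / b))"
    by (simp only: distrib_left distrib_right right_diff_distrib left_diff_distrib mult_ac)
  also have "a / (a + b) + b / (a + b) = 1" using assms by (simp add: add_divide_distrib[symmetric])
  also have "(a / (a + b)) * (u / a) + (b / (a + b)) * (v / b) = s"
    using assms by (simp add: s_def add_divide_distrib)
  finally have "s powr p =
      a / (a + b) * (s powr p + k * (u / a - s)) + b / (a + b) * (s powr p + k * (v / b - s))"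
    by simp
  also have "\<dots> \<le> a / (a + b) * (u / a) powr p + b / (a + b) * (v / b) powr p"
    using assms s
    by (intro add_mono mult_left_mono powr_above_tangent[of p s, folded k_def]) auto
  finally have "s powr p \<le> a / (a + b) * (u / a) powr p + b / (a + b) * (v / b) powr p" .
  moreover have "(u + v) powr p = (a + b) powr p * s powr p"
    using assms by (simp add: powr_mult[symmetric] s_def)
  ultimately show ?thesis by (simp add: mult_left_mono)
qed

text \<open>Minkowski's inequality. With \<open>a\<close> and \<open>b\<close> slightly above the
  two norms, \<open>powr_convex_combination\<close> holds pointwise with coefficients for which the
  integral is at most \<open>(a + b) powr p\<close>. The summands \<open>e / 2\<close> keep
  \<open>a\<close> and \<open>b\<close> positive when a norm vanishes.\<close>

lemma LpE_add:
  assumes [measurable]: "u \<in> borel_measurable borel" "v \<in> borel_measurable borel" and p: "1 \<le> p"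
  shows "LpE p (\<lambda>x. u x + v x) \<le> LpE p u + LpE p v"
proof (rule ennreal_le_epsilon)
  fix e :: real assume fin: "LpE p u + LpE p v < top" and e: "0 < e"
  define a where "a = enn2real (LpE p u) + e / 2"
  define b where "b = enn2real (LpE p v) + e / 2"
  have ab: "0 < a" "0 < b" using e by (auto simp: a_def b_def add_nonneg_pos)
  have "LpE p u \<le> ennreal a" "LpE p v \<le> ennreal b"
    using fin e by (auto simp: a_def b_def ennreal_plus ennreal_enn2real)
  then have le: "epowr (LpE p u) p \<le> ennreal (a powr p)" "epowr (LpE p v) p \<le> ennreal (b powr p)"
    using p ab epowr_mono[of p "LpE p u" "ennreal a"] epowr_mono[of p "LpE p v" "ennreal b"]
    by (auto simp: epowr_ennreal)
  let ?A = "ennreal ((a + b) powr p * (a / (a + b)) / a powr p)"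
  let ?B = "ennreal ((a + b) powr p * (b / (a + b)) / b powr p)"
  have pointwise: "epowr (x + y) p \<le> ?A * epowr x p + ?B * epowr y p" for x y :: ennreal
  proof (cases "x = top \<or> y = top")
    case True
    have "0 < (a + b) powr p * (a / (a + b)) / a powr p" "0 < (a + b) powr p * (b / (a + b)) / b powr p"
      using ab by auto
    then show ?thesis using True by (auto simp: ennreal_mult_top ennreal_top_mult)
  next
    case False
    then obtain r s where rs: "x = ennreal r" "y = ennreal s" "0 \<le> r" "0 \<le> s"
      by (metis ennreal_cases)
    have "(r + s) powr p \<le> (a + b) powr p * (a / (a + b)) / a powr p * r powr p +
        (a + b) powr p * (b / (a + b)) / b powr p * s powr p"
      using powr_convex_combination[OF p rs(3,4) ab] rs ab by (simp add: powr_divide algebra_simps)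
    then show ?thesis using rs ab
      by (simp add: epowr_ennreal ennreal_plus[symmetric] ennreal_mult[symmetric] del: ennreal_plus)
  qed
  have "(\<integral>\<^sup>+x. epowr (u x + v x) p \<partial>lborel) \<le>
      (\<integral>\<^sup>+x. ?A * epowr (u x) p + ?B * epowr (v x) p \<partial>lborel)"
    by (intro nn_integral_mono pointwise)
  also have "\<dots> = ?A * epowr (LpE p u) p + ?B * epowr (LpE p v) p"
    using p by (simp add: nn_integral_add nn_integral_cmult epowr_LpE)
  also have "\<dots> \<le> ?A * ennreal (a powr p) + ?B * ennreal (b powr p)"
    using le by (intro add_mono mult_left_mono) auto
  also have "\<dots> = ennreal ((a + b) powr p * (a / (a + b)) + (a + b) powr p * (b / (a + b)))"
    using ab by (simp add: ennreal_mult[symmetric] ennreal_plus[symmetric] del: ennreal_plus)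
  also have "(a + b) powr p * (a / (a + b)) + (a + b) powr p * (b / (a + b)) = (a + b) powr p"
    using ab by (simp add: distrib_left[symmetric] add_divide_distrib[symmetric])
  finally have "LpE p (\<lambda>x. u x + v x) \<le> epowr (ennreal ((a + b) powr p)) (1 / p)"
    unfolding LpE_def using p by (intro epowr_mono) auto
  also have "\<dots> = ennreal (a + b)" using p ab by (simp add: epowr_ennreal powr_powr)
  also have "\<dots> = LpE p u + LpE p v + ennreal e"
  proof -
    have "ennreal (a + b) = ennreal (enn2real (LpE p u) + enn2real (LpE p v) + e)"
      by (simp add: a_def b_def add_ac)
    then show ?thesis using fin e by (simp add: ennreal_plus ennreal_enn2real)
  qed
  finally show "LpE p (\<lambda>x. u x + v x) \<le> LpE p u + LpE p v + ennreal e" .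
qed

lemma LpE_sum:
  assumes "finite I" "\<And>i. i \<in> I \<Longrightarrow> u i \<in> borel_measurable borel" and p: "1 \<le> p"
  shows "LpE p (\<lambda>x. \<Sum>i\<in>I. u i x) \<le> (\<Sum>i\<in>I. LpE p (u i))"
  using assms(1,2)
proof (induction I rule: finite_induct)
  case (insert i I)
  have "LpE p (\<lambda>x. u i x + (\<Sum>i\<in>I. u i x)) \<le> LpE p (u i) + LpE p (\<lambda>x. \<Sum>i\<in>I. u i x)"
    using insert.prems by (intro LpE_add p borel_measurable_sum) auto
  also have "\<dots> \<le> LpE p (u i) + (\<Sum>i\<in>I. LpE p (u i))"
    using insert by (intro add_left_mono) auto
  finally show ?case using insert by simp
qed simp

text \<open>Tonelli's theorem for p-th powers. It relies on equal exponents inside and outside,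
  where the outer p-th power undoes the inner root.\<close>

lemma LpE_LpE:
  fixes u :: "'a::euclidean_space \<times> 'b::euclidean_space \<Rightarrow> ennreal"
  assumes [measurable]: "u \<in> borel_measurable borel" and p: "p \<noteq> 0"
  shows "LpE p (\<lambda>x. LpE p (\<lambda>y. u (x, y))) = LpE p u"
proof -
  have m: "(\<lambda>z. epowr (u z) p) \<in> borel_measurable (lborel \<Otimes>\<^sub>M lborel)"
    unfolding lborel_prod by measurable
  have "(\<integral>\<^sup>+x. (\<integral>\<^sup>+y. epowr (u (x, y)) p \<partial>lborel) \<partial>lborel) = (\<integral>\<^sup>+z. epowr (u z) p \<partial>lborel)"
    using lborel.nn_integral_fst[OF m] by (simp add: lborel_prod)
  then show ?thesis using p by (simp add: LpE_def[of p "\<lambda>x. LpE p (\<lambda>y. u (x, y))"] epowr_LpE)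
      (simp add: LpE_def)
qed

lemma borel_measurable_LpE_slice [measurable]:
  fixes u :: "'a::euclidean_space \<times> 'b::euclidean_space \<Rightarrow> ennreal"
  assumes [measurable]: "u \<in> borel_measurable borel"
  shows "(\<lambda>x. LpE p (\<lambda>y. u (x, y))) \<in> borel_measurable borel"
proof -
  have [measurable]: "(\<lambda>z. epowr (u z) p) \<in> borel_measurable (borel \<Otimes>\<^sub>M lborel)"
    using assms by (simp add: borel_prod[symmetric] cong: measurable_cong_sets)
  show ?thesis unfolding LpE_def by measurable
qed

lemma eLp_norm_scaleR:
  fixes f :: "'a::euclidean_space \<Rightarrow> 'b::real_normed_vector"
  assumes [measurable]: "f \<in> borel_measurable borel" and "p \<noteq> 0"
  shows "eLp_norm p (\<lambda>x. c *\<^sub>R f x) = ennreal \<bar>c\<bar> * eLp_norm p f"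
  using LpE_cmult[of "\<lambda>x. ennreal (norm (f x))" p "ennreal \<bar>c\<bar>"] assms
  by (simp add: eLp_norm_eq_LpE ennreal_mult)

lemma eLp_norm_add:
  fixes f g :: "'a::euclidean_space \<Rightarrow> 'b::real_normed_vector"
  assumes [measurable]: "f \<in> borel_measurable borel" "g \<in> borel_measurable borel" and "1 \<le> p"
  shows "eLp_norm p (\<lambda>x. f x + g x) \<le> eLp_norm p f + eLp_norm p g"
proof -
  have "eLp_norm p (\<lambda>x. f x + g x) \<le> LpE p (\<lambda>x. ennreal (norm (f x)) + ennreal (norm (g x)))"
    unfolding eLp_norm_eq_LpE using assms
    by (intro LpE_mono)
      (auto simp: ennreal_plus[symmetric] simp del: ennreal_plus intro!: ennreal_leI norm_triangle_ineq)
  also have "\<dots> \<le> eLp_norm p f + eLp_norm p g"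
    unfolding eLp_norm_eq_LpE using assms by (intro LpE_add) auto
  finally show ?thesis .
qed

section \<open>Pointwise bounds by \<open>L\<^sup>p\<close> norms of derivatives\<close>

text \<open>
  The starting point is \<open>\<phi>(0) = \<integral>\<^sub>0\<^sup>1 \<phi>(t) - (1 - t) \<phi>'(t) dt\<close>, followed by Jensen's inequality.
\<close>

lemma powr_le_nn_integral_derivative:
  fixes \<phi> :: "real \<Rightarrow> real"
  assumes p: "1 \<le> p" and der: "\<And>t. (\<phi> has_real_derivative \<phi>' t) (at t)"
    and cont: "continuous_on UNIV \<phi>'"
  shows "ennreal (\<bar>\<phi> 0\<bar> powr p) \<le>
    ennreal (2 powr p) * (\<integral>\<^sup>+t. ennreal (\<bar>\<phi> t\<bar> powr p) + ennreal (\<bar>\<phi>' t\<bar> powr p) \<partial>lborel)"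
proof (cases "\<phi> 0 = 0")
  case True
  then show ?thesis by simp
next
  case False
  define a where "a = \<bar>\<phi> 0\<bar>"
  have a: "0 < a" using False by (simp add: a_def)
  have c\<phi>: "continuous_on S \<phi>" for S
    using der by (meson DERIV_isCont continuous_at_imp_continuous_on)
  have c\<phi>': "continuous_on S \<phi>'" for S using cont continuous_on_subset by blast
  define \<psi> where "\<psi> t = \<bar>\<phi> t\<bar> + \<bar>\<phi>' t\<bar>" for t
  have c\<psi>: "continuous_on S \<psi>" for S
    unfolding \<psi>_def by (intro continuous_intros c\<phi> c\<phi>')
  have \<psi>_int: "\<psi> integrable_on {0..1}" by (intro integrable_continuous_interval c\<psi>)
  \<comment> \<open>An antiderivative that vanishes at 1 and equals \<open>- \<phi> 0\<close> at 0,
    so that the integral over \<open>{0..1}\<close> is the point value.\<close>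
  have "((\<lambda>t. - ((1 - t) * \<phi> t)) has_real_derivative \<phi> t - (1 - t) * \<phi>' t) (at t)" for t
    using der[of t] by (auto intro!: derivative_eq_intros)
  then have "((\<lambda>t. \<phi> t - (1 - t) * \<phi>' t) has_integral - ((1 - 1) * \<phi> 1) - - ((1 - 0) * \<phi> 0)) {0..1}"
    by (intro fundamental_theorem_of_calculus)
      (auto simp: has_real_derivative_iff_has_vector_derivative intro: has_vector_derivative_at_within)
  then have I: "((\<lambda>t. \<phi> t - (1 - t) * \<phi>' t) has_integral \<phi> 0) {0..1}" by simp
  have "norm (integral {0..1} (\<lambda>t. \<phi> t - (1 - t) * \<phi>' t)) \<le> integral {0..1} \<psi>"
  proof (rule integral_norm_bound_integral)
    show "norm (\<phi> t - (1 - t) * \<phi>' t) \<le> \<psi> t" if "t \<in> {0..1}" for t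
    proof -
      have "\<bar>(1 - t) * \<phi>' t\<bar> \<le> 1 * \<bar>\<phi>' t\<bar>"
        unfolding abs_mult using that by (intro mult_right_mono) auto
      then show ?thesis unfolding \<psi>_def by auto
    qed
  qed (use I \<psi>_int in \<open>auto simp: integrable_on_def\<close>)
  then have a_le: "a \<le> integral {0..1} \<psi>" using I by (simp add: integral_unique a_def)
  have cpow: "continuous_on {0..1} (\<lambda>t. \<psi> t powr p)"
    using p by (intro continuous_on_powr' c\<psi> continuous_on_const) (auto simp: \<psi>_def)
  have pow_int: "((\<lambda>t. \<psi> t powr p) has_integral integral {0..1} (\<lambda>t. \<psi> t powr p)) {0..1}"
    by (intro integrable_integral integrable_continuous_interval cpow)
  \<comment> \<open>Jensen's inequality by hand: integrate the tangent of the p-th power at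
    \<open>a\<close> over the unit interval. Its linear term is nonnegative because \<open>a\<close>
    is at most the integral of \<open>\<psi>\<close>.\<close>
  have "((\<lambda>t. a powr p + p * a powr (p - 1) * (\<psi> t - a)) has_integral
      (a powr p + p * a powr (p - 1) * (integral {0..1} \<psi> - a))) {0..1}"
    using has_integral_add[OF has_integral_const_real[of "a powr p" 0 1]
        has_integral_mult_right[OF has_integral_diff[OF integrable_integral[OF \<psi>_int]
          has_integral_const_real[of a 0 1]], of "p * a powr (p - 1)"]]
    by simp
  from has_integral_le[OF this pow_int]
  have "a powr p + p * a powr (p - 1) * (integral {0..1} \<psi> - a) \<le> integral {0..1} (\<lambda>t. \<psi> t powr p)"
    using powr_above_tangent[OF p a] by (auto simp: \<psi>_def)
  moreover have "0 \<le> p * a powr (p - 1) * (integral {0..1} \<psi> - a)"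
    using p a_le by (intro mult_nonneg_nonneg) auto
  ultimately have "ennreal (a powr p) \<le> ennreal (integral {0..1} (\<lambda>t. \<psi> t powr p))"
    by (intro ennreal_leI) linarith
  also have "\<dots> = (\<integral>\<^sup>+t. ennreal (indicator {0..1} t * \<psi> t powr p) \<partial>lborel)"
    by (rule nn_integral_has_integral_lebesgue[symmetric, OF _ pow_int]) simp
  also have "\<dots> \<le> (\<integral>\<^sup>+t. ennreal (2 powr p) * (ennreal (\<bar>\<phi> t\<bar> powr p) + ennreal (\<bar>\<phi>' t\<bar> powr p)) \<partial>lborel)"
  proof (rule nn_integral_mono)
    fix t :: real
    have "\<psi> t powr p \<le> (2 * max \<bar>\<phi> t\<bar> \<bar>\<phi>' t\<bar>) powr p"
      using p by (intro powr_mono2) (auto simp: \<psi>_def)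
    also have "\<dots> = 2 powr p * max \<bar>\<phi> t\<bar> \<bar>\<phi>' t\<bar> powr p" by (simp add: powr_mult)
    also have "\<dots> \<le> 2 powr p * (\<bar>\<phi> t\<bar> powr p + \<bar>\<phi>' t\<bar> powr p)"
      by (intro mult_left_mono) (auto simp: max_def)
    finally have *: "\<psi> t powr p \<le> 2 powr p * (\<bar>\<phi> t\<bar> powr p + \<bar>\<phi>' t\<bar> powr p)" .
    have "ennreal (indicator {0..1} t * \<psi> t powr p) \<le> ennreal (\<psi> t powr p)"
      by (intro ennreal_leI) (auto simp: indicator_def)
    also have "\<dots> \<le> ennreal (2 powr p * (\<bar>\<phi> t\<bar> powr p + \<bar>\<phi>' t\<bar> powr p))"
      using * by (rule ennreal_leI)
    finally show "ennreal (indicator {0..1} t * \<psi> t powr p) \<le>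
        ennreal (2 powr p) * (ennreal (\<bar>\<phi> t\<bar> powr p) + ennreal (\<bar>\<phi>' t\<bar> powr p))"
      by (simp add: ennreal_mult ennreal_plus)
  qed
  also have "\<dots> = ennreal (2 powr p) * (\<integral>\<^sup>+t. ennreal (\<bar>\<phi> t\<bar> powr p) + ennreal (\<bar>\<phi>' t\<bar> powr p) \<partial>lborel)"
  proof -
    have [measurable]: "\<phi> \<in> borel_measurable borel" "\<phi>' \<in> borel_measurable borel"
      using c\<phi> c\<phi>' by (auto intro: borel_measurable_continuous_onI)
    show ?thesis by (rule nn_integral_cmult) measurable
  qed
  finally show ?thesis by (simp add: a_def)
qed

text \<open>For \<open>B \<subseteq> Basis\<close> this is the Lebesgue integral over the affine
  subspace through \<open>x\<close> spanned by \<open>B\<close>. It interpolates between the value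
  at \<open>x\<close> and the integral over the whole space, so that the Sobolev estimate can be
  proved by adding one direction at a time.\<close>

definition nn_integral_span :: "'a::euclidean_space set \<Rightarrow> ('a \<Rightarrow> ennreal) \<Rightarrow> 'a \<Rightarrow> ennreal" where
  "nn_integral_span B h x = (\<integral>\<^sup>+s. h (x + (\<Sum>b\<in>B. s b *\<^sub>R b)) \<partial>(\<Pi>\<^sub>M b\<in>B. lborel))"

interpretation lborel_product: product_sigma_finite "\<lambda>_. lborel :: real measure" ..

lemma nn_integral_span_empty [simp]: "nn_integral_span {} h x = h x"
  unfolding nn_integral_span_def
  by (subst lborel_product.nn_integral_empty) auto

lemma nn_integral_span_insert:
  assumes "finite B" "b \<notin> B" and [measurable]: "h \<in> borel_measurable borel"
  shows "nn_integral_span (insert b B) h x = (\<integral>\<^sup>+t. nn_integral_span B h (x + t *\<^sub>R b) \<partial>lborel)"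
proof -
  have m: "(\<lambda>s. h (x + (\<Sum>c\<in>insert b B. s c *\<^sub>R c))) \<in> borel_measurable (\<Pi>\<^sub>M b\<in>insert b B. lborel)"
    using assms(1) by measurable
  have eq: "(\<Sum>c\<in>insert b B. (s(b := t)) c *\<^sub>R c) = t *\<^sub>R b + (\<Sum>c\<in>B. s c *\<^sub>R c)" for s t
  proof -
    have "(\<Sum>c\<in>B. (s(b := t)) c *\<^sub>R c) = (\<Sum>c\<in>B. s c *\<^sub>R c)"
      using assms(2) by (intro sum.cong) auto
    then show ?thesis using assms(1,2) by simp
  qed
  show ?thesis
    unfolding nn_integral_span_def
      lborel_product.product_nn_integral_insert_rev[OF assms(1,2) m] eq
    by (simp add: add.assoc)
qed

lemma nn_integral_span_measurable:
  assumes "finite B" and [measurable]: "h \<in> borel_measurable borel"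
  shows "nn_integral_span B h \<in> borel_measurable borel"
proof -
  interpret B: sigma_finite_measure "\<Pi>\<^sub>M b\<in>B. lborel :: real measure"
    using lborel_product.sigma_finite[OF assms(1)] .
  have "(\<lambda>x. \<integral>\<^sup>+s. h (x + (\<Sum>b\<in>B. s b *\<^sub>R b)) \<partial>(\<Pi>\<^sub>M b\<in>B. lborel)) \<in> borel_measurable borel"
    using assms(1) by measurable
  then show ?thesis unfolding nn_integral_span_def[abs_def] .
qed

text \<open>Lebesgue measure is the image of the product measure on coordinates; by translation
  invariance the base point \<open>x\<close> disappears, which makes the resulting pointwise bound
  uniform in \<open>x\<close>.\<close>

lemma nn_integral_span_Basis:
  fixes h :: "'a::euclidean_space \<Rightarrow> ennreal"
  assumes [measurable]: "h \<in> borel_measurable borel"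
  shows "nn_integral_span Basis h x = (\<integral>\<^sup>+z. h z \<partial>lborel)"
proof -
  have "(\<integral>\<^sup>+z. h (x + z) \<partial>lborel) =
      (\<integral>\<^sup>+z. h (x + z) \<partial>distr (\<Pi>\<^sub>M b\<in>Basis. lborel) borel (\<lambda>f. \<Sum>b\<in>Basis. f b *\<^sub>R b))"
    by (subst lborel_eq) simp
  also have "\<dots> = nn_integral_span Basis h x"
    unfolding nn_integral_span_def by (subst nn_integral_distr) auto
  finally have "nn_integral_span Basis h x = (\<integral>\<^sup>+z. h (x + z) \<partial>lborel)" by simp
  also have "\<dots> = (\<integral>\<^sup>+z. h z \<partial>distr lborel borel ((+) x))"
    by (subst nn_integral_distr) auto
  finally show ?thesis by (simp add: lborel_distr_plus)
qed

section \<open>Sobolev estimates on the whole space and on slices\<close>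

definition basis_lists :: "nat \<Rightarrow> 'a::euclidean_space list set" where
  "basis_lists k = {bs. set bs \<subseteq> Basis \<and> length bs \<le> k}"

lemma finite_basis_lists [simp]: "finite (basis_lists k)"
  unfolding basis_lists_def by (intro finite_lists_length_le) simp

lemma basis_listsD: "S \<in> basis_lists k \<Longrightarrow> set S \<subseteq> Basis" "S \<in> basis_lists k \<Longrightarrow> length S \<le> k"
  by (simp_all add: basis_lists_def)

text \<open>Apply the one-dimensional estimate in the direction \<open>b\<close>, then the induction
  hypothesis to \<open>u\<close> and to its derivative along \<open>b\<close> at the points
  \<open>x + t *\<^sub>R b\<close>. Each direction costs \<open>2 powr p\<close> from the former,
  and a factor 2 because both functions contribute a sum over the longer lists.\<close>

lemma powr_le_nn_integral_span:
  fixes u :: "'a::euclidean_space \<Rightarrow> real"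
  assumes p: "1 \<le> p" and "finite B" "B \<subseteq> Basis" "smooth_into euclidean u"
  shows "ennreal (\<bar>u x\<bar> powr p) \<le> ennreal (2 * 2 powr p) ^ card B *
    (\<Sum>S\<in>basis_lists (card B). nn_integral_span B (\<lambda>z. ennreal (\<bar>pderivs euclidean S u z\<bar> powr p)) x)"
  using assms(2-)
proof (induction B arbitrary: u x rule: finite_induct)
  case empty
  have "basis_lists 0 = {[] :: 'a list}" by (auto simp: basis_lists_def)
  then show ?case by simp
next
  case (insert b B)
  let ?k = "card B" and ?c = "ennreal (2 * 2 powr p)"
  let ?h = "\<lambda>S v z. ennreal (\<bar>pderivs euclidean S v z\<bar> powr p)"
  let ?J = "nn_integral_span B" and ?J' = "nn_integral_span (insert b B)"
  let ?v = "pderivs euclidean [b] u"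
  have b: "b \<in> Basis" and sm: "smooth_into euclidean u" "smooth_into euclidean ?v"
    using insert.prems by (auto intro: smooth_into_pderivs simp del: pderivs_simps)
  have meas: "?h S v \<in> borel_measurable borel"
    if "S \<in> basis_lists k" "smooth_into euclidean v" for S v k
    using smooth_borel_measurable[OF that(2), of S] basis_listsD(1)[OF that(1)] by measurable
  have Jmeas: "(\<lambda>t. ?J (?h S v) (x + t *\<^sub>R b)) \<in> borel_measurable borel"
    if "S \<in> basis_lists k" "smooth_into euclidean v" for S v k
    using nn_integral_span_measurable[OF insert.hyps(1) meas[OF that]] by measurable
  have Jsum: "(\<integral>\<^sup>+t. (\<Sum>S\<in>basis_lists ?k. ?J (?h S v) (x + t *\<^sub>R b)) \<partial>lborel) =
      (\<Sum>S\<in>basis_lists ?k. ?J' (?h S v) x)" if "smooth_into euclidean v" for v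
    using Jmeas[OF _ that] nn_integral_span_insert[OF insert.hyps(1,2) meas[OF _ that]]
    by (simp add: nn_integral_sum)
  have "ennreal (\<bar>u x\<bar> powr p) \<le> ennreal (2 powr p) *
      (\<integral>\<^sup>+t. ennreal (\<bar>u (x + t *\<^sub>R b)\<bar> powr p) + ennreal (\<bar>?v (x + t *\<^sub>R b)\<bar> powr p) \<partial>lborel)"
    using powr_le_nn_integral_derivative[OF p, of "\<lambda>t. u (x + t *\<^sub>R b)" "\<lambda>t. ?v (x + t *\<^sub>R b)"]
      smooth_has_derivative[OF sm(1), of "[]" b] b
      continuous_on_compose2[OF smooth_continuous_on[OF sm(1), of "[b]" UNIV], of UNIV "\<lambda>t. x + t *\<^sub>R b"]
    by (simp add: continuous_intros)
  also have "\<dots> \<le> ennreal (2 powr p) * (\<integral>\<^sup>+t.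
      ?c ^ ?k * (\<Sum>S\<in>basis_lists ?k. ?J (?h S u) (x + t *\<^sub>R b)) +
      ?c ^ ?k * (\<Sum>S\<in>basis_lists ?k. ?J (?h S ?v) (x + t *\<^sub>R b)) \<partial>lborel)"
    using insert.prems sm by (intro mult_left_mono nn_integral_mono add_mono insert.IH) auto
  also have "\<dots> = ennreal (2 powr p) * (?c ^ ?k * (\<Sum>S\<in>basis_lists ?k. ?J' (?h S u) x) +
      ?c ^ ?k * (\<Sum>S\<in>basis_lists ?k. ?J' (?h S ?v) x))"
    using Jmeas[OF _ sm(1)] Jmeas[OF _ sm(2)] Jsum[OF sm(1)] Jsum[OF sm(2)]
    by (simp add: nn_integral_add nn_integral_cmult del: pderivs_simps)
  also have "\<dots> \<le> ennreal (2 powr p) * (?c ^ ?k * (\<Sum>S\<in>basis_lists (Suc ?k). ?J' (?h S u) x) +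
      ?c ^ ?k * (\<Sum>S\<in>basis_lists (Suc ?k). ?J' (?h S u) x))"
  proof (intro mult_left_mono add_mono)
    show "(\<Sum>S\<in>basis_lists ?k. ?J' (?h S u) x) \<le> (\<Sum>S\<in>basis_lists (Suc ?k). ?J' (?h S u) x)"
      by (rule sum_mono2[OF finite_basis_lists]) (auto simp: basis_lists_def)
    have "(\<Sum>S\<in>basis_lists ?k. ?J' (?h S ?v) x) = (\<Sum>S\<in>(\<lambda>S. S @ [b]) ` basis_lists ?k. ?J' (?h S u) x)"
      by (subst sum.reindex) (auto simp: inj_on_def)
    also have "\<dots> \<le> (\<Sum>S\<in>basis_lists (Suc ?k). ?J' (?h S u) x)"
      using b by (intro sum_mono2[OF finite_basis_lists]) (auto simp: basis_lists_def)
    finally show "(\<Sum>S\<in>basis_lists ?k. ?J' (?h S ?v) x) \<le> (\<Sum>S\<in>basis_lists (Suc ?k). ?J' (?h S u) x)" .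
  qed auto
  also have "\<dots> = (2 * ennreal (2 powr p)) * ?c ^ ?k * (\<Sum>S\<in>basis_lists (Suc ?k). ?J' (?h S u) x)"
    by (simp add: mult_2[symmetric] mult_ac)
  also have "2 * ennreal (2 powr p) = ?c" by (simp add: ennreal_mult)
  finally show ?case using insert.hyps by simp
qed

definition sobolev_const :: "'a::euclidean_space itself \<Rightarrow> real \<Rightarrow> real" where
  "sobolev_const _ p = (2 * 2 powr p) ^ DIM('a)"

lemma powr_le_sobolev:
  fixes u :: "'a::euclidean_space \<Rightarrow> real"
  assumes "1 \<le> p" "smooth_into euclidean u"
  shows "ennreal (\<bar>u x\<bar> powr p) \<le> ennreal (sobolev_const TYPE('a) p) *
    (\<Sum>S\<in>basis_lists DIM('a). \<integral>\<^sup>+z. ennreal (\<bar>pderivs euclidean S u z\<bar> powr p) \<partial>lborel)"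
proof -
  have "(\<lambda>z. ennreal (\<bar>pderivs euclidean S u z\<bar> powr p)) \<in> borel_measurable borel"
    if "S \<in> basis_lists DIM('a)" for S :: "'a list"
    using smooth_borel_measurable[OF assms(2) basis_listsD(1)[OF that]] by measurable
  then show ?thesis
    using powr_le_nn_integral_span[OF assms(1) finite_Basis subset_refl assms(2), of x]
    by (simp add: sobolev_const_def nn_integral_span_Basis ennreal_power)
qed

lemma epowr_eLp_norm:
  fixes f :: "'a::euclidean_space \<Rightarrow> real"
  assumes "p \<noteq> 0"
  shows "epowr (eLp_norm p f) p = (\<integral>\<^sup>+z. ennreal (\<bar>f z\<bar> powr p) \<partial>lborel)"
  using assms by (simp add: eLp_norm_eq_LpE epowr_LpE epowr_ennreal)

text \<open>The p-th root of the constant that appears when each of the finitely many integrals in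
  \<open>powr_le_sobolev\<close> is bounded by the same p-th power.\<close>

definition sobolev_factor :: "'a::euclidean_space itself \<Rightarrow> real \<Rightarrow> real" where
  "sobolev_factor _ p = (sobolev_const TYPE('a) p * card (basis_lists DIM('a) :: 'a list set)) powr (1 / p)"

lemma sobolev_factor_nonneg [simp]: "0 \<le> sobolev_factor T p"
  by (simp add: sobolev_factor_def)

lemma epowr_sobolev_factor:
  assumes "1 \<le> p"
  shows "epowr (ennreal (sobolev_factor TYPE('a::euclidean_space) p)) p =
    ennreal (sobolev_const TYPE('a) p) * of_nat (card (basis_lists DIM('a) :: 'a list set))"
  using assms
  by (simp add: sobolev_factor_def epowr_ennreal powr_powr sobolev_const_def ennreal_mult ennreal_of_nat_eq_real_of_nat)

lemma sobolev_pointwise: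
  fixes u :: "'a::euclidean_space \<Rightarrow> real"
  assumes p: "1 \<le> p" and u: "smooth_into euclidean u"
    and Q: "\<And>S. S \<in> basis_lists DIM('a) \<Longrightarrow> eLp_norm p (pderivs euclidean S u) \<le> Q"
  shows "ennreal \<bar>u x\<bar> \<le> ennreal (sobolev_factor TYPE('a) p) * Q"
proof -
  have "(\<Sum>S\<in>basis_lists DIM('a). \<integral>\<^sup>+z. ennreal (\<bar>pderivs euclidean S u z\<bar> powr p) \<partial>lborel) \<le>
      (\<Sum>S\<in>(basis_lists DIM('a) :: 'a list set). epowr Q p)"
    using p Q by (intro sum_mono) (auto simp: epowr_eLp_norm[symmetric] intro!: epowr_mono)
  then have "ennreal (sobolev_const TYPE('a) p) *
      (\<Sum>S\<in>basis_lists DIM('a). \<integral>\<^sup>+z. ennreal (\<bar>pderivs euclidean S u z\<bar> powr p) \<partial>lborel) \<le>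
      epowr (ennreal (sobolev_factor TYPE('a) p) * Q) p"
    by (simp add: epowr_mult epowr_sobolev_factor[OF p] mult.assoc mult_left_mono)
  with powr_le_sobolev[OF p u, of x]
  have "epowr (ennreal \<bar>u x\<bar>) p \<le> epowr (ennreal (sobolev_factor TYPE('a) p) * Q) p"
    by (simp add: epowr_ennreal)
  then show ?thesis by (rule epowr_le_cancel[rotated]) (use p in simp)
qed

text \<open>Not the supremum of \<open>F\<close> over the first variable but its Sobolev majorant
  (\<open>le_slice_sup\<close>). Unlike the supremum itself it is an explicit integral in
  \<open>x\<close>, hence measurable in \<open>y\<close>, and Tonelli computes its norm.\<close>

definition slice_sup :: "real \<Rightarrow> ('a::euclidean_space \<times> 'b::euclidean_space \<Rightarrow> real) \<Rightarrow> 'b \<Rightarrow> ennreal" where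
  "slice_sup p F y = epowr (ennreal (sobolev_const TYPE('a) p) *
     (\<Sum>S\<in>basis_lists DIM('a). \<integral>\<^sup>+x. ennreal (\<bar>pderivs euclidean (inl S) F (x, y)\<bar> powr p) \<partial>lborel)) (1 / p)"

lemma le_slice_sup:
  fixes F :: "'a::euclidean_space \<times> 'b::euclidean_space \<Rightarrow> real"
  assumes "1 \<le> p" "smooth_into euclidean F"
  shows "ennreal \<bar>F (x, y)\<bar> \<le> slice_sup p F y"
proof -
  have "ennreal (\<bar>F (x, y)\<bar> powr p) \<le> ennreal (sobolev_const TYPE('a) p) *
     (\<Sum>S\<in>basis_lists DIM('a). \<integral>\<^sup>+x. ennreal (\<bar>pderivs euclidean (inl S) F (x, y)\<bar> powr p) \<partial>lborel)"
    using powr_le_sobolev[OF assms(1) smooth_slice_fst[OF assms(2), of y], of x]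
      pderivs_slice_fst[OF assms(2) basis_listsD(1), of _ _ y]
    by simp
  then have "epowr (epowr (ennreal \<bar>F (x, y)\<bar>) p) (1 / p) \<le> slice_sup p F y"
    unfolding slice_sup_def using assms(1) by (intro epowr_mono) (auto simp: epowr_ennreal)
  then show ?thesis using assms(1) by simp
qed

lemma slice_measurable:
  fixes F :: "'a::euclidean_space \<times> 'b::euclidean_space \<Rightarrow> real"
  assumes "smooth_into euclidean F" "set ds \<subseteq> Basis"
  shows "(\<lambda>z. ennreal (\<bar>pderivs euclidean ds F z\<bar> powr p)) \<in> borel_measurable (lborel \<Otimes>\<^sub>M lborel)"
  unfolding lborel_prod using smooth_borel_measurable[OF assms] by measurable

lemma slice_sup_measurable:
  fixes F :: "'a::euclidean_space \<times> 'b::euclidean_space \<Rightarrow> real"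
  assumes "smooth_into euclidean F"
  shows "slice_sup p F \<in> borel_measurable borel"
proof -
  have [measurable]: "(\<lambda>y. \<integral>\<^sup>+x. ennreal (\<bar>pderivs euclidean (inl S) F (x, y)\<bar> powr p) \<partial>lborel) \<in> borel_measurable borel"
    if "S \<in> basis_lists DIM('a)" for S :: "'a list"
  proof -
    have "(\<lambda>(y, x). ennreal (\<bar>pderivs euclidean (inl S) F (x, y)\<bar> powr p)) \<in> borel_measurable (lborel \<Otimes>\<^sub>M lborel)"
      using measurable_compose[OF measurable_pair_swap'
          slice_measurable[OF assms set_inl_inr(1)[THEN iffD2, OF basis_listsD(1)[OF that]], of p]]
      by (simp add: split_beta)
    from lborel.borel_measurable_nn_integral[OF this] show ?thesis by simp
  qed
  show ?thesis unfolding slice_sup_def[abs_def] by measurable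
qed

text \<open>Integrating the Sobolev majorant in \<open>y\<close> turns its integrals over slices
  into integrals over the product. A supremum in the outer variable is thus paid for with at most
  \<open>DIM('a)\<close> additional outer derivatives.\<close>

lemma LpE_slice_sup_le:
  fixes F :: "'a::euclidean_space \<times> 'b::euclidean_space \<Rightarrow> real"
  assumes p: "1 \<le> p" and F: "smooth_into euclidean F"
    and Q: "\<And>S. S \<in> basis_lists DIM('a) \<Longrightarrow> eLp_norm p (pderivs euclidean (inl S) F) \<le> Q"
  shows "LpE p (slice_sup p F) \<le> ennreal (sobolev_factor TYPE('a) p) * Q"
proof -
  let ?g = "\<lambda>S z. ennreal (\<bar>pderivs euclidean (inl S) F z\<bar> powr p)"
  note set_inl_inr [simp del]
  have m: "?g S \<in> borel_measurable (lborel \<Otimes>\<^sub>M lborel)" if "S \<in> basis_lists DIM('a)" for S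
    using slice_measurable[OF F] set_inl_inr(1)[THEN iffD2, OF basis_listsD(1)[OF that]] by blast
  have m': "(\<lambda>y. \<integral>\<^sup>+x. ?g S (x, y) \<partial>lborel) \<in> borel_measurable lborel"
    if "S \<in> basis_lists DIM('a)" for S
    using measurable_compose[OF measurable_pair_swap' m[OF that]]
    by (intro lborel.borel_measurable_nn_integral) (simp add: split_beta)
  have "(\<integral>\<^sup>+y. epowr (slice_sup p F y) p \<partial>lborel) = (\<integral>\<^sup>+y. ennreal (sobolev_const TYPE('a) p) *
     (\<Sum>S\<in>basis_lists DIM('a). \<integral>\<^sup>+x. ?g S (x, y) \<partial>lborel) \<partial>lborel)"
    using p by (simp add: slice_sup_def)
  also have "\<dots> = ennreal (sobolev_const TYPE('a) p) *
     (\<Sum>S\<in>basis_lists DIM('a). \<integral>\<^sup>+y. \<integral>\<^sup>+x. ?g S (x, y) \<partial>lborel \<partial>lborel)"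
    using m' by (subst nn_integral_cmult) (auto simp: nn_integral_sum intro!: borel_measurable_sum)
  also have "\<dots> = ennreal (sobolev_const TYPE('a) p) *
     (\<Sum>S\<in>basis_lists DIM('a). \<integral>\<^sup>+z. ?g S z \<partial>lborel)"
    using lborel_pair.nn_integral_snd[OF m] by (simp add: lborel_prod)
  also have "\<dots> = ennreal (sobolev_const TYPE('a) p) *
     (\<Sum>S\<in>(basis_lists DIM('a) :: 'a list set). epowr (eLp_norm p (pderivs euclidean (inl S) F)) p)"
    using p by (simp add: epowr_eLp_norm)
  also have "\<dots> \<le> ennreal (sobolev_const TYPE('a) p) * (\<Sum>S\<in>(basis_lists DIM('a) :: 'a list set). epowr Q p)"
    using p Q by (intro mult_left_mono sum_mono epowr_mono) auto
  also have "\<dots> = epowr (ennreal (sobolev_factor TYPE('a) p) * Q) p"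
    by (simp add: epowr_mult epowr_sobolev_factor[OF p] mult.assoc)
  finally have "LpE p (slice_sup p F) \<le> epowr (epowr (ennreal (sobolev_factor TYPE('a) p) * Q) p) (1 / p)"
    unfolding LpE_def using p by (intro epowr_mono) auto
  then show ?thesis using p by simp
qed

section \<open>Spaces of smooth functions defined by weights\<close>

text \<open>For smooth \<open>f\<close> the supremum over lists equals the one over multi-indices
  (\<open>wnorm_eq_SUP_mi_deriv\<close>); with lists, derivatives of derivatives are handled by
  concatenation.\<close>

definition wnorm :: "(nat \<Rightarrow> real) \<Rightarrow> real \<Rightarrow> ('a::euclidean_space \<Rightarrow> real) \<Rightarrow> ennreal" where
  "wnorm w p f = (SUP bs\<in>{bs. set bs \<subseteq> Basis}. ennreal (w (length bs)) * eLp_norm p (pderivs euclidean bs f))"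

definition wspace :: "real \<Rightarrow> (nat \<Rightarrow> real) set \<Rightarrow> ('a::euclidean_space \<Rightarrow> real) set" where
  "wspace p W = {f. smooth_into euclidean f \<and> (\<forall>w\<in>W. wnorm w p f < \<infinity>)}"

definition wseminorms :: "real \<Rightarrow> (nat \<Rightarrow> real) set \<Rightarrow> (('a::euclidean_space \<Rightarrow> real) \<Rightarrow> real) set" where
  "wseminorms p W = {\<lambda>f. enn2real (wnorm w p f) | w. w \<in> W}"

text \<open>The second clause combines an outer and an inner weight into one for the total order,
  with a spare geometric factor \<open>K ^ k\<close> that pays for summing over all inner lists of
  length \<open>k\<close>. The third clause goes back and yields the norms of the uncurried
  function. The last one provides a weight that sees all low orders, as the Sobolev estimates
  require; the indicator weights vanish at high orders.\<close>

definition weight_system :: "(nat \<Rightarrow> real) set \<Rightarrow> bool" where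
  "weight_system W \<longleftrightarrow>
     (\<forall>w\<in>W. \<forall>k. 0 \<le> w k) \<and>
     (\<forall>w1\<in>W. \<forall>w2\<in>W. \<forall>K\<ge>1. \<exists>w\<in>W. \<exists>C\<ge>0. \<forall>j k. w1 j * w2 k * K ^ k \<le> C * w (j + k)) \<and>
     (\<forall>w\<in>W. \<exists>w1\<in>W. \<exists>w2\<in>W. \<exists>C\<ge>0. \<forall>j k. w (j + k) \<le> C * (w1 j * w2 k)) \<and>
     (\<forall>J. \<exists>w\<in>W. \<forall>j\<le>J. 0 < w j)"

lemma le_wnorm:
  "set bs \<subseteq> Basis \<Longrightarrow> ennreal (w (length bs)) * eLp_norm p (pderivs euclidean bs f) \<le> wnorm w p f"
  unfolding wnorm_def by (rule SUP_upper) simp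

lemma wnorm_leI:
  "(\<And>bs. set bs \<subseteq> Basis \<Longrightarrow> ennreal (w (length bs)) * eLp_norm p (pderivs euclidean bs f) \<le> Q) \<Longrightarrow> wnorm w p f \<le> Q"
  unfolding wnorm_def by (rule SUP_least) simp

lemma eLp_norm_le_wnorm:
  assumes "set bs \<subseteq> Basis" "0 < w (length bs)"
  shows "eLp_norm p (pderivs euclidean bs f) \<le> ennreal (1 / w (length bs)) * wnorm w p f"
proof -
  have "eLp_norm p (pderivs euclidean bs f) =
      ennreal (1 / w (length bs)) * (ennreal (w (length bs)) * eLp_norm p (pderivs euclidean bs f))"
    using assms(2) by (simp add: mult.assoc[symmetric] ennreal_mult[symmetric])
  also have "\<dots> \<le> ennreal (1 / w (length bs)) * wnorm w p f"
    by (intro mult_left_mono le_wnorm assms) auto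
  finally show ?thesis .
qed

lemma smooth_fun_add:
  fixes f g :: "'a::euclidean_space \<Rightarrow> real"
  assumes "smooth_into euclidean f" "smooth_into euclidean g"
  shows "smooth_into euclidean (f + g)"
    and "set bs \<subseteq> Basis \<Longrightarrow>
      pderivs euclidean bs (f + g) = (\<lambda>x. pderivs euclidean bs f x + pderivs euclidean bs g x)"
  using smooth_lincomb[OF assms, where c = 1 and d = 1] by (simp_all add: plus_fun_def)

lemma smooth_fun_diff:
  fixes f g :: "'a::euclidean_space \<Rightarrow> real"
  assumes "smooth_into euclidean f" "smooth_into euclidean g"
  shows "smooth_into euclidean (f - g)"
    and "set bs \<subseteq> Basis \<Longrightarrow>
      pderivs euclidean bs (f - g) = (\<lambda>x. pderivs euclidean bs f x - pderivs euclidean bs g x)"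
  using smooth_lincomb[OF assms, where c = 1 and d = "-1"] by (simp_all add: fun_diff_def)

lemma smooth_fun_scaleR:
  fixes f :: "'a::euclidean_space \<Rightarrow> real"
  assumes "smooth_into euclidean f"
  shows "smooth_into euclidean (c *\<^sub>R f)"
    and "set bs \<subseteq> Basis \<Longrightarrow> pderivs euclidean bs (c *\<^sub>R f) = (\<lambda>x. c * pderivs euclidean bs f x)"
  using smooth_lincomb[OF assms assms, where c = c and d = 0] by (simp_all add: scaleR_fun_def)

lemma wnorm_add:
  fixes f g :: "'a::euclidean_space \<Rightarrow> real"
  assumes "smooth_into euclidean f" "smooth_into euclidean g" "1 \<le> p"
  shows "wnorm w p (f + g) \<le> wnorm w p f + wnorm w p g"
proof (rule wnorm_leI)
  fix bs :: "'a list" assume bs: "set bs \<subseteq> Basis"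
  have "eLp_norm p (pderivs euclidean bs (f + g)) \<le>
      eLp_norm p (pderivs euclidean bs f) + eLp_norm p (pderivs euclidean bs g)"
    unfolding smooth_fun_add(2)[OF assms(1,2) bs]
    using assms bs by (intro eLp_norm_add smooth_borel_measurable)
  then have "ennreal (w (length bs)) * eLp_norm p (pderivs euclidean bs (f + g)) \<le>
      ennreal (w (length bs)) * (eLp_norm p (pderivs euclidean bs f) + eLp_norm p (pderivs euclidean bs g))"
    by (intro mult_left_mono) auto
  also have "\<dots> \<le> wnorm w p f + wnorm w p g"
    unfolding distrib_left using bs by (intro add_mono le_wnorm)
  finally show "ennreal (w (length bs)) * eLp_norm p (pderivs euclidean bs (f + g)) \<le> wnorm w p f + wnorm w p g" .
qed

lemma wnorm_scaleR:
  fixes f :: "'a::euclidean_space \<Rightarrow> real"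
  assumes "smooth_into euclidean f" "1 \<le> p"
  shows "wnorm w p (c *\<^sub>R f) = ennreal \<bar>c\<bar> * wnorm w p f"
proof -
  have "wnorm w p (c *\<^sub>R f) =
    (SUP bs\<in>{bs. set bs \<subseteq> Basis}. ennreal \<bar>c\<bar> * (ennreal (w (length bs)) * eLp_norm p (pderivs euclidean bs f)))"
    unfolding wnorm_def
  proof (rule SUP_cong)
    fix bs :: "'a list" assume "bs \<in> {bs. set bs \<subseteq> Basis}"
    then have "set bs \<subseteq> Basis" by simp
    then show "ennreal (w (length bs)) * eLp_norm p (pderivs euclidean bs (c *\<^sub>R f)) =
        ennreal \<bar>c\<bar> * (ennreal (w (length bs)) * eLp_norm p (pderivs euclidean bs f))"
      using smooth_fun_scaleR(2)[OF assms(1)] assms(2)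
        eLp_norm_scaleR[OF smooth_borel_measurable[OF assms(1)], of bs p c]
      by (simp add: mult_ac)
  qed simp
  also have "\<dots> = ennreal \<bar>c\<bar> * wnorm w p f"
    unfolding wnorm_def by (rule SUP_mult_left_ennreal[symmetric])
  finally show ?thesis .
qed

lemma subspace_wspace:
  assumes "1 \<le> p"
  shows "subspace (wspace p W :: ('a::euclidean_space \<Rightarrow> real) set)"
proof (rule subspaceI)
  show "f + g \<in> wspace p W" if "f \<in> wspace p W" "g \<in> wspace p W" for f g :: "'a \<Rightarrow> real"
  proof -
    have "wnorm w p (f + g) < top" if "w \<in> W" for w
    proof (rule le_less_trans[OF wnorm_add])
      show "wnorm w p f + wnorm w p g < top"
        using that \<open>f \<in> wspace p W\<close> \<open>g \<in> wspace p W\<close> by (simp add: wspace_def)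
    qed (use \<open>f \<in> wspace p W\<close> \<open>g \<in> wspace p W\<close> assms in \<open>auto simp: wspace_def\<close>)
    then show ?thesis using that smooth_fun_add(1)[of f g] by (simp add: wspace_def)
  qed
  show "c *\<^sub>R f \<in> wspace p W" if "f \<in> wspace p W" for c and f :: "'a \<Rightarrow> real"
    using that smooth_fun_scaleR(1)[of f c] wnorm_scaleR[of f p _ c] assms
    by (simp add: wspace_def ennreal_mult_less_top)
  have z: "smooth_into euclidean (0 :: 'a \<Rightarrow> real)"
    using smooth_zero(1) by (simp add: zero_fun_def)
  have "wnorm w p (0 :: 'a \<Rightarrow> real) = 0" for w
    using wnorm_scaleR[OF z assms, of w 0] by simp
  then show "(0 :: 'a \<Rightarrow> real) \<in> wspace p W" using z by (simp add: wspace_def)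
qed

lemma seminorm_on_wnorm:
  fixes V :: "('a::euclidean_space \<Rightarrow> real) set"
  assumes "1 \<le> p" "\<And>f. f \<in> V \<Longrightarrow> smooth_into euclidean f \<and> wnorm w p f < \<infinity>"
  shows "seminorm_on V (\<lambda>f. enn2real (wnorm w p f))"
  unfolding seminorm_on_def
proof (intro conjI ballI allI)
  show "enn2real (wnorm w p (f + g)) \<le> enn2real (wnorm w p f) + enn2real (wnorm w p g)"
    if "f \<in> V" "g \<in> V" for f g
  proof -
    have "enn2real (wnorm w p (f + g)) \<le> enn2real (wnorm w p f + wnorm w p g)"
      using that assms by (intro enn2real_mono wnorm_add) auto
    also have "\<dots> = enn2real (wnorm w p f) + enn2real (wnorm w p g)"
      using that assms by (intro enn2real_plus) auto
    finally show ?thesis .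
  qed
  show "enn2real (wnorm w p (c *\<^sub>R f)) = \<bar>c\<bar> * enn2real (wnorm w p f)" if "f \<in> V" for c f
    using that assms by (simp add: wnorm_scaleR enn2real_mult)
qed simp

lemma seminorm_family_wspace:
  assumes "1 \<le> p"
  shows "seminorm_family (wspace p W) (wseminorms p W)"
  unfolding seminorm_family_def
proof (intro conjI ballI subspace_wspace assms)
  fix q :: "('a \<Rightarrow> real) \<Rightarrow> real" assume "q \<in> wseminorms p W"
  then obtain w where "w \<in> W" "q = (\<lambda>f. enn2real (wnorm w p f))" by (auto simp: wseminorms_def)
  then show "seminorm_on (wspace p W) q"
    using assms by (auto simp: wspace_def intro!: seminorm_on_wnorm)
qed

section \<open>Pointwise control and convergence in weighted spaces\<close>

lemma weight_pos_lower_bound: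
  fixes J :: nat and w :: "nat \<Rightarrow> real"
  assumes "\<And>j. j \<le> J \<Longrightarrow> 0 < w j"
  obtains c where "0 < c" "\<And>j. j \<le> J \<Longrightarrow> c \<le> w j"
proof (rule that)
  show "0 < Min (w ` {..J})" using assms by (simp add: Min_gr_iff)
  show "Min (w ` {..J}) \<le> w j" if "j \<le> J" for j using that by simp
qed

text \<open>The Sobolev bound for \<open>pderivs euclidean bs u\<close> involves derivatives of
  order at most \<open>DIM('a) + length bs\<close>. A weight that is positive up to this order has a
  positive minimum \<open>c\<close> there and controls all of them at once.\<close>

lemma pderivs_le_wnorm:
  assumes W: "weight_system W" and p: "1 \<le> p" and bs: "set (bs :: 'a::euclidean_space list) \<subseteq> Basis"
  obtains w K where "w \<in> W" "0 \<le> K"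
    "\<And>u y. u \<in> wspace p W \<Longrightarrow> \<bar>pderivs euclidean bs u y\<bar> \<le> K * enn2real (wnorm w p u)"
proof -
  obtain w where w: "w \<in> W" "\<And>j. j \<le> DIM('a) + length bs \<Longrightarrow> 0 < w j"
    using W unfolding weight_system_def by meson
  obtain c where c: "0 < c" "\<And>j. j \<le> DIM('a) + length bs \<Longrightarrow> c \<le> w j"
    using weight_pos_lower_bound[of "DIM('a) + length bs" w] w(2) by blast
  let ?s = "sobolev_factor TYPE('a) p"
  have "\<bar>pderivs euclidean bs u y\<bar> \<le> (?s / c) * enn2real (wnorm w p u)" if u: "u \<in> wspace p W" for u y
  proof -
    have sm: "smooth_into euclidean u" and fin: "wnorm w p u < top"
      using u w(1) by (auto simp: wspace_def)
    have "ennreal \<bar>pderivs euclidean bs u y\<bar> \<le> ennreal ?s * (ennreal (1 / c) * wnorm w p u)"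
    proof (rule sobolev_pointwise[OF p smooth_into_pderivs[OF sm bs]])
      fix S :: "'a list" assume S: "S \<in> basis_lists DIM('a)"
      then have len: "length (S @ bs) \<le> DIM('a) + length bs" using basis_listsD by fastforce
      have "eLp_norm p (pderivs euclidean (S @ bs) u) \<le> ennreal (1 / w (length (S @ bs))) * wnorm w p u"
        using basis_listsD(1)[OF S] bs w(2)[OF len] by (intro eLp_norm_le_wnorm) auto
      also have "\<dots> \<le> ennreal (1 / c) * wnorm w p u"
        using c(1) c(2)[OF len] by (intro mult_right_mono ennreal_leI divide_left_mono) auto
      finally show "eLp_norm p (pderivs euclidean S (pderivs euclidean bs u)) \<le> ennreal (1 / c) * wnorm w p u"
        by simp
    qed
    also have "\<dots> = ennreal (?s / c * enn2real (wnorm w p u))"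
      using fin c(1) by (cases "wnorm w p u" rule: ennreal_cases) (auto simp: ennreal_mult[symmetric] mult_ac)
    finally show ?thesis using c(1) by (simp add: ennreal_le_iff)
  qed
  then show ?thesis using that[of w "?s / c"] w(1) c(1) by simp
qed

text \<open>\<open>P\<close> generates a topology on \<open>wspace p W\<close> at least as fine as
  that of the weights. It may be strictly finer, which leaves room for the inductive limit
  topology.\<close>

definition admissible :: "real \<Rightarrow> (nat \<Rightarrow> real) set \<Rightarrow> (('b::euclidean_space \<Rightarrow> real) \<Rightarrow> real) set \<Rightarrow> bool" where
  "admissible p W P \<longleftrightarrow> seminorm_family (wspace p W) P \<and>
     (\<forall>w\<in>W. seminorm_dominated (wspace p W) P (\<lambda>f. enn2real (wnorm w p f)))"

lemma admissible_wseminorms: "1 \<le> p \<Longrightarrow> admissible p W (wseminorms p W)"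
  unfolding admissible_def using seminorm_family_wspace[of p W]
  by (auto intro!: seminorm_dominated_member simp: wseminorms_def)

lemma tendsto_dominated:
  assumes "seminorm_family V P" "seminorm_dominated V P s" "eventually (\<lambda>x. f x - l \<in> V) G"
    "\<And>q. q \<in> P \<Longrightarrow> ((\<lambda>x. q (f x - l)) \<longlongrightarrow> 0) G" "seminorm_on V s"
  shows "((\<lambda>x. s (f x - l)) \<longlongrightarrow> 0) G"
proof -
  obtain F C where F: "finite F" "F \<subseteq> P" "\<forall>x\<in>V. s x \<le> C * (\<Sum>q\<in>F. q x)"
    using assms(2) by (auto simp: seminorm_dominated_def)
  have "((\<lambda>x. C * (\<Sum>q\<in>F. q (f x - l))) \<longlongrightarrow> C * (\<Sum>q\<in>F. 0)) G"
    using F assms(4) by (intro tendsto_intros) auto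
  then have lim: "((\<lambda>x. C * (\<Sum>q\<in>F. q (f x - l))) \<longlongrightarrow> 0) G" by simp
  show ?thesis
  proof (rule tendsto_sandwich[OF _ _ tendsto_const lim])
    show "\<forall>\<^sub>F x in G. 0 \<le> s (f x - l)"
      using assms(3) by eventually_elim (rule seminorm_on_nonneg[OF assms(5)])
    show "\<forall>\<^sub>F x in G. s (f x - l) \<le> C * (\<Sum>q\<in>F. q (f x - l))"
      using assms(3) by eventually_elim (use F in blast)
  qed
qed

text \<open>Sobolev bounds every derivative uniformly in the point by a norm that \<open>P\<close>
  dominates. Pointwise convergence identifies the derivatives of an uncurried map; uniformity gives
  their joint continuity.\<close>

lemma admissible_uniform_limit_pderivs:
  assumes W: "weight_system W" and adm: "admissible p W P" and p: "1 \<le> p"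
    and bs: "set (bs :: 'b::euclidean_space list) \<subseteq> Basis"
    and lim: "limitin (seminorm_topology (wspace p W) P) f l G"
  shows "uniform_limit UNIV (\<lambda>x. pderivs euclidean bs (f x)) (pderivs euclidean bs l) G"
proof -
  have fam: "seminorm_family (wspace p W) P" using adm by (simp add: admissible_def)
  obtain w K where w: "w \<in> W" "0 \<le> K"
    "\<And>u y. u \<in> wspace p W \<Longrightarrow> \<bar>pderivs euclidean bs u y\<bar> \<le> K * enn2real (wnorm w p u)"
    using pderivs_le_wnorm[OF W p bs] by metis
  have l: "l \<in> wspace p W" and f: "eventually (\<lambda>x. f x \<in> wspace p W) G"
    and P0: "\<And>q. q \<in> P \<Longrightarrow> ((\<lambda>x. q (f x - l)) \<longlongrightarrow> 0) G"
    using lim unfolding limitin_seminorm_topology[OF fam] by auto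
  have fl: "eventually (\<lambda>x. f x - l \<in> wspace p W) G"
    using f by eventually_elim (use l subspace_diff[OF subspace_wspace[OF p]] in blast)
  have "((\<lambda>x. enn2real (wnorm w p (f x - l))) \<longlongrightarrow> 0) G"
  proof (rule tendsto_dominated[OF fam])
    show "\<forall>\<^sub>F x in G. f x - l \<in> wspace p W" by (rule fl)
    show "((\<lambda>x. q (f x - l)) \<longlongrightarrow> 0) G" if "q \<in> P" for q by (rule P0[OF that])
    show "seminorm_dominated (wspace p W) P (\<lambda>f. enn2real (wnorm w p f))"
      using adm w(1) by (simp add: admissible_def)
    show "seminorm_on (wspace p W) (\<lambda>f. enn2real (wnorm w p f))"
      by (rule seminorm_on_wnorm[OF p]) (use w(1) in \<open>auto simp: wspace_def\<close>)
  qed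
  then have lim1: "((\<lambda>x. K * enn2real (wnorm w p (f x - l))) \<longlongrightarrow> 0) G"
    using tendsto_mult_right_zero by blast
  show ?thesis
    unfolding uniform_limit_iff
  proof (intro allI impI)
    fix e :: real assume "0 < e"
    from order_tendstoD(2)[OF lim1 this] fl f
    show "\<forall>\<^sub>F x in G. \<forall>y\<in>UNIV. dist (pderivs euclidean bs (f x) y) (pderivs euclidean bs l y) < e"
    proof eventually_elim
      case (elim x)
      have "\<bar>pderivs euclidean bs (f x) y - pderivs euclidean bs l y\<bar> \<le> K * enn2real (wnorm w p (f x - l))" for y
        using w(3)[OF elim(2), of y] smooth_fun_diff(2)[of "f x" l bs] l bs elim(3) by (simp add: wspace_def)
      then show ?case using elim(1) by (auto simp: dist_real_def intro: le_less_trans)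
    qed
  qed
qed

lemma admissible_separating:
  assumes "weight_system W" "admissible p W P" "1 \<le> p"
    and u: "u \<in> wspace p W" "\<forall>q\<in>P. q u = 0"
  shows "u = (0 :: 'a::euclidean_space \<Rightarrow> real)"
proof -
  obtain w K where w: "w \<in> W" "0 \<le> K"
    "\<And>u y. u \<in> wspace p W \<Longrightarrow> \<bar>pderivs euclidean [] u y\<bar> \<le> K * enn2real (wnorm w p (u :: 'a \<Rightarrow> real))"
    using pderivs_le_wnorm[OF assms(1,3), of "[]"] by (metis empty_subsetI list.set(1))
  obtain F C where F: "F \<subseteq> P" "enn2real (wnorm w p u) \<le> C * (\<Sum>q\<in>F. q u)"
    using assms(2) w(1) u(1) unfolding admissible_def seminorm_dominated_def by meson
  have "(\<Sum>q\<in>F. q u) = 0" using F u by (intro sum.neutral) auto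
  then have "enn2real (wnorm w p u) = 0" using F by (simp add: order_antisym)
  then show "u = 0" using w(3)[OF u(1)] by (auto simp: fun_eq_iff)
qed

lemma Hausdorff_space_admissible:
  assumes "weight_system W" "admissible p W P" "1 \<le> p"
  shows "Hausdorff_space (seminorm_topology (wspace p W) P)"
  using assms(2) admissible_separating[OF assms]
  by (intro Hausdorff_space_seminorm_topology) (simp_all add: admissible_def)

subsection \<open>From functions of two variables to vector-valued functions\<close>

text \<open>Used for functions \<open>H\<close> built from slices of \<open>F\<close>: a slice
  itself, an increment, or the error of a difference quotient. The inner norm of the Sobolev
  majorant costs outer orders up to \<open>J\<close>, namely \<open>DIM('a)\<close> plus the length
  of the lists in \<open>A\<close>, so \<open>w\<close> has to be compared with \<open>w'\<close>
  only after shifts by at most \<open>J\<close>.\<close>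

lemma wnorm_slice_le:
  fixes F :: "'a::euclidean_space \<times> 'b::euclidean_space \<Rightarrow> real" and H :: "'b \<Rightarrow> real"
  assumes p: "1 \<le> p" and F: "smooth_into euclidean F" and A: "finite A"
    and AJ: "\<And>as. as \<in> A \<Longrightarrow> set as \<subseteq> Basis \<and> DIM('a) + length as \<le> J"
    and nn: "0 \<le> c" "0 \<le> C" "\<And>k. 0 \<le> w k"
    and ww: "\<And>j k. j \<le> J \<Longrightarrow> w k \<le> C * w' (j + k)"
    and H: "\<And>bs y. set bs \<subseteq> Basis \<Longrightarrow> ennreal \<bar>pderivs euclidean bs H y\<bar> \<le>
      ennreal c * (\<Sum>as\<in>A. slice_sup p (pderivs euclidean (inl as @ inr bs) F) y)"
  shows "wnorm w p H \<le> ennreal (c * card A * sobolev_factor TYPE('a) p * C) * wnorm w' p F"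
proof (rule wnorm_leI)
  fix bs :: "'b list" assume bs: "set bs \<subseteq> Basis"
  let ?s = "sobolev_factor TYPE('a) p" and ?Q = "wnorm w' p F"
  let ?G = "\<lambda>as. pderivs euclidean (inl as @ inr bs) F"
  have sub: "set (inl S @ inl as @ inr bs :: ('a \<times> 'b) list) \<subseteq> Basis" if "as \<in> A" "set S \<subseteq> Basis" for as S
    using AJ[OF that(1)] that(2) bs by (auto simp: Pair_in_Basis)
  have smG: "smooth_into euclidean (?G as)" if "as \<in> A" for as
    using sub[OF that, of "[]"] by (intro smooth_into_pderivs F) simp
  have bound: "ennreal (w (length bs)) * LpE p (slice_sup p (?G as)) \<le> ennreal (?s * C) * ?Q" if as: "as \<in> A" for as
  \<comment> \<open>Where the weight vanishes the left-hand side is 0; elsewhere the weight can be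
    divided out.\<close>
  proof (cases "w (length bs) = 0")
    case False
    then have w: "0 < w (length bs)" using nn(3)[of "length bs"] by simp
    have "LpE p (slice_sup p (?G as)) \<le> ennreal ?s * (ennreal (C / w (length bs)) * ?Q)"
    proof (rule LpE_slice_sup_le[OF p smG[OF as]])
      fix S :: "'a list" assume S: "S \<in> basis_lists DIM('a)"
      let ?ds = "inl S @ inl as @ inr bs :: ('a \<times> 'b) list"
      have le: "w (length bs) \<le> C * w' (length ?ds)"
        using ww[of "length S + length as" "length bs"] basis_listsD(2)[OF S] AJ[OF as] by (simp add: add.assoc)
      have "ennreal (w (length bs)) * eLp_norm p (pderivs euclidean ?ds F) \<le>
          ennreal (C * w' (length ?ds)) * eLp_norm p (pderivs euclidean ?ds F)"
        by (intro mult_right_mono ennreal_leI le) auto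
      also have "\<dots> = ennreal C * (ennreal (w' (length ?ds)) * eLp_norm p (pderivs euclidean ?ds F))"
        using nn by (simp add: ennreal_mult' mult.assoc)
      also have "\<dots> \<le> ennreal C * ?Q"
        using sub[OF as basis_listsD(1)[OF S]] by (intro mult_left_mono le_wnorm) auto
      finally have "ennreal (1 / w (length bs)) * (ennreal (w (length bs)) * eLp_norm p (pderivs euclidean ?ds F)) \<le>
          ennreal (1 / w (length bs)) * (ennreal C * ?Q)"
        by (intro mult_left_mono) auto
      then show "eLp_norm p (pderivs euclidean (inl S) (?G as)) \<le> ennreal (C / w (length bs)) * ?Q"
        using w nn by (simp add: mult.assoc[symmetric] ennreal_mult[symmetric])
    qed
    then have "ennreal (w (length bs)) * LpE p (slice_sup p (?G as)) \<le>
        ennreal (w (length bs)) * (ennreal ?s * (ennreal (C / w (length bs)) * ?Q))"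
      by (intro mult_left_mono) auto
    also have "\<dots> = ennreal (?s * C) * ?Q"
      using w nn by (simp add: mult.assoc[symmetric] ennreal_mult[symmetric])
    finally show ?thesis .
  qed simp
  have "eLp_norm p (pderivs euclidean bs H) \<le> LpE p (\<lambda>y. ennreal c * (\<Sum>as\<in>A. slice_sup p (?G as) y))"
    unfolding eLp_norm_eq_LpE using p H[OF bs] by (intro LpE_mono) auto
  also have "\<dots> = ennreal c * LpE p (\<lambda>y. \<Sum>as\<in>A. slice_sup p (?G as) y)"
    using p slice_sup_measurable[OF smG] by (intro LpE_cmult borel_measurable_sum) auto
  also have "\<dots> \<le> ennreal c * (\<Sum>as\<in>A. LpE p (slice_sup p (?G as)))"
    using p slice_sup_measurable[OF smG] A by (intro mult_left_mono LpE_sum) auto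
  finally have "ennreal (w (length bs)) * eLp_norm p (pderivs euclidean bs H) \<le>
      ennreal (w (length bs)) * (ennreal c * (\<Sum>as\<in>A. LpE p (slice_sup p (?G as))))"
    by (intro mult_left_mono) auto
  also have "\<dots> = ennreal c * (\<Sum>as\<in>A. ennreal (w (length bs)) * LpE p (slice_sup p (?G as)))"
    by (simp add: sum_distrib_left mult_ac)
  also have "\<dots> \<le> ennreal c * (\<Sum>as\<in>A. ennreal (?s * C) * ?Q)"
    by (intro mult_left_mono sum_mono bound) auto
  also have "\<dots> = ennreal (c * card A * ?s * C) * ?Q"
    using nn by (simp add: ennreal_of_nat_eq_real_of_nat mult.assoc[symmetric] ennreal_mult[symmetric])
  finally show "ennreal (w (length bs)) * eLp_norm p (pderivs euclidean bs H) \<le> ennreal (c * card A * ?s * C) * ?Q" .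
qed

section \<open>Increments and difference quotients of slices\<close>

lemma real_mvt:
  fixes \<phi> :: "real \<Rightarrow> real"
  assumes "\<And>t. (\<phi> has_real_derivative \<phi>' t) (at t)"
  obtains \<xi> where "\<bar>\<xi>\<bar> \<le> \<bar>d\<bar>" "\<phi> d - \<phi> 0 = d * \<phi>' \<xi>"
proof (cases d "0::real" rule: linorder_cases)
  case less
  then obtain z where "d < z" "z < 0" "\<phi> 0 - \<phi> d = (0 - d) * \<phi>' z"
    using MVT2[of d 0 \<phi> \<phi>'] assms by blast
  then show ?thesis using that[of z] by (simp add: algebra_simps)
next
  case equal
  then show ?thesis using that[of 0] by simp
next
  case greater
  then obtain z where "0 < z" "z < d" "\<phi> d - \<phi> 0 = (d - 0) * \<phi>' z"
    using MVT2[of 0 d \<phi> \<phi>'] assms by blast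
  then show ?thesis using that[of z] by simp
qed

text \<open>Move along one coordinate at a time and apply the mean value theorem to each
  leg.\<close>

lemma smooth_increment_le:
  fixes u :: "'a::euclidean_space \<Rightarrow> real"
  assumes u: "smooth_into euclidean u" and B: "finite B" "B \<subseteq> Basis"
    and M: "\<And>z b. b \<in> B \<Longrightarrow> ennreal \<bar>pderivs euclidean [b] u z\<bar> \<le> M b"
  shows "ennreal \<bar>u (x + (\<Sum>b\<in>B. d b *\<^sub>R b)) - u x\<bar> \<le> (\<Sum>b\<in>B. ennreal \<bar>d b\<bar> * M b)"
  using B M
proof (induction B arbitrary: x rule: finite_induct)
  case (insert b B)
  let ?x = "x + (\<Sum>b\<in>B. d b *\<^sub>R b)"
  have b: "b \<in> Basis" using insert.prems by simp
  obtain \<xi> where \<xi>: "u (?x + d b *\<^sub>R b) - u (?x + 0 *\<^sub>R b) = d b * pderivs euclidean [b] u (?x + \<xi> *\<^sub>R b)"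
    using real_mvt[of "\<lambda>t. u (?x + t *\<^sub>R b)" "\<lambda>t. pderivs euclidean [b] u (?x + t *\<^sub>R b)" "d b"]
      smooth_has_derivative[OF u, of "[]" b ?x] b by auto
  have "ennreal \<bar>u (?x + d b *\<^sub>R b) - u ?x\<bar> = ennreal \<bar>d b\<bar> * ennreal \<bar>pderivs euclidean [b] u (?x + \<xi> *\<^sub>R b)\<bar>"
    using \<xi> by (simp add: abs_mult ennreal_mult del: pderivs_simps)
  also have "\<dots> \<le> ennreal \<bar>d b\<bar> * M b" using insert.prems by (intro mult_left_mono) auto
  finally have 1: "ennreal \<bar>u (?x + d b *\<^sub>R b) - u ?x\<bar> \<le> ennreal \<bar>d b\<bar> * M b" .
  have 2: "ennreal \<bar>u ?x - u x\<bar> \<le> (\<Sum>b\<in>B. ennreal \<bar>d b\<bar> * M b)"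
    using insert.prems by (intro insert.IH) auto
  have "x + (\<Sum>b\<in>insert b B. d b *\<^sub>R b) = ?x + d b *\<^sub>R b" using insert.hyps by (simp add: add_ac)
  then have "ennreal \<bar>u (x + (\<Sum>b\<in>insert b B. d b *\<^sub>R b)) - u x\<bar> \<le>
      ennreal (\<bar>u (?x + d b *\<^sub>R b) - u ?x\<bar> + \<bar>u ?x - u x\<bar>)"
    by (simp only:) (intro ennreal_leI, linarith)
  also have "\<dots> \<le> ennreal \<bar>d b\<bar> * M b + (\<Sum>b\<in>B. ennreal \<bar>d b\<bar> * M b)"
    using add_mono[OF 1 2] by simp
  finally show ?case using insert.hyps by simp
qed simp

lemma slice_increment_le:
  fixes G :: "'a::euclidean_space \<times> 'b::euclidean_space \<Rightarrow> real"
  assumes p: "1 \<le> p" and G: "smooth_into euclidean G"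
  shows "ennreal \<bar>G (x', y) - G (x, y)\<bar> \<le>
    ennreal (norm (x' - x)) * (\<Sum>a\<in>Basis. slice_sup p (pderivs euclidean [(a, 0)] G) y)"
proof -
  have "ennreal \<bar>G (x + (\<Sum>a\<in>Basis. ((x' - x) \<bullet> a) *\<^sub>R a), y) - G (x, y)\<bar> \<le>
      (\<Sum>a\<in>Basis. ennreal \<bar>(x' - x) \<bullet> a\<bar> * slice_sup p (pderivs euclidean [(a, 0)] G) y)"
  proof (rule smooth_increment_le[OF smooth_slice_fst[OF G]])
    fix z a :: 'a assume a: "a \<in> Basis"
    have "smooth_into euclidean (pderivs euclidean [(a, 0)] G)"
      using a by (intro smooth_into_pderivs G) (simp add: Pair_in_Basis)
    from le_slice_sup[OF p this, of z y]
    show "ennreal \<bar>pderivs euclidean [a] (\<lambda>x. G (x, y)) z\<bar> \<le> slice_sup p (pderivs euclidean [(a, 0)] G) y"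
      using pderivs_slice_fst[OF G, of "[a]" y] a by (simp del: pderivs_simps)
  qed auto
  also have "\<dots> \<le> (\<Sum>a\<in>Basis. ennreal (norm (x' - x)) * slice_sup p (pderivs euclidean [(a, 0)] G) y)"
    by (intro sum_mono mult_right_mono ennreal_leI Basis_le_norm) auto
  finally show ?thesis by (simp add: euclidean_representation sum_distrib_left)
qed

text \<open>Two mean value steps: the quotient is the first derivative at some \<open>\<xi>\<close>,
  and its deviation from the derivative at 0 is \<open>\<xi>\<close> times a second derivative, with
  \<open>\<xi>\<close> no larger than \<open>t\<close> in absolute value.\<close>

lemma slice_quotient_le:
  fixes G :: "'a::euclidean_space \<times> 'b::euclidean_space \<Rightarrow> real"
  assumes p: "1 \<le> p" and G: "smooth_into euclidean G" and a: "a \<in> Basis" and t: "t \<noteq> 0"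
  shows "ennreal \<bar>inverse t * (G (x + t *\<^sub>R a, y) - G (x, y)) - pderivs euclidean [(a, 0)] G (x, y)\<bar> \<le>
    ennreal \<bar>t\<bar> * slice_sup p (pderivs euclidean [(a, 0), (a, 0)] G) y"
proof -
  have a0: "(a, 0) \<in> (Basis :: ('a \<times> 'b) set)" using a by (simp add: Pair_in_Basis)
  let ?D = "\<lambda>ds t. pderivs euclidean ds G ((x, y) + t *\<^sub>R (a, 0))"
  have der: "(?D ds has_real_derivative ?D ((a, 0) # ds) t) (at t)" if "set ds \<subseteq> Basis" for ds t
    using smooth_has_derivative[OF G that a0] .
  obtain \<xi> where \<xi>: "\<bar>\<xi>\<bar> \<le> \<bar>t\<bar>" "?D [] t - ?D [] 0 = t * ?D [(a, 0)] \<xi>"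
    using real_mvt[OF der[of "[]"], of t] by auto
  obtain \<eta> where \<eta>: "?D [(a, 0)] \<xi> - ?D [(a, 0)] 0 = \<xi> * ?D [(a, 0), (a, 0)] \<eta>"
    using real_mvt[OF der[of "[(a, 0)]"], of \<xi>] a0 by auto
  have "inverse t * (G (x + t *\<^sub>R a, y) - G (x, y)) - pderivs euclidean [(a, 0)] G (x, y) =
      \<xi> * ?D [(a, 0), (a, 0)] \<eta>"
  proof -
    have "inverse t * (?D [] t - ?D [] 0) = ?D [(a, 0)] \<xi>" unfolding \<xi>(2) using t by simp
    then show ?thesis using \<eta> by (simp del: pderivs_simps(2))
  qed
  then have "ennreal \<bar>inverse t * (G (x + t *\<^sub>R a, y) - G (x, y)) - pderivs euclidean [(a, 0)] G (x, y)\<bar> =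
      ennreal \<bar>\<xi>\<bar> * ennreal \<bar>?D [(a, 0), (a, 0)] \<eta>\<bar>"
    by (simp add: abs_mult ennreal_mult del: pderivs_simps)
  also have "\<dots> \<le> ennreal \<bar>t\<bar> * slice_sup p (pderivs euclidean [(a, 0), (a, 0)] G) y"
  proof (intro mult_mono ennreal_leI \<xi>(1))
    have "smooth_into euclidean (pderivs euclidean [(a, 0), (a, 0)] G)"
      using a0 by (intro smooth_into_pderivs G) simp
    from le_slice_sup[OF p this, of "x + \<eta> *\<^sub>R a" y]
    show "ennreal \<bar>?D [(a, 0), (a, 0)] \<eta>\<bar> \<le> slice_sup p (pderivs euclidean [(a, 0), (a, 0)] G) y"
      by (simp del: pderivs_simps)
  qed auto
  finally show ?thesis .
qed

text \<open>The candidates for the iterated derivatives of \<open>curry F\<close> in the sense of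
  \<open>smooth_into_family\<close>.\<close>

definition slice :: "('a::euclidean_space \<times> 'b::euclidean_space \<Rightarrow> real) \<Rightarrow> 'a list \<Rightarrow> 'a \<Rightarrow> 'b \<Rightarrow> real" where
  "slice F as x = (\<lambda>y. pderivs euclidean (inl as) F (x, y))"

lemma slice_Nil: "slice F [] = curry F"
  by (auto simp: slice_def fun_eq_iff)

lemma
  fixes F :: "'a::euclidean_space \<times> 'b::euclidean_space \<Rightarrow> real"
  assumes F: "smooth_into euclidean F" and as: "set as \<subseteq> Basis"
  shows smooth_into_slice: "smooth_into euclidean (slice F as x)"
    and pderivs_slice: "set bs \<subseteq> Basis \<Longrightarrow>
      pderivs euclidean bs (slice F as x) = (\<lambda>y. pderivs euclidean (inl as @ inr bs) F (x, y))"
proof -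
  have sm: "smooth_into euclidean (pderivs euclidean (inl as) F)"
    using as by (intro smooth_into_pderivs F set_inl_inr[THEN iffD2])
  then show "smooth_into euclidean (slice F as x)"
    unfolding slice_def by (rule smooth_slice_snd)
  assume bs: "set bs \<subseteq> Basis"
  have "pderivs euclidean (inr bs @ inl as) F = pderivs euclidean (inl as @ inr bs) F"
    using set_inl_inr(1)[THEN iffD2, OF as] set_inl_inr(2)[THEN iffD2, OF bs]
    by (intro pderivs_mset F) simp_all
  then show "pderivs euclidean bs (slice F as x) = (\<lambda>y. pderivs euclidean (inl as @ inr bs) F (x, y))"
    unfolding slice_def pderivs_slice_snd[OF sm bs] by simp
qed

text \<open>
  For every continuous seminorm \<open>s\<close> on the target there is a weight \<open>w\<close> dominating \<open>s\<close> such that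
  the weights bounding \<open>f\<close> absorb \<open>w\<close> together with any weight in \<open>W\<close> for the outer variable.
  In the Roumieu case \<open>w\<close> has to depend on \<open>f\<close> and is not in \<open>W\<close>.
\<close>

definition controlled ::
    "real \<Rightarrow> (nat \<Rightarrow> real) set \<Rightarrow> (('b::euclidean_space \<Rightarrow> real) \<Rightarrow> real) set
      \<Rightarrow> ('a::euclidean_space \<times> 'b \<Rightarrow> real) \<Rightarrow> bool" where
  "controlled p W P f \<longleftrightarrow> (\<forall>s\<in>P. \<forall>K\<ge>1. \<exists>w C. (\<forall>k. 0 \<le> w k) \<and> 0 \<le> C \<and>
     (\<forall>u\<in>wspace p W. wnorm w p u < \<infinity> \<longrightarrow> s u \<le> C * enn2real (wnorm w p u)) \<and>
     (\<forall>v\<in>W. \<exists>w' C'. 0 \<le> C' \<and> wnorm w' p f < \<infinity> \<and>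
        (\<forall>j k. v j * w k * K ^ k \<le> C' * w' (j + k))))"

lemma controlledE:
  assumes "controlled p W P f" "s \<in> P" "1 \<le> K"
  obtains w C where "\<And>k. 0 \<le> w k" "0 \<le> C"
    "\<And>u. u \<in> wspace p W \<Longrightarrow> wnorm w p u < \<infinity> \<Longrightarrow> s u \<le> C * enn2real (wnorm w p u)"
    "\<And>v. v \<in> W \<Longrightarrow> \<exists>w' C'. 0 \<le> C' \<and> wnorm w' p f < \<infinity> \<and>
        (\<forall>j k. v j * w k * K ^ k \<le> C' * w' (j + k))"
  using assms unfolding controlled_def by (metis (no_types, lifting))

text \<open>Absorb \<open>w\<close> together with a weight \<open>v \<in> W\<close> that is positive
  up to \<open>J\<close>, then divide by the minimum of \<open>v\<close> on that range. One constant
  and one \<open>w'\<close> serve all shifts \<open>j \<le> J\<close>.\<close>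

lemma weight_shift:
  assumes W: "weight_system W" and nn: "\<And>k. 0 \<le> w k"
    and abs: "\<And>v. v \<in> W \<Longrightarrow> \<exists>w' C'. 0 \<le> C' \<and> wnorm w' p f < \<infinity> \<and> (\<forall>j k. v j * w k \<le> C' * w' (j + k))"
  obtains w' C where "0 \<le> (C :: real)" "wnorm w' p f < \<infinity>" "\<And>j k. j \<le> J \<Longrightarrow> w k \<le> C * w' (j + k)"
proof -
  obtain v where v: "v \<in> W" "\<And>j. j \<le> J \<Longrightarrow> 0 < v j"
    using W unfolding weight_system_def by meson
  obtain c where c: "0 < c" "\<And>j. j \<le> J \<Longrightarrow> c \<le> v j"
    using weight_pos_lower_bound[of J v] v(2) by blast
  obtain w' C' where w': "0 \<le> C'" "wnorm w' p f < \<infinity>" "\<And>j k. v j * w k \<le> C' * w' (j + k)"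
    using abs[OF v(1)] by blast
  have "w k \<le> C' / c * w' (j + k)" if "j \<le> J" for j k
  proof -
    have "c * w k \<le> v j * w k" using c(2)[OF that] nn by (intro mult_right_mono) auto
    also have "\<dots> \<le> C' * w' (j + k)" by (rule w'(3))
    finally show ?thesis using c(1) by (simp add: field_simps)
  qed
  then show ?thesis using that[of "C' / c" w'] w' c by simp
qed

lemma weight_system_shift:
  assumes W: "weight_system W" and f: "f \<in> wspace p W" and w: "w \<in> W"
  obtains w' C where "0 \<le> (C :: real)" "wnorm w' p f < \<infinity>" "\<And>j k. j \<le> J \<Longrightarrow> w k \<le> C * w' (j + k)"
proof (rule weight_shift[OF W])
  show "0 \<le> w k" for k using W w by (simp add: weight_system_def)
  fix v assume v: "v \<in> W"
  have "\<exists>w'\<in>W. \<exists>C\<ge>0. \<forall>j k. v j * w k * 1 ^ k \<le> C * w' (j + k)"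
    using W v w order_refl[of "1::real"] unfolding weight_system_def by blast
  then show "\<exists>w' C'. 0 \<le> C' \<and> wnorm w' p f < \<infinity> \<and> (\<forall>j k. v j * w k \<le> C' * w' (j + k))"
    using f by (auto simp: wspace_def)
qed (use that in blast)

text \<open>Stated for an arbitrary nonnegative \<open>w\<close>, since the weight supplied by
  \<open>controlled\<close> need not belong to \<open>W\<close>.\<close>

lemma wnorm_slice_finite:
  fixes f :: "'a::euclidean_space \<times> 'b::euclidean_space \<Rightarrow> real"
  assumes p: "1 \<le> p" and sm: "smooth_into euclidean f" and as: "set as \<subseteq> Basis"
    and nn: "\<And>k. 0 \<le> w k" "0 \<le> C" and fin: "wnorm w' p f < \<infinity>"
    and ww: "\<And>j k. j \<le> DIM('a) + length as \<Longrightarrow> w k \<le> C * w' (j + k)"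
  shows "wnorm w p (slice f as x) < \<infinity>"
proof -
  have "wnorm w p (slice f as x) \<le>
      ennreal (1 * real (card {as}) * sobolev_factor TYPE('a) p * C) * wnorm w' p f"
  proof (rule wnorm_slice_le[OF p sm])
    show "ennreal \<bar>pderivs euclidean bs (slice f as x) y\<bar> \<le>
        ennreal 1 * (\<Sum>as\<in>{as}. slice_sup p (pderivs euclidean (inl as @ inr bs) f) y)"
      if bs: "set bs \<subseteq> Basis" for bs y
    proof -
      have "smooth_into euclidean (pderivs euclidean (inl as @ inr bs) f)"
        using set_inl_inr(1)[THEN iffD2, OF as] set_inl_inr(2)[THEN iffD2, OF bs]
        by (intro smooth_into_pderivs sm) simp
      from le_slice_sup[OF p this] show ?thesis
        by (simp add: pderivs_slice[OF sm as bs] del: pderivs_simps)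
    qed
  qed (use as nn ww in auto)
  also have "\<dots> < \<infinity>" using fin by (simp add: ennreal_mult_less_top)
  finally show ?thesis .
qed

lemma slice_in_wspace:
  fixes f :: "'a::euclidean_space \<times> 'b::euclidean_space \<Rightarrow> real"
  assumes W: "weight_system W" and p: "1 \<le> p" and f: "f \<in> wspace p W" and as: "set as \<subseteq> Basis"
  shows "slice f as x \<in> wspace p W"
proof -
  have sm: "smooth_into euclidean f" using f by (simp add: wspace_def)
  have "wnorm w p (slice f as x) < \<infinity>" if w: "w \<in> W" for w
  proof -
    obtain w' C where C: "0 \<le> (C :: real)" "wnorm w' p f < \<infinity>"
        "\<And>j k. j \<le> DIM('a) + length as \<Longrightarrow> w k \<le> C * w' (j + k)"
      using weight_system_shift[OF W f w] by metis
    have "0 \<le> w k" for k using W w by (simp add: weight_system_def)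
    from wnorm_slice_finite[OF p sm as this C] show ?thesis .
  qed
  then show ?thesis using smooth_into_slice[OF sm as] by (simp add: wspace_def)
qed

section \<open>Smoothness of the curried function\<close>

context
  fixes W :: "(nat \<Rightarrow> real) set" and p :: real
    and P :: "(('b::euclidean_space \<Rightarrow> real) \<Rightarrow> real) set" and f :: "'a::euclidean_space \<times> 'b \<Rightarrow> real"
  assumes W: "weight_system W" and p: "1 \<le> p" and adm: "admissible p W P"
    and f: "f \<in> wspace p W" and ctrl: "controlled p W P f"
begin

private lemma sm: "smooth_into euclidean f"
  using f by (simp add: wspace_def)

private lemma seminorm_family_P: "seminorm_family (wspace p W) P"
  using adm by (simp add: admissible_def)

private lemma diff_mem: "u \<in> wspace p W \<Longrightarrow> v \<in> wspace p W \<Longrightarrow> u - v \<in> wspace p W"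
  by (rule subspace_diff[OF subspace_wspace[OF p]])

text \<open>The constant \<open>K\<close> depends on \<open>s\<close>, \<open>A\<close> and
  \<open>f\<close>, but not on \<open>c\<close> or \<open>H\<close>. With \<open>c\<close> the
  length of an increment this yields continuity of slices, and with \<open>c\<close> the step of a
  difference quotient it yields their derivatives.\<close>

private lemma seminorm_le:
  assumes s: "s \<in> P" and A: "finite A" "\<And>as. as \<in> A \<Longrightarrow> set as \<subseteq> Basis"
  obtains K where "0 \<le> K"
    "\<And>c H. 0 \<le> c \<Longrightarrow> H \<in> wspace p W \<Longrightarrow> (\<And>bs y. set bs \<subseteq> Basis \<Longrightarrow> ennreal \<bar>pderivs euclidean bs H y\<bar> \<le>
      ennreal c * (\<Sum>as\<in>A. slice_sup p (pderivs euclidean (inl as @ inr bs) f) y)) \<Longrightarrow> s H \<le> K * c"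
proof -
  obtain w C where w: "\<And>k. 0 \<le> w k" "0 \<le> C"
      "\<And>u. u \<in> wspace p W \<Longrightarrow> wnorm w p u < \<infinity> \<Longrightarrow> s u \<le> C * enn2real (wnorm w p u)"
      "\<And>v. v \<in> W \<Longrightarrow> \<exists>w' C'. 0 \<le> C' \<and> wnorm w' p f < \<infinity> \<and>
        (\<forall>j k. v j * w k * 1 ^ k \<le> C' * w' (j + k))"
    using controlledE[OF ctrl s order_refl] by blast
  have abs: "\<exists>w' C'. 0 \<le> C' \<and> wnorm w' p f < \<infinity> \<and> (\<forall>j k. v j * w k \<le> C' * w' (j + k))" if "v \<in> W" for v
    using w(4)[OF that] by simp
  obtain w' D where w': "0 \<le> (D :: real)" "wnorm w' p f < \<infinity>"
      "\<And>j k. j \<le> DIM('a) + Max (length ` A) \<Longrightarrow> w k \<le> D * w' (j + k)"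
    by (rule weight_shift[where w = w and f = f and p = p and J = "DIM('a) + Max (length ` A)", OF W w(1) abs]) blast+
  define L where "L = card A * sobolev_factor TYPE('a) p * D * enn2real (wnorm w' p f)"
  have "s H \<le> (C * L) * c"
    if c: "0 \<le> c" and Hm: "H \<in> wspace p W" and H: "\<And>bs y. set bs \<subseteq> Basis \<Longrightarrow> ennreal \<bar>pderivs euclidean bs H y\<bar> \<le>
      ennreal c * (\<Sum>as\<in>A. slice_sup p (pderivs euclidean (inl as @ inr bs) f) y)" for c H
  proof -
    have le: "wnorm w p H \<le> ennreal (c * card A * sobolev_factor TYPE('a) p * D) * wnorm w' p f"
      by (rule wnorm_slice_le[where J = "DIM('a) + Max (length ` A)" and w = w and w' = w' and H = H, OF p sm A(1)])
        (use A c w'(1,3) w(1) H in auto)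
    also have "\<dots> = ennreal (L * c)"
      using w'(1,2) c
      by (cases "wnorm w' p f" rule: ennreal_cases) (auto simp: L_def ennreal_mult[symmetric] mult_ac)
    finally have le': "wnorm w p H \<le> ennreal (L * c)" .
    have "s H \<le> C * enn2real (wnorm w p H)"
      by (rule w(3)[OF Hm]) (use le' in \<open>simp add: le_less_trans[OF _ ennreal_less_top]\<close>)
    also have "\<dots> \<le> C * (L * c)"
      using le' w c w' by (intro mult_left_mono enn2real_leI) (auto simp: L_def)
    finally show ?thesis by (simp add: mult_ac)
  qed
  moreover have "0 \<le> C * L" using w w' by (auto simp: L_def)
  ultimately show ?thesis using that by blast
qed

private lemma slice_mem: "set as \<subseteq> Basis \<Longrightarrow> slice f as x \<in> wspace p W"
  by (rule slice_in_wspace[OF W p f])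

private lemma smooth_mixed: "set as \<subseteq> Basis \<Longrightarrow> set bs \<subseteq> Basis \<Longrightarrow>
    smooth_into euclidean (pderivs euclidean (inl as @ inr bs) f)"
  using set_inl_inr(1)[THEN iffD2, of as] set_inl_inr(2)[THEN iffD2, of bs]
  by (intro smooth_into_pderivs sm) simp

private lemma slice_continuous:
  assumes as: "set as \<subseteq> Basis"
  shows "continuous_map euclidean (seminorm_topology (wspace p W) P) (slice f as)"
  unfolding continuous_map_into_seminorm_topology[OF seminorm_family_P]
proof (intro conjI allI ballI slice_mem as)
  fix x s assume s: "s \<in> P"
  obtain K where K: "0 \<le> K" and le: "\<And>c H. 0 \<le> c \<Longrightarrow> H \<in> wspace p W \<Longrightarrow>
      (\<And>bs y. set bs \<subseteq> Basis \<Longrightarrow> ennreal \<bar>pderivs euclidean bs H y\<bar> \<le>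
      ennreal c * (\<Sum>as\<in>(\<lambda>a. a # as) ` Basis. slice_sup p (pderivs euclidean (inl as @ inr bs) f) y)) \<Longrightarrow> s H \<le> K * c"
    by (rule seminorm_le[OF s, of "(\<lambda>a. a # as) ` Basis"]) (use as in auto)
  \<comment> \<open>A Lipschitz estimate: an increment in \<open>x\<close> costs one further outer
    derivative, in any of the coordinate directions, hence the lists \<open>a # as\<close>.\<close>
  have bound: "s (slice f as x' - slice f as x) \<le> K * norm (x' - x)" for x'
  proof (rule le)
    fix bs :: "'b list" and y assume bs: "set bs \<subseteq> Basis"
    let ?G = "pderivs euclidean (inl as @ inr bs) f"
    have "pderivs euclidean bs (slice f as x' - slice f as x) y = ?G (x', y) - ?G (x, y)"
      using smooth_fun_diff(2)[OF smooth_into_slice smooth_into_slice, OF sm as sm as bs, of x' x]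
      by (simp only: pderivs_slice[OF sm as bs])
    then have "ennreal \<bar>pderivs euclidean bs (slice f as x' - slice f as x) y\<bar> \<le>
        ennreal (norm (x' - x)) * (\<Sum>a\<in>Basis. slice_sup p (pderivs euclidean [(a, 0)] ?G) y)"
      using slice_increment_le[OF p smooth_mixed[OF as bs]] by simp
    also have "(\<Sum>a\<in>Basis. slice_sup p (pderivs euclidean [(a, 0)] ?G) y) =
        (\<Sum>as\<in>(\<lambda>a. a # as) ` Basis. slice_sup p (pderivs euclidean (inl as @ inr bs) f) y)"
      by (subst sum.reindex) (auto simp: inj_on_def)
    finally show "ennreal \<bar>pderivs euclidean bs (slice f as x' - slice f as x) y\<bar> \<le>
        ennreal (norm (x' - x)) * (\<Sum>as\<in>(\<lambda>a. a # as) ` Basis. slice_sup p (pderivs euclidean (inl as @ inr bs) f) y)" .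
  qed (use diff_mem[OF slice_mem[OF as] slice_mem[OF as]] in auto)
  have "((\<lambda>x'. K * norm (x' - x)) \<longlongrightarrow> K * norm (x - x)) (at x)" by (intro tendsto_intros)
  then have lim: "((\<lambda>x'. K * norm (x' - x)) \<longlongrightarrow> 0) (at x)" by simp
  have nn: "0 \<le> s (slice f as x' - slice f as x)" for x'
    using seminorm_family_P s diff_mem[OF slice_mem[OF as] slice_mem[OF as]] seminorm_on_nonneg[of "wspace p W" s]
    unfolding seminorm_family_def by blast
  show "((\<lambda>x'. s (slice f as x' - slice f as x)) \<longlongrightarrow> 0) (at x)"
    by (rule tendsto_sandwich[OF _ _ tendsto_const lim]) (simp_all add: nn bound)
qed

private lemma slice_partial:
  assumes as: "set as \<subseteq> Basis" and a: "a \<in> Basis"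
  shows "partial_at (seminorm_topology (wspace p W) P) a (slice f as) x (slice f (a # as) x)"
  unfolding partial_at_def limitin_seminorm_topology[OF seminorm_family_P]
proof (intro conjI ballI)
  have aas: "set (a # as) \<subseteq> Basis" using as a by simp
  show "slice f (a # as) x \<in> wspace p W" by (rule slice_mem[OF aas])
  let ?q = "\<lambda>h. inverse h *\<^sub>R (slice f as (x + h *\<^sub>R a) - slice f as x)"
  have qm: "?q h \<in> wspace p W" for h
    by (intro subspace_scale[OF subspace_wspace[OF p]] diff_mem slice_mem as)
  then show "\<forall>\<^sub>F h in at 0. ?q h \<in> wspace p W" by simp
  fix s assume s: "s \<in> P"
  obtain K where K: "0 \<le> K" and le: "\<And>c H. 0 \<le> c \<Longrightarrow> H \<in> wspace p W \<Longrightarrow>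
      (\<And>bs y. set bs \<subseteq> Basis \<Longrightarrow> ennreal \<bar>pderivs euclidean bs H y\<bar> \<le>
      ennreal c * (\<Sum>as\<in>{a # a # as}. slice_sup p (pderivs euclidean (inl as @ inr bs) f) y)) \<Longrightarrow> s H \<le> K * c"
    by (rule seminorm_le[OF s, of "{a # a # as}"]) (use aas in auto)
  \<comment> \<open>The error of the difference quotient is controlled by the second derivative in
    the direction \<open>a\<close>, hence the list \<open>a # a # as\<close>, and is linear in
    \<open>h\<close>.\<close>
  have bound: "s (?q h - slice f (a # as) x) \<le> K * \<bar>h\<bar>" if h: "h \<noteq> 0" for h
  proof (rule le)
    fix bs :: "'b list" and y assume bs: "set bs \<subseteq> Basis"
    let ?G = "pderivs euclidean (inl as @ inr bs) f"
    note d = smooth_into_slice[OF sm as] smooth_into_slice[OF sm aas]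
    have "pderivs euclidean bs (?q h - slice f (a # as) x) y =
        inverse h * (?G (x + h *\<^sub>R a, y) - ?G (x, y)) - pderivs euclidean [(a, 0)] ?G (x, y)"
      unfolding smooth_fun_diff(2)[OF smooth_fun_scaleR(1)[OF smooth_fun_diff(1)[OF d(1) d(1)]] d(2) bs]
        smooth_fun_scaleR(2)[OF smooth_fun_diff(1)[OF d(1) d(1)] bs] smooth_fun_diff(2)[OF d(1) d(1) bs]
        pderivs_slice[OF sm as bs] pderivs_slice[OF sm aas bs]
      by simp
    then have "ennreal \<bar>pderivs euclidean bs (?q h - slice f (a # as) x) y\<bar> \<le>
        ennreal \<bar>h\<bar> * slice_sup p (pderivs euclidean [(a, 0), (a, 0)] ?G) y"
      using slice_quotient_le[OF p smooth_mixed[OF as bs] a h, of x y] by (simp only:)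
    then show "ennreal \<bar>pderivs euclidean bs (?q h - slice f (a # as) x) y\<bar> \<le>
        ennreal \<bar>h\<bar> * (\<Sum>as\<in>{a # a # as}. slice_sup p (pderivs euclidean (inl as @ inr bs) f) y)"
      by simp
  qed (use diff_mem[OF qm slice_mem[OF aas]] in auto)
  have "((\<lambda>h::real. K * \<bar>h\<bar>) \<longlongrightarrow> K * \<bar>0\<bar>) (at 0)" by (intro tendsto_intros)
  then have lim: "((\<lambda>h::real. K * \<bar>h\<bar>) \<longlongrightarrow> 0) (at 0)" by simp
  have nn: "0 \<le> s (?q h - slice f (a # as) x)" for h
    using seminorm_family_P s diff_mem[OF qm slice_mem[OF aas]] seminorm_on_nonneg[of "wspace p W" s]
    unfolding seminorm_family_def by blast
  show "((\<lambda>h. s (?q h - slice f (a # as) x)) \<longlongrightarrow> 0) (at 0)"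
    by (rule tendsto_sandwich[OF _ _ tendsto_const lim])
      (use nn bound in \<open>auto simp: eventually_at_filter\<close>)
qed

lemma smooth_into_curry: "smooth_into (seminorm_topology (wspace p W) P) (curry f)"
  using smooth_into_family(1)[where \<Phi> = "slice f", OF Hausdorff_space_admissible[OF W adm p] slice_Nil[of f]]
    slice_continuous slice_partial by blast

lemma pderivs_curry:
  "set as \<subseteq> Basis \<Longrightarrow> pderivs (seminorm_topology (wspace p W) P) as (curry f) = slice f as"
  using smooth_into_family(2)[where \<Phi> = "slice f", OF Hausdorff_space_admissible[OF W adm p] slice_Nil[of f]]
    slice_continuous slice_partial by blast

end

text \<open>The supremum is traded for a series of p-th powers, because a series of nonnegative
  functions may be integrated term by term in the outer variable.\<close>

lemma wnorm_powr_le: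
  fixes u :: "'b::euclidean_space \<Rightarrow> real"
  assumes "1 \<le> p"
  shows "epowr (wnorm w p u) p \<le>
    (\<Sum>k. \<Sum>bs | set bs \<subseteq> Basis \<and> length bs = k. epowr (ennreal (w k) * eLp_norm p (pderivs euclidean bs u)) p)"
    (is "_ \<le> ?S")
proof -
  have "wnorm w p u \<le> epowr ?S (1 / p)"
  proof (rule wnorm_leI)
    fix bs :: "'b list" assume bs: "set bs \<subseteq> Basis"
    let ?t = "\<lambda>k bs. epowr (ennreal (w k) * eLp_norm p (pderivs euclidean bs u)) p"
    have "?t (length bs) bs \<le> (\<Sum>cs | set cs \<subseteq> Basis \<and> length cs = length bs. ?t (length bs) cs)"
      using bs by (intro member_le_sum) (auto simp: finite_lists_length_eq)
    also have "\<dots> \<le> ?S" by (rule sum_le_suminf[of _ "{length bs}", simplified]) auto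
    finally have "epowr (?t (length bs) bs) (1 / p) \<le> epowr ?S (1 / p)"
      using assms by (intro epowr_mono) auto
    then show "ennreal (w (length bs)) * eLp_norm p (pderivs euclidean bs u) \<le> epowr ?S (1 / p)"
      using assms epowr_inverse(1)[of p] by simp
  qed
  then have "epowr (wnorm w p u) p \<le> epowr (epowr ?S (1 / p)) p"
    using assms by (intro epowr_mono) auto
  then show ?thesis using assms epowr_inverse(2)[of p] by simp
qed

text \<open>Integrate the series of \<open>wnorm_powr_le\<close> term by term and merge the two
  norms by Tonelli. The hypothesis has a surplus \<open>(2 * real DIM('b)) ^ k\<close>, which
  outweighs the \<open>DIM('b) ^ k\<close> lists of length \<open>k\<close> and leaves a geometric
  series with sum 2; its p-th root is the factor in the conclusion.\<close>

lemma LpE_wnorm_slice_le: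
  fixes f :: "'a::euclidean_space \<times> 'b::euclidean_space \<Rightarrow> real"
  assumes p: "1 \<le> p" and f: "smooth_into euclidean f" and as: "set as \<subseteq> Basis"
    and nn: "0 \<le> c" "0 \<le> C" "\<And>k. 0 \<le> w k"
    and ww: "\<And>k. c * w k * (2 * real DIM('b)) ^ k \<le> C * w' (length as + k)"
  shows "ennreal c * LpE p (\<lambda>x. wnorm w p (slice f as x)) \<le> ennreal (2 powr (1 / p) * C) * wnorm w' p f"
proof -
  let ?D = "\<lambda>bs. pderivs euclidean (inl as @ inr bs) f"
  let ?Q = "wnorm w' p f" and ?m = "2 * real DIM('b)"
  let ?B = "\<lambda>k. {bs :: 'b list. set bs \<subseteq> Basis \<and> length bs = k}"
  have sub: "set (inl as @ inr bs :: ('a \<times> 'b) list) \<subseteq> Basis" if "set bs \<subseteq> Basis" for bs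
    using set_inl_inr(1)[THEN iffD2, OF as] set_inl_inr(2)[THEN iffD2, OF that] by simp
  have slice_eLp: "eLp_norm p (pderivs euclidean bs (slice f as x)) = LpE p (\<lambda>y. ennreal (norm (?D bs (x, y))))"
    if "set bs \<subseteq> Basis" for bs x
    unfolding eLp_norm_eq_LpE pderivs_slice[OF f as that] ..
  have meas [measurable]: "(\<lambda>x. LpE p (\<lambda>y. ennreal (norm (?D bs (x, y))))) \<in> borel_measurable borel"
    if "set bs \<subseteq> Basis" for bs
    using smooth_borel_measurable[OF f sub[OF that]]
    by (intro borel_measurable_LpE_slice) measurable
  have term_le: "epowr (ennreal c) p * epowr (ennreal (w k)) p * epowr (eLp_norm p (?D bs)) p \<le>
      ennreal (1 / ?m ^ k) * epowr (ennreal C * ?Q) p" if bs: "bs \<in> ?B k" for bs k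
  proof -
    have "1 \<le> real DIM('b)" by (metis DIM_ge_Suc0 One_nat_def of_nat_1 of_nat_le_iff)
    then have m: "1 \<le> ?m" by linarith
    have "ennreal (c * w k * ?m ^ k) * eLp_norm p (?D bs) \<le> ennreal (C * w' (length as + k)) * eLp_norm p (?D bs)"
      by (intro mult_right_mono ennreal_leI ww) auto
    also have "\<dots> = ennreal C * (ennreal (w' (length (inl as @ inr bs :: ('a \<times> 'b) list))) * eLp_norm p (?D bs))"
      using bs nn by (simp add: ennreal_mult' mult.assoc)
    also have "\<dots> \<le> ennreal C * ?Q"
      using sub[of bs] bs by (intro mult_left_mono le_wnorm) auto
    finally have "ennreal (1 / ?m ^ k) * (ennreal (c * w k * ?m ^ k) * eLp_norm p (?D bs)) \<le>
        ennreal (1 / ?m ^ k) * (ennreal C * ?Q)"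
      by (rule mult_left_mono) auto
    also have "ennreal (1 / ?m ^ k) * (ennreal (c * w k * ?m ^ k) * eLp_norm p (?D bs)) =
        ennreal c * ennreal (w k) * eLp_norm p (?D bs)"
      using nn m by (simp add: mult.assoc[symmetric] ennreal_mult[symmetric])
    finally have "epowr (ennreal c * ennreal (w k) * eLp_norm p (?D bs)) p \<le>
        epowr (ennreal (1 / ?m ^ k)) p * epowr (ennreal C * ?Q) p"
      using p by (simp add: epowr_mult[symmetric] epowr_mono)
    \<comment> \<open>The base is at most 1 and \<open>p \<ge> 1\<close>, so dropping the exponent
      enlarges the term; what remains decays fast enough for every \<open>p\<close>.\<close>
    also have "epowr (ennreal (1 / ?m ^ k)) p \<le> epowr (ennreal (1 / ?m ^ k)) 1"
    proof -
      have "(1 / ?m ^ k) powr p \<le> (1 / ?m ^ k) powr 1"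
        using m p one_le_power[OF m, of k] by (intro powr_mono') auto
      then show ?thesis by (simp add: epowr_ennreal)
    qed
    finally show ?thesis by (simp add: epowr_mult mult_right_mono)
  qed
  have "epowr (ennreal c * LpE p (\<lambda>x. wnorm w p (slice f as x))) p =
      epowr (ennreal c) p * (\<integral>\<^sup>+x. epowr (wnorm w p (slice f as x)) p \<partial>lborel)"
    using p by (simp add: epowr_mult epowr_LpE)
  also have "\<dots> \<le> epowr (ennreal c) p * (\<integral>\<^sup>+x. (\<Sum>k. \<Sum>bs\<in>?B k. epowr (ennreal (w k)) p *
      epowr (LpE p (\<lambda>y. ennreal (norm (?D bs (x, y))))) p) \<partial>lborel)"
    using wnorm_powr_le[OF p, of w "slice f as _"]
    by (intro mult_left_mono nn_integral_mono) (auto simp: slice_eLp epowr_mult)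
  also have "(\<integral>\<^sup>+x. (\<Sum>k. \<Sum>bs\<in>?B k. epowr (ennreal (w k)) p *
      epowr (LpE p (\<lambda>y. ennreal (norm (?D bs (x, y))))) p) \<partial>lborel) =
      (\<Sum>k. \<Sum>bs\<in>?B k. epowr (ennreal (w k)) p * (\<integral>\<^sup>+x. epowr (LpE p (\<lambda>y. ennreal (norm (?D bs (x, y))))) p \<partial>lborel))"
  proof (subst nn_integral_suminf)
    have meas2: "(\<lambda>x. epowr (LpE p (\<lambda>y. ennreal (norm (?D bs (x, y))))) p) \<in> borel_measurable lborel"
      if "set bs \<subseteq> Basis" for bs
      using meas[OF that] by measurable
    show "(\<lambda>x. \<Sum>bs\<in>?B k. epowr (ennreal (w k)) p *
        epowr (LpE p (\<lambda>y. ennreal (norm (?D bs (x, y))))) p) \<in> borel_measurable lborel" for k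
      by (intro borel_measurable_sum borel_measurable_times_ennreal meas2) auto
    show "(\<Sum>k. \<integral>\<^sup>+x. (\<Sum>bs\<in>?B k. epowr (ennreal (w k)) p *
        epowr (LpE p (\<lambda>y. ennreal (norm (?D bs (x, y))))) p) \<partial>lborel) =
      (\<Sum>k. \<Sum>bs\<in>?B k. epowr (ennreal (w k)) p * (\<integral>\<^sup>+x. epowr (LpE p (\<lambda>y. ennreal (norm (?D bs (x, y))))) p \<partial>lborel))"
    proof (rule suminf_cong)
      fix k
      have "(\<integral>\<^sup>+x. (\<Sum>bs\<in>?B k. epowr (ennreal (w k)) p *
          epowr (LpE p (\<lambda>y. ennreal (norm (?D bs (x, y))))) p) \<partial>lborel) =
          (\<Sum>bs\<in>?B k. \<integral>\<^sup>+x. epowr (ennreal (w k)) p *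
          epowr (LpE p (\<lambda>y. ennreal (norm (?D bs (x, y))))) p \<partial>lborel)"
        by (intro nn_integral_sum borel_measurable_times_ennreal meas2) auto
      also have "\<dots> = (\<Sum>bs\<in>?B k. epowr (ennreal (w k)) p * (\<integral>\<^sup>+x. epowr (LpE p (\<lambda>y. ennreal (norm (?D bs (x, y))))) p \<partial>lborel))"
        by (intro sum.cong refl nn_integral_cmult meas2) auto
      finally show "(\<integral>\<^sup>+x. (\<Sum>bs\<in>?B k. epowr (ennreal (w k)) p *
          epowr (LpE p (\<lambda>y. ennreal (norm (?D bs (x, y))))) p) \<partial>lborel) =
          (\<Sum>bs\<in>?B k. epowr (ennreal (w k)) p * (\<integral>\<^sup>+x. epowr (LpE p (\<lambda>y. ennreal (norm (?D bs (x, y))))) p \<partial>lborel))" .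
    qed
  qed
  also have "\<dots> = (\<Sum>k. \<Sum>bs\<in>?B k. epowr (ennreal (w k)) p * epowr (eLp_norm p (?D bs)) p)"
  proof -
    have "(\<integral>\<^sup>+x. epowr (LpE p (\<lambda>y. ennreal (norm (?D bs (x, y))))) p \<partial>lborel) = epowr (eLp_norm p (?D bs)) p"
      if "set bs \<subseteq> Basis" for bs
    proof -
      have "(\<lambda>z. ennreal (norm (?D bs z))) \<in> borel_measurable borel"
        using smooth_borel_measurable[OF f sub[OF that]] by measurable
      from LpE_LpE[OF this, of p] show ?thesis using p by (simp add: epowr_LpE[symmetric] eLp_norm_eq_LpE)
    qed
    then show ?thesis by simp
  qed
  also have "epowr (ennreal c) p * \<dots> = (\<Sum>k. \<Sum>bs\<in>?B k. epowr (ennreal c) p * epowr (ennreal (w k)) p * epowr (eLp_norm p (?D bs)) p)"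
    by (simp add: ennreal_suminf_cmult[symmetric] sum_distrib_left mult.assoc)
  also have "\<dots> \<le> (\<Sum>k. \<Sum>bs\<in>?B k. ennreal (1 / ?m ^ k) * epowr (ennreal C * ?Q) p)"
    by (intro suminf_le sum_mono term_le) auto
  also have "\<dots> = (\<Sum>k. ennreal ((1 / 2) ^ k) * epowr (ennreal C * ?Q) p)"
  proof (intro suminf_cong)
    fix k
    \<comment> \<open>\<open>DIM('b) ^ k\<close> lists against \<open>(2 * DIM('b)) ^ k\<close>
      leaves \<open>(1 / 2) ^ k\<close>.\<close>
    have "of_nat (card (?B k)) * ennreal (1 / ?m ^ k) = ennreal ((1 / 2) ^ k)"
      by (simp add: card_lists_length_eq ennreal_of_nat_eq_real_of_nat ennreal_mult[symmetric] power_mult_distrib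
          power_divide)
    then show "(\<Sum>bs\<in>?B k. ennreal (1 / ?m ^ k) * epowr (ennreal C * ?Q) p) =
        ennreal ((1 / 2) ^ k) * epowr (ennreal C * ?Q) p"
      by (simp add: mult.assoc[symmetric])
  qed
  also have "\<dots> = 2 * epowr (ennreal C * ?Q) p"
  proof -
    have "(\<Sum>k. ennreal ((1 / 2) ^ k)) = ennreal (\<Sum>k. (1 / 2) ^ k)"
      by (intro suminf_ennreal_eq summable_sums summable_geometric) auto
    also have "\<dots> = 2" by (simp add: suminf_geometric)
    finally show ?thesis by simp
  qed
  also have "\<dots> = epowr (ennreal (2 powr (1 / p) * C) * ?Q) p"
    using p nn by (simp add: epowr_mult ennreal_mult epowr_ennreal powr_powr mult.assoc)
  finally show ?thesis by (rule epowr_le_cancel[rotated]) (use p in simp)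
qed

section \<open>Outer norms of the curried function\<close>

lemma continuous_seminorm_measurable:
  assumes "continuous_seminorm X s" "continuous_map euclidean X (g :: 'a::euclidean_space \<Rightarrow> _)"
  shows "(\<lambda>x. s (g x)) \<in> borel_measurable borel"
proof -
  have "continuous_map euclidean euclideanreal (s \<circ> g)"
    using assms by (intro continuous_map_compose[of _ X]) (auto simp: continuous_seminorm_def)
  then show ?thesis
    by (intro borel_measurable_continuous_onI) (simp add: o_def)
qed

lemma continuous_seminorm_nonneg:
  assumes "continuous_seminorm X s" "x \<in> topspace X"
  shows "0 \<le> s x"
  using assms by (auto simp: continuous_seminorm_def intro: seminorm_on_nonneg)

context
  fixes W :: "(nat \<Rightarrow> real) set" and p :: real
    and P :: "(('b::euclidean_space \<Rightarrow> real) \<Rightarrow> real) set" and f :: "'a::euclidean_space \<times> 'b \<Rightarrow> real"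
  assumes W: "weight_system W" and p: "1 \<le> p" and adm: "admissible p W P"
    and f: "f \<in> wspace p W" and ctrl: "controlled p W P f"
begin

text \<open>In the Roumieu case \<open>s\<close> is given by no formula; measurability comes from
  continuity of \<open>s\<close> and of the slice map.\<close>

lemma seminorm_slice_measurable:
  assumes s: "s \<in> P" and as: "set as \<subseteq> Basis"
  shows "(\<lambda>x. s (slice f as x)) \<in> borel_measurable borel"
proof (rule continuous_seminorm_measurable[where X = "seminorm_topology (wspace p W) P" and s = s])
  show "continuous_seminorm (seminorm_topology (wspace p W) P) s"
    using adm s by (intro continuous_seminormI seminorm_dominated_member)
      (auto simp: admissible_def seminorm_family_def)
  show "continuous_map euclidean (seminorm_topology (wspace p W) P) (slice f as)"
    using smooth_into_continuous[OF smooth_into_curry[OF W p adm f ctrl] as]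
      pderivs_curry[OF W p adm f ctrl as] by simp
qed

text \<open>The bound \<open>B\<close> is uniform in \<open>as\<close>, as the supremum defining
  \<open>LW\<close> demands. This works because \<open>controlled\<close> fixes the dominating
  weight \<open>w\<close> before the outer weight \<open>v\<close>, and absorbs both with the factor
  \<open>K = 2 * real DIM('b)\<close> of \<open>LpE_wnorm_slice_le\<close>.\<close>

lemma outer_bound:
  assumes s: "s \<in> P" and v: "v \<in> W"
  obtains B where "B < \<infinity>" "\<And>as. set as \<subseteq> Basis \<Longrightarrow>
    ennreal (v (length as)) * LpE p (\<lambda>x. ennreal (s (slice f as x))) \<le> B"
proof -
  have sm: "smooth_into euclidean f" using f by (simp add: wspace_def)
  have "1 \<le> real DIM('b)" by (metis DIM_ge_Suc0 One_nat_def of_nat_1 of_nat_le_iff)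
  then have K: "1 \<le> 2 * real DIM('b)" by linarith
  obtain w C where w: "\<And>k. 0 \<le> w k" "0 \<le> C"
      "\<And>u. u \<in> wspace p W \<Longrightarrow> wnorm w p u < \<infinity> \<Longrightarrow> s u \<le> C * enn2real (wnorm w p u)"
      "\<And>v. v \<in> W \<Longrightarrow> \<exists>w' C'. 0 \<le> C' \<and> wnorm w' p f < \<infinity> \<and>
        (\<forall>j k. v j * w k * (2 * real DIM('b)) ^ k \<le> C' * w' (j + k))"
    using controlledE[OF ctrl s K] by blast
  obtain w' C' where w': "0 \<le> C'" "wnorm w' p f < \<infinity>"
      "\<And>j k. v j * w k * (2 * real DIM('b)) ^ k \<le> C' * w' (j + k)"
    using w(4)[OF v] by blast
  have v0: "0 \<le> v j" for j using W v by (simp add: weight_system_def)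
  show ?thesis
  proof (rule that)
    show "ennreal C * (ennreal (2 powr (1 / p) * C') * wnorm w' p f) < \<infinity>"
      using w'(2) by (simp add: ennreal_mult_less_top)
    fix as :: "'a list" assume as: "set as \<subseteq> Basis"
    show "ennreal (v (length as)) * LpE p (\<lambda>x. ennreal (s (slice f as x))) \<le>
        ennreal C * (ennreal (2 powr (1 / p) * C') * wnorm w' p f)"
    proof -
      \<comment> \<open>\<open>w\<close> may lie outside \<open>W\<close>, so membership of the
        slice in \<open>wspace p W\<close> does not make this norm finite; a separate shift of
        weights does.\<close>
      obtain w'' C'' where w'': "0 \<le> (C'' :: real)" "wnorm w'' p f < \<infinity>"
        "\<And>j k. j \<le> DIM('a) + length as \<Longrightarrow> w k \<le> C'' * w'' (j + k)"
      proof (rule weight_shift[where w = w and f = f and p = p and J = "DIM('a) + length as", OF W w(1)])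
        show "\<exists>w' C'. 0 \<le> C' \<and> wnorm w' p f < \<infinity> \<and> (\<forall>j k. v j * w k \<le> C' * w' (j + k))"
          if "v \<in> W" for v
        proof -
          have "0 \<le> v j * w k" for j k using W that w(1) by (simp add: weight_system_def)
          then have "v j * w k \<le> v j * w k * (2 * real DIM('b)) ^ k" for j k
            using mult_left_mono[OF one_le_power[OF K, of k], of "v j * w k"] by simp
          then show ?thesis using w(4)[OF that] order_trans by meson
        qed
      qed blast+
      have fin: "wnorm w p (slice f as x) < \<infinity>" for x
        by (rule wnorm_slice_finite[OF p sm as w(1) w''])
    have "ennreal (s (slice f as x)) \<le> ennreal C * wnorm w p (slice f as x)" for x
    proof -
      have "s (slice f as x) \<le> C * enn2real (wnorm w p (slice f as x))"
        using fin by (intro w(3) slice_in_wspace[OF W p f as]) simp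
      then have "ennreal (s (slice f as x)) \<le> ennreal (C * enn2real (wnorm w p (slice f as x)))"
        by (rule ennreal_leI)
      also have "\<dots> = ennreal C * wnorm w p (slice f as x)"
        using fin[of x] w(2) by (simp add: ennreal_mult ennreal_enn2real)
      finally show ?thesis .
    qed
    then have "LpE p (\<lambda>x. ennreal (s (slice f as x))) \<le> LpE p (\<lambda>x. ennreal C * wnorm w p (slice f as x))"
      using p by (intro LpE_mono) auto
    also have "\<dots> = ennreal C * LpE p (\<lambda>x. wnorm w p (slice f as x))"
    proof (rule LpE_cmult)
      have c: "(\<lambda>x. eLp_norm p (pderivs euclidean bs (slice f as x))) \<in> borel_measurable borel"
        if "set bs \<subseteq> Basis" for bs
      proof -
        have "set (inl as @ inr bs :: ('a \<times> 'b) list) \<subseteq> Basis"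
          using set_inl_inr(1)[THEN iffD2, OF as] set_inl_inr(2)[THEN iffD2, OF that]
          unfolding set_append by blast
        from smooth_borel_measurable[OF sm this]
        have "(\<lambda>z. ennreal (norm (pderivs euclidean (inl as @ inr bs) f z))) \<in> borel_measurable borel"
          by measurable
        from borel_measurable_LpE_slice[OF this, of p] show ?thesis
          unfolding eLp_norm_eq_LpE pderivs_slice[OF sm as that] .
      qed
      \<comment> \<open>Countably many lists, so the supremum in \<open>wnorm\<close> preserves
        measurability.\<close>
      have "countable {bs :: 'b list. set bs \<subseteq> Basis}"
        using countable_lists[OF countable_finite[OF finite_Basis]] by (simp add: lists_eq_set)
      then show "(\<lambda>x. wnorm w p (slice f as x)) \<in> borel_measurable borel"
        unfolding wnorm_def using c by (intro borel_measurable_SUP borel_measurable_times_ennreal) auto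
    qed (use p in auto)
    finally have "ennreal (v (length as)) * LpE p (\<lambda>x. ennreal (s (slice f as x))) \<le>
        ennreal (v (length as)) * (ennreal C * LpE p (\<lambda>x. wnorm w p (slice f as x)))"
      by (rule mult_left_mono) auto
    also have "\<dots> = ennreal C * (ennreal (v (length as)) * LpE p (\<lambda>x. wnorm w p (slice f as x)))"
      by (simp add: mult_ac)
    also have "\<dots> \<le> ennreal C * (ennreal (2 powr (1 / p) * C') * wnorm w' p f)"
      by (intro mult_left_mono LpE_wnorm_slice_le[OF p sm as v0 w'(1) w(1) w'(3)]) auto
    finally show ?thesis .
    qed
  qed
qed

end


subsection \<open>From vector-valued functions to functions of two variables\<close>

text \<open>\<open>smooth_real_family\<close> asks for a candidate derivative along every list of
  product basis vectors, in whatever order the factors are interleaved. The candidate forgets the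
  interleaving: all outer derivatives are taken first, in the function space, and then all inner
  ones.\<close>

definition lefts :: "('a::euclidean_space \<times> 'b::euclidean_space) list \<Rightarrow> 'a list" where
  "lefts ds = map fst (filter (\<lambda>d. snd d = 0) ds)"

definition rights :: "('a::euclidean_space \<times> 'b::euclidean_space) list \<Rightarrow> 'b list" where
  "rights ds = map snd (filter (\<lambda>d. fst d = 0) ds)"

lemma set_lefts_rights:
  fixes ds :: "('a::euclidean_space \<times> 'b::euclidean_space) list"
  assumes "set ds \<subseteq> Basis"
  shows "set (lefts ds) \<subseteq> Basis" "set (rights ds) \<subseteq> Basis"
  using assms nonzero_Basis by (fastforce simp: lefts_def rights_def Basis_prod_def)+

lemma lefts_rights_inl_inr:
  assumes "set as \<subseteq> Basis" "set bs \<subseteq> Basis"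
  shows "lefts (inl as @ inr bs :: ('a::euclidean_space \<times> 'b::euclidean_space) list) = as"
    and "rights (inl as @ inr bs :: ('a \<times> 'b) list) = bs"
proof -
  have "0 \<notin> set as" "0 \<notin> set bs" using assms nonzero_Basis by blast+
  then have "filter (\<lambda>d. snd d = 0) (inr bs :: ('a \<times> 'b) list) = []"
    "filter (\<lambda>d. snd d = 0) (inl as :: ('a \<times> 'b) list) = inl as"
    "filter (\<lambda>d. fst d = 0) (inl as :: ('a \<times> 'b) list) = []"
    "filter (\<lambda>d. fst d = 0) (inr bs :: ('a \<times> 'b) list) = inr bs"
    by (auto simp: filter_empty_conv filter_id_conv)
  then show "lefts (inl as @ inr bs :: ('a \<times> 'b) list) = as" "rights (inl as @ inr bs :: ('a \<times> 'b) list) = bs"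
    by (simp_all add: lefts_def rights_def o_def)
qed

context
  fixes W :: "(nat \<Rightarrow> real) set" and p :: real
    and P :: "(('b::euclidean_space \<Rightarrow> real) \<Rightarrow> real) set" and g :: "'a::euclidean_space \<Rightarrow> 'b \<Rightarrow> real"
  assumes W: "weight_system W" and p: "1 \<le> p" and adm: "admissible p W P"
    and g: "smooth_into (seminorm_topology (wspace p W) P) g"
begin

private abbreviation (input) X where "X \<equiv> seminorm_topology (wspace p W) P"

private abbreviation (input) uncurried where
  "uncurried ds z \<equiv> pderivs euclidean (rights ds) (pderivs X (lefts ds) g (fst z)) (snd z)"

lemma pderivs_in_wspace:
  assumes "set as \<subseteq> Basis"
  shows "pderivs X as g x \<in> wspace p W"
  using smooth_into_continuous[OF g assms] continuous_map_image_subset_topspace by fastforce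

text \<open>Compare the values with those of the fixed function at \<open>fst z\<close>: this
  function is continuous in the inner variable, and the error made by moving the outer variable is
  small uniformly in the inner one.\<close>

private lemma uncurried_continuous:
  assumes as: "set as \<subseteq> Basis" and bs: "set bs \<subseteq> Basis"
  shows "continuous_on UNIV (\<lambda>z. pderivs euclidean bs (pderivs X as g (fst z)) (snd z))"
  unfolding continuous_on_def
proof (rule ballI)
  fix z :: "'a \<times> 'b"
  let ?u = "pderivs X as g"
  have lim: "limitin X ?u (?u (fst z)) (at (fst z))"
    using smooth_into_continuous[OF g as] unfolding continuous_map_euclidean_iff_limitin by blast
  have "uniform_limit UNIV (\<lambda>x. pderivs euclidean bs (?u x)) (pderivs euclidean bs (?u (fst z))) (at (fst z))"
    by (rule admissible_uniform_limit_pderivs[OF W adm p bs lim])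
  \<comment> \<open>Passing from \<open>at\<close> to \<open>nhds\<close> adds the centre, where the
    distance is 0; points near \<open>z\<close> may share its first component.\<close>
  then have unif: "eventually (\<lambda>x. \<forall>y. dist (pderivs euclidean bs (?u x) y) (pderivs euclidean bs (?u (fst z)) y) < e) (nhds (fst z))"
    if "0 < e" for e
    using that unfolding uniform_limit_iff eventually_at_filter
    by (auto elim!: allE[of _ e] eventually_mono)
  have sm: "smooth_into euclidean (?u (fst z))"
    using pderivs_in_wspace[OF as] by (simp add: wspace_def)
  have "((\<lambda>z'. pderivs euclidean bs (?u (fst z)) (snd z')) \<longlongrightarrow> pderivs euclidean bs (?u (fst z)) (snd z)) (at z)"
    by (intro continuous_on_tendsto_compose[OF smooth_continuous_on[OF sm bs, of UNIV]] tendsto_intros) auto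
  moreover have "((\<lambda>z'. pderivs euclidean bs (?u (fst z')) (snd z') - pderivs euclidean bs (?u (fst z)) (snd z')) \<longlongrightarrow> 0) (at z)"
  proof (rule tendstoI)
    fix e :: real assume "0 < e"
    have "filterlim fst (nhds (fst z)) (at z)" by (intro tendsto_intros)
    from eventually_compose_filterlim[OF unif[OF \<open>0 < e\<close>] this]
    show "\<forall>\<^sub>F z' in at z. dist (pderivs euclidean bs (?u (fst z')) (snd z') - pderivs euclidean bs (?u (fst z)) (snd z')) 0 < e"
      by eventually_elim (simp add: dist_real_def)
  qed
  ultimately have "((\<lambda>z'. pderivs euclidean bs (?u (fst z)) (snd z') +
      (pderivs euclidean bs (?u (fst z')) (snd z') - pderivs euclidean bs (?u (fst z)) (snd z'))) \<longlongrightarrow>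
      pderivs euclidean bs (?u (fst z)) (snd z) + 0) (at z)"
    by (rule tendsto_add)
  then show "((\<lambda>z. pderivs euclidean bs (?u (fst z)) (snd z)) \<longlongrightarrow> pderivs euclidean bs (?u (fst z)) (snd z)) (at z within UNIV)"
    by simp
qed

private lemma uncurried_derivative:
  assumes ds: "set ds \<subseteq> Basis" and d: "d \<in> Basis"
  shows "((\<lambda>t. uncurried ds (z + t *\<^sub>R d)) has_real_derivative uncurried (d # ds) z) (at 0)"
proof -
  let ?as = "lefts ds" and ?bs = "rights ds"
  note as = set_lefts_rights(1)[OF ds] and bs = set_lefts_rights(2)[OF ds]
  let ?u = "pderivs X ?as g"
  from d consider a where "d = (a, 0)" "a \<in> Basis" | b where "d = (0, b)" "b \<in> Basis"
    by (auto simp: Basis_prod_def)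
  then show ?thesis
  proof cases
    case 1
    have "a \<noteq> 0" using 1 nonzero_Basis by blast
    then have ab: "lefts (d # ds) = a # ?as" "rights (d # ds) = ?bs" using 1 by (auto simp: lefts_def rights_def)
    obtain x y where z: "z = (x, y)" by (cases z)
    have sm: "smooth_into euclidean (pderivs X as g x)" if "set as \<subseteq> Basis" for as x
      using pderivs_in_wspace[OF that] by (simp add: wspace_def)
    have "limitin X (\<lambda>h. inverse h *\<^sub>R (?u (x + h *\<^sub>R a) - ?u x)) (pderivs X (a # ?as) g x) (at 0)"
      using smooth_into_partial_at[OF g as 1(2), of x] by (simp only: partial_at_def)
    \<comment> \<open>Inner derivatives and evaluation at \<open>y\<close> are continuous on the
      function space, so the limit of outer difference quotients may be taken after applying
      them.\<close>
    from admissible_uniform_limit_pderivs[OF W adm p bs this]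
    have "((\<lambda>h. pderivs euclidean ?bs (inverse h *\<^sub>R (?u (x + h *\<^sub>R a) - ?u x)) y) \<longlongrightarrow>
        pderivs euclidean ?bs (pderivs X (a # ?as) g x) y) (at 0)"
      by (rule tendsto_uniform_limitI) simp
    also have "(\<lambda>h. pderivs euclidean ?bs (inverse h *\<^sub>R (?u (x + h *\<^sub>R a) - ?u x)) y) =
        (\<lambda>h. (uncurried ds ((x, y) + h *\<^sub>R d) - uncurried ds (x, y)) / h)"
      using smooth_fun_scaleR(2)[OF smooth_fun_diff(1)[OF sm sm] bs, OF as as]
        smooth_fun_diff(2)[OF sm sm bs, OF as as] 1
      by (simp add: divide_inverse mult.commute)
    finally show ?thesis unfolding DERIV_def ab z by simp
  next
    case 2
    have "b \<noteq> 0" using 2 nonzero_Basis by blast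
    then have ab: "lefts (d # ds) = ?as" "rights (d # ds) = b # ?bs" using 2 by (auto simp: lefts_def rights_def)
    have sm: "smooth_into euclidean (?u (fst z))"
      using pderivs_in_wspace[OF as] by (simp add: wspace_def)
    from smooth_has_derivative[OF this bs 2(2), of "snd z" 0]
    show ?thesis unfolding ab using 2(1) by simp
  qed
qed

lemma smooth_uncurry: "smooth_into euclidean (case_prod g)"
  by (rule smooth_real_family(1)[of uncurried])
    (use uncurried_continuous[OF set_lefts_rights] uncurried_derivative in
      \<open>auto simp: lefts_def[of "[]"] rights_def[of "[]"] fun_eq_iff\<close>)

lemma pderivs_uncurry:
  assumes "set as \<subseteq> Basis" "set bs \<subseteq> Basis"
  shows "pderivs euclidean (inl as @ inr bs) (case_prod g) (x, y) = pderivs euclidean bs (pderivs X as g x) y"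
proof -
  have "pderivs euclidean (inl as @ inr bs) (case_prod g) = uncurried (inl as @ inr bs)"
    by (rule smooth_real_family(2)[of uncurried])
      (use uncurried_continuous[OF set_lefts_rights] uncurried_derivative
        set_inl_inr(1)[THEN iffD2, OF assms(1)] set_inl_inr(2)[THEN iffD2, OF assms(2)] in
        \<open>auto simp: lefts_def[of "[]"] rights_def[of "[]"] fun_eq_iff\<close>)
  then show ?thesis by (simp add: lefts_rights_inl_inr[OF assms] del: pderivs_simps)
qed

text \<open>Split the weight \<open>w\<close> into \<open>w1\<close> and \<open>w2\<close>: an inner
  derivative weighted by \<open>w2\<close> is at most the inner norm pointwise, and its outer norm
  weighted by \<open>w1\<close> is bounded by hypothesis. No Sobolev loss occurs in this direction
  of the norm estimate.\<close>

lemma uncurry_in_wspace: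
  assumes bound: "\<And>v w. v \<in> W \<Longrightarrow> w \<in> W \<Longrightarrow> \<exists>B<\<infinity>. \<forall>\<alpha>.
    ennreal (v (mi_order \<alpha>)) * LpE p (\<lambda>x. wnorm w p (pderivs X (mi_list \<alpha>) g x)) \<le> B"
  shows "case_prod g \<in> wspace p W"
proof -
  have "wnorm w p (case_prod g) < \<infinity>" if w: "w \<in> W" for w
  proof -
    obtain w1 w2 C where W2: "w1 \<in> W" "w2 \<in> W" "0 \<le> C" "\<And>j k. w (j + k) \<le> C * (w1 j * w2 k)"
      using W w unfolding weight_system_def by meson
    obtain B where B: "B < \<infinity>" "\<And>\<alpha>. ennreal (w1 (mi_order \<alpha>)) * LpE p (\<lambda>x. wnorm w2 p (pderivs X (mi_list \<alpha>) g x)) \<le> B"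
      using bound[OF W2(1,2)] by blast
    have nn: "0 \<le> w1 k" "0 \<le> w2 k" for k using W W2 by (simp_all add: weight_system_def)
    have "wnorm w p (case_prod g) \<le> ennreal C * B"
    proof (rule wnorm_leI)
      fix ds :: "('a \<times> 'b) list" assume ds: "set ds \<subseteq> Basis"
      obtain as bs where asbs: "set as \<subseteq> Basis" "set bs \<subseteq> Basis" "mset ds = mset (inl as @ inr bs)"
        using split_list_prod_Basis[OF ds] by metis
      \<comment> \<open>\<open>bound\<close> speaks of canonical lists of multi-indices, so
        \<open>as\<close> is replaced by the canonical permutation of itself.\<close>
      let ?as = "mi_list (count (mset as))"
      have ms: "mset ?as = mset as" by (rule mset_mi_list_count[OF asbs(1)])
      then have eqm: "mset ds = mset (inl ?as @ inr bs)" using asbs(3) by (simp add: mset_map)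
      have D: "pderivs euclidean ds (case_prod g) = pderivs euclidean (inl ?as @ inr bs) (case_prod g)"
        by (rule pderivs_mset[OF smooth_uncurry ds eqm])
      have len: "length ds = length ?as + length bs"
        using mset_eq_length[OF eqm] by simp
      have eq: "eLp_norm p (pderivs euclidean ds (case_prod g)) =
          LpE p (\<lambda>x. eLp_norm p (pderivs euclidean bs (pderivs X ?as g x)))"
      proof -
        have "(\<lambda>z. ennreal (norm (pderivs euclidean ds (case_prod g) z))) \<in> borel_measurable borel"
          using smooth_borel_measurable[OF smooth_uncurry ds] by measurable
        from LpE_LpE[OF this, of p] p show ?thesis
          by (simp add: eLp_norm_eq_LpE D pderivs_uncurry[OF set_mi_list asbs(2)] del: pderivs_simps)
      qed
      have "ennreal (w (length ds)) * eLp_norm p (pderivs euclidean ds (case_prod g)) \<le>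
          ennreal (C * (w1 (length ?as) * w2 (length bs))) * eLp_norm p (pderivs euclidean ds (case_prod g))"
        unfolding len by (intro mult_right_mono ennreal_leI W2(4)) auto
      also have "\<dots> = ennreal C * (ennreal (w1 (length ?as)) *
          (ennreal (w2 (length bs)) * LpE p (\<lambda>x. eLp_norm p (pderivs euclidean bs (pderivs X ?as g x)))))"
        using W2(3) nn by (simp add: eq ennreal_mult mult_ac)
      also have "ennreal (w2 (length bs)) * LpE p (\<lambda>x. eLp_norm p (pderivs euclidean bs (pderivs X ?as g x))) =
          LpE p (\<lambda>x. ennreal (w2 (length bs)) * eLp_norm p (pderivs euclidean bs (pderivs X ?as g x)))"
      proof (rule LpE_cmult[symmetric])
        have "set (inl ?as @ inr bs :: ('a \<times> 'b) list) \<subseteq> Basis"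
          using set_inl_inr(1)[THEN iffD2, OF set_mi_list] set_inl_inr(2)[THEN iffD2, OF asbs(2)]
          unfolding set_append by blast
        from smooth_borel_measurable[OF smooth_uncurry this]
        have "(\<lambda>z. ennreal (norm (pderivs euclidean (inl ?as @ inr bs) (case_prod g) z))) \<in> borel_measurable borel"
          by measurable
        from borel_measurable_LpE_slice[OF this, of p]
        show "(\<lambda>x. eLp_norm p (pderivs euclidean bs (pderivs X ?as g x))) \<in> borel_measurable borel"
          by (simp add: eLp_norm_eq_LpE pderivs_uncurry[OF set_mi_list asbs(2)] del: pderivs_simps)
      qed (use p in simp)
      also have "ennreal C * (ennreal (w1 (length ?as)) *
          LpE p (\<lambda>x. ennreal (w2 (length bs)) * eLp_norm p (pderivs euclidean bs (pderivs X ?as g x)))) \<le>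
          ennreal C * (ennreal (w1 (length ?as)) * LpE p (\<lambda>x. wnorm w2 p (pderivs X ?as g x)))"
        using p asbs(2) by (intro mult_left_mono LpE_mono le_wnorm) auto
      also have "\<dots> \<le> ennreal C * B"
        using B(2) by (intro mult_left_mono) auto
      finally show "ennreal (w (length ds)) * eLp_norm p (pderivs euclidean ds (case_prod g)) \<le> ennreal C * B" .
    qed
    also have "\<dots> < \<infinity>" using B(1) by (simp add: ennreal_mult_less_top)
    finally show ?thesis .
  qed
  then show ?thesis using smooth_uncurry by (simp add: wspace_def)
qed

end

section \<open>The exponential law for weight systems\<close>

definition vcoord :: "'n \<Rightarrow> ('a \<Rightarrow> real ^ 'n) \<Rightarrow> 'a \<Rightarrow> real" where
  "vcoord i f = (\<lambda>x. f x $ i)"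

definition vspace :: "('a \<Rightarrow> real) set \<Rightarrow> ('a \<Rightarrow> real ^ 'n) set" where
  "vspace V = {f. \<forall>i. vcoord i f \<in> V}"

definition vseminorms :: "(('a \<Rightarrow> real) \<Rightarrow> real) set \<Rightarrow> (('a \<Rightarrow> real ^ 'n) \<Rightarrow> real) set" where
  "vseminorms P = {\<lambda>f. q (vcoord i f) | q i. q \<in> P}"

lemma ball_vseminorms: "(\<forall>s\<in>vseminorms P. Q s) \<longleftrightarrow> (\<forall>q\<in>P. \<forall>i. Q (\<lambda>f. q (vcoord i f)))"
  by (auto simp: vseminorms_def)

lemma vec_valued_eq:
  "seminorm_family V P \<Longrightarrow>
    vec_valued (seminorm_topology V P) = seminorm_topology (vspace V) (vseminorms P)"
  by (simp add: vec_valued_seminorm_topology vspace_def vseminorms_def vcoord_def)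

lemma seminorm_family_vspace:
  "seminorm_family V P \<Longrightarrow> seminorm_family (vspace V) (vseminorms P)"
  using seminorm_family_vec[of V P] by (simp add: vspace_def vseminorms_def vcoord_def)

lemma vcoord_linear:
  "vcoord i (f + g) = vcoord i f + vcoord i g" "vcoord i (f - g) = vcoord i f - vcoord i g"
  "vcoord i (c *\<^sub>R f) = c *\<^sub>R vcoord i f" "vcoord i 0 = 0"
  by (auto simp: vcoord_def fun_eq_iff scaleR_fun_def)

lemma vcoord_eqI: "(\<And>i. vcoord i f = vcoord i g) \<Longrightarrow> f = g"
  by (auto simp: vcoord_def fun_eq_iff vec_eq_iff)

lemma vcoord_surj: "\<exists>f. \<forall>i. vcoord i f = d i"
  by (intro exI[of _ "\<lambda>x. \<chi> i. d i x"]) (simp add: vcoord_def)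

lemma limitin_vspace:
  fixes f :: "'c \<Rightarrow> 'a \<Rightarrow> real ^ 'n"
  assumes "seminorm_family V P"
  shows "limitin (seminorm_topology (vspace V) (vseminorms P)) f l G \<longleftrightarrow>
    (\<forall>i. limitin (seminorm_topology V P) (\<lambda>x. vcoord i (f x)) (vcoord i l) G)"
proof -
  \<comment> \<open>Exchanging \<open>eventually\<close> with the quantifier over coordinates uses
    that \<open>'n\<close> is finite.\<close>
  have "eventually (\<lambda>x. f x \<in> vspace V) G \<longleftrightarrow> (\<forall>i. eventually (\<lambda>x. vcoord i (f x) \<in> V) G)"
    unfolding vspace_def mem_Collect_eq
    by (auto intro: eventually_all_finite elim: eventually_mono)
  moreover have "(\<forall>q\<in>vseminorms P. ((\<lambda>x. q (f x - l)) \<longlongrightarrow> 0) G) \<longleftrightarrow>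
      (\<forall>i. \<forall>q\<in>P. ((\<lambda>x. q (vcoord i (f x) - vcoord i l)) \<longlongrightarrow> 0) G)"
    unfolding vcoord_linear(2)[symmetric] ball_vseminorms by blast
  ultimately show ?thesis
    unfolding limitin_seminorm_topology[OF assms] limitin_seminorm_topology[OF seminorm_family_vspace[OF assms]]
    by (auto simp: vspace_def)
qed

lemma
  fixes h :: "'a::euclidean_space \<Rightarrow> real ^ 'n"
  assumes "\<And>i. smooth_into euclidean (vcoord i h)"
  shows pderivs_vcoord: "set bs \<subseteq> Basis \<Longrightarrow> pderivs euclidean bs (vcoord i h) = vcoord i (pderivs euclidean bs h)"
proof -
  have lim: "limitin euclidean f l G \<longleftrightarrow> (\<forall>i. limitin euclidean (\<lambda>x. f x $ i) (l $ i) G)"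
    for f :: "'z \<Rightarrow> real ^ 'n" and l G
    by (auto intro: vec_tendstoI tendsto_vec_nth)
  have surj: "\<exists>v :: real ^ 'n. \<forall>i. v $ i = d i" for d
    by (intro exI[of _ "\<chi> i. d i"]) simp
  have H: "Hausdorff_space (euclidean :: (real ^ 'n) topology)" "Hausdorff_space euclideanreal" by simp_all
  note cw = smooth_into_componentwise[where \<pi> = "\<lambda>i (v :: real ^ 'n). v $ i" and f = h, OF H lim lim _ surj]
  have sm: "smooth_into euclidean h"
    by (rule cw(1)[THEN iffD2]) (use assms in \<open>auto simp: vcoord_def vec_eq_iff\<close>)
  show "set bs \<subseteq> Basis \<Longrightarrow> pderivs euclidean bs (vcoord i h) = vcoord i (pderivs euclidean bs h)"
    unfolding vcoord_def by (rule cw(2)) (use sm in \<open>auto simp: vec_eq_iff\<close>)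
qed

text \<open>The common form of the three vector-valued spaces (\<open>LW_inf_eq\<close>,
  \<open>LW_beurling_eq\<close>, \<open>LW_roumieu_eq\<close>); \<open>mixed_seminorms\<close> plays
  the same part for their topologies.\<close>

definition LW :: "real \<Rightarrow> (nat \<Rightarrow> real) set \<Rightarrow> 'v::real_vector topology \<Rightarrow> ('a::euclidean_space \<Rightarrow> 'v) set" where
  "LW p W X = {g. smooth_into X g \<and> (\<forall>s v. continuous_seminorm X s \<longrightarrow> v \<in> W \<longrightarrow>
     (SUP \<alpha>. ennreal (v (mi_order \<alpha>)) * eLp_norm p (s \<circ> mi_deriv X \<alpha> g)) < \<infinity>)}"

definition mixed_seminorms ::
    "real \<Rightarrow> (nat \<Rightarrow> real) set \<Rightarrow> ('b::euclidean_space \<Rightarrow> real ^ 'n) topology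
      \<Rightarrow> (('a::euclidean_space \<Rightarrow> 'b \<Rightarrow> real ^ 'n) \<Rightarrow> real) set" where
  "mixed_seminorms p W X = {\<lambda>g. enn2real (SUP (\<alpha>, \<beta>).
     ennreal (w1 (mi_order \<alpha>) * w2 (mi_order \<beta>)) * mixed_norm p X \<alpha> \<beta> g) | w1 w2. w1 \<in> W \<and> w2 \<in> W}"

text \<open>Taken coordinate by coordinate, so that the scalar theory applies; the Euclidean norm of
  this vector is the integrand of \<open>mixed_norm\<close> for the curried function.\<close>

definition mixed_deriv ::
    "('a::euclidean_space \<Rightarrow> nat) \<Rightarrow> ('b::euclidean_space \<Rightarrow> nat) \<Rightarrow> ('a \<times> 'b \<Rightarrow> real ^ 'n) \<Rightarrow> 'a \<times> 'b \<Rightarrow> real ^ 'n" where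
  "mixed_deriv \<alpha> \<beta> f z = (\<chi> i. pderivs euclidean (inl (mi_list \<alpha>) @ inr (mi_list \<beta>)) (vcoord i f) z)"

lemma set_inl_inr_mi_list:
  "set (inl (mi_list \<alpha>) @ inr (mi_list \<beta>) :: ('a::euclidean_space \<times> 'b::euclidean_space) list) \<subseteq> Basis"
  using set_inl_inr(1)[THEN iffD2, OF set_mi_list] set_inl_inr(2)[THEN iffD2, OF set_mi_list]
  unfolding set_append by blast

lemma mixed_deriv_measurable:
  fixes f :: "'a::euclidean_space \<times> 'b::euclidean_space \<Rightarrow> real ^ 'n"
  assumes "\<And>i. smooth_into euclidean (vcoord i f)"
  shows "mixed_deriv \<alpha> \<beta> f \<in> borel_measurable borel"
  unfolding mixed_deriv_def[abs_def]
  by (intro borel_measurable_continuous_onI continuous_on_vec_lambda smooth_continuous_on assms set_inl_inr_mi_list)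

lemma eLp_norm_mixed_deriv_ge:
  fixes f :: "'a::euclidean_space \<times> 'b::euclidean_space \<Rightarrow> real ^ 'n"
  assumes "0 \<le> p"
  shows "eLp_norm p (pderivs euclidean (inl (mi_list \<alpha>) @ inr (mi_list \<beta>)) (vcoord i f)) \<le> eLp_norm p (mixed_deriv \<alpha> \<beta> f)"
  unfolding eLp_norm_eq_LpE
proof (rule LpE_mono[OF assms], rule ennreal_leI)
  fix z
  show "norm (pderivs euclidean (inl (mi_list \<alpha>) @ inr (mi_list \<beta>)) (vcoord i f) z) \<le> norm (mixed_deriv \<alpha> \<beta> f z)"
    using Finite_Cartesian_Product.norm_nth_le[of "mixed_deriv \<alpha> \<beta> f z" i] by (simp add: mixed_deriv_def del: pderivs_simps)
qed

lemma eLp_norm_mixed_deriv_le: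
  fixes f :: "'a::euclidean_space \<times> 'b::euclidean_space \<Rightarrow> real ^ 'n"
  assumes p: "1 \<le> p" and f: "\<And>i. smooth_into euclidean (vcoord i f)"
  shows "eLp_norm p (mixed_deriv \<alpha> \<beta> f) \<le>
    (\<Sum>i\<in>UNIV. eLp_norm p (pderivs euclidean (inl (mi_list \<alpha>) @ inr (mi_list \<beta>)) (vcoord i f)))"
proof -
  let ?D = "\<lambda>i. pderivs euclidean (inl (mi_list \<alpha>) @ inr (mi_list \<beta>)) (vcoord i f)"
  have "norm (mixed_deriv \<alpha> \<beta> f z) \<le> (\<Sum>i\<in>UNIV. norm (?D i z))" for z
    using norm_le_l1_cart[of "mixed_deriv \<alpha> \<beta> f z"] by (simp add: mixed_deriv_def del: pderivs_simps)
  then have "eLp_norm p (mixed_deriv \<alpha> \<beta> f) \<le> LpE p (\<lambda>z. \<Sum>i\<in>UNIV. ennreal (norm (?D i z)))"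
    unfolding eLp_norm_eq_LpE using p by (intro LpE_mono) (auto simp: sum_ennreal intro!: ennreal_leI)
  also have "\<dots> \<le> (\<Sum>i\<in>UNIV. eLp_norm p (?D i))"
    unfolding eLp_norm_eq_LpE
  proof (rule LpE_sum[OF _ _ p])
    show "(\<lambda>z. ennreal (norm (?D i z))) \<in> borel_measurable borel" for i
      using smooth_borel_measurable[OF f set_inl_inr_mi_list] by measurable
  qed simp
  finally show ?thesis .
qed

lemma mixed_deriv_linear:
  fixes f g :: "'a::euclidean_space \<times> 'b::euclidean_space \<Rightarrow> real ^ 'n"
  assumes "\<And>i. smooth_into euclidean (vcoord i f)" "\<And>i. smooth_into euclidean (vcoord i g)"
  shows "mixed_deriv \<alpha> \<beta> (f + g) = (\<lambda>z. mixed_deriv \<alpha> \<beta> f z + mixed_deriv \<alpha> \<beta> g z)"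
    and "mixed_deriv \<alpha> \<beta> (c *\<^sub>R f) = (\<lambda>z. c *\<^sub>R mixed_deriv \<alpha> \<beta> f z)"
  using smooth_fun_add(2)[OF assms set_inl_inr_mi_list] smooth_fun_scaleR(2)[OF assms(1) set_inl_inr_mi_list]
  by (auto simp: fun_eq_iff vec_eq_iff mixed_deriv_def vcoord_linear simp del: pderivs_simps)

text \<open>The index set \<open>A\<close> is a parameter so that one proof covers the weighted
  suprema, with \<open>A = UNIV\<close>, and a single mixed norm, with \<open>A\<close> a
  singleton.\<close>

lemma seminorm_on_SUP_mixed_deriv:
  fixes V :: "('a::euclidean_space \<times> 'b::euclidean_space \<Rightarrow> real ^ 'n) set"
    and w :: "('a \<Rightarrow> nat) \<times> ('b \<Rightarrow> nat) \<Rightarrow> real" and A and p :: real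
  defines "m \<equiv> \<lambda>f. SUP (\<alpha>, \<beta>)\<in>A. ennreal (w (\<alpha>, \<beta>)) * eLp_norm p (mixed_deriv \<alpha> \<beta> f)"
  assumes p: "1 \<le> p" and V: "\<And>f i. f \<in> V \<Longrightarrow> smooth_into euclidean (vcoord i f)"
    and fin: "\<And>f. f \<in> V \<Longrightarrow> m f < \<infinity>"
  shows "seminorm_on V (\<lambda>f. enn2real (m f))"
proof -
  have add: "m (f + g) \<le> m f + m g" if "f \<in> V" "g \<in> V" for f g
    unfolding m_def
  proof (rule SUP_least, clarify)
    fix \<alpha> \<beta> assume A: "(\<alpha>, \<beta>) \<in> A"
    have "eLp_norm p (mixed_deriv \<alpha> \<beta> (f + g)) \<le> eLp_norm p (mixed_deriv \<alpha> \<beta> f) + eLp_norm p (mixed_deriv \<alpha> \<beta> g)"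
      unfolding mixed_deriv_linear(1)[OF V[OF that(1)] V[OF that(2)]]
      by (intro eLp_norm_add mixed_deriv_measurable V that p)
    then have "ennreal (w (\<alpha>, \<beta>)) * eLp_norm p (mixed_deriv \<alpha> \<beta> (f + g)) \<le>
        ennreal (w (\<alpha>, \<beta>)) * eLp_norm p (mixed_deriv \<alpha> \<beta> f) + ennreal (w (\<alpha>, \<beta>)) * eLp_norm p (mixed_deriv \<alpha> \<beta> g)"
      unfolding distrib_left[symmetric] by (rule mult_left_mono) simp
    also have "\<dots> \<le> (SUP (\<alpha>, \<beta>)\<in>A. ennreal (w (\<alpha>, \<beta>)) * eLp_norm p (mixed_deriv \<alpha> \<beta> f)) +
        (SUP (\<alpha>, \<beta>)\<in>A. ennreal (w (\<alpha>, \<beta>)) * eLp_norm p (mixed_deriv \<alpha> \<beta> g))"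
      by (intro add_mono SUP_upper2[OF A]) auto
    finally show "ennreal (w (\<alpha>, \<beta>)) * eLp_norm p (mixed_deriv \<alpha> \<beta> (f + g)) \<le>
        (SUP (\<alpha>, \<beta>)\<in>A. ennreal (w (\<alpha>, \<beta>)) * eLp_norm p (mixed_deriv \<alpha> \<beta> f)) +
        (SUP (\<alpha>, \<beta>)\<in>A. ennreal (w (\<alpha>, \<beta>)) * eLp_norm p (mixed_deriv \<alpha> \<beta> g))" .
  qed
  have scale: "m (c *\<^sub>R f) = ennreal \<bar>c\<bar> * m f" if "f \<in> V" for c f
  proof -
    have "eLp_norm p (mixed_deriv \<alpha> \<beta> (c *\<^sub>R f)) = ennreal \<bar>c\<bar> * eLp_norm p (mixed_deriv \<alpha> \<beta> f)" for \<alpha> \<beta>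
      unfolding mixed_deriv_linear(2)[OF V[OF that] V[OF that]]
      using p by (intro eLp_norm_scaleR mixed_deriv_measurable V that) auto
    then show ?thesis
      unfolding m_def by (simp add: SUP_mult_left_ennreal split_beta mult.left_commute)
  qed
  show ?thesis
    unfolding seminorm_on_def
  proof (intro conjI ballI allI)
    fix f g c assume fg: "f \<in> V" "g \<in> V"
    have "enn2real (m (f + g)) \<le> enn2real (m f + m g)"
      using add[OF fg] fin fg by (intro enn2real_mono) auto
    also have "\<dots> = enn2real (m f) + enn2real (m g)"
      using fin fg by (intro enn2real_plus) auto
    finally show "enn2real (m (f + g)) \<le> enn2real (m f) + enn2real (m g)" .
  qed (simp_all add: scale enn2real_mult)
qed

text \<open>The right-hand spaces are images under \<open>curry\<close>. Subspace and seminorm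
  properties are transported along it, so sums of derivatives in the vector-valued space need no
  separate study.\<close>

lemma seminorm_family_image:
  assumes V: "subspace V"
    and add: "\<And>x y. x \<in> V \<Longrightarrow> y \<in> V \<Longrightarrow> \<phi> (x + y) = \<phi> x + \<phi> y"
    and scale: "\<And>c x. x \<in> V \<Longrightarrow> \<phi> (c *\<^sub>R x) = c *\<^sub>R \<phi> x"
    and Q: "\<And>q. q \<in> Q \<Longrightarrow> seminorm_on V (\<lambda>x. q (\<phi> x))"
  shows "seminorm_family (\<phi> ` V) Q"
  unfolding seminorm_family_def
proof (intro conjI ballI)
  show "subspace (\<phi> ` V)"
  proof (rule subspaceI)
    show "0 \<in> \<phi> ` V" using scale[OF subspace_0[OF V], of 0] subspace_0[OF V] by force
    show "x + y \<in> \<phi> ` V" if "x \<in> \<phi> ` V" "y \<in> \<phi> ` V" for x y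
      using that add subspace_add[OF V] by (metis (no_types, lifting) imageE imageI)
    show "c *\<^sub>R x \<in> \<phi> ` V" if "x \<in> \<phi> ` V" for c x
      using that scale subspace_scale[OF V] by (metis (no_types, lifting) imageE imageI)
  qed
  fix q assume "q \<in> Q"
  from seminorm_onD[OF Q[OF this]] show "seminorm_on (\<phi> ` V) q"
    unfolding seminorm_on_def by (auto simp: add[symmetric] scale[symmetric])
qed

section \<open>Inner spaces with values in a finite-dimensional space\<close>

context
  fixes W :: "(nat \<Rightarrow> real) set" and p :: real
    and P :: "(('b::euclidean_space \<Rightarrow> real) \<Rightarrow> real) set"
    and X :: "('b \<Rightarrow> real ^ 'n) topology"
  assumes W: "weight_system W" and p: "1 \<le> p" and adm: "admissible p W P"
  defines X: "X \<equiv> seminorm_topology (vspace (wspace p W)) (vseminorms P)"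
begin

private abbreviation (input) X0 where "X0 \<equiv> seminorm_topology (wspace p W) P"

private lemma seminorm_family_inner: "seminorm_family (wspace p W) P"
  using adm by (simp add: admissible_def)

private lemma vfam: "seminorm_family (vspace (wspace p W) :: ('b \<Rightarrow> real ^ 'n) set) (vseminorms P)"
  by (rule seminorm_family_vspace[OF seminorm_family_inner])

lemma Hausdorff_space_vspace: "Hausdorff_space X"
  unfolding X
proof (rule Hausdorff_space_seminorm_topology[OF seminorm_family_vspace[OF seminorm_family_inner]])
  fix u :: "'b \<Rightarrow> real ^ 'n" assume u: "u \<in> vspace (wspace p W)" "\<forall>q\<in>vseminorms P. q u = 0"
  have "vcoord i u = 0" for i
    by (rule admissible_separating[OF W adm p]) (use u in \<open>auto simp: vspace_def vseminorms_def\<close>)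
  then show "u = 0" by (intro vcoord_eqI) (simp add: vcoord_linear)
qed

lemma
  fixes g :: "'a::euclidean_space \<Rightarrow> 'b \<Rightarrow> real ^ 'n"
  shows smooth_into_vspace: "smooth_into X g \<longleftrightarrow> (\<forall>i. smooth_into X0 (\<lambda>x. vcoord i (g x)))"
    and pderivs_vspace: "smooth_into X g \<Longrightarrow> set as \<subseteq> Basis \<Longrightarrow>
      pderivs X0 as (\<lambda>x. vcoord i (g x)) = (\<lambda>x. vcoord i (pderivs X as g x))"
proof -
  have lim: "limitin X f l G \<longleftrightarrow> (\<forall>i. limitin X0 (\<lambda>x. vcoord i (f x)) (vcoord i l) G)"
    for f :: "'a \<Rightarrow> _" and l G
    unfolding X by (rule limitin_vspace[OF seminorm_family_inner])
  \<comment> \<open>The same equivalence for filters on \<open>real\<close>, which difference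
    quotients use; \<open>lim\<close> serves continuity on \<open>'a\<close>.\<close>
  have lim': "limitin X f l G \<longleftrightarrow> (\<forall>i. limitin X0 (\<lambda>x. vcoord i (f x)) (vcoord i l) G)"
    for f :: "real \<Rightarrow> _" and l G
    unfolding X by (rule limitin_vspace[OF seminorm_family_inner])
  note cw = smooth_into_componentwise[where \<pi> = vcoord and f = g, OF Hausdorff_space_vspace
      Hausdorff_space_admissible[OF W adm p] lim lim' _ vcoord_surj vcoord_eqI]
  show "smooth_into X g \<longleftrightarrow> (\<forall>i. smooth_into X0 (\<lambda>x. vcoord i (g x)))"
    by (rule cw(1)) (simp_all add: vcoord_linear)
  show "smooth_into X g \<Longrightarrow> set as \<subseteq> Basis \<Longrightarrow>
      pderivs X0 as (\<lambda>x. vcoord i (g x)) = (\<lambda>x. vcoord i (pderivs X as g x))"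
    by (rule cw(2)) (simp_all add: vcoord_linear)
qed

context
  fixes f :: "'a::euclidean_space \<times> 'b \<Rightarrow> real ^ 'n"
  assumes f: "f \<in> vspace (wspace p W)" and ctrl: "\<And>i. controlled p W P (vcoord i f)"
begin

private lemma fi: "vcoord i f \<in> wspace p W"
  using f by (simp add: vspace_def)

private lemma curry_vcoord: "(\<lambda>x. vcoord i (curry f x)) = curry (vcoord i f)"
  by (simp add: vcoord_def fun_eq_iff)

lemma smooth_into_curry_vspace: "smooth_into X (curry f)"
  unfolding smooth_into_vspace curry_vcoord by (intro allI smooth_into_curry[OF W p adm fi ctrl])

lemma vcoord_pderivs_curry:
  assumes "set as \<subseteq> Basis"
  shows "vcoord i (pderivs X as (curry f) x) = slice (vcoord i f) as x"
  using pderivs_vspace[OF smooth_into_curry_vspace assms, of i]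
    pderivs_curry[OF W p adm fi ctrl assms] by (simp add: curry_vcoord fun_eq_iff)

text \<open>\<open>LW\<close> tests with every continuous seminorm of \<open>X\<close>. Each is
  dominated by a finite sum of seminorms \<open>q (vcoord i u)\<close> with
  \<open>q \<in> P\<close>, and \<open>outer_bound\<close> bounds these uniformly in the
  multi-index.\<close>

lemma curry_in_LW: "curry f \<in> LW p W X"
  unfolding LW_def mem_Collect_eq
proof (intro conjI allI impI smooth_into_curry_vspace)
  fix s v assume s: "continuous_seminorm X s" and v: "v \<in> W"
  obtain F C where F: "finite F" "F \<subseteq> vseminorms P" "0 \<le> C"
      "\<And>u. u \<in> vspace (wspace p W) \<Longrightarrow> s u \<le> C * (\<Sum>q\<in>F. q u)"
    using continuous_seminorm_dominated[OF seminorm_family_vspace[OF seminorm_family_inner] s[unfolded X]]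
    unfolding seminorm_dominated_def by blast
  have nnF: "0 \<le> q u" if "q \<in> F" "u \<in> vspace (wspace p W)" for q u
    using F(2) that vfam seminorm_on_nonneg[of "vspace (wspace p W)" q u]
    unfolding seminorm_family_def by blast
  have mem: "mi_deriv X \<alpha> (curry f) x \<in> vspace (wspace p W)" for \<alpha> x
    using vcoord_pderivs_curry[of "mi_list \<alpha>" _ x] slice_in_wspace[OF W p fi]
    by (simp add: vspace_def mi_deriv_eq_pderivs)
  have "\<exists>B<\<infinity>. \<forall>\<alpha>. ennreal (v (mi_order \<alpha>)) * LpE p (\<lambda>x. ennreal (q (mi_deriv X \<alpha> (curry f) x))) \<le> B \<and>
      (\<lambda>x. ennreal (q (mi_deriv X \<alpha> (curry f) x))) \<in> borel_measurable borel" if q: "q \<in> F" for q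
  proof -
    obtain q0 i where q0: "q = (\<lambda>f. q0 (vcoord i f))" "q0 \<in> P" using q F(2) by (auto simp: vseminorms_def)
    obtain B where B: "B < \<infinity>" "\<And>as. set as \<subseteq> Basis \<Longrightarrow>
        ennreal (v (length as)) * LpE p (\<lambda>x. ennreal (q0 (slice (vcoord i f) as x))) \<le> B"
      using outer_bound[OF W p adm fi ctrl q0(2) v] by metis
    have eq: "q (mi_deriv X \<alpha> (curry f) x) = q0 (slice (vcoord i f) (mi_list \<alpha>) x)" for \<alpha> x
      using vcoord_pderivs_curry[of "mi_list \<alpha>" i x] by (simp add: q0 mi_deriv_eq_pderivs)
    have "(\<lambda>x. ennreal (q0 (slice (vcoord i f) (mi_list \<alpha>) x))) \<in> borel_measurable borel" for \<alpha>
      using seminorm_slice_measurable[OF W p adm fi ctrl q0(2) set_mi_list[of \<alpha>]] by measurable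
    then show ?thesis using B(1) B(2)[OF set_mi_list] unfolding eq by auto
  qed
  then obtain B where B: "\<And>q. q \<in> F \<Longrightarrow> B q < \<infinity>"
      "\<And>q \<alpha>. q \<in> F \<Longrightarrow> ennreal (v (mi_order \<alpha>)) * LpE p (\<lambda>x. ennreal (q (mi_deriv X \<alpha> (curry f) x))) \<le> B q"
      "\<And>q \<alpha>. q \<in> F \<Longrightarrow> (\<lambda>x. ennreal (q (mi_deriv X \<alpha> (curry f) x))) \<in> borel_measurable borel"
    by metis
  have "ennreal (v (mi_order \<alpha>)) * eLp_norm p (s \<circ> mi_deriv X \<alpha> (curry f)) \<le> ennreal C * (\<Sum>q\<in>F. B q)" for \<alpha>
  proof -
    let ?u = "mi_deriv X \<alpha> (curry f)"
    have "ennreal (norm (s (?u x))) \<le> ennreal C * (\<Sum>q\<in>F. ennreal (q (?u x)))" for x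
    proof -
      have "0 \<le> s (?u x)" by (rule continuous_seminorm_nonneg[OF s]) (use mem[of \<alpha> x] in \<open>simp add: X\<close>)
      then have "ennreal (norm (s (?u x))) \<le> ennreal (C * (\<Sum>q\<in>F. q (?u x)))"
        using F(4)[OF mem] by (intro ennreal_leI) auto
      also have "\<dots> = ennreal C * (\<Sum>q\<in>F. ennreal (q (?u x)))"
        using F(3) nnF mem by (simp add: ennreal_mult sum_nonneg sum_ennreal)
      finally show ?thesis .
    qed
    then have "eLp_norm p (s \<circ> ?u) \<le> LpE p (\<lambda>x. ennreal C * (\<Sum>q\<in>F. ennreal (q (?u x))))"
      unfolding eLp_norm_eq_LpE using p by (intro LpE_mono) auto
    also have "\<dots> = ennreal C * LpE p (\<lambda>x. \<Sum>q\<in>F. ennreal (q (?u x)))"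
      using p B(3) by (intro LpE_cmult borel_measurable_sum) auto
    also have "\<dots> \<le> ennreal C * (\<Sum>q\<in>F. LpE p (\<lambda>x. ennreal (q (?u x))))"
      using p B(3) F(1) by (intro mult_left_mono LpE_sum) auto
    finally have "ennreal (v (mi_order \<alpha>)) * eLp_norm p (s \<circ> ?u) \<le>
        ennreal (v (mi_order \<alpha>)) * (ennreal C * (\<Sum>q\<in>F. LpE p (\<lambda>x. ennreal (q (?u x)))))"
      by (rule mult_left_mono) auto
    also have "\<dots> = ennreal C * (\<Sum>q\<in>F. ennreal (v (mi_order \<alpha>)) * LpE p (\<lambda>x. ennreal (q (?u x))))"
      by (simp add: sum_distrib_left mult_ac)
    also have "\<dots> \<le> ennreal C * (\<Sum>q\<in>F. B q)"
      by (intro mult_left_mono sum_mono B(2)) auto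
    finally show ?thesis .
  qed
  then have "(SUP \<alpha>. ennreal (v (mi_order \<alpha>)) * eLp_norm p (s \<circ> mi_deriv X \<alpha> (curry f))) \<le> ennreal C * (\<Sum>q\<in>F. B q)"
    by (intro SUP_least)
  also have "\<dots> < \<infinity>" using B(1) F(1) by (simp add: ennreal_mult_less_top ennreal_sum_less_top)
  finally show "(SUP \<alpha>. ennreal (v (mi_order \<alpha>)) * eLp_norm p (s \<circ> mi_deriv X \<alpha> (curry f))) < \<infinity>" .
qed

text \<open>The vector-valued derivatives of \<open>curry f\<close> are slices of the scalar ones,
  so \<open>LpE_LpE\<close> merges inner and outer norm.\<close>

lemma mixed_norm_curry: "mixed_norm p X \<alpha> \<beta> (curry f) = eLp_norm p (mixed_deriv \<alpha> \<beta> f)"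
proof -
  let ?u = "\<lambda>x. pderivs X (mi_list \<alpha>) (curry f) x"
  have smi: "smooth_into euclidean (vcoord i f)" for i using fi[of i] by (simp add: wspace_def)
  have sm: "smooth_into euclidean (vcoord i (?u x))" for i x
    unfolding vcoord_pderivs_curry[OF set_mi_list] by (rule smooth_into_slice[OF smi set_mi_list])
  have "pderivs euclidean (mi_list \<beta>) (?u x) y = mixed_deriv \<alpha> \<beta> f (x, y)" for x y
  proof -
    have "vcoord i (pderivs euclidean (mi_list \<beta>) (?u x)) y = mixed_deriv \<alpha> \<beta> f (x, y) $ i" for i
      unfolding pderivs_vcoord[OF sm set_mi_list, symmetric] vcoord_pderivs_curry[OF set_mi_list]
      by (simp add: pderivs_slice[OF smi set_mi_list set_mi_list] mixed_deriv_def del: pderivs_simps)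
    then show ?thesis by (simp add: vcoord_def vec_eq_iff)
  qed
  then have "eLp_norm p (mi_deriv euclidean \<beta> (mi_deriv X \<alpha> (curry f) x)) =
      LpE p (\<lambda>y. ennreal (norm (mixed_deriv \<alpha> \<beta> f (x, y))))" for x
    by (simp add: eLp_norm_eq_LpE mi_deriv_eq_pderivs)
  then have "mixed_norm p X \<alpha> \<beta> (curry f) = LpE p (\<lambda>x. LpE p (\<lambda>y. ennreal (norm (mixed_deriv \<alpha> \<beta> f (x, y)))))"
    by (simp add: mixed_norm_def LpE_def)
  also have "\<dots> = eLp_norm p (mixed_deriv \<alpha> \<beta> f)"
    unfolding eLp_norm_eq_LpE using p mixed_deriv_measurable[OF smi] by (intro LpE_LpE) auto
  finally show ?thesis .
qed

end

text \<open>Admissibility makes each weighted norm of a coordinate a continuous seminorm on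
  \<open>X\<close>; testing \<open>g\<close> with these gives exactly the hypothesis of
  \<open>uncurry_in_wspace\<close>.\<close>

lemma uncurry_in_vspace:
  fixes g :: "'a::euclidean_space \<Rightarrow> 'b \<Rightarrow> real ^ 'n"
  assumes g: "g \<in> LW p W X"
  shows "case_prod g \<in> vspace (wspace p W)"
proof -
  have sm: "smooth_into X g" using g by (simp add: LW_def)
  have "case_prod (\<lambda>x. vcoord i (g x)) \<in> wspace p W" for i
  proof (rule uncurry_in_wspace[OF W p adm])
    show "smooth_into X0 (\<lambda>x. vcoord i (g x))" using sm smooth_into_vspace by blast
    fix v w assume v: "v \<in> W" and w: "w \<in> W"
    let ?s = "\<lambda>u :: 'b \<Rightarrow> real ^ 'n. enn2real (wnorm w p (vcoord i u))"
    have so: "seminorm_on (vspace (wspace p W)) ?s"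
    proof -
      have "seminorm_family (wspace p W) {\<lambda>f. enn2real (wnorm w p f)}"
        using subspace_wspace[OF p] w seminorm_on_wnorm[OF p, of "wspace p W" w]
        by (auto simp: seminorm_family_def wspace_def)
      from seminorm_family_vspace[OF this] have
        "seminorm_family (vspace (wspace p W) :: ('b \<Rightarrow> real ^ 'n) set) (vseminorms {\<lambda>f. enn2real (wnorm w p f)})" .
      then show ?thesis
        unfolding seminorm_family_def ball_vseminorms by simp
    qed
    have "continuous_seminorm X ?s"
      unfolding X
    proof (rule continuous_seminormI[OF seminorm_family_vspace[OF seminorm_family_inner] so])
      obtain F C where F: "finite F" "F \<subseteq> P" "0 \<le> C" "\<And>u. u \<in> wspace p W \<Longrightarrow> enn2real (wnorm w p u) \<le> C * (\<Sum>q\<in>F. q u)"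
        using adm w unfolding admissible_def seminorm_dominated_def by meson
      define F' where "F' = (\<lambda>q u. q (vcoord i u :: 'b \<Rightarrow> real)) ` F"
      \<comment> \<open>A sum over a set of seminorms would lose terms if two of them coincided
        after composition with \<open>vcoord i\<close>; surjectivity of the coordinate map excludes
        this.\<close>
      have "inj_on (\<lambda>q (u :: 'b \<Rightarrow> real ^ 'n). q (vcoord i u :: 'b \<Rightarrow> real)) F"
      proof (rule inj_onI, rule ext)
        fix q q' :: "('b \<Rightarrow> real) \<Rightarrow> real" and u
        assume eq: "(\<lambda>u :: 'b \<Rightarrow> real ^ 'n. q (vcoord i u)) = (\<lambda>u. q' (vcoord i u))"
        obtain u' :: "'b \<Rightarrow> real ^ 'n" where "\<forall>j. vcoord j u' = u" using vcoord_surj[of "\<lambda>_. u"] by blast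
        then show "q u = q' u" using fun_cong[OF eq, of u'] by simp
      qed
      then have sum: "(\<Sum>q\<in>F'. q u) = (\<Sum>q\<in>F. q (vcoord i u))" for u
        unfolding F'_def by (subst sum.reindex) simp_all
      show "seminorm_dominated (vspace (wspace p W)) (vseminorms P) ?s"
        by (rule seminorm_dominatedI[of F' _ C])
          (use F in \<open>auto simp: sum[unfolded F'_def] vspace_def F'_def vseminorms_def\<close>)
    qed
    with g v have B: "(SUP \<alpha>. ennreal (v (mi_order \<alpha>)) * eLp_norm p (?s \<circ> mi_deriv X \<alpha> g)) < \<infinity>"
      by (auto simp: LW_def)
    have eq: "eLp_norm p (?s \<circ> mi_deriv X \<alpha> g) = LpE p (\<lambda>x. wnorm w p (pderivs X0 (mi_list \<alpha>) (\<lambda>x. vcoord i (g x)) x))" for \<alpha>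
    proof -
      have "wnorm w p (vcoord i (mi_deriv X \<alpha> g x)) < \<infinity>" for x
      proof -
        have "mi_deriv X \<alpha> g x \<in> vspace (wspace p W)"
          using smooth_into_continuous[OF sm set_mi_list[of \<alpha>]] continuous_map_image_subset_topspace
          unfolding X mi_deriv_eq_pderivs by fastforce
        then show ?thesis using w by (simp add: vspace_def wspace_def)
      qed
      then show ?thesis
        unfolding eLp_norm_eq_LpE pderivs_vspace[OF sm set_mi_list]
        by (simp add: mi_deriv_eq_pderivs ennreal_enn2real)
    qed
    show "\<exists>B<\<infinity>. \<forall>\<alpha>. ennreal (v (mi_order \<alpha>)) * LpE p (\<lambda>x. wnorm w p (pderivs X0 (mi_list \<alpha>) (\<lambda>x. vcoord i (g x)) x)) \<le> B"
      using B by (intro exI[of _ "SUP \<alpha>. ennreal (v (mi_order \<alpha>)) * eLp_norm p (?s \<circ> mi_deriv X \<alpha> g)"])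
        (auto simp: eq intro: SUP_upper)
  qed
  moreover have "vcoord i (case_prod g) = case_prod (\<lambda>x. vcoord i (g x))" for i
    by (auto simp: vcoord_def)
  ultimately show ?thesis by (simp add: vspace_def)
qed

end

section \<open>Comparison of mixed norms with weighted norms\<close>

lemma mset_eq_mixed_list:
  fixes ds :: "('a::euclidean_space \<times> 'b::euclidean_space) list"
  assumes "set ds \<subseteq> Basis"
  obtains \<alpha> \<beta> where "mset ds = mset (inl (mi_list \<alpha>) @ inr (mi_list \<beta>))"
    "length ds = mi_order \<alpha> + mi_order \<beta>"
proof -
  obtain as bs where asbs: "set as \<subseteq> Basis" "set bs \<subseteq> Basis" "mset ds = mset (inl as @ inr bs)"
    using split_list_prod_Basis[OF assms] by metis
  have "mset ds = mset (inl (mi_list (count (mset as))) @ inr (mi_list (count (mset bs))))"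
    using asbs(3) mset_mi_list_count[OF asbs(1)] mset_mi_list_count[OF asbs(2)] by (simp add: mset_map)
  from that[OF this] mset_eq_length[OF this] show ?thesis by simp
qed

lemma vseminormsI: "q \<in> P \<Longrightarrow> (\<lambda>f. q (vcoord i f)) \<in> vseminorms P"
  by (auto simp: vseminorms_def)

lemma wseminormsI: "w \<in> W \<Longrightarrow> (\<lambda>f. enn2real (wnorm w p f)) \<in> wseminorms p W"
  by (auto simp: wseminorms_def)

text \<open>A mixed seminorm of the right-hand side, pulled back along \<open>curry\<close> and
  before conversion to a real number.\<close>

definition mixed_sup ::
    "real \<Rightarrow> (nat \<Rightarrow> real) \<Rightarrow> (nat \<Rightarrow> real) \<Rightarrow> ('a::euclidean_space \<times> 'b::euclidean_space \<Rightarrow> real ^ 'n) \<Rightarrow> ennreal" where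
  "mixed_sup p v w f = (SUP (\<alpha>, \<beta>). ennreal (v (mi_order \<alpha>) * w (mi_order \<beta>)) * eLp_norm p (mixed_deriv \<alpha> \<beta> f))"

lemma vspace_wspaceD:
  assumes "f \<in> vspace (wspace p W)"
  shows "smooth_into euclidean (vcoord i f)" "w \<in> W \<Longrightarrow> wnorm w p (vcoord i f) < \<infinity>"
  using assms by (auto simp: vspace_def wspace_def)

text \<open>This direction is the absorption clause of \<open>weight_system\<close> with
  \<open>K = 1\<close>: a mixed derivative of orders \<open>j\<close> and \<open>k\<close> has total
  order \<open>j + k\<close>.\<close>

lemma mixed_sup_le_wnorm:
  assumes W: "weight_system W" and p: "1 \<le> p" and vw: "v \<in> W" "w \<in> W"
  obtains w' C where "w' \<in> W" "0 \<le> C"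
    "\<And>f :: 'a::euclidean_space \<times> 'b::euclidean_space \<Rightarrow> real ^ 'n. f \<in> vspace (wspace p W) \<Longrightarrow>
      mixed_sup p v w f \<le> ennreal C * (\<Sum>i\<in>UNIV. wnorm w' p (vcoord i f))"
proof -
  have "\<exists>w'\<in>W. \<exists>C\<ge>0. \<forall>j k. v j * w k * 1 ^ k \<le> C * w' (j + k)"
    using W vw order_refl[of "1::real"] unfolding weight_system_def by blast
  then obtain w' C where w': "w' \<in> W" "0 \<le> C" "\<And>j k. v j * w k \<le> C * w' (j + k)" by auto
  have "mixed_sup p v w f \<le> ennreal C * (\<Sum>i\<in>UNIV. wnorm w' p (vcoord i f))"
    if f: "f \<in> vspace (wspace p W)" for f :: "'a \<times> 'b \<Rightarrow> real ^ 'n"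
    unfolding mixed_sup_def
  proof (rule SUP_least, clarify)
    fix \<alpha> :: "'a \<Rightarrow> nat" and \<beta> :: "'b \<Rightarrow> nat"
    let ?ds = "inl (mi_list \<alpha>) @ inr (mi_list \<beta>) :: ('a \<times> 'b) list"
    have "ennreal (v (mi_order \<alpha>) * w (mi_order \<beta>)) * eLp_norm p (mixed_deriv \<alpha> \<beta> f) \<le>
        ennreal (C * w' (length ?ds)) * (\<Sum>i\<in>UNIV. eLp_norm p (pderivs euclidean ?ds (vcoord i f)))"
      using w'(3)[of "mi_order \<alpha>" "mi_order \<beta>"] vspace_wspaceD(1)[OF f]
      by (intro mult_mono[OF ennreal_leI eLp_norm_mixed_deriv_le[OF p]]) auto
    also have "\<dots> = ennreal C * (\<Sum>i\<in>UNIV. ennreal (w' (length ?ds)) * eLp_norm p (pderivs euclidean ?ds (vcoord i f)))"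
      using w'(2) by (simp add: ennreal_mult' sum_distrib_left mult.assoc del: pderivs_simps)
    also have "\<dots> \<le> ennreal C * (\<Sum>i\<in>UNIV. wnorm w' p (vcoord i f))"
      by (intro mult_left_mono sum_mono le_wnorm set_inl_inr_mi_list) auto
    finally show "ennreal (v (mi_order \<alpha>) * w (mi_order \<beta>)) * eLp_norm p (mixed_deriv \<alpha> \<beta> f) \<le>
        ennreal C * (\<Sum>i\<in>UNIV. wnorm w' p (vcoord i f))" .
  qed
  then show ?thesis using that w' by blast
qed

text \<open>The converse direction uses the splitting clause; every list of product basis vectors is
  a permutation of outer directions followed by inner ones.\<close>

lemma wnorm_le_mixed_sup:
  assumes W: "weight_system W" and p: "1 \<le> p" and w: "w \<in> W"
  obtains w1 w2 C where "w1 \<in> W" "w2 \<in> W" "0 \<le> C"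
    "\<And>(f :: 'a::euclidean_space \<times> 'b::euclidean_space \<Rightarrow> real ^ 'n) i. f \<in> vspace (wspace p W) \<Longrightarrow>
      wnorm w p (vcoord i f) \<le> ennreal C * mixed_sup p w1 w2 f"
proof -
  obtain w1 w2 C where W2: "w1 \<in> W" "w2 \<in> W" "0 \<le> C" "\<And>j k. w (j + k) \<le> C * (w1 j * w2 k)"
    using W w unfolding weight_system_def by meson
  have "wnorm w p (vcoord i f) \<le> ennreal C * mixed_sup p w1 w2 f"
    if f: "f \<in> vspace (wspace p W)" for f :: "'a \<times> 'b \<Rightarrow> real ^ 'n" and i
  proof (rule wnorm_leI)
    fix ds :: "('a \<times> 'b) list" assume ds: "set ds \<subseteq> Basis"
    obtain \<alpha> \<beta> where ab: "mset ds = mset (inl (mi_list \<alpha>) @ inr (mi_list \<beta>))" "length ds = mi_order \<alpha> + mi_order \<beta>"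
      using mset_eq_mixed_list[OF ds] by blast
    have "ennreal (w (length ds)) * eLp_norm p (pderivs euclidean ds (vcoord i f)) \<le>
        ennreal (C * (w1 (mi_order \<alpha>) * w2 (mi_order \<beta>))) * eLp_norm p (mixed_deriv \<alpha> \<beta> f)"
      unfolding ab(2) pderivs_mset[OF vspace_wspaceD(1)[OF f] ds ab(1)]
      using p by (intro mult_mono ennreal_leI W2(4) eLp_norm_mixed_deriv_ge) auto
    also have "\<dots> = ennreal C * (ennreal (w1 (mi_order \<alpha>) * w2 (mi_order \<beta>)) * eLp_norm p (mixed_deriv \<alpha> \<beta> f))"
      using W2(3) by (simp add: ennreal_mult' mult.assoc)
    also have "\<dots> \<le> ennreal C * mixed_sup p w1 w2 f"
      unfolding mixed_sup_def by (intro mult_left_mono SUP_upper2[of "(\<alpha>, \<beta>)"]) auto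
    finally show "ennreal (w (length ds)) * eLp_norm p (pderivs euclidean ds (vcoord i f)) \<le> ennreal C * mixed_sup p w1 w2 f" .
  qed
  then show ?thesis using that W2 by blast
qed

lemma mixed_sup_finite:
  assumes "weight_system W" "1 \<le> p" "v \<in> W" "w \<in> W" "f \<in> vspace (wspace p W)"
  shows "mixed_sup p v w f < \<infinity>"
proof -
  obtain w' C where "w' \<in> W" "mixed_sup p v w f \<le> ennreal C * (\<Sum>i\<in>UNIV. wnorm w' p (vcoord i f))"
    using mixed_sup_le_wnorm[OF assms(1-4)] assms(5) by metis
  then show ?thesis
    using vspace_wspaceD(2)[OF assms(5)]
    by (auto simp: ennreal_mult_less_top ennreal_sum_less_top intro: le_less_trans)
qed

section \<open>The homeomorphism for an abstract weight system\<close>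

lemma linear_on_space_curry: "linear_on_space Y curry"
  by (auto simp: linear_on_space_def fun_eq_iff scaleR_fun_def)

lemma linear_on_space_uncurry: "linear_on_space Y case_prod"
  by (auto simp: linear_on_space_def fun_eq_iff scaleR_fun_def)

lemma bornological_isomorphism_if_homeomorphic_maps:
  assumes hom: "homeomorphic_maps X Y \<phi> \<psi>" and lin: "linear_on_space X \<phi>" "linear_on_space Y \<psi>"
    and zero: "0 \<in> topspace X" "0 \<in> topspace Y"
  shows "bornological_isomorphism X Y \<phi>"
proof -
  have cont: "continuous_map X Y \<phi>" "continuous_map Y X \<psi>"
    and inv: "\<And>x. x \<in> topspace X \<Longrightarrow> \<psi> (\<phi> x) = x" "\<And>y. y \<in> topspace Y \<Longrightarrow> \<phi> (\<psi> y) = y"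
    using hom by (auto simp: homeomorphic_maps_def)
  have mem: "\<And>x. x \<in> topspace X \<Longrightarrow> \<phi> x \<in> topspace Y" "\<And>y. y \<in> topspace Y \<Longrightarrow> \<psi> y \<in> topspace X"
    using cont continuous_map_image_subset_topspace by fastforce+
  have bij: "bij_betw \<phi> (topspace X) (topspace Y)"
    by (rule bij_betwI[of _ _ _ \<psi>]) (use mem inv in auto)
  have "inv_into (topspace X) \<phi> ` B = \<psi> ` B" if "B \<subseteq> topspace Y" for B
  proof (rule image_cong[OF refl])
    fix y assume "y \<in> B"
    then have y: "y \<in> topspace Y" using that by blast
    show "inv_into (topspace X) \<phi> y = \<psi> y"
      using bij_betw_inv_into_left[OF bij mem(2)[OF y]] inv(2)[OF y] by simp
  qed
  then show ?thesis
    unfolding bornological_isomorphism_def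
    using lin bij vn_bounded_image_continuous_linear[OF lin(1) cont(1) zero(1)]
      vn_bounded_image_continuous_linear[OF lin(2) cont(2) zero(2)]
    by (auto simp: vn_bounded_def[of Y])
qed

context
  fixes W :: "(nat \<Rightarrow> real) set" and p :: real
    and P :: "(('b::euclidean_space \<Rightarrow> real) \<Rightarrow> real) set"
    and X :: "('b \<Rightarrow> real ^ 'n) topology"
    and V :: "('a::euclidean_space \<times> 'b \<Rightarrow> real ^ 'n) set"
  assumes W: "weight_system W" and p: "1 \<le> p" and adm: "admissible p W P"
  defines X: "X \<equiv> seminorm_topology (vspace (wspace p W)) (vseminorms P)"
    and V: "V \<equiv> vspace (wspace p W)"
  assumes ctrl: "\<And>f i. f \<in> V \<Longrightarrow> controlled p W P (vcoord i f)"
begin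

text \<open>From here on the right-hand space is treated through its preimages, where mixed norms
  are norms of ordinary partial derivatives.\<close>

lemma LW_eq_curry_image: "LW p W X = curry ` V"
proof
  show "curry ` V \<subseteq> LW p W X"
    using curry_in_LW[OF W p adm _ ctrl] unfolding V X by blast
  show "LW p W X \<subseteq> curry ` V"
  proof
    fix g :: "'a \<Rightarrow> 'b \<Rightarrow> real ^ 'n" assume "g \<in> LW p W X"
    then have "case_prod g \<in> V" unfolding V X by (rule uncurry_in_vspace[OF W p adm])
    then show "g \<in> curry ` V" by (intro image_eqI[of _ _ "case_prod g"]) simp_all
  qed
qed

lemma mixed_norm_curry_eq: "f \<in> V \<Longrightarrow> mixed_norm p X \<alpha> \<beta> (curry f) = eLp_norm p (mixed_deriv \<alpha> \<beta> f)"
  using mixed_norm_curry[OF W p adm _ ctrl] unfolding V X by blast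

private lemma seminorm_family_outer: "seminorm_family V (vseminorms (wseminorms p W))"
  unfolding V by (rule seminorm_family_vspace[OF seminorm_family_wspace[OF p]])

private lemma V_smooth: "f \<in> V \<Longrightarrow> smooth_into euclidean (vcoord i f)"
  unfolding V by (rule vspace_wspaceD(1))

private lemma mixed_seminorm_curry:
  "f \<in> V \<Longrightarrow> (SUP (\<alpha>, \<beta>). ennreal (v (mi_order \<alpha>) * w (mi_order \<beta>)) * mixed_norm p X \<alpha> \<beta> (curry f)) = mixed_sup p v w f"
  by (simp add: mixed_sup_def mixed_norm_curry_eq)

lemma eLp_norm_mixed_deriv_finite:
  assumes "f \<in> V"
  shows "eLp_norm p (mixed_deriv \<alpha> \<beta> f) < \<infinity>"
proof -
  obtain w where w: "w \<in> W" "\<And>j. j \<le> max (mi_order \<alpha>) (mi_order \<beta>) \<Longrightarrow> 0 < w j"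
    using W unfolding weight_system_def by meson
  have pos: "0 < w (mi_order \<alpha>) * w (mi_order \<beta>)" using w(2) by simp
  have "ennreal (w (mi_order \<alpha>) * w (mi_order \<beta>)) * eLp_norm p (mixed_deriv \<alpha> \<beta> f) \<le> mixed_sup p w w f"
    unfolding mixed_sup_def by (intro SUP_upper2[of "(\<alpha>, \<beta>)"]) auto
  also have "\<dots> < \<infinity>" using mixed_sup_finite[OF W p w(1) w(1)] assms unfolding V by blast
  finally show ?thesis using pos by (auto simp: ennreal_mult_less_top ennreal_zero_less_mult_iff)
qed

lemma seminorm_family_LW:
  "seminorm_family (LW p W X :: ('a \<Rightarrow> 'b \<Rightarrow> real ^ 'n) set) (mixed_seminorms p W X)"
  "seminorm_family (LW p W X :: ('a \<Rightarrow> 'b \<Rightarrow> real ^ 'n) set) {\<lambda>g. enn2real (mixed_norm p X \<alpha> \<beta> g) | \<alpha> \<beta>. True}"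
proof -
  have sub: "subspace V" using seminorm_family_outer by (simp add: seminorm_family_def)
  have lin: "curry (f + g) = curry f + curry g" "curry (c *\<^sub>R f) = c *\<^sub>R curry f"
    for f g :: "'a \<times> 'b \<Rightarrow> real ^ 'n" and c
    by (auto simp: fun_eq_iff scaleR_fun_def)
  show "seminorm_family (LW p W X :: ('a \<Rightarrow> 'b \<Rightarrow> real ^ 'n) set) (mixed_seminorms p W X)"
    unfolding LW_eq_curry_image
  proof (rule seminorm_family_image[OF sub])
    show "curry (f + g) = curry f + curry g" "curry (c *\<^sub>R f) = c *\<^sub>R curry f"
      for f g :: "'a \<times> 'b \<Rightarrow> real ^ 'n" and c
      by (rule lin)+
    fix q :: "('a \<Rightarrow> 'b \<Rightarrow> real ^ 'n) \<Rightarrow> real" assume "q \<in> mixed_seminorms p W X"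
    then obtain v w where q: "q = (\<lambda>g. enn2real (SUP (\<alpha>, \<beta>).
        ennreal (v (mi_order \<alpha>) * w (mi_order \<beta>)) * mixed_norm p X \<alpha> \<beta> g))" "v \<in> W" "w \<in> W"
      by (auto simp: mixed_seminorms_def)
    have "seminorm_on V (\<lambda>f. enn2real (mixed_sup p v w f))"
    proof -
      have "mixed_sup p v w f < \<infinity>" if "f \<in> V" for f
        using mixed_sup_finite[OF W p q(2,3)] that unfolding V by blast
      then show ?thesis
        using seminorm_on_SUP_mixed_deriv[where V = V and A = UNIV and
            w = "\<lambda>(\<alpha>, \<beta>). v (mi_order \<alpha>) * w (mi_order \<beta>)", OF p V_smooth]
        unfolding mixed_sup_def by simp
    qed
    then show "seminorm_on V (\<lambda>f. q (curry f))"
      unfolding q(1) seminorm_on_def using mixed_seminorm_curry sub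
      by (simp add: subspace_add subspace_scale)
  qed
  show "seminorm_family (LW p W X :: ('a \<Rightarrow> 'b \<Rightarrow> real ^ 'n) set) {\<lambda>g. enn2real (mixed_norm p X \<alpha> \<beta> g) | \<alpha> \<beta>. True}"
    unfolding LW_eq_curry_image
  proof (rule seminorm_family_image[OF sub])
    show "curry (f + g) = curry f + curry g" "curry (c *\<^sub>R f) = c *\<^sub>R curry f"
      for f g :: "'a \<times> 'b \<Rightarrow> real ^ 'n" and c
      by (rule lin)+
    fix q :: "('a \<Rightarrow> 'b \<Rightarrow> real ^ 'n) \<Rightarrow> real"
    assume "q \<in> {\<lambda>g. enn2real (mixed_norm p X \<alpha> \<beta> g) | \<alpha> \<beta>. True}"
    then obtain \<alpha> \<beta> where q: "q = (\<lambda>g. enn2real (mixed_norm p X \<alpha> \<beta> g))" by blast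
    have "seminorm_on V (\<lambda>f. enn2real (eLp_norm p (mixed_deriv \<alpha> \<beta> f)))"
      using seminorm_on_SUP_mixed_deriv[OF p V_smooth, where A = "{(\<alpha>, \<beta>)}" and w = "\<lambda>_. 1"]
        eLp_norm_mixed_deriv_finite by simp
    then show "seminorm_on V (\<lambda>f. q (curry f))"
      unfolding q(1) seminorm_on_def using mixed_norm_curry_eq sub
      by (simp add: subspace_add subspace_scale)
  qed
qed

theorem homeomorphic_maps_curry:
  "homeomorphic_maps (seminorm_topology V (vseminorms (wseminorms p W)))
     (seminorm_topology (LW p W X :: ('a \<Rightarrow> 'b \<Rightarrow> real ^ 'n) set) (mixed_seminorms p W X)) curry case_prod"
  unfolding homeomorphic_maps_def
proof (intro conjI ballI)
  have mem: "curry f \<in> LW p W X" if "f \<in> V" for f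
    unfolding LW_eq_curry_image using that by blast
  have mem': "case_prod g \<in> V" if "g \<in> LW p W X" for g :: "'a \<Rightarrow> 'b \<Rightarrow> real ^ 'n"
    using that unfolding LW_eq_curry_image by auto
  show "continuous_map (seminorm_topology V (vseminorms (wseminorms p W)))
     (seminorm_topology (LW p W X :: ('a \<Rightarrow> 'b \<Rightarrow> real ^ 'n) set) (mixed_seminorms p W X)) curry"
  proof (rule continuous_map_seminorm_linear[OF seminorm_family_outer seminorm_family_LW(1) mem])
    show "curry f - curry g = curry (f - g)" for f g :: "'a \<times> 'b \<Rightarrow> real ^ 'n" by (auto simp: fun_eq_iff)
    fix q :: "('a \<Rightarrow> 'b \<Rightarrow> real ^ 'n) \<Rightarrow> real" assume "q \<in> mixed_seminorms p W X"
    then obtain v w where q: "q = (\<lambda>g. enn2real (SUP (\<alpha>, \<beta>).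
        ennreal (v (mi_order \<alpha>) * w (mi_order \<beta>)) * mixed_norm p X \<alpha> \<beta> g))" "v \<in> W" "w \<in> W"
      by (auto simp: mixed_seminorms_def)
    obtain w' C where w': "w' \<in> W" "0 \<le> C"
      "\<And>f. f \<in> V \<Longrightarrow> mixed_sup p v w f \<le> ennreal C * (\<Sum>i\<in>UNIV. wnorm w' p (vcoord i f))"
      using mixed_sup_le_wnorm[OF W p q(2,3), where 'a='a and 'b='b and 'n='n] unfolding V by metis
    define r where "r i f = enn2real (wnorm w' p (vcoord i f))" for i :: 'n and f :: "'a \<times> 'b \<Rightarrow> real ^ 'n"
    have r: "r i \<in> vseminorms (wseminorms p W)" for i
      unfolding r_def[abs_def] by (intro vseminormsI wseminormsI w'(1))
    have rnn: "0 \<le> r i f" for i f by (simp add: r_def)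
    show "seminorm_dominated V (vseminorms (wseminorms p W)) (\<lambda>f. q (curry f))"
    \<comment> \<open>The \<open>r i\<close> may coincide as functions, so a sum over
      \<open>range r\<close> need not equal the sum over \<open>i\<close>. Each term is bounded by
      the whole sum over the range, which costs the factor \<open>CARD('n)\<close>.\<close>
    proof (rule seminorm_dominatedI[of "range r" _ "C * CARD('n)"])
      fix f assume f: "f \<in> V"
      have fin: "wnorm w' p (vcoord i f) < \<infinity>" for i using f w'(1) unfolding V by (rule vspace_wspaceD(2))
      have "q (curry f) = enn2real (mixed_sup p v w f)" unfolding q(1) mixed_seminorm_curry[OF f] ..
      also have "\<dots> \<le> enn2real (ennreal C * (\<Sum>i\<in>UNIV. wnorm w' p (vcoord i f)))"
        using fin by (intro enn2real_mono w'(3)[OF f]) (auto simp: ennreal_mult_less_top ennreal_sum_less_top)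
      also have "\<dots> = C * (\<Sum>i\<in>UNIV. r i f)"
        using fin w'(2) by (simp add: enn2real_mult enn2real_sum r_def)
      also have "\<dots> \<le> C * (\<Sum>i\<in>(UNIV::'n set). \<Sum>q\<in>range r. q f)"
        using w'(2) rnn by (intro mult_left_mono sum_mono member_le_sum) auto
      finally show "q (curry f) \<le> C * CARD('n) * (\<Sum>q\<in>range r. q f)" by simp
    qed (use r w'(2) in auto)
  qed
  show "continuous_map (seminorm_topology (LW p W X :: ('a \<Rightarrow> 'b \<Rightarrow> real ^ 'n) set) (mixed_seminorms p W X))
      (seminorm_topology V (vseminorms (wseminorms p W))) case_prod"
  proof (rule continuous_map_seminorm_linear[OF seminorm_family_LW(1) seminorm_family_outer mem'])
    show "case_prod g - case_prod h = case_prod (g - h)" for g h :: "'a \<Rightarrow> 'b \<Rightarrow> real ^ 'n" by (auto simp: fun_eq_iff)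
    fix q :: "('a \<times> 'b \<Rightarrow> real ^ 'n) \<Rightarrow> real" assume "q \<in> vseminorms (wseminorms p W)"
    then obtain w i where q: "q = (\<lambda>f. enn2real (wnorm w p (vcoord i f)))" "w \<in> W"
      by (auto simp: vseminorms_def wseminorms_def)
    obtain w1 w2 C where w12: "w1 \<in> W" "w2 \<in> W" "0 \<le> C"
      "\<And>f i. f \<in> V \<Longrightarrow> wnorm w p (vcoord i f) \<le> ennreal C * mixed_sup p w1 w2 f"
      using wnorm_le_mixed_sup[OF W p q(2), where 'a='a and 'b='b and 'n='n] unfolding V by metis
    let ?m = "\<lambda>g. enn2real (SUP (\<alpha>, \<beta>). ennreal (w1 (mi_order \<alpha>) * w2 (mi_order \<beta>)) * mixed_norm p X \<alpha> \<beta> g)"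
    show "seminorm_dominated (LW p W X) (mixed_seminorms p W X) (\<lambda>g. q (case_prod g))"
    proof (rule seminorm_dominated_single[of ?m _ C])
      show "?m \<in> mixed_seminorms p W X" using w12(1,2) unfolding mixed_seminorms_def by blast
      fix g :: "'a \<Rightarrow> 'b \<Rightarrow> real ^ 'n" assume "g \<in> LW p W X"
      then obtain f where f: "f \<in> V" "g = curry f" unfolding LW_eq_curry_image by blast
      have fin: "mixed_sup p w1 w2 f < \<infinity>" using mixed_sup_finite[OF W p w12(1,2)] f(1) unfolding V by blast
      have "q (case_prod g) \<le> enn2real (ennreal C * mixed_sup p w1 w2 f)"
        unfolding q(1) f(2) case_prod_curry using fin
        by (intro enn2real_mono w12(4)[OF f(1)]) (simp add: ennreal_mult_less_top)
      also have "\<dots> = C * ?m g"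
        unfolding f(2) mixed_seminorm_curry[OF f(1)] using w12(3) by (simp add: enn2real_mult)
      finally show "q (case_prod g) \<le> C * ?m g" .
    qed (rule w12(3))
  qed
qed simp_all

end

section \<open>The three weight systems\<close>

lemma ennreal_divide_eq: "0 < c \<Longrightarrow> x / ennreal c = ennreal (1 / c) * x"
  by (simp add: divide_ennreal_def inverse_ennreal divide_inverse mult.commute)

lemma wnorm_eq_SUP_mi_deriv:
  assumes "smooth_into euclidean f"
  shows "wnorm w p f = (SUP \<alpha>. ennreal (w (mi_order \<alpha>)) * eLp_norm p (mi_deriv euclidean \<alpha> f))"
proof (rule antisym)
  show "(SUP \<alpha>. ennreal (w (mi_order \<alpha>)) * eLp_norm p (mi_deriv euclidean \<alpha> f)) \<le> wnorm w p f"
    using le_wnorm[OF set_mi_list] by (intro SUP_least) (simp add: mi_deriv_eq_pderivs)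
  show "wnorm w p f \<le> (SUP \<alpha>. ennreal (w (mi_order \<alpha>)) * eLp_norm p (mi_deriv euclidean \<alpha> f))"
  proof (rule wnorm_leI)
    fix bs :: "'a list" assume bs: "set bs \<subseteq> Basis"
    let ?\<alpha> = "count (mset bs)"
    have eq: "mset bs = mset (mi_list ?\<alpha>)" using mset_mi_list_count[OF bs] by simp
    have "length bs = mi_order ?\<alpha>" using mset_eq_length[OF eq] by simp
    moreover have "pderivs euclidean bs f = mi_deriv euclidean ?\<alpha> f"
      unfolding mi_deriv_eq_pderivs by (rule pderivs_mset[OF assms bs eq])
    ultimately show "ennreal (w (length bs)) * eLp_norm p (pderivs euclidean bs f) \<le>
        (SUP \<alpha>. ennreal (w (mi_order \<alpha>)) * eLp_norm p (mi_deriv euclidean \<alpha> f))"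
      by (intro SUP_upper2[of ?\<alpha>]) auto
  qed
qed

lemma wnorm_mono:
  assumes "0 \<le> C" "\<And>k. v k \<le> C * w k"
  shows "wnorm v p f \<le> ennreal C * wnorm w p f"
proof (rule wnorm_leI)
  fix bs :: "'a list" assume bs: "set bs \<subseteq> Basis"
  have "ennreal (v (length bs)) * eLp_norm p (pderivs euclidean bs f) \<le>
      ennreal (C * w (length bs)) * eLp_norm p (pderivs euclidean bs f)"
    by (intro mult_right_mono ennreal_leI assms) auto
  also have "\<dots> = ennreal C * (ennreal (w (length bs)) * eLp_norm p (pderivs euclidean bs f))"
    using assms(1) by (simp add: ennreal_mult' mult.assoc)
  also have "\<dots> \<le> ennreal C * wnorm w p f" by (intro mult_left_mono le_wnorm bs) auto
  finally show "ennreal (v (length bs)) * eLp_norm p (pderivs euclidean bs f) \<le> ennreal C * wnorm w p f" .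
qed

text \<open>When \<open>P\<close> consists of the weighted norms themselves, the weight defining
  \<open>s\<close> is its own dominating weight, and the absorption clause supplies
  \<open>w' \<in> W\<close>, for which \<open>f\<close> has finite norm.\<close>

lemma controlled_wseminorms:
  assumes W: "weight_system W" and f: "f \<in> wspace p W"
  shows "controlled p W (wseminorms p W) f"
  unfolding controlled_def
proof (intro ballI allI impI)
  fix s :: "('b \<Rightarrow> real) \<Rightarrow> real" and K :: real assume "s \<in> wseminorms p W" and K: "1 \<le> K"
  then obtain w where w: "w \<in> W" "s = (\<lambda>u. enn2real (wnorm w p u))" by (auto simp: wseminorms_def)
  have "\<exists>w' C'. 0 \<le> C' \<and> wnorm w' p f < \<infinity> \<and> (\<forall>j k. v j * w k * K ^ k \<le> C' * w' (j + k))"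
    if v: "v \<in> W" for v
  proof -
    have "\<exists>w'\<in>W. \<exists>C\<ge>0. \<forall>j k. v j * w k * K ^ k \<le> C * w' (j + k)"
      using W v w(1) K unfolding weight_system_def by blast
    then show ?thesis using f by (auto simp: wspace_def)
  qed
  moreover have "0 \<le> w k" for k using W w(1) by (simp add: weight_system_def)
  ultimately show "\<exists>w C. (\<forall>k. 0 \<le> w k) \<and> 0 \<le> C \<and>
     (\<forall>u\<in>wspace p W. wnorm w p u < \<infinity> \<longrightarrow> s u \<le> C * enn2real (wnorm w p u)) \<and>
     (\<forall>v\<in>W. \<exists>w' C'. 0 \<le> C' \<and> wnorm w' p f < \<infinity> \<and> (\<forall>j k. v j * w k * K ^ k \<le> C' * w' (j + k)))"
    unfolding w(2) by (intro exI[of _ w] exI[of _ "1::real"]) auto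
qed

lemma mixed_seminormsI:
  "v \<in> W \<Longrightarrow> w \<in> W \<Longrightarrow> (\<lambda>g. enn2real (SUP (\<alpha>, \<beta>).
     ennreal (v (mi_order \<alpha>) * w (mi_order \<beta>)) * mixed_norm p X \<alpha> \<beta> g)) \<in> mixed_seminorms p W X"
  unfolding mixed_seminorms_def by (rule CollectI, rule exI[of _ v], rule exI[of _ w]) simp

text \<open>\<open>Y\<close> carries the topology of the weights whatever \<open>P\<close> is;
  \<open>P\<close> enters through the inner space \<open>X\<close>. In the Roumieu case
  \<open>Y\<close> is thus not yet the inductive limit, a gap closed afterwards at the level of
  bounded sets.\<close>

lemma curry_isomorphism:
  fixes p :: real and P :: "(('b::euclidean_space \<Rightarrow> real) \<Rightarrow> real) set"
  assumes W: "weight_system W" and p: "1 \<le> p" and adm: "admissible p W P"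
    and ctrl: "\<And>f i. f \<in> (vspace (wspace p W) :: ('a::euclidean_space \<times> 'b \<Rightarrow> real ^ 'n) set) \<Longrightarrow>
      controlled p W P (vcoord i f)"
  defines "X \<equiv> vec_valued (seminorm_topology (wspace p W) P) :: ('b \<Rightarrow> real ^ 'n) topology"
  defines "Y \<equiv> vec_valued (seminorm_topology (wspace p W) (wseminorms p W)) :: ('a \<times> 'b \<Rightarrow> real ^ 'n) topology"
  defines "Z \<equiv> seminorm_topology (LW p W X) (mixed_seminorms p W X)"
  shows "bornological_isomorphism Y Z curry" "homeomorphic_map Y Z curry"
proof -
  have X: "X = seminorm_topology (vspace (wspace p W)) (vseminorms P)"
    unfolding X_def using adm by (intro vec_valued_eq) (simp add: admissible_def)
  have Y: "Y = seminorm_topology (vspace (wspace p W)) (vseminorms (wseminorms p W))"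
    unfolding Y_def by (rule vec_valued_eq[OF seminorm_family_wspace[OF p]])
  have hom: "homeomorphic_maps Y Z curry case_prod"
    unfolding Z_def X Y by (rule homeomorphic_maps_curry[OF W p adm ctrl])
  then show "homeomorphic_map Y Z curry" unfolding homeomorphic_map_maps by blast
  have "subspace (LW p W X :: ('a \<Rightarrow> 'b \<Rightarrow> real ^ 'n) set)"
    using seminorm_family_LW(1)[OF W p adm ctrl, folded X] by (simp add: seminorm_family_def)
  moreover have "subspace (vspace (wspace p W) :: ('a \<times> 'b \<Rightarrow> real ^ 'n) set)"
  proof -
    have "seminorm_family (vspace (wspace p W) :: ('a \<times> 'b \<Rightarrow> real ^ 'n) set) (vseminorms (wseminorms p W))"
      by (rule seminorm_family_vspace[OF seminorm_family_wspace[OF p]])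
    then show ?thesis by (simp add: seminorm_family_def)
  qed
  ultimately show "bornological_isomorphism Y Z curry"
    by (intro bornological_isomorphism_if_homeomorphic_maps[OF hom] linear_on_space_curry linear_on_space_uncurry)
      (simp_all add: Y Z_def subspace_0)
qed

lemma controlled_vcoord_wseminorms:
  assumes "weight_system W" "f \<in> vspace (wspace p W)"
  shows "controlled p W (wseminorms p W) (vcoord i f)"
  using assms(2) by (intro controlled_wseminorms[OF assms(1)]) (simp add: vspace_def)

subsection \<open>Smooth functions\<close>

definition inf_weights :: "(nat \<Rightarrow> real) set" where
  "inf_weights = {\<lambda>j. of_bool (j \<le> k) | k. True}"

lemma inf_weightsI: "(\<lambda>j. of_bool (j \<le> k)) \<in> inf_weights"
  by (auto simp: inf_weights_def)

lemma weight_system_inf: "weight_system inf_weights"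
  unfolding weight_system_def
proof (intro conjI ballI allI impI)
  show "0 \<le> w k" if "w \<in> inf_weights" for w k using that by (auto simp: inf_weights_def)
  show "\<exists>w\<in>inf_weights. \<exists>C\<ge>0. \<forall>j k. w1 j * w2 k * K ^ k \<le> C * w (j + k)"
    if w12: "w1 \<in> inf_weights" "w2 \<in> inf_weights" and K: "1 \<le> K" for w1 w2 and K :: real
  proof -
    obtain a b where "w1 = (\<lambda>j. of_bool (j \<le> a))" "w2 = (\<lambda>j. of_bool (j \<le> b))"
      using w12 by (auto simp: inf_weights_def)
    \<comment> \<open>The product vanishes unless \<open>j \<le> a\<close> and
      \<open>k \<le> b\<close>; in that range \<open>j + k \<le> a + b\<close> and
      \<open>K ^ k \<le> K ^ b\<close>.\<close>
    then show ?thesis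
      using K by (intro bexI[OF _ inf_weightsI[of "a + b"]] exI[of _ "K ^ b"])
        (auto simp: of_bool_def intro: power_increasing)
  qed
  show "\<exists>w1\<in>inf_weights. \<exists>w2\<in>inf_weights. \<exists>C\<ge>0. \<forall>j k. w (j + k) \<le> C * (w1 j * w2 k)"
    if w: "w \<in> inf_weights" for w
  proof -
    obtain a where "w = (\<lambda>j. of_bool (j \<le> a))" using w by (auto simp: inf_weights_def)
    then show ?thesis by (intro bexI[OF _ w] exI[of _ 1]) (auto simp: of_bool_def)
  qed
  show "\<exists>w\<in>inf_weights. \<forall>j\<le>J. 0 < w j" for J
    by (intro bexI[OF _ inf_weightsI[of J]]) simp
qed

text \<open>The set of multi-indices of bounded order is itself infinite, since values off the basis
  are arbitrary; only their canonical lists are finite in number. This is why finite sums run over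
  representatives below.\<close>

lemma finite_mi_lists: "finite (mi_list ` {\<alpha> :: 'a::euclidean_space \<Rightarrow> nat. mi_order \<alpha> \<le> k})"
  by (rule finite_subset[OF _ finite_basis_lists[of k]]) (auto simp: basis_lists_def dest: subsetD[OF set_mi_list])

text \<open>\<open>F\<close> selects indices that realise every value of \<open>l\<close> on
  \<open>I\<close>; terms outside \<open>I\<close> carry the coefficient 0.\<close>

lemma SUP_of_bool_le_sum:
  fixes a :: "'i \<Rightarrow> ennreal" and l :: "'i \<Rightarrow> 'l"
  assumes fin: "finite (l ` I)" and eq: "\<And>i j. i \<in> I \<Longrightarrow> j \<in> I \<Longrightarrow> l i = l j \<Longrightarrow> a i = a j"
    and out: "\<And>i. i \<notin> I \<Longrightarrow> c i = 0" "\<And>i. c i \<le> (1 :: ennreal)"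
  obtains F where "finite F" "F \<subseteq> I" "(SUP i. c i * a i) \<le> (\<Sum>i\<in>F. a i)"
proof -
  obtain F where F: "F \<subseteq> I" "l ` F = l ` I" "finite F"
    using finite_subset_image[OF fin subset_refl] by metis
  have "c i * a i \<le> (\<Sum>i\<in>F. a i)" for i
  proof (cases "i \<in> I")
    case True
    then obtain j where j: "j \<in> F" "l i = l j" using F(2) by (metis imageE imageI)
    have "c i * a i \<le> 1 * a j" using eq[OF True, of j] j F(1) out(2) by (intro mult_mono) auto
    also have "\<dots> \<le> (\<Sum>i\<in>F. a i)" using member_le_sum[of j F a] j F(3) by simp
    finally show ?thesis .
  qed (simp add: out)
  then show ?thesis using that[of F] F by (auto intro: SUP_least)
qed

lemma wspace_inf:
  "wspace p inf_weights = {f. smooth_into euclidean f \<and> (\<forall>\<alpha>. eLp_norm p (mi_deriv euclidean \<alpha> f) < \<infinity>)}"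
proof (intro set_eqI iffI; clarify intro!: CollectI)
  fix f :: "'a \<Rightarrow> real"
  {
    assume f: "f \<in> wspace p inf_weights"
    have "eLp_norm p (mi_deriv euclidean \<alpha> f) < \<infinity>" for \<alpha>
    proof -
      have "eLp_norm p (mi_deriv euclidean \<alpha> f) \<le> wnorm (\<lambda>j. of_bool (j \<le> mi_order \<alpha>)) p f"
        using le_wnorm[OF set_mi_list[of \<alpha>], of "\<lambda>j. of_bool (j \<le> mi_order \<alpha>)" p f] by (simp add: mi_deriv_eq_pderivs)
      also have "\<dots> < \<infinity>" using f inf_weightsI by (auto simp: wspace_def)
      finally show ?thesis .
    qed
    then show "smooth_into euclidean f \<and> (\<forall>\<alpha>. eLp_norm p (mi_deriv euclidean \<alpha> f) < \<infinity>)"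
      using f by (simp add: wspace_def)
  }
  {
    assume sm: "smooth_into euclidean f" and fin: "\<forall>\<alpha>. eLp_norm p (mi_deriv euclidean \<alpha> f) < \<infinity>"
    have "wnorm w p f < \<infinity>" if w: "w \<in> inf_weights" for w
    proof -
      obtain k where k: "w = (\<lambda>j. of_bool (j \<le> k))" using w by (auto simp: inf_weights_def)
      obtain F where F: "finite F" "(SUP \<alpha>. ennreal (w (mi_order \<alpha>)) * eLp_norm p (mi_deriv euclidean \<alpha> f)) \<le>
          (\<Sum>\<alpha>\<in>F. eLp_norm p (mi_deriv euclidean \<alpha> f))"
        by (rule SUP_of_bool_le_sum[OF finite_mi_lists[of k], of "\<lambda>\<alpha>. eLp_norm p (mi_deriv euclidean \<alpha> f)"
              "\<lambda>\<alpha>. ennreal (w (mi_order \<alpha>))"])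
          (auto simp: mi_deriv_eq_pderivs k)
      then show ?thesis
        using fin unfolding wnorm_eq_SUP_mi_deriv[OF sm] by (auto simp: ennreal_sum_less_top intro: le_less_trans)
    qed
    then show "f \<in> wspace p inf_weights" using sm by (simp add: wspace_def)
  }
qed

lemma seminorm_on_eLp_norm_mi_deriv:
  fixes V :: "('a::euclidean_space \<Rightarrow> real) set"
  assumes p: "1 \<le> p" and V: "\<And>f. f \<in> V \<Longrightarrow> smooth_into euclidean f \<and> eLp_norm p (mi_deriv euclidean \<alpha> f) < \<infinity>"
  shows "seminorm_on V (\<lambda>f. enn2real (eLp_norm p (mi_deriv euclidean \<alpha> f)))"
  unfolding seminorm_on_def
proof (intro conjI ballI allI)
  have m: "pderivs euclidean (mi_list \<alpha>) f \<in> borel_measurable borel" if "f \<in> V" for f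
    using V that by (intro smooth_borel_measurable) auto
  show "enn2real (eLp_norm p (mi_deriv euclidean \<alpha> (f + g))) \<le>
      enn2real (eLp_norm p (mi_deriv euclidean \<alpha> f)) + enn2real (eLp_norm p (mi_deriv euclidean \<alpha> g))"
    if fg: "f \<in> V" "g \<in> V" for f g
  proof -
    have "eLp_norm p (mi_deriv euclidean \<alpha> (f + g)) \<le>
        eLp_norm p (mi_deriv euclidean \<alpha> f) + eLp_norm p (mi_deriv euclidean \<alpha> g)"
      using eLp_norm_add[OF m[OF fg(1)] m[OF fg(2)] p] smooth_fun_add(2)[of f g "mi_list \<alpha>"] V fg
      by (simp add: mi_deriv_eq_pderivs)
    then have "enn2real (eLp_norm p (mi_deriv euclidean \<alpha> (f + g))) \<le>
        enn2real (eLp_norm p (mi_deriv euclidean \<alpha> f) + eLp_norm p (mi_deriv euclidean \<alpha> g))"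
      using V fg by (intro enn2real_mono) auto
    also have "\<dots> = enn2real (eLp_norm p (mi_deriv euclidean \<alpha> f)) + enn2real (eLp_norm p (mi_deriv euclidean \<alpha> g))"
      using V fg by (intro enn2real_plus) auto
    finally show ?thesis .
  qed
  show "enn2real (eLp_norm p (mi_deriv euclidean \<alpha> (c *\<^sub>R f))) = \<bar>c\<bar> * enn2real (eLp_norm p (mi_deriv euclidean \<alpha> f))"
    if "f \<in> V" for c f
    using eLp_norm_scaleR[OF m[OF that], of p c] smooth_fun_scaleR(2)[of f "mi_list \<alpha>" c] V that p
    by (simp add: mi_deriv_eq_pderivs enn2real_mult)
qed simp

lemma W_inf_eq:
  assumes p: "1 \<le> p"
  shows "(W_inf p :: ('a::euclidean_space \<Rightarrow> real) topology) =
    seminorm_topology (wspace p inf_weights) (wseminorms p inf_weights)"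
  unfolding W_inf_def wspace_inf[symmetric]
proof (rule seminorm_topology_cong[OF _ seminorm_family_wspace[OF p]])
  let ?V = "wspace p inf_weights :: ('a \<Rightarrow> real) set"
  let ?P = "{\<lambda>f::'a \<Rightarrow> real. enn2real (eLp_norm p (mi_deriv euclidean \<alpha> f)) | \<alpha>. True}"
  have fin: "smooth_into euclidean f" "eLp_norm p (mi_deriv euclidean \<alpha> f) < \<infinity>" if "f \<in> ?V" for f \<alpha>
    using that unfolding wspace_inf by auto
  show "seminorm_family ?V ?P"
    unfolding seminorm_family_def
    using subspace_wspace[OF p, of inf_weights] seminorm_on_eLp_norm_mi_deriv[OF p, of ?V] fin by blast
  show "seminorm_dominated ?V (wseminorms p inf_weights) q" if "q \<in> ?P" for q
  proof -
    obtain \<alpha> where q: "q = (\<lambda>f. enn2real (eLp_norm p (mi_deriv euclidean \<alpha> f)))" using \<open>q \<in> ?P\<close> by blast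
    show ?thesis
    proof (rule seminorm_dominated_single[OF wseminormsI[OF inf_weightsI[of "mi_order \<alpha>"]], of 1])
      fix f assume f: "f \<in> ?V"
      have "eLp_norm p (mi_deriv euclidean \<alpha> f) \<le> wnorm (\<lambda>j. of_bool (j \<le> mi_order \<alpha>)) p f"
        using le_wnorm[OF set_mi_list[of \<alpha>], of "\<lambda>j. of_bool (j \<le> mi_order \<alpha>)" p f] by (simp add: mi_deriv_eq_pderivs)
      then show "q f \<le> 1 * enn2real (wnorm (\<lambda>j. of_bool (j \<le> mi_order \<alpha>)) p f)"
        unfolding q using f inf_weightsI by (auto simp: wspace_def intro!: enn2real_mono)
    qed simp
  qed
  show "seminorm_dominated ?V ?P q" if qW: "q \<in> wseminorms p inf_weights" for q
  proof -
    obtain k where q: "q = (\<lambda>f. enn2real (wnorm (\<lambda>j. of_bool (j \<le> k)) p f))" (is "_ = (\<lambda>f. enn2real (wnorm ?w p f))")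
      using qW by (auto simp: wseminorms_def inf_weights_def)
    let ?I = "{\<alpha> :: 'a \<Rightarrow> nat. mi_order \<alpha> \<le> k}"
    obtain F where F: "F \<subseteq> ?I" "mi_list ` F = mi_list ` ?I" "finite F"
      using finite_subset_image[OF finite_mi_lists subset_refl] by metis
    let ?q = "\<lambda>\<alpha> (f :: 'a \<Rightarrow> real). enn2real (eLp_norm p (mi_deriv euclidean \<alpha> f))"
    show ?thesis
    proof (rule seminorm_dominatedI[of "?q ` F" _ "card F"])
      fix f assume f: "f \<in> ?V"
      have "wnorm ?w p f \<le> (\<Sum>\<alpha>\<in>F. eLp_norm p (mi_deriv euclidean \<alpha> f))"
        unfolding wnorm_eq_SUP_mi_deriv[OF fin(1)[OF f]]
      proof (rule SUP_least)
        fix \<alpha> :: "'a \<Rightarrow> nat"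
        show "ennreal (?w (mi_order \<alpha>)) * eLp_norm p (mi_deriv euclidean \<alpha> f) \<le> (\<Sum>\<alpha>\<in>F. eLp_norm p (mi_deriv euclidean \<alpha> f))"
        proof (cases "mi_order \<alpha> \<le> k")
          case True
          then obtain \<beta> where "\<beta> \<in> F" "mi_list \<alpha> = mi_list \<beta>" using F(2) by (metis (mono_tags) imageE imageI mem_Collect_eq)
          then show ?thesis
            using member_le_sum[of \<beta> F "\<lambda>\<alpha>. eLp_norm p (mi_deriv euclidean \<alpha> f)"] F(3) True
            by (simp add: mi_deriv_eq_pderivs)
        qed simp
      qed
      then have "q f \<le> enn2real (\<Sum>\<alpha>\<in>F. eLp_norm p (mi_deriv euclidean \<alpha> f))"
        unfolding q using fin(2)[OF f] by (intro enn2real_mono) (auto simp: ennreal_sum_less_top F(3))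
      also have "\<dots> = (\<Sum>\<alpha>\<in>F. ?q \<alpha> f)" using fin(2)[OF f] by (simp add: enn2real_sum)
      also have "\<dots> \<le> (\<Sum>\<alpha>\<in>F. \<Sum>q\<in>?q ` F. q f)"
        using F(3) by (intro sum_mono member_le_sum) auto
      finally show "q f \<le> card F * (\<Sum>q\<in>?q ` F. q f)" by simp
    qed (use F(3) in auto)
  qed
qed


lemma LW_inf_eq: "LW_inf p X = LW p inf_weights X"
proof -
  have "(\<forall>\<alpha>. eLp_norm p (s \<circ> mi_deriv X \<alpha> f) < \<infinity>) \<longleftrightarrow>
      (\<forall>v\<in>inf_weights. (SUP \<alpha>. ennreal (v (mi_order \<alpha>)) * eLp_norm p (s \<circ> mi_deriv X \<alpha> f)) < \<infinity>)" for s f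
  proof (intro iffI allI ballI)
    fix \<alpha> assume fin: "\<forall>v\<in>inf_weights. (SUP \<alpha>. ennreal (v (mi_order \<alpha>)) * eLp_norm p (s \<circ> mi_deriv X \<alpha> f)) < \<infinity>"
    have "eLp_norm p (s \<circ> mi_deriv X \<alpha> f) \<le>
        (SUP \<beta>. ennreal (of_bool (mi_order \<beta> \<le> mi_order \<alpha>)) * eLp_norm p (s \<circ> mi_deriv X \<beta> f))"
      by (rule SUP_upper2[of \<alpha>]) auto
    also have "\<dots> < \<infinity>" using fin[rule_format, OF inf_weightsI[of "mi_order \<alpha>"]] by simp
    finally show "eLp_norm p (s \<circ> mi_deriv X \<alpha> f) < \<infinity>" .
  next
    fix v assume fin: "\<forall>\<alpha>. eLp_norm p (s \<circ> mi_deriv X \<alpha> f) < \<infinity>" and v: "v \<in> inf_weights"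
    obtain k where k: "v = (\<lambda>j. of_bool (j \<le> k))" using v by (auto simp: inf_weights_def)
    obtain F where F: "finite F" "(SUP \<alpha>. ennreal (v (mi_order \<alpha>)) * eLp_norm p (s \<circ> mi_deriv X \<alpha> f)) \<le>
        (\<Sum>\<alpha>\<in>F. eLp_norm p (s \<circ> mi_deriv X \<alpha> f))"
      by (rule SUP_of_bool_le_sum[OF finite_mi_lists[of k], of "\<lambda>\<alpha>. eLp_norm p (s \<circ> mi_deriv X \<alpha> f)"
            "\<lambda>\<alpha>. ennreal (v (mi_order \<alpha>))"])
        (auto simp: mi_deriv_eq_pderivs k)
    then show "(SUP \<alpha>. ennreal (v (mi_order \<alpha>)) * eLp_norm p (s \<circ> mi_deriv X \<alpha> f)) < \<infinity>"
      using fin by (auto simp: ennreal_sum_less_top intro: le_less_trans)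
  qed
  then show ?thesis unfolding LW_inf_def LW_def by blast
qed

lemma WW_inf_eq:
  fixes p :: real
  assumes p: "1 \<le> p"
  defines "X \<equiv> vec_valued (W_inf p) :: ('b::euclidean_space \<Rightarrow> real ^ 'n) topology"
  shows "(WW_inf p :: ('a::euclidean_space \<Rightarrow> 'b \<Rightarrow> real ^ 'n) topology) =
    seminorm_topology (LW p inf_weights X) (mixed_seminorms p inf_weights X)"
proof -
  note W = weight_system_inf
  have adm: "admissible p inf_weights (wseminorms p inf_weights :: (('b \<Rightarrow> real) \<Rightarrow> real) set)"
    by (rule admissible_wseminorms[OF p])
  have X: "X = seminorm_topology (vspace (wspace p inf_weights)) (vseminorms (wseminorms p inf_weights))"
    unfolding X_def W_inf_eq[OF p] by (rule vec_valued_eq[OF seminorm_family_wspace[OF p]])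
  note ctrl = controlled_vcoord_wseminorms[OF W]
  let ?V = "LW p inf_weights X :: ('a \<Rightarrow> 'b \<Rightarrow> real ^ 'n) set"
  let ?P = "{\<lambda>g::'a \<Rightarrow> 'b \<Rightarrow> real ^ 'n. enn2real (mixed_norm p X \<alpha> \<beta> g) | \<alpha> \<beta>. True}"
  let ?S = "\<lambda>v w (g::'a \<Rightarrow> 'b \<Rightarrow> real ^ 'n). SUP (\<alpha>, \<beta>). ennreal (v (mi_order \<alpha>) * w (mi_order \<beta>)) * mixed_norm p X \<alpha> \<beta> g"
  have fam: "seminorm_family ?V (mixed_seminorms p inf_weights X)" "seminorm_family ?V ?P"
    unfolding X by (rule seminorm_family_LW[OF W p adm ctrl]; assumption)+
  have curry: "\<exists>f\<in>vspace (wspace p inf_weights). g = curry f" if "g \<in> ?V" for g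
    using that LW_eq_curry_image[OF W p adm ctrl] unfolding X by blast
  have fin: "mixed_norm p X \<alpha> \<beta> g < \<infinity>" if g: "g \<in> ?V" for g \<alpha> \<beta>
  proof -
    obtain f where f: "f \<in> vspace (wspace p inf_weights)" "g = curry f" using curry[OF g] by blast
    show ?thesis
      using eLp_norm_mixed_deriv_finite[OF W p adm ctrl f(1)] mixed_norm_curry_eq[OF W p adm ctrl f(1)]
      unfolding X f(2) by simp
  qed
  have finS: "?S v w g < \<infinity>" if g: "g \<in> ?V" and vw: "v \<in> inf_weights" "w \<in> inf_weights" for g v w
  proof -
    obtain f where f: "f \<in> vspace (wspace p inf_weights)" "g = curry f" using curry[OF g] by blast
    show ?thesis
      using mixed_sup_finite[OF W p vw f(1)] mixed_norm_curry_eq[OF W p adm ctrl f(1)]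
      unfolding X f(2) mixed_sup_def by simp
  qed
  have "seminorm_topology ?V ?P = seminorm_topology ?V (mixed_seminorms p inf_weights X)"
  proof (rule seminorm_topology_cong[OF fam(2,1)])
    fix q assume "q \<in> ?P"
    then obtain \<alpha> \<beta> where q: "q = (\<lambda>g. enn2real (mixed_norm p X \<alpha> \<beta> g))" by blast
    let ?v = "\<lambda>j. of_bool (j \<le> mi_order \<alpha>) :: real" and ?w = "\<lambda>j. of_bool (j \<le> mi_order \<beta>) :: real"
    show "seminorm_dominated ?V (mixed_seminorms p inf_weights X) q"
    proof (rule seminorm_dominated_single[of "\<lambda>g. enn2real (?S ?v ?w g)" _ 1])
      show "(\<lambda>g. enn2real (?S ?v ?w g)) \<in> mixed_seminorms p inf_weights X"
        by (intro mixed_seminormsI inf_weightsI)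
      fix g assume g: "g \<in> ?V"
      have "mixed_norm p X \<alpha> \<beta> g \<le> ?S ?v ?w g" by (rule SUP_upper2[of "(\<alpha>, \<beta>)"]) auto
      then show "q g \<le> 1 * enn2real (?S ?v ?w g)"
        unfolding q using finS[OF g inf_weightsI inf_weightsI, of "mi_order \<alpha>" "mi_order \<beta>"]
        by (auto intro!: enn2real_mono)
    qed simp
  next
    fix q :: "('a \<Rightarrow> 'b \<Rightarrow> real ^ 'n) \<Rightarrow> real" assume "q \<in> mixed_seminorms p inf_weights X"
    then obtain a b where q: "q = (\<lambda>g. enn2real (?S (\<lambda>j. of_bool (j \<le> a)) (\<lambda>j. of_bool (j \<le> b)) g))"
      by (auto simp: mixed_seminorms_def inf_weights_def)
    let ?v = "\<lambda>j. of_bool (j \<le> a) :: real" and ?w = "\<lambda>j. of_bool (j \<le> b) :: real"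
    let ?I = "{\<alpha> :: 'a \<Rightarrow> nat. mi_order \<alpha> \<le> a} \<times> {\<beta> :: 'b \<Rightarrow> nat. mi_order \<beta> \<le> b}"
    let ?l = "map_prod mi_list mi_list :: ('a \<Rightarrow> nat) \<times> ('b \<Rightarrow> nat) \<Rightarrow> _"
    have finI: "finite (?l ` ?I)"
      unfolding map_prod_image by (intro finite_cartesian_product finite_mi_lists)
    obtain F where F: "F \<subseteq> ?I" "?l ` F = ?l ` ?I" "finite F"
      using finite_subset_image[OF finI subset_refl] by metis
    let ?q = "\<lambda>i (g :: 'a \<Rightarrow> 'b \<Rightarrow> real ^ 'n). enn2real (mixed_norm p X (fst i) (snd i) g)"
    show "seminorm_dominated ?V ?P q"
    proof (rule seminorm_dominatedI[of "?q ` F" _ "card F"])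
      fix g assume g: "g \<in> ?V"
      have "?S ?v ?w g \<le> (\<Sum>i\<in>F. mixed_norm p X (fst i) (snd i) g)"
      proof (rule SUP_least, clarify)
        fix \<alpha> :: "'a \<Rightarrow> nat" and \<beta> :: "'b \<Rightarrow> nat"
        show "ennreal (?v (mi_order \<alpha>) * ?w (mi_order \<beta>)) * mixed_norm p X \<alpha> \<beta> g \<le>
            (\<Sum>i\<in>F. mixed_norm p X (fst i) (snd i) g)"
        proof (cases "(\<alpha>, \<beta>) \<in> ?I")
          case True
          have "?l (\<alpha>, \<beta>) \<in> ?l ` F" unfolding F(2) by (rule imageI[OF True])
          then obtain i where i: "?l (\<alpha>, \<beta>) = ?l i" "i \<in> F" by (rule imageE)
          have "mixed_norm p X \<alpha> \<beta> g = mixed_norm p X (fst i) (snd i) g"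
            using i(1) by (cases i) (simp add: mixed_norm_def mi_deriv_eq_pderivs)
          then show ?thesis
            using member_le_sum[of i F "\<lambda>i. mixed_norm p X (fst i) (snd i) g"] F(3) i(2) True by simp
        qed auto
      qed
      then have "q g \<le> enn2real (\<Sum>i\<in>F. mixed_norm p X (fst i) (snd i) g)"
        unfolding q using fin[OF g] by (intro enn2real_mono) (auto simp: ennreal_sum_less_top F(3))
      also have "\<dots> = (\<Sum>i\<in>F. ?q i g)" using fin[OF g] by (simp add: enn2real_sum)
      also have "\<dots> \<le> (\<Sum>i\<in>F. \<Sum>q\<in>?q ` F. q g)"
        using F(3) by (intro sum_mono member_le_sum) auto
      finally show "q g \<le> card F * (\<Sum>q\<in>?q ` F. q g)" by simp
    qed (use F(3) in auto)
  qed
  then show ?thesis unfolding WW_inf_def Let_def X_def[symmetric] LW_inf_eq .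
qed

subsection \<open>Weight sequences\<close>

definition ultra_weight :: "(nat \<Rightarrow> real) \<Rightarrow> real \<Rightarrow> nat \<Rightarrow> real" where
  "ultra_weight M \<rho> k = 1 / (\<rho> ^ k * fact k * M k)"

text \<open>Log-convexity makes the quotients \<open>a (Suc k) / a k\<close> increasing. Since
  \<open>a 0 = 1\<close>, \<open>a k\<close> is the product of the first \<open>k\<close> quotients,
  and shifting them by \<open>j\<close> can only enlarge it.\<close>

lemma log_convex_mult_le:
  assumes pos: "\<And>k. 0 < (a k :: real)" and "log_convex a" "a 0 = 1"
  shows "a j * a k \<le> a (j + k)"
proof -
  have step: "a (Suc k) / a k \<le> a (Suc (Suc k)) / a (Suc k)" for k
  proof -
    have "(a (Suc k))\<^sup>2 \<le> a k * a (Suc (Suc k))"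
      using assms(2) unfolding log_convex_def by (metis Suc_eq_plus1 diff_Suc_1 le_add2)
    then show ?thesis using pos[of k] pos[of "Suc k"] by (simp add: field_simps power2_eq_square)
  qed
  have mono: "a (Suc k) / a k \<le> a (Suc (j + k)) / a (j + k)" for j k
    by (induction j) (auto intro: order_trans[OF _ step])
  show ?thesis
  proof (induction k)
    case (Suc k)
    have "a j * a (Suc k) = (a j * a k) * (a (Suc k) / a k)" using pos[of k] by simp
    also have "\<dots> \<le> a (j + k) * (a (Suc (j + k)) / a (j + k))"
      using Suc mono[of k j] pos by (intro mult_mono) (auto simp: less_imp_le)
    also have "\<dots> = a (j + Suc k)" using pos[of "j + k"] by simp
    finally show ?case .
  qed (simp add: assms(3))
qed

text \<open>\<open>A\<close>, \<open>B\<close>, \<open>C\<close> stand for \<open>k! M_k\<close> at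
  \<open>j\<close>, \<open>k\<close> and \<open>j + k\<close>. In \<open>\<rho>\<close>, the minimum
  serves both given radii, \<open>H\<close> pays for moderate growth and \<open>K\<close> for the
  geometric factor.\<close>

lemma ultra_weight_absorb:
  fixes A B C H K \<rho> \<sigma> \<tau> :: real
  assumes pos: "0 < A" "0 < B" "0 < C" and le: "C \<le> H ^ (j + k) * (A * B)"
    and st: "0 < \<sigma>" "0 < \<tau>" and H: "1 \<le> H" and K: "1 \<le> K" and \<rho>: "\<rho> = min \<sigma> \<tau> / (H * K)"
  shows "1 / (\<sigma> ^ j * A) * (1 / (\<tau> ^ k * B)) * K ^ k \<le> 1 / (\<rho> ^ (j + k) * C)"
proof -
  have \<rho>0: "0 < \<rho>" using st H K by (simp add: \<rho>)
  have "\<rho> ^ (j + k) * C * K ^ k \<le> \<rho> ^ (j + k) * (H ^ (j + k) * (A * B)) * K ^ (j + k)"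
  proof (rule mult_mono)
    show "\<rho> ^ (j + k) * C \<le> \<rho> ^ (j + k) * (H ^ (j + k) * (A * B))"
      using \<rho>0 by (intro mult_left_mono[OF le]) simp
    show "K ^ k \<le> K ^ (j + k)" using K by (intro power_increasing) auto
  qed (use \<rho>0 pos H K in auto)
  also have "\<dots> = (min \<sigma> \<tau> ^ j * min \<sigma> \<tau> ^ k) * (A * B)"
    using H K by (simp add: \<rho> power_divide power_mult_distrib power_add)
  also have "\<dots> \<le> (\<sigma> ^ j * \<tau> ^ k) * (A * B)"
    using st pos by (intro mult_right_mono mult_mono power_mono) auto
  finally have le: "\<rho> ^ (j + k) * C * K ^ k \<le> (\<sigma> ^ j * A) * (\<tau> ^ k * B)" by (simp add: mult_ac)
  have "1 / (\<sigma> ^ j * A) * (1 / (\<tau> ^ k * B)) * K ^ k = K ^ k / ((\<sigma> ^ j * A) * (\<tau> ^ k * B))" by simp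
  also have "\<dots> \<le> K ^ k / (\<rho> ^ (j + k) * C * K ^ k)"
    using le \<rho>0 pos K st by (intro divide_left_mono mult_pos_pos) auto
  also have "\<dots> = 1 / (\<rho> ^ (j + k) * C)" using K by simp
  finally show ?thesis .
qed

locale weight_seq =
  fixes M :: "nat \<Rightarrow> real"
  assumes weight_sequence: "weight_sequence M" and convex: "weakly_log_convex M" and growth: "moderate_growth M"
begin

abbreviation N :: "nat \<Rightarrow> real" where "N k \<equiv> fact k * M k"

lemma M_pos: "0 < M k"
  using weight_sequence by (simp add: weight_sequence_def)

lemma N_pos: "0 < N k"
  using M_pos by simp

lemma N_mult_le: "N j * N k \<le> N (j + k)"
  using log_convex_mult_le[of N j k] N_pos convex weight_sequence
  by (simp add: weakly_log_convex_def weight_sequence_def)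

text \<open>\<open>H\<close> is the product of a bound from moderate growth of \<open>M\<close> and
  of 2, which comes from binomial coefficients via
  \<open>(j + k)! \<le> 2 ^ (j + k) * j! * k!\<close>.\<close>

lemma N_add_le:
  obtains H where "1 \<le> H" "\<And>j k. N (j + k) \<le> H ^ (j + k) * (N j * N k)"
proof -
  obtain B where B: "\<And>j k. 1 \<le> j \<Longrightarrow> 1 \<le> k \<Longrightarrow> (M (j + k) / (M j * M k)) powr (1 / real (j + k)) \<le> B"
    using growth unfolding moderate_growth_def bdd_above_def by blast
  \<comment> \<open>Moderate growth covers only \<open>j, k \<ge> 1\<close>. If one index is 0, then
    \<open>M 0 = 1\<close> gives equality, and \<open>A \<ge> 1\<close> suffices.\<close>
  define A where "A = max 1 B"
  have A: "1 \<le> A" by (simp add: A_def)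
  have "M (j + k) \<le> A ^ (j + k) * (M j * M k)" for j k
  proof (cases "1 \<le> j \<and> 1 \<le> k")
    case True
    let ?r = "M (j + k) / (M j * M k)"
    have r: "0 < ?r" using M_pos by simp
    have "?r powr (1 / real (j + k)) \<le> A" using B[of j k] True by (simp add: A_def)
    then have "(?r powr (1 / real (j + k))) ^ (j + k) \<le> A ^ (j + k)"
      by (intro power_mono) auto
    moreover have "(?r powr (1 / real (j + k))) ^ (j + k) = ?r"
    proof -
      have "(x powr (1 / real n)) ^ n = x" if "0 < x" "0 < n" for x :: real and n
        using that by (simp add: powr_realpow[symmetric] powr_powr)
      from this[OF r, of "j + k"] True show ?thesis by simp
    qed
    ultimately show ?thesis using M_pos by (simp add: field_simps)
  next
    case False
    then have "M (j + k) = 1 * (M j * M k)"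
      using weight_sequence by (auto simp: weight_sequence_def not_le)
    also have "\<dots> \<le> A ^ (j + k) * (M j * M k)"
      using A M_pos by (intro mult_right_mono) (auto simp: less_imp_le)
    finally show ?thesis .
  qed
  moreover have "fact (j + k) \<le> 2 ^ (j + k) * (fact j * fact k :: real)" for j k
  proof -
    have "real ((j + k) choose j) \<le> real (2 ^ (j + k))"
      using binomial_le_pow2[of "j + k" j] of_nat_le_iff by blast
    moreover have "fact (j + k) = real ((j + k) choose j) * (fact j * fact k)"
      using binomial_fact[of j "j + k", where 'a=real] by simp
    ultimately show ?thesis by (simp add: mult_right_mono)
  qed
  ultimately have "fact (j + k) * M (j + k) \<le> (2 ^ (j + k) * (fact j * fact k)) * (A ^ (j + k) * (M j * M k))" for j k
    using M_pos A by (intro mult_mono) (auto simp: less_imp_le)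
  then have "N (j + k) \<le> (2 * A) ^ (j + k) * (N j * N k)" for j k
    by (simp add: power_mult_distrib mult_ac)
  with A show ?thesis using that[of "2 * A"] by simp
qed

definition beurling_weights :: "(nat \<Rightarrow> real) set" where
  "beurling_weights = {ultra_weight M \<rho> | \<rho>. 0 < \<rho>}"

lemma ultra_weight_eq: "ultra_weight M \<rho> k = 1 / (\<rho> ^ k * N k)"
  by (simp add: ultra_weight_def mult.assoc)

lemma ultra_weight_pos: "0 < \<rho> \<Longrightarrow> 0 < ultra_weight M \<rho> k"
  using N_pos by (simp add: ultra_weight_eq)

lemma ultra_weight_antimono: "0 < \<rho> \<Longrightarrow> \<rho> \<le> \<sigma> \<Longrightarrow> ultra_weight M \<sigma> k \<le> ultra_weight M \<rho> k"
  unfolding ultra_weight_eq using M_pos[of k]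
  by (intro divide_left_mono mult_right_mono power_mono mult_pos_pos) (auto simp: less_imp_le)

lemma weight_system_beurling: "weight_system beurling_weights"
  unfolding weight_system_def
proof (intro conjI ballI allI impI)
  show "0 \<le> w k" if "w \<in> beurling_weights" for w k
    using that ultra_weight_pos by (auto simp: beurling_weights_def less_imp_le)
  show "\<exists>w\<in>beurling_weights. \<exists>C\<ge>0. \<forall>j k. w1 j * w2 k * K ^ k \<le> C * w (j + k)"
    if w12: "w1 \<in> beurling_weights" "w2 \<in> beurling_weights" and K: "1 \<le> K" for w1 w2 and K :: real
  proof -
    obtain \<sigma> \<tau> where st: "w1 = ultra_weight M \<sigma>" "w2 = ultra_weight M \<tau>" "0 < \<sigma>" "0 < \<tau>"
      using w12 by (auto simp: beurling_weights_def)
    obtain H where H: "1 \<le> H" "\<And>j k. N (j + k) \<le> H ^ (j + k) * (N j * N k)" by (rule N_add_le) blast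
    define \<rho> where "\<rho> = min \<sigma> \<tau> / (H * K)"
    have \<rho>: "0 < \<rho>" using st H K by (simp add: \<rho>_def)
    have "w1 j * w2 k * K ^ k \<le> 1 * ultra_weight M \<rho> (j + k)" for j k
      using ultra_weight_absorb[OF N_pos N_pos N_pos H(2) st(3,4) H(1) K \<rho>_def]
      by (simp add: st ultra_weight_eq)
    then show ?thesis using \<rho> by (intro bexI[of _ "ultra_weight M \<rho>"] exI[of _ 1]) (auto simp: beurling_weights_def)
  qed
  show "\<exists>w1\<in>beurling_weights. \<exists>w2\<in>beurling_weights. \<exists>C\<ge>0. \<forall>j k. w (j + k) \<le> C * (w1 j * w2 k)"
    if w: "w \<in> beurling_weights" for w
  proof -
    obtain \<rho> where \<rho>: "w = ultra_weight M \<rho>" "0 < \<rho>" using w by (auto simp: beurling_weights_def)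
    have "w (j + k) \<le> 1 * (w j * w k)" for j k
    proof -
      have "w (j + k) = 1 / (\<rho> ^ (j + k) * N (j + k))" by (simp add: \<rho> ultra_weight_eq)
      also have "\<dots> \<le> 1 / (\<rho> ^ (j + k) * (N j * N k))"
        using \<rho> N_mult_le[of j k] M_pos by (intro divide_left_mono mult_left_mono mult_pos_pos) auto
      also have "\<dots> = 1 * (w j * w k)" by (simp add: \<rho> ultra_weight_eq power_add)
      finally show ?thesis .
    qed
    then show ?thesis using w by (intro bexI[OF _ w] exI[of _ 1]) auto
  qed
  show "\<exists>w\<in>beurling_weights. \<forall>j\<le>J. 0 < w j" for J
    by (intro bexI[of _ "ultra_weight M 1"]) (auto simp: beurling_weights_def ultra_weight_pos intro!: exI[of _ 1])
qed

lemma ultra_norm_eq_wnorm: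
  assumes "smooth_into euclidean f" "0 < \<rho>"
  shows "ultra_norm M p \<rho> f = wnorm (ultra_weight M \<rho>) p f"
  unfolding ultra_norm_def wnorm_eq_SUP_mi_deriv[OF assms(1)] ultra_weight_def
  using assms(2) M_pos by (intro SUP_cong refl ennreal_divide_eq) simp

text \<open>\<open>ultra_norm\<close> is identified with \<open>wnorm\<close> only on smooth
  functions, where derivatives commute. The generating seminorms are therefore compared on the space
  instead of being equated.\<close>

lemma W_step_eq:
  assumes p: "1 \<le> p" and \<rho>: "0 < \<rho>"
  shows "(W_step M p \<rho> :: ('a::euclidean_space \<Rightarrow> real) topology) = seminorm_topology (wspace p {ultra_weight M \<rho>} :: ('a \<Rightarrow> real) set) (wseminorms p {ultra_weight M \<rho>})"
proof -
  have V: "{f :: 'a \<Rightarrow> real. smooth_into euclidean f \<and> ultra_norm M p \<rho> f < \<infinity>} = (wspace p {ultra_weight M \<rho>} :: ('a \<Rightarrow> real) set)"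
    by (auto simp: wspace_def ultra_norm_eq_wnorm[OF _ \<rho>])
  have eq: "enn2real (ultra_norm M p \<rho> f) = enn2real (wnorm (ultra_weight M \<rho>) p f)"
    if "f \<in> (wspace p {ultra_weight M \<rho>} :: ('a \<Rightarrow> real) set)" for f
    using that by (simp add: wspace_def ultra_norm_eq_wnorm[OF _ \<rho>])
  have fam: "seminorm_family (wspace p {ultra_weight M \<rho>} :: ('a \<Rightarrow> real) set) (wseminorms p {ultra_weight M \<rho>})"
    by (rule seminorm_family_wspace[OF p])
  then have sub: "subspace (wspace p {ultra_weight M \<rho>} :: ('a \<Rightarrow> real) set)"
    and so: "seminorm_on (wspace p {ultra_weight M \<rho>} :: ('a \<Rightarrow> real) set) (\<lambda>f. enn2real (wnorm (ultra_weight M \<rho>) p f))"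
    unfolding seminorm_family_def by (auto simp: wseminorms_def)
  have "seminorm_on (wspace p {ultra_weight M \<rho>} :: ('a \<Rightarrow> real) set) (\<lambda>f. enn2real (ultra_norm M p \<rho> f))"
    using so sub unfolding seminorm_on_def by (simp add: eq subspace_add subspace_scale)
  then have fam': "seminorm_family (wspace p {ultra_weight M \<rho>}) {\<lambda>f :: 'a \<Rightarrow> real. enn2real (ultra_norm M p \<rho> f)}"
    using sub by (simp add: seminorm_family_def)
  show ?thesis
    unfolding W_step_def V
  proof (rule seminorm_topology_cong[OF fam' fam])
    show "seminorm_dominated (wspace p {ultra_weight M \<rho>}) (wseminorms p {ultra_weight M \<rho>}) q"
      if "q \<in> {\<lambda>f :: 'a \<Rightarrow> real. enn2real (ultra_norm M p \<rho> f)}" for q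
      using that eq by (intro seminorm_dominated_single[OF wseminormsI, of "ultra_weight M \<rho>" _ 1]) auto
    show "seminorm_dominated (wspace p {ultra_weight M \<rho>}) {\<lambda>f :: 'a \<Rightarrow> real. enn2real (ultra_norm M p \<rho> f)} q"
      if "q \<in> wseminorms p {ultra_weight M \<rho>}" for q
      using that eq by (intro seminorm_dominated_single[where C = 1, OF singletonI]) (auto simp: wseminorms_def)
  qed
qed

end

subsection \<open>The Beurling case\<close>

lemma setcompr2_cong:
  "(\<And>x y. P x y \<Longrightarrow> f x y = g x y) \<Longrightarrow> {f x y | x y. P x y} = {g x y | x y. P x y}"
  by (auto; metis)

lemma setcompr2_image:
  "{f v w | v w. v \<in> {h x | x. P x} \<and> w \<in> {h x | x. P x}} = {f (h x) (h y) | x y. P x \<and> P y}"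
  by blast

lemma projective_limit_cong:
  "(\<And>i. i \<in> I \<Longrightarrow> X i = Y i) \<Longrightarrow> projective_limit I X = projective_limit I Y"
proof -
  assume eq: "\<And>i. i \<in> I \<Longrightarrow> X i = Y i"
  have "(\<Inter>i\<in>I. topspace (X i)) = (\<Inter>i\<in>I. topspace (Y i))"
    by (rule INF_cong) (simp_all add: eq)
  moreover have "{U \<inter> V | i U. i \<in> I \<and> openin (X i) U} = {U \<inter> V | i U. i \<in> I \<and> openin (Y i) U}" for V
  proof -
    have "i \<in> I \<and> openin (X i) U \<longleftrightarrow> i \<in> I \<and> openin (Y i) U" for i U using eq by auto
    then show ?thesis by (simp only:)
  qed
  ultimately show ?thesis by (simp add: projective_limit_def)
qed

context weight_seq
begin

lemma ex_inverse_le: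
  assumes "0 < (\<rho> :: real)"
  obtains n :: nat where "1 \<le> n" "1 / real n \<le> \<rho>"
proof -
  obtain n where "inverse (real (Suc n)) < \<rho>" using reals_Archimedean[OF assms] by blast
  then show ?thesis using that[of "Suc n"] by (simp add: inverse_eq_divide)
qed

lemma wnorm_ultra_weight_mono:
  "0 < \<rho> \<Longrightarrow> \<rho> \<le> \<sigma> \<Longrightarrow> wnorm (ultra_weight M \<sigma>) p f \<le> wnorm (ultra_weight M \<rho>) p f"
  using wnorm_mono[of 1 "ultra_weight M \<sigma>" "ultra_weight M \<rho>" p f] ultra_weight_antimono by simp

lemma wspace_beurling:
  "(\<Inter>n\<in>{1::nat..}. wspace p {ultra_weight M (1 / real n)}) = wspace p beurling_weights"
proof (intro equalityI subsetI)
  fix f :: "'a \<Rightarrow> real" assume f: "f \<in> (\<Inter>n\<in>{1::nat..}. wspace p {ultra_weight M (1 / real n)})"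
  then have fn: "wnorm (ultra_weight M (1 / real n)) p f < \<infinity>" if "1 \<le> n" for n :: nat
    using that by (simp add: wspace_def)
  have "wnorm (ultra_weight M \<rho>) p f < \<infinity>" if \<rho>: "0 < \<rho>" for \<rho>
  proof -
    obtain n :: nat where n: "1 \<le> n" "1 / real n \<le> \<rho>" by (rule ex_inverse_le[OF \<rho>])
    show ?thesis
      by (rule le_less_trans[OF wnorm_ultra_weight_mono fn[OF n(1)]]) (use n in auto)
  qed
  moreover have "smooth_into euclidean f" using f by (auto simp: wspace_def)
  ultimately show "f \<in> wspace p beurling_weights" by (auto simp: wspace_def beurling_weights_def)
next
  fix f :: "'a \<Rightarrow> real" assume f: "f \<in> wspace p beurling_weights"
  have "ultra_weight M (1 / real n) \<in> beurling_weights" if "1 \<le> n" for n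
    unfolding beurling_weights_def using that by (intro CollectI exI[of _ "1 / real n"]) simp
  then show "f \<in> (\<Inter>n\<in>{1::nat..}. wspace p {ultra_weight M (1 / real n)})"
    using f by (simp add: wspace_def)
qed

lemma W_beurling_eq:
  assumes p: "1 \<le> p"
  shows "(W_beurling M p :: ('a::euclidean_space \<Rightarrow> real) topology) =
    seminorm_topology (wspace p beurling_weights) (wseminorms p beurling_weights)"
proof -
  let ?V = "\<lambda>n::nat. wspace p {ultra_weight M (1 / real n)} :: ('a \<Rightarrow> real) set"
  let ?P = "\<lambda>n::nat. wseminorms p {ultra_weight M (1 / real n)} :: (('a \<Rightarrow> real) \<Rightarrow> real) set"
  have famn: "seminorm_family (?V n) (?P n)" for n by (rule seminorm_family_wspace[OF p])
  have "(W_beurling M p :: ('a \<Rightarrow> real) topology) = projective_limit {1..} (\<lambda>n. seminorm_topology (?V n) (?P n))"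
    unfolding W_beurling_def by (intro projective_limit_cong W_step_eq[OF p]) simp
  also have "\<dots> = seminorm_topology (\<Inter>n\<in>{1..}. ?V n) (\<Union>n\<in>{1..}. ?P n)"
    by (rule projective_limit_seminorm_topology[OF famn]) simp
  also have "\<dots> = seminorm_topology (wspace p beurling_weights) (\<Union>n\<in>{1..}. ?P n)"
    unfolding wspace_beurling ..
  also have "\<dots> = seminorm_topology (wspace p beurling_weights) (wseminorms p beurling_weights)"
  proof (rule seminorm_topology_cong[OF _ seminorm_family_wspace[OF p]])
    have sub: "(\<Union>n\<in>{1..}. ?P n) \<subseteq> wseminorms p beurling_weights"
    proof
      fix q assume "q \<in> (\<Union>n\<in>{1..}. ?P n)"
      then obtain n :: nat where n: "1 \<le> n" "q = (\<lambda>f. enn2real (wnorm (ultra_weight M (1 / real n)) p f))"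
        by (auto simp: wseminorms_def)
      have "ultra_weight M (1 / real n) \<in> beurling_weights"
        unfolding beurling_weights_def using n(1) by (intro CollectI exI[of _ "1 / real n"]) simp
      then show "q \<in> wseminorms p beurling_weights" unfolding n(2) by (rule wseminormsI)
    qed
    then show "seminorm_family (wspace p beurling_weights) (\<Union>n\<in>{1..}. ?P n)"
      using seminorm_family_wspace[OF p, of beurling_weights] unfolding seminorm_family_def by blast
    show "seminorm_dominated (wspace p beurling_weights) (wseminorms p beurling_weights) q"
      if "q \<in> (\<Union>n\<in>{1..}. ?P n)" for q
      using that sub by (intro seminorm_dominated_member) blast
    show "seminorm_dominated (wspace p beurling_weights) (\<Union>n\<in>{1..}. ?P n) q"
      if q: "q \<in> wseminorms p beurling_weights" for q
    proof -
      obtain \<rho> where \<rho>: "0 < \<rho>" "q = (\<lambda>f. enn2real (wnorm (ultra_weight M \<rho>) p f))"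
        using q by (auto simp: wseminorms_def beurling_weights_def)
      obtain n :: nat where n: "1 \<le> n" "1 / real n \<le> \<rho>" by (rule ex_inverse_le[OF \<rho>(1)])
      let ?q = "\<lambda>f :: 'a \<Rightarrow> real. enn2real (wnorm (ultra_weight M (1 / real n)) p f)"
      show ?thesis
      proof (rule seminorm_dominated_single[of ?q _ 1])
        have "?q \<in> ?P n" by (rule wseminormsI) simp
        then show "?q \<in> (\<Union>n\<in>{1..}. ?P n)" using n(1) by blast
        fix f :: "'a \<Rightarrow> real" assume "f \<in> wspace p beurling_weights"
        then have "f \<in> ?V n" using n(1) unfolding wspace_beurling[symmetric] by blast
        then have "wnorm (ultra_weight M (1 / real n)) p f < \<infinity>" by (simp add: wspace_def)
        then show "q f \<le> 1 * ?q f"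
          unfolding \<rho>(2) using wnorm_ultra_weight_mono[of "1 / real n" \<rho> p f] n by (auto intro!: enn2real_mono)
      qed simp
    qed
  qed
  finally show ?thesis .
qed

lemma ultra_seminorm_eq:
  assumes "0 < \<sigma>"
  shows "ultra_seminorm M p X s \<sigma> f =
    (SUP \<alpha>. ennreal (ultra_weight M \<sigma> (mi_order \<alpha>)) * eLp_norm p (s \<circ> mi_deriv X \<alpha> f))"
  unfolding ultra_seminorm_def ultra_weight_def
  using assms M_pos by (intro SUP_cong refl ennreal_divide_eq) simp

lemma LW_beurling_eq: "LW_beurling M p X = LW p beurling_weights X"
  unfolding LW_beurling_def LW_def beurling_weights_def
  by (intro Collect_cong) (auto simp: ultra_seminorm_eq)

lemma WW_beurling_eq:
  "(WW_beurling M p :: ('a::euclidean_space \<Rightarrow> 'b::euclidean_space \<Rightarrow> real ^ 'n) topology) =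
    seminorm_topology (LW p beurling_weights (vec_valued (W_beurling M p)))
      (mixed_seminorms p beurling_weights (vec_valued (W_beurling M p)))"
proof -
  let ?X = "vec_valued (W_beurling M p) :: ('b \<Rightarrow> real ^ 'n) topology"
  have "mixed_norm p ?X \<alpha> \<beta> g / ennreal (\<tau> ^ mi_order \<beta> * \<sigma> ^ mi_order \<alpha> * fact (mi_order \<beta>) * fact (mi_order \<alpha>) *
        M (mi_order \<beta>) * M (mi_order \<alpha>)) =
      ennreal (ultra_weight M \<sigma> (mi_order \<alpha>) * ultra_weight M \<tau> (mi_order \<beta>)) * mixed_norm p ?X \<alpha> \<beta> g"
    if "0 < \<sigma>" "0 < \<tau>" for \<sigma> \<tau> \<alpha> \<beta> and g :: "'a \<Rightarrow> 'b \<Rightarrow> real ^ 'n"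
    using that M_pos by (subst ennreal_divide_eq) (simp_all add: ultra_weight_def mult_ac)
  then have "{\<lambda>g :: 'a \<Rightarrow> 'b \<Rightarrow> real ^ 'n. enn2real (SUP (\<alpha>, \<beta>). mixed_norm p ?X \<alpha> \<beta> g /
        ennreal (\<tau> ^ mi_order \<beta> * \<sigma> ^ mi_order \<alpha> * fact (mi_order \<beta>) * fact (mi_order \<alpha>) *
          M (mi_order \<beta>) * M (mi_order \<alpha>))) | \<sigma> \<tau>. 0 < \<sigma> \<and> 0 < \<tau>} = mixed_seminorms p beurling_weights ?X"
    unfolding mixed_seminorms_def beurling_weights_def setcompr2_image
    by (intro setcompr2_cong) simp
  then show ?thesis unfolding WW_beurling_def Let_def LW_beurling_eq by simp
qed

subsection \<open>The Roumieu case\<close>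

end

section \<open>Rapidly decreasing sequences and geometric bounds\<close>

lemma rapid_sequences_iff:
  "r \<in> rapid_sequences \<longleftrightarrow> (\<forall>k. 0 < r k) \<and> (\<forall>\<sigma>>0. \<exists>C. \<forall>k. r k * \<sigma> ^ k \<le> C)"
proof (intro iffI conjI allI impI)
  fix \<sigma> :: real assume r: "r \<in> rapid_sequences" and \<sigma>: "0 < \<sigma>"
  then have "Bseq (\<lambda>k. r k * \<sigma> ^ k)"
    by (intro convergent_imp_Bseq) (auto simp: rapid_sequences_def convergent_def)
  then obtain C where "\<And>k. norm (r k * \<sigma> ^ k) \<le> C" by (auto simp: Bseq_def)
  then show "\<exists>C. \<forall>k. r k * \<sigma> ^ k \<le> C" by (intro exI[of _ C]) (metis abs_le_D1 real_norm_def)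
next
  assume r: "(\<forall>k. 0 < r k) \<and> (\<forall>\<sigma>>0. \<exists>C. \<forall>k. r k * \<sigma> ^ k \<le> C)"
  have "(\<lambda>k. r k * \<sigma> ^ k) \<longlonglongrightarrow> 0" if \<sigma>: "0 < \<sigma>" for \<sigma>
  proof -
    \<comment> \<open>Boundedness at \<open>2 * \<sigma>\<close> gives decay like
      \<open>(1 / 2) ^ k\<close> at \<open>\<sigma>\<close>.\<close>
    obtain C where C: "\<And>k. r k * (2 * \<sigma>) ^ k \<le> C" using r \<sigma> by (metis mult_pos_pos zero_less_numeral)
    have "(\<lambda>k. C * (1 / 2) ^ k) \<longlonglongrightarrow> C * 0" by (intro tendsto_intros) auto
    then have lim: "(\<lambda>k. C * (1 / 2) ^ k) \<longlonglongrightarrow> 0" by simp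
    show ?thesis
    proof (rule tendsto_sandwich[OF _ _ tendsto_const lim])
      show "\<forall>\<^sub>F k in sequentially. 0 \<le> r k * \<sigma> ^ k" using r \<sigma> by (auto simp: less_imp_le)
      have "r k * \<sigma> ^ k \<le> C * (1 / 2) ^ k" for k
        using mult_right_mono[OF C[of k], of "(1 / 2) ^ k"] by (simp add: power_mult_distrib power_divide)
      then show "\<forall>\<^sub>F k in sequentially. r k * \<sigma> ^ k \<le> C * (1 / 2) ^ k" by simp
    qed
  qed
  then show "r \<in> rapid_sequences" using r by (auto simp: rapid_sequences_def)
qed (auto simp: rapid_sequences_def)

lemma rapid_sequences_bound:
  assumes "r \<in> rapid_sequences" "0 < \<sigma>"
  obtains C where "0 \<le> C" "\<And>k. r k \<le> C * (1 / \<sigma> ^ k)"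
proof -
  obtain C where C: "\<And>k. r k * \<sigma> ^ k \<le> C" using assms unfolding rapid_sequences_iff by blast
  have "0 < r 0" using assms by (simp add: rapid_sequences_iff)
  then have "0 \<le> C" using C[of 0] by simp
  then show ?thesis using that C assms(2) by (simp add: field_simps)
qed

text \<open>Absorption in the Roumieu case needs one sequence that dominates
  \<open>t j * r k\<close> at \<open>j + k\<close> for every splitting; the convolution sum does,
  and rapid decrease tolerates the factor \<open>H ^ n\<close>.\<close>

lemma rapid_sequences_convolution:
  assumes "t \<in> rapid_sequences" "r \<in> rapid_sequences" "0 < H"
  shows "(\<lambda>n. H ^ n * (\<Sum>j\<le>n. t j * r (n - j))) \<in> rapid_sequences"
  unfolding rapid_sequences_iff
proof (intro conjI allI impI)
  have pos: "0 < t k" "0 < r k" for k using assms by (simp_all add: rapid_sequences_iff)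
  show "0 < H ^ n * (\<Sum>j\<le>n. t j * r (n - j))" for n
    using assms(3) pos by (intro mult_pos_pos sum_pos) auto
  fix \<sigma> :: real assume \<sigma>: "0 < \<sigma>"
  \<comment> \<open>\<open>H\<close> and \<open>\<sigma>\<close> cancel the two powers, and the 2
    leaves \<open>2 ^ n\<close> to outweigh the \<open>n + 1\<close> summands of the
    convolution.\<close>
  then have s: "0 < 2 * (H * \<sigma>)" using assms(3) by simp
  obtain C where C: "0 \<le> C" "\<And>k. t k \<le> C * (1 / (2 * (H * \<sigma>)) ^ k)" by (rule rapid_sequences_bound[OF assms(1) s]) blast
  obtain D where D: "0 \<le> D" "\<And>k. r k \<le> D * (1 / (2 * (H * \<sigma>)) ^ k)" by (rule rapid_sequences_bound[OF assms(2) s]) blast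
  have "H ^ n * (\<Sum>j\<le>n. t j * r (n - j)) * \<sigma> ^ n \<le> C * D" for n
  proof -
    have "t j * r (n - j) \<le> C * D * (1 / (2 * (H * \<sigma>)) ^ n)" if j: "j \<le> n" for j
    proof -
      have "t j * r (n - j) \<le> (C * (1 / (2 * (H * \<sigma>)) ^ j)) * (D * (1 / (2 * (H * \<sigma>)) ^ (n - j)))"
        using C D pos s by (intro mult_mono) (auto simp: less_imp_le)
      also have "\<dots> = C * D * (1 / ((2 * (H * \<sigma>)) ^ j * (2 * (H * \<sigma>)) ^ (n - j)))" by simp
      also have "\<dots> = C * D * (1 / (2 * (H * \<sigma>)) ^ n)" using j by (simp only: power_add[symmetric]) simp
      finally show ?thesis .
    qed
    then have "(\<Sum>j\<le>n. t j * r (n - j)) \<le> (\<Sum>j\<le>n. C * D * (1 / (2 * (H * \<sigma>)) ^ n))" by (intro sum_mono) auto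
    then have "H ^ n * (\<Sum>j\<le>n. t j * r (n - j)) * \<sigma> ^ n \<le> H ^ n * (\<Sum>j\<le>n. C * D * (1 / (2 * (H * \<sigma>)) ^ n)) * \<sigma> ^ n"
      using assms(3) \<sigma> by (intro mult_right_mono mult_left_mono) auto
    also have "\<dots> = C * D * (real (Suc n) / 2 ^ n)"
      using assms(3) \<sigma> by (simp add: power_mult_distrib)
    also have "\<dots> \<le> C * D * 1"
    proof (intro mult_left_mono mult_nonneg_nonneg C(1) D(1))
      have "Suc n \<le> 2 ^ n" by (rule Suc_leI[OF less_exp])
      then have "real (Suc n) \<le> 2 ^ n" by (metis of_nat_le_iff of_nat_numeral of_nat_power)
      then show "real (Suc n) / 2 ^ n \<le> 1" by simp
    qed
    finally show ?thesis by simp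
  qed
  then show "\<exists>C. \<forall>n. H ^ n * (\<Sum>j\<le>n. t j * r (n - j)) * \<sigma> ^ n \<le> C" by blast
qed

text \<open>\<open>T\<close> is the least decreasing majorant of \<open>t\<close>. Since
  \<open>t (j + k)\<close> is at most \<open>T j\<close> and at most \<open>T k\<close>, it is at
  most their geometric mean, so \<open>r\<close> is the square root of \<open>T\<close>.\<close>

lemma rapid_sequences_sqrt:
  assumes t: "t \<in> rapid_sequences"
  obtains r where "r \<in> rapid_sequences" "\<And>j k. t (j + k) \<le> r j * r k"
proof -
  have pos: "0 < t k" for k using t by (simp add: rapid_sequences_iff)
  define T where "T j = (SUP n\<in>{j..}. t n)" for j
  obtain B where B: "0 \<le> B" "\<And>k. t k \<le> B * (1 / 1 ^ k)" by (rule rapid_sequences_bound[OF t zero_less_one]) blast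
  have bdd: "bdd_above (t ` {j..})" for j using B(2) by (intro bdd_aboveI[of _ B]) auto
  have le_T: "t n \<le> T j" if "j \<le> n" for j n
    unfolding T_def using that by (intro cSUP_upper bdd) auto
  have T_le: "T j \<le> x" if "\<And>n. j \<le> n \<Longrightarrow> t n \<le> x" for j x
    unfolding T_def using that by (intro cSUP_least) auto
  have T_pos: "0 < T j" for j using le_T[of j j] pos[of j] by simp
  show ?thesis
  proof (rule that)
    show "(\<lambda>j. sqrt (T j)) \<in> rapid_sequences"
      unfolding rapid_sequences_iff
    proof (intro conjI allI impI)
      fix \<sigma> :: real assume \<sigma>: "0 < \<sigma>"
      \<comment> \<open>The square compensates the root in \<open>r\<close>;
        \<open>\<tau> \<ge> 1\<close> makes the bound on \<open>t n\<close> decreasing in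
        \<open>n\<close>, so that it passes to the supremum over the tail.\<close>
      define \<tau> where "\<tau> = max 1 (\<sigma>\<^sup>2)"
      have \<tau>: "1 \<le> \<tau>" "\<sigma>\<^sup>2 \<le> \<tau>" by (simp_all add: \<tau>_def)
      obtain C where C: "0 \<le> C" "\<And>k. t k \<le> C * (1 / \<tau> ^ k)"
        using rapid_sequences_bound[OF t, of \<tau>] \<tau> by auto
      have "sqrt (T j) * \<sigma> ^ j \<le> sqrt C" for j
      proof -
        have "T j \<le> C * (1 / \<tau> ^ j)"
        proof (rule T_le)
          fix n assume "j \<le> n"
          then have "1 / \<tau> ^ n \<le> 1 / \<tau> ^ j" using \<tau>(1) by (intro divide_left_mono power_increasing) auto
          then show "t n \<le> C * (1 / \<tau> ^ j)" using C mult_left_mono order_trans by meson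
        qed
        then have "T j * (\<sigma>\<^sup>2) ^ j \<le> C * (1 / \<tau> ^ j) * \<tau> ^ j"
          using \<tau> C(1) by (intro mult_mono power_mono) auto
        also have "\<dots> = C" using \<tau> by simp
        finally have "sqrt (T j * (\<sigma>\<^sup>2) ^ j) \<le> sqrt C" by (rule real_sqrt_le_mono)
        moreover have "sqrt ((\<sigma>\<^sup>2) ^ j) = \<sigma> ^ j"
        proof -
          have "(\<sigma>\<^sup>2) ^ j = (\<sigma> ^ j)\<^sup>2" by (metis power_mult mult.commute)
          then show ?thesis using \<sigma> by simp
        qed
        ultimately show ?thesis by (simp add: real_sqrt_mult)
      qed
      then show "\<exists>C. \<forall>j. sqrt (T j) * \<sigma> ^ j \<le> C" by blast
    qed (use T_pos in simp)
    show "t (j + k) \<le> sqrt (T j) * sqrt (T k)" for j k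
    proof -
      have "t (j + k) * t (j + k) \<le> T j * T k"
        using pos[of "j + k"] T_pos[of j] by (intro mult_mono le_T) (auto simp: less_imp_le)
      then have "sqrt (t (j + k) * t (j + k)) \<le> sqrt (T j * T k)" by (rule real_sqrt_le_mono)
      then show ?thesis using pos[of "j + k"] by (simp add: real_sqrt_mult)
    qed
  qed
qed

lemma rapid_sequences_inverse_fact: "(\<lambda>k. inverse (fact k)) \<in> rapid_sequences"
  unfolding rapid_sequences_def using summable_LIMSEQ_zero[OF summable_exp] by auto

text \<open>
  If \<open>d n\<close>, the running maximum of the \<open>k\<close>-th roots of \<open>b k\<close>, were unbounded, then
  \<open>t n = d n powr (- n / 2)\<close> would be rapidly decreasing, and boundedness of \<open>t n * b n\<close>
  would give \<open>d n \<le> B * sqrt (d n)\<close>.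
\<close>

lemma geometric_bound_if_rapid:
  fixes b :: "nat \<Rightarrow> real"
  assumes b: "\<And>n. 0 \<le> b n" and rapid: "\<And>t. t \<in> rapid_sequences \<Longrightarrow> \<exists>B. \<forall>n. t n * b n \<le> B"
  obtains m :: nat and C where "1 \<le> m" "0 \<le> C" "\<And>n. b n \<le> C * real m ^ n"
proof -
  define d where "d n = Max (insert 1 ((\<lambda>k. root k (b k)) ` {1..n}))" for n
  have d1: "1 \<le> d n" for n by (simp add: d_def)
  have d_ge: "root k (b k) \<le> d n" if "1 \<le> k" "k \<le> n" for k n
    unfolding d_def using that by (intro Max_ge) auto
  have d_le: "d n \<le> x" if "1 \<le> x" "\<And>k. 1 \<le> k \<Longrightarrow> k \<le> n \<Longrightarrow> root k (b k) \<le> x" for n x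
    unfolding d_def using that by (subst Max_le_iff) auto
  have d_mono: "d k \<le> d n" if "k \<le> n" for k n
    using that d1 d_ge by (intro d_le) auto
  have "\<exists>x. \<forall>n. d n \<le> x"
  proof (rule ccontr)
    assume "\<nexists>x. \<forall>n. d n \<le> x"
    then have unb: "\<exists>n. x < d n" for x by (metis not_less)
    define t where "t n = 1 / sqrt (d n) ^ n" for n
    have sd: "1 \<le> sqrt (d n)" for n using d1 by simp
    have "t \<in> rapid_sequences"
      unfolding rapid_sequences_iff
    proof (intro conjI allI impI)
      show "0 < t n" for n using sd[of n] by (simp add: t_def)
      fix \<sigma> :: real assume \<sigma>: "0 < \<sigma>"
      obtain n0 where n0: "\<sigma>\<^sup>2 < d n0" using unb by blast
      have "t n * \<sigma> ^ n \<le> max 1 (\<sigma> ^ n0)" for n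
      proof (cases "n0 \<le> n")
        case True
        then have "\<sigma>\<^sup>2 \<le> d n" using d_mono[OF True] n0 by simp
        then have "\<sigma> \<le> sqrt (d n)" by (rule real_le_rsqrt)
        then have "\<sigma> ^ n \<le> sqrt (d n) ^ n" using \<sigma> by (intro power_mono) auto
        then have "t n * \<sigma> ^ n \<le> 1" using sd[of n] by (simp add: t_def)
        then show ?thesis by simp
      next
        case False
        have "t n * \<sigma> ^ n \<le> 1 * \<sigma> ^ n"
          using \<sigma> sd[of n] one_le_power[OF sd, of n n] by (intro mult_right_mono) (auto simp: t_def)
        also have "\<dots> \<le> max 1 (\<sigma> ^ n0)"
        proof (cases "1 \<le> \<sigma>")
          case True
          then have "\<sigma> ^ n \<le> \<sigma> ^ n0" using False by (intro power_increasing) auto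
          then show ?thesis by simp
        next
          case False
          then have "\<sigma> ^ n \<le> 1" using \<sigma> by (intro power_le_one) auto
          then show ?thesis by simp
        qed
        finally show ?thesis .
      qed
      then show "\<exists>C. \<forall>k. t k * \<sigma> ^ k \<le> C" by blast
    qed
    from rapid[OF this] obtain B0 where B0: "\<And>n. t n * b n \<le> B0" by blast
    \<comment> \<open>\<open>B \<ge> 1\<close> gives \<open>B \<le> B ^ k\<close> for
      \<open>k \<ge> 1\<close>, so the k-th root below turns this constant into a factor of at most
      \<open>B\<close>.\<close>
    define B where "B = max 1 B0"
    have B: "1 \<le> B" "\<And>n. t n * b n \<le> B" using B0 by (auto simp: B_def le_max_iff_disj)
    have root_le: "root k (b k) \<le> B * sqrt (d k)" if k: "1 \<le> k" for k
    proof -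
      have "b k \<le> B * sqrt (d k) ^ k"
        using B(2)[of k] sd[of k] by (simp add: t_def field_simps)
      also have "\<dots> \<le> B ^ k * sqrt (d k) ^ k"
        using B(1) k sd[of k] by (intro mult_right_mono self_le_power) auto
      also have "\<dots> = (B * sqrt (d k)) ^ k" by (simp add: power_mult_distrib)
      finally have "root k (b k) \<le> root k ((B * sqrt (d k)) ^ k)" using k by simp
      also have "\<dots> = B * sqrt (d k)" using k B(1) sd[of k] by (intro real_root_power_cancel) auto
      finally show ?thesis .
    qed
    have "d n \<le> B\<^sup>2" for n
    proof -
      \<comment> \<open>Monotonicity of \<open>d\<close> carries the bound on each earlier root over
        to \<open>n\<close>; the maximum over \<open>k \<le> n\<close> is \<open>d n\<close>
        itself.\<close>
      have "d n \<le> B * sqrt (d n)"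
      proof (rule d_le)
        show "1 \<le> B * sqrt (d n)" using mult_mono[OF B(1) sd[of n]] B(1) by simp
        fix k assume "1 \<le> k" "k \<le> n"
        have "B * sqrt (d k) \<le> B * sqrt (d n)" using B(1) d_mono[OF \<open>k \<le> n\<close>] by (intro mult_left_mono) auto
        then show "root k (b k) \<le> B * sqrt (d n)" using root_le[OF \<open>1 \<le> k\<close>] by simp
      qed
      then have "sqrt (d n) * sqrt (d n) \<le> B * sqrt (d n)" using d1[of n] by simp
      then have "sqrt (d n) \<le> B" by (rule mult_right_le_imp_le) (use sd[of n] in simp)
      then have "(sqrt (d n))\<^sup>2 \<le> B\<^sup>2" using sd[of n] by (intro power_mono) auto
      then show ?thesis using d1[of n] by simp
    qed
    then show False using unb[of "B\<^sup>2"] by (meson not_less)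
  qed
  then obtain x where x: "\<And>n. d n \<le> x" by blast
  define m where "m = nat \<lceil>max 1 x\<rceil>"
  have m: "1 \<le> m" "x \<le> real m" unfolding m_def by linarith+
  \<comment> \<open>Roots are taken only for \<open>n \<ge> 1\<close>, so \<open>b 0\<close> enters
    through the constant.\<close>
  have "b n \<le> max 1 (b 0) * real m ^ n" for n
  proof (cases "n = 0")
    case False
    then have "root n (b n) \<le> real m" using d_ge[of n n] x[of n] m(2) by simp
    then have "root n (b n) ^ n \<le> real m ^ n" using real_root_ge_zero[OF b] by (intro power_mono)
    then have "b n \<le> 1 * real m ^ n" using False b by simp
    also have "\<dots> \<le> max 1 (b 0) * real m ^ n" by (intro mult_right_mono) auto
    finally show ?thesis .
  qed simp
  then show ?thesis using that m(1) by (metis max.cobounded1 order_trans zero_le_one)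
qed


section \<open>Roumieu weights and the inductive limit\<close>

context weight_seq
begin

definition roumieu_weights :: "(nat \<Rightarrow> real) set" where
  "roumieu_weights = {\<lambda>k. t k / N k | t. t \<in> rapid_sequences}"

lemma roumieu_weightsI: "t \<in> rapid_sequences \<Longrightarrow> (\<lambda>k. t k / N k) \<in> roumieu_weights"
  unfolding roumieu_weights_def by blast

lemma roumieu_weightsE:
  assumes "w \<in> roumieu_weights"
  obtains t where "w = (\<lambda>k. t k / N k)" "t \<in> rapid_sequences" "\<And>k. 0 < t k"
  using assms unfolding roumieu_weights_def rapid_sequences_def by blast

text \<open>Up to a constant, every Roumieu weight lies below every
  \<open>ultra_weight M \<sigma>\<close>; hence its norm is finite and continuous on every step of
  the inductive limit.\<close>

lemma roumieu_weight_le: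
  assumes w: "w \<in> roumieu_weights" and \<sigma>: "0 < \<sigma>"
  obtains C where "0 \<le> C" "\<And>k. w k \<le> C * ultra_weight M \<sigma> k"
proof -
  obtain t where t: "w = (\<lambda>k. t k / N k)" "t \<in> rapid_sequences" "\<And>k. 0 < t k"
    by (rule roumieu_weightsE[OF w]) blast
  obtain C where C: "0 \<le> C" "\<And>k. t k \<le> C * (1 / \<sigma> ^ k)" by (rule rapid_sequences_bound[OF t(2) \<sigma>]) blast
  have "w k \<le> C * ultra_weight M \<sigma> k" for k
  proof -
    have "t k / N k \<le> C * (1 / \<sigma> ^ k) / N k" using C(2) less_imp_le[OF N_pos] by (intro divide_right_mono)
    then show ?thesis by (simp add: t(1) ultra_weight_eq)
  qed
  then show ?thesis using that C(1) by blast
qed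

lemma weight_system_roumieu: "weight_system roumieu_weights"
  unfolding weight_system_def
proof (intro conjI ballI allI impI)
  show "0 \<le> w k" if w: "w \<in> roumieu_weights" for w k
    by (rule roumieu_weightsE[OF w]) (use N_pos in \<open>simp add: less_imp_le\<close>)
  show "\<exists>w\<in>roumieu_weights. \<exists>C\<ge>0. \<forall>j k. w1 j * w2 k * K ^ k \<le> C * w (j + k)"
    if w12: "w1 \<in> roumieu_weights" "w2 \<in> roumieu_weights" and K: "1 \<le> K" for w1 w2 and K :: real
  proof -
    obtain t where t: "w1 = (\<lambda>k. t k / N k)" "t \<in> rapid_sequences" "\<And>k. 0 < t k"
      by (rule roumieu_weightsE[OF w12(1)]) blast
    obtain r where r: "w2 = (\<lambda>k. r k / N k)" "r \<in> rapid_sequences" "\<And>k. 0 < r k"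
      by (rule roumieu_weightsE[OF w12(2)]) blast
    obtain H where H: "1 \<le> H" "\<And>j k. N (j + k) \<le> H ^ (j + k) * (N j * N k)" by (rule N_add_le) blast
    \<comment> \<open>The new weight sees only \<open>n = j + k\<close>, so it sums over all
      splittings; the base takes \<open>H\<close> from moderate growth and \<open>K\<close> from the
      geometric factor.\<close>
    define u where "u n = (H * K) ^ n * (\<Sum>j\<le>n. t j * r (n - j))" for n
    have "0 < H * K" using H(1) K by simp
    then have u: "u \<in> rapid_sequences"
      unfolding u_def[abs_def] by (rule rapid_sequences_convolution[OF t(2) r(2)])
    have "w1 j * w2 k * K ^ k \<le> 1 * (u (j + k) / N (j + k))" for j k
    proof -
      have tr: "t j * r k \<le> (\<Sum>i\<le>j + k. t i * r (j + k - i))"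
        using member_le_sum[of j "{..j + k}" "\<lambda>i. t i * r (j + k - i)"] t(3) r(3) by (simp add: less_imp_le)
      have le: "N (j + k) * K ^ k \<le> (H * K) ^ (j + k) * (N j * N k)"
      proof -
        have "N (j + k) * K ^ k \<le> (H ^ (j + k) * (N j * N k)) * K ^ (j + k)"
        proof (rule mult_mono[OF H(2)])
          show "K ^ k \<le> K ^ (j + k)" using K by (intro power_increasing) auto
        qed (use H(1) K less_imp_le[OF N_pos] in auto)
        then show ?thesis by (simp add: power_mult_distrib mult_ac)
      qed
      have "w1 j * w2 k * K ^ k = (t j * r k) * (K ^ k / (N j * N k))" by (simp add: t(1) r(1))
      also have "\<dots> \<le> (\<Sum>i\<le>j + k. t i * r (j + k - i)) * ((H * K) ^ (j + k) / N (j + k))"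
      proof (rule mult_mono[OF tr])
        have "K ^ k / (N j * N k) = (N (j + k) * K ^ k) / (N (j + k) * (N j * N k))" using M_pos[of "j + k"] by simp
        also have "\<dots> \<le> ((H * K) ^ (j + k) * (N j * N k)) / (N (j + k) * (N j * N k))"
          using le M_pos by (intro divide_right_mono) (auto simp: less_imp_le)
        also have "\<dots> = (H * K) ^ (j + k) / N (j + k)" using M_pos[of j] M_pos[of k] by simp
        finally show "K ^ k / (N j * N k) \<le> (H * K) ^ (j + k) / N (j + k)" .
        show "0 \<le> (\<Sum>i\<le>j + k. t i * r (j + k - i))" using t(3) r(3) by (intro sum_nonneg) (simp add: less_imp_le)
        show "0 \<le> K ^ k / (N j * N k)" using K M_pos by (simp add: less_imp_le)
      qed
      also have "\<dots> = 1 * (u (j + k) / N (j + k))" by (simp add: u_def)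
      finally show ?thesis .
    qed
    then show ?thesis by (intro bexI[OF _ roumieu_weightsI[OF u]] exI[of _ 1]) auto
  qed
  show "\<exists>w1\<in>roumieu_weights. \<exists>w2\<in>roumieu_weights. \<exists>C\<ge>0. \<forall>j k. w (j + k) \<le> C * (w1 j * w2 k)"
    if w: "w \<in> roumieu_weights" for w
  proof -
    obtain t where t: "w = (\<lambda>k. t k / N k)" "t \<in> rapid_sequences" "\<And>k. 0 < t k"
      by (rule roumieu_weightsE[OF w]) blast
    obtain r where r: "r \<in> rapid_sequences" "\<And>j k. t (j + k) \<le> r j * r k"
      by (rule rapid_sequences_sqrt[OF t(2)]) blast
    have "w (j + k) \<le> 1 * (r j / N j * (r k / N k))" for j k
    proof -
      have "w (j + k) \<le> (r j * r k) / (N j * N k)"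
        unfolding t(1) using r(2)[of j k] N_mult_le[of j k] M_pos t(3)[of "j + k"]
        by (intro frac_le) (auto simp: less_imp_le)
      then show ?thesis by simp
    qed
    then show ?thesis
      by (intro bexI[OF _ roumieu_weightsI[OF r(1)]] exI[of _ 1]) auto
  qed
  show "\<exists>w\<in>roumieu_weights. \<forall>j\<le>J. 0 < w j" for J
    using M_pos by (intro bexI[OF _ roumieu_weightsI[OF rapid_sequences_inverse_fact]]) simp
qed

text \<open>
  Uniformity over an index set is what makes this identify not only the Roumieu spaces, but also
  their vector-valued versions and their bounded sets.
\<close>

lemma roumieu_iff_ultra_weight:
  fixes a :: "'i \<Rightarrow> ennreal" and ord :: "'i \<Rightarrow> nat"
  shows "(\<forall>w\<in>roumieu_weights. (SUP i\<in>I. ennreal (w (ord i)) * a i) < \<infinity>) \<longleftrightarrow>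
    (\<exists>m::nat\<ge>1. (SUP i\<in>I. ennreal (ultra_weight M (real m) (ord i)) * a i) < \<infinity>)"
proof
  assume "\<exists>m::nat\<ge>1. (SUP i\<in>I. ennreal (ultra_weight M (real m) (ord i)) * a i) < \<infinity>"
  then obtain m :: nat where m: "1 \<le> m" "(SUP i\<in>I. ennreal (ultra_weight M (real m) (ord i)) * a i) < \<infinity>" by blast
  show "\<forall>w\<in>roumieu_weights. (SUP i\<in>I. ennreal (w (ord i)) * a i) < \<infinity>"
  proof
    fix w assume w: "w \<in> roumieu_weights"
    obtain C where C: "0 \<le> C" "\<And>k. w k \<le> C * ultra_weight M (real m) k"
      by (rule roumieu_weight_le[OF w, of "real m"]) (use m(1) in auto)
    have "ennreal (w (ord i)) * a i \<le> ennreal C * (SUP i\<in>I. ennreal (ultra_weight M (real m) (ord i)) * a i)"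
      if "i \<in> I" for i
    proof -
      have "ennreal (w (ord i)) * a i \<le> ennreal (C * ultra_weight M (real m) (ord i)) * a i"
        by (intro mult_right_mono ennreal_leI C(2)) simp
      also have "\<dots> = ennreal C * (ennreal (ultra_weight M (real m) (ord i)) * a i)"
        using C(1) by (simp add: ennreal_mult' mult.assoc)
      also have "\<dots> \<le> ennreal C * (SUP i\<in>I. ennreal (ultra_weight M (real m) (ord i)) * a i)"
        by (intro mult_left_mono SUP_upper that) simp
      finally show ?thesis .
    qed
    then have "(SUP i\<in>I. ennreal (w (ord i)) * a i) \<le> ennreal C * (SUP i\<in>I. ennreal (ultra_weight M (real m) (ord i)) * a i)"
      by (rule SUP_least)
    also have "\<dots> < \<infinity>" using m(2) by (simp add: ennreal_mult_less_top)
    finally show "(SUP i\<in>I. ennreal (w (ord i)) * a i) < \<infinity>" .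
  qed
next
  assume fin: "\<forall>w\<in>roumieu_weights. (SUP i\<in>I. ennreal (w (ord i)) * a i) < \<infinity>"
  \<comment> \<open>Collecting all terms of the same order reduces the claim to one sequence of
    numbers, to which \<open>geometric_bound_if_rapid\<close> applies.\<close>
  define b where "b n = (SUP i\<in>{i\<in>I. ord i = n}. ennreal (1 / N n) * a i)" for n
  have tb: "ennreal (t n) * b n \<le> (SUP i\<in>I. ennreal (t (ord i) / N (ord i)) * a i)"
    if t: "t \<in> rapid_sequences" for t n
  proof -
    have "0 \<le> t n" using t by (simp add: rapid_sequences_def less_imp_le)
    have "ennreal (t n) * b n = (SUP i\<in>{i\<in>I. ord i = n}. ennreal (t n) * (ennreal (1 / N n) * a i))"
      unfolding b_def by (rule SUP_mult_left_ennreal)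
    also have "\<dots> \<le> (SUP i\<in>I. ennreal (t (ord i) / N (ord i)) * a i)"
    proof (rule SUP_least)
      fix i assume i: "i \<in> {i\<in>I. ord i = n}"
      have "ennreal (t n) * (ennreal (1 / N n) * a i) = ennreal (t (ord i) / N (ord i)) * a i"
        using i \<open>0 \<le> t n\<close> M_pos[of n] by (simp add: mult.assoc[symmetric] ennreal_mult[symmetric] less_imp_le)
      also have "\<dots> \<le> (SUP i\<in>I. ennreal (t (ord i) / N (ord i)) * a i)" using i by (intro SUP_upper) simp
      finally show "ennreal (t n) * (ennreal (1 / N n) * a i) \<le> (SUP i\<in>I. ennreal (t (ord i) / N (ord i)) * a i)" .
    qed
    finally show ?thesis .
  qed
  have fint: "(SUP i\<in>I. ennreal (t (ord i) / N (ord i)) * a i) < \<infinity>" if "t \<in> rapid_sequences" for t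
    using bspec[OF fin roumieu_weightsI[OF that]] by simp
  have bfin: "b n < \<infinity>" for n
  proof -
    have "ennreal (inverse (fact n)) * b n < \<infinity>"
      using tb[OF rapid_sequences_inverse_fact, of n] fint[OF rapid_sequences_inverse_fact] by (rule le_less_trans)
    then show ?thesis by (auto simp: ennreal_mult_less_top)
  qed
  have "\<exists>B. \<forall>n. t n * enn2real (b n) \<le> B" if t: "t \<in> rapid_sequences" for t
  proof (intro exI allI)
    fix n
    have "0 \<le> t n" using t by (simp add: rapid_sequences_def less_imp_le)
    then have "t n * enn2real (b n) = enn2real (ennreal (t n) * b n)" by (simp add: enn2real_mult)
    also have "\<dots> \<le> enn2real (SUP i\<in>I. ennreal (t (ord i) / N (ord i)) * a i)"
      using fint[OF t] by (intro enn2real_mono tb[OF t]) auto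
    finally show "t n * enn2real (b n) \<le> enn2real (SUP i\<in>I. ennreal (t (ord i) / N (ord i)) * a i)" .
  qed
  then obtain m :: nat and C where m: "1 \<le> m" "0 \<le> C" "\<And>n. enn2real (b n) \<le> C * real m ^ n"
    using geometric_bound_if_rapid[of "\<lambda>n. enn2real (b n)"] by (metis enn2real_nonneg)
  have "ennreal (ultra_weight M (real m) (ord i)) * a i \<le> ennreal C" if i: "i \<in> I" for i
  proof -
    let ?n = "ord i"
    have "ennreal (ultra_weight M (real m) ?n) * a i = ennreal (1 / real m ^ ?n) * (ennreal (1 / N ?n) * a i)"
      using M_pos[of ?n] m(1) by (simp add: ultra_weight_eq mult.assoc[symmetric] ennreal_mult[symmetric] less_imp_le)
    also have "\<dots> \<le> ennreal (1 / real m ^ ?n) * b ?n"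
      unfolding b_def using i by (intro mult_left_mono SUP_upper) auto
    also have "\<dots> = ennreal (1 / real m ^ ?n) * ennreal (enn2real (b ?n))"
      using bfin[of ?n] by (simp add: ennreal_enn2real)
    also have "\<dots> \<le> ennreal (1 / real m ^ ?n) * ennreal (C * real m ^ ?n)"
      by (intro mult_left_mono ennreal_leI m(3)) simp
    also have "\<dots> = ennreal C" using m(1,2) by (simp add: ennreal_mult[symmetric])
    finally show ?thesis .
  qed
  then have "(SUP i\<in>I. ennreal (ultra_weight M (real m) (ord i)) * a i) \<le> ennreal C" by (rule SUP_least)
  then have "(SUP i\<in>I. ennreal (ultra_weight M (real m) (ord i)) * a i) < \<infinity>"
    by (rule le_less_trans) simp
  then show "\<exists>m::nat\<ge>1. (SUP i\<in>I. ennreal (ultra_weight M (real m) (ord i)) * a i) < \<infinity>" using m(1) by blast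
qed

lemma wspace_roumieu: "wspace p roumieu_weights = (\<Union>n\<in>{1::nat..}. wspace p {ultra_weight M (real n)})"
proof -
  have "(\<forall>w\<in>roumieu_weights. wnorm w p f < \<infinity>) \<longleftrightarrow> (\<exists>m::nat\<ge>1. wnorm (ultra_weight M (real m)) p f < \<infinity>)"
    for f :: "'a \<Rightarrow> real"
    unfolding wnorm_def by (rule roumieu_iff_ultra_weight)
  then show ?thesis unfolding wspace_def by auto
qed

definition roumieu_seminorms :: "real \<Rightarrow> (('a::euclidean_space \<Rightarrow> real) \<Rightarrow> real) set" where
  "roumieu_seminorms p = {s. seminorm_on (wspace p roumieu_weights) s \<and>
     (\<forall>n\<in>{1::nat..}. continuous_map (W_step M p (real n)) euclideanreal s)}"

lemma W_roumieu_eq: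
  assumes p: "1 \<le> p"
  shows "(W_roumieu M p :: ('a::euclidean_space \<Rightarrow> real) topology) =
    seminorm_topology (wspace p roumieu_weights) (roumieu_seminorms p)"
proof -
  have "(\<Union>n\<in>{1::nat..}. topspace (W_step M p (real n) :: ('a \<Rightarrow> real) topology)) =
      (\<Union>n\<in>{1::nat..}. wspace p {ultra_weight M (real n)})"
    by (intro SUP_cong refl) (simp add: W_step_eq[OF p])
  then have top: "(\<Union>n\<in>{1::nat..}. topspace (W_step M p (real n) :: ('a \<Rightarrow> real) topology)) = wspace p roumieu_weights"
    unfolding wspace_roumieu .
  show ?thesis
    unfolding W_roumieu_def lc_inductive_limit_def Let_def top roumieu_seminorms_def ..
qed

text \<open>A step is a normed space, so continuity of the restriction of \<open>s\<close> amounts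
  to a single inequality.\<close>

lemma roumieu_seminorm_bound:
  assumes p: "1 \<le> p" and s: "s \<in> roumieu_seminorms p" and n: "1 \<le> (n :: nat)"
  obtains C where "0 \<le> C" "\<And>u. u \<in> wspace p {ultra_weight M (real n)} \<Longrightarrow>
    s u \<le> C * enn2real (wnorm (ultra_weight M (real n)) p u)"
proof -
  let ?V = "wspace p {ultra_weight M (real n)} :: ('a \<Rightarrow> real) set"
  let ?q = "\<lambda>u :: 'a \<Rightarrow> real. enn2real (wnorm (ultra_weight M (real n)) p u)"
  have sub: "?V \<subseteq> wspace p roumieu_weights" unfolding wspace_roumieu using n by blast
  have "continuous_seminorm (seminorm_topology ?V (wseminorms p {ultra_weight M (real n)})) s"
    unfolding continuous_seminorm_def
  proof
    show "seminorm_on (topspace (seminorm_topology ?V (wseminorms p {ultra_weight M (real n)}))) s"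
      using s sub by (auto simp: roumieu_seminorms_def intro: seminorm_on_subset)
    have n0: "0 < real n" using n by simp
    have "continuous_map (W_step M p (real n)) euclideanreal s"
      using s n by (auto simp: roumieu_seminorms_def)
    then show "continuous_map (seminorm_topology ?V (wseminorms p {ultra_weight M (real n)})) euclideanreal s"
      unfolding W_step_eq[OF p n0] .
  qed
  from continuous_seminorm_dominated[OF seminorm_family_wspace[OF p] this]
  obtain F C where F: "finite F" "F \<subseteq> {?q}" "0 \<le> C" "\<And>u. u \<in> ?V \<Longrightarrow> s u \<le> C * (\<Sum>q\<in>F. q u)"
    unfolding seminorm_dominated_def wseminorms_def by auto
  have "(\<Sum>q\<in>F. q u) \<le> ?q u" for u
    using F(2) by (cases "F = {}") (auto simp: subset_singleton_iff)
  then have "s u \<le> C * ?q u" if "u \<in> ?V" for u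
    using F(3) F(4)[OF that] mult_left_mono order_trans by meson
  then show ?thesis using that F(3) by blast
qed

lemma wseminorms_subset_roumieu_seminorms:
  assumes p: "1 \<le> p"
  shows "wseminorms p roumieu_weights \<subseteq> (roumieu_seminorms p :: (('a::euclidean_space \<Rightarrow> real) \<Rightarrow> real) set)"
proof
  fix q :: "('a \<Rightarrow> real) \<Rightarrow> real" assume "q \<in> wseminorms p roumieu_weights"
  then obtain w where w: "w \<in> roumieu_weights" "q = (\<lambda>u. enn2real (wnorm w p u))" by (auto simp: wseminorms_def)
  have fin: "wnorm w p u < \<infinity>" if "u \<in> wspace p roumieu_weights" for u :: "'a \<Rightarrow> real"
    using that w(1) by (simp add: wspace_def)
  have q: "seminorm_on (wspace p roumieu_weights) q"
    unfolding w(2) using fin by (intro seminorm_on_wnorm[OF p]) (auto simp: wspace_def)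
  have "continuous_map (W_step M p (real n)) euclideanreal q" if n: "1 \<le> n" for n :: nat
  proof -
    let ?V = "wspace p {ultra_weight M (real n)} :: ('a \<Rightarrow> real) set"
    have n0: "0 < real n" using n by simp
    have sub: "?V \<subseteq> wspace p roumieu_weights" unfolding wspace_roumieu using n by blast
    obtain C where C: "0 \<le> C" "\<And>k. w k \<le> C * ultra_weight M (real n) k"
      by (rule roumieu_weight_le[OF w(1) n0]) blast
    have "continuous_seminorm (seminorm_topology ?V (wseminorms p {ultra_weight M (real n)})) q"
    proof (rule continuous_seminormI[OF seminorm_family_wspace[OF p] seminorm_on_subset[OF q sub]])
      show "seminorm_dominated ?V (wseminorms p {ultra_weight M (real n)}) q"
      proof (rule seminorm_dominated_single[OF wseminormsI[OF singletonI] C(1)])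
        fix u assume u: "u \<in> ?V"
        have "q u \<le> enn2real (ennreal C * wnorm (ultra_weight M (real n)) p u)"
          unfolding w(2) using u by (intro enn2real_mono wnorm_mono C) (simp add: wspace_def ennreal_mult_less_top)
        then show "q u \<le> C * enn2real (wnorm (ultra_weight M (real n)) p u)"
          using C(1) by (simp add: enn2real_mult)
      qed
    qed
    then show ?thesis unfolding W_step_eq[OF p n0] continuous_seminorm_def by blast
  qed
  then show "q \<in> roumieu_seminorms p" using q by (simp add: roumieu_seminorms_def)
qed

lemma admissible_roumieu:
  assumes p: "1 \<le> p"
  shows "admissible p roumieu_weights (roumieu_seminorms p :: (('a::euclidean_space \<Rightarrow> real) \<Rightarrow> real) set)"
  unfolding admissible_def seminorm_family_def
proof (intro conjI ballI)
  show "subspace (wspace p roumieu_weights :: ('a \<Rightarrow> real) set)" by (rule subspace_wspace[OF p])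
next
  fix q :: "('a \<Rightarrow> real) \<Rightarrow> real" assume "q \<in> roumieu_seminorms p"
  then show "seminorm_on (wspace p roumieu_weights) q" by (simp add: roumieu_seminorms_def)
next
  fix w assume "w \<in> roumieu_weights"
  then show "seminorm_dominated (wspace p roumieu_weights) (roumieu_seminorms p) (\<lambda>u :: 'a \<Rightarrow> real. enn2real (wnorm w p u))"
    by (intro seminorm_dominated_member subsetD[OF wseminorms_subset_roumieu_seminorms[OF p]] wseminormsI)
qed

text \<open>\<open>f\<close> lies in some step \<open>m\<close>. On a much larger step
  \<open>n\<close>, the seminorm \<open>s\<close> is bounded by the norm of that step, and
  \<open>v\<close> is bounded by a multiple of \<open>ultra_weight M (real n)\<close>. The product
  of the two weights at \<open>n\<close>, with its geometric factor, is absorbed into the weight at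
  \<open>m\<close>, for which \<open>f\<close> has finite norm. The dependence of \<open>w\<close>
  on \<open>f\<close> is the dependence of \<open>n\<close> on \<open>m\<close>.\<close>

lemma controlled_roumieu:
  assumes p: "1 \<le> p" and f: "f \<in> wspace p roumieu_weights"
  shows "controlled p roumieu_weights (roumieu_seminorms p) f"
  unfolding controlled_def
proof (intro ballI allI impI)
  fix s :: "('b \<Rightarrow> real) \<Rightarrow> real" and K :: real assume s: "s \<in> roumieu_seminorms p" and K: "1 \<le> K"
  obtain m :: nat where m: "1 \<le> m" "wnorm (ultra_weight M (real m)) p f < \<infinity>"
    using f unfolding wspace_roumieu by (auto simp: wspace_def)
  obtain H where H: "1 \<le> H" "\<And>j k. N (j + k) \<le> H ^ (j + k) * (N j * N k)" by (rule N_add_le) blast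
  \<comment> \<open>Absorption divides the radius by \<open>H * K\<close>; this choice keeps the
    quotient at least \<open>m\<close>.\<close>
  define n where "n = nat \<lceil>real m * (H * K)\<rceil>"
  have HK: "1 \<le> H * K" using mult_mono[OF H(1) K] H(1) by simp
  have n: "real m * (H * K) \<le> real n" unfolding n_def by linarith
  have "1 * 1 \<le> real m * (H * K)" using m(1) HK by (intro mult_mono) auto
  then have n1: "1 \<le> n" "0 < real n" using n by linarith+
  obtain C where C: "0 \<le> C" "\<And>u. u \<in> wspace p {ultra_weight M (real n)} \<Longrightarrow>
      s u \<le> C * enn2real (wnorm (ultra_weight M (real n)) p u)"
    by (rule roumieu_seminorm_bound[OF p s n1(1)]) blast
  have "\<exists>w' C'. 0 \<le> C' \<and> wnorm w' p f < \<infinity> \<and> (\<forall>j k. v j * ultra_weight M (real n) k * K ^ k \<le> C' * w' (j + k))"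
    if v: "v \<in> roumieu_weights" for v
  proof -
    obtain D where D: "0 \<le> D" "\<And>k. v k \<le> D * ultra_weight M (real n) k"
      by (rule roumieu_weight_le[OF v n1(2)]) blast
    have "v j * ultra_weight M (real n) k * K ^ k \<le> D * ultra_weight M (real m) (j + k)" for j k
    proof -
      let ?\<rho> = "min (real n) (real n) / (H * K)"
      have "v j * ultra_weight M (real n) k * K ^ k \<le> (D * ultra_weight M (real n) j) * ultra_weight M (real n) k * K ^ k"
        using D(2) less_imp_le[OF ultra_weight_pos[OF n1(2)]] K by (intro mult_right_mono) auto
      also have "\<dots> = D * (ultra_weight M (real n) j * ultra_weight M (real n) k * K ^ k)" by (simp add: mult_ac)
      also have "\<dots> \<le> D * ultra_weight M ?\<rho> (j + k)"
        unfolding ultra_weight_eq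
        by (intro mult_left_mono[OF _ D(1)] ultra_weight_absorb[OF N_pos N_pos N_pos H(2) n1(2) n1(2) H(1) K refl])
      also have "\<dots> \<le> D * ultra_weight M (real m) (j + k)"
        using n m(1) HK by (intro mult_left_mono[OF ultra_weight_antimono D(1)]) (auto simp: field_simps)
      finally show ?thesis .
    qed
    then show ?thesis using D(1) m(2) by blast
  qed
  moreover have "s u \<le> C * enn2real (wnorm (ultra_weight M (real n)) p u)"
    if "u \<in> wspace p roumieu_weights" "wnorm (ultra_weight M (real n)) p u < \<infinity>" for u
    using that by (intro C(2)) (simp add: wspace_def)
  moreover have "0 \<le> ultra_weight M (real n) k" for k using ultra_weight_pos[OF n1(2)] by (rule less_imp_le)
  ultimately show "\<exists>w C. (\<forall>k. 0 \<le> w k) \<and> 0 \<le> C \<and>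
     (\<forall>u\<in>wspace p roumieu_weights. wnorm w p u < \<infinity> \<longrightarrow> s u \<le> C * enn2real (wnorm w p u)) \<and>
     (\<forall>v\<in>roumieu_weights. \<exists>w' C'. 0 \<le> C' \<and> wnorm w' p f < \<infinity> \<and> (\<forall>j k. v j * w k * K ^ k \<le> C' * w' (j + k)))"
    using C(1) by (intro exI[of _ "ultra_weight M (real n)"] exI[of _ C]) blast
qed

text \<open>For a fixed seminorm \<open>s\<close> the equivalence of weights is applied to the
  family of all derivatives; real \<open>\<sigma>\<close> are rounded up to integers because
  \<open>ultra_weight\<close> decreases in its radius.\<close>

lemma LW_roumieu_eq: "LW_roumieu M p X = LW p roumieu_weights X"
proof -
  have "(\<exists>\<sigma>>0. ultra_seminorm M p X s \<sigma> f < \<infinity>) \<longleftrightarrow>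
      (\<forall>v\<in>roumieu_weights. (SUP \<alpha>. ennreal (v (mi_order \<alpha>)) * eLp_norm p (s \<circ> mi_deriv X \<alpha> f)) < \<infinity>)" for s f
    unfolding roumieu_iff_ultra_weight
  proof
    assume "\<exists>m::nat\<ge>1. (SUP \<alpha>. ennreal (ultra_weight M (real m) (mi_order \<alpha>)) * eLp_norm p (s \<circ> mi_deriv X \<alpha> f)) < \<infinity>"
    then obtain m :: nat where m: "1 \<le> m" "(SUP \<alpha>. ennreal (ultra_weight M (real m) (mi_order \<alpha>)) * eLp_norm p (s \<circ> mi_deriv X \<alpha> f)) < \<infinity>"
      by blast
    then show "\<exists>\<sigma>>0. ultra_seminorm M p X s \<sigma> f < \<infinity>"
      by (intro exI[of _ "real m"]) (simp add: ultra_seminorm_eq)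
  next
    assume "\<exists>\<sigma>>0. ultra_seminorm M p X s \<sigma> f < \<infinity>"
    then obtain \<sigma> where \<sigma>: "0 < \<sigma>" "ultra_seminorm M p X s \<sigma> f < \<infinity>" by blast
    define m where "m = nat \<lceil>max 1 \<sigma>\<rceil>"
    have m: "1 \<le> m" "\<sigma> \<le> real m" unfolding m_def by linarith+
    have "(SUP \<alpha>. ennreal (ultra_weight M (real m) (mi_order \<alpha>)) * eLp_norm p (s \<circ> mi_deriv X \<alpha> f)) \<le> ultra_seminorm M p X s \<sigma> f"
      unfolding ultra_seminorm_eq[OF \<sigma>(1)]
      by (intro SUP_mono' mult_right_mono ennreal_leI ultra_weight_antimono \<sigma> m) simp
    with \<sigma>(2) m(1) show "\<exists>m::nat\<ge>1. (SUP \<alpha>. ennreal (ultra_weight M (real m) (mi_order \<alpha>)) * eLp_norm p (s \<circ> mi_deriv X \<alpha> f)) < \<infinity>"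
      by (intro exI[of _ m]) (auto intro: le_less_trans)
  qed
  then show ?thesis unfolding LW_roumieu_def LW_def by blast
qed

lemma WW_roumieu_eq:
  "(WW_roumieu M p :: ('a::euclidean_space \<Rightarrow> 'b::euclidean_space \<Rightarrow> real ^ 'n) topology) =
    seminorm_topology (LW p roumieu_weights (vec_valued (W_roumieu M p)))
      (mixed_seminorms p roumieu_weights (vec_valued (W_roumieu M p)))"
proof -
  let ?X = "vec_valued (W_roumieu M p) :: ('b \<Rightarrow> real ^ 'n) topology"
  have "ennreal (t (mi_order \<beta>) * r (mi_order \<alpha>)) * (mixed_norm p ?X \<alpha> \<beta> g /
          ennreal (fact (mi_order \<beta>) * fact (mi_order \<alpha>) * M (mi_order \<beta>) * M (mi_order \<alpha>))) =
      ennreal (r (mi_order \<alpha>) / N (mi_order \<alpha>) * (t (mi_order \<beta>) / N (mi_order \<beta>))) * mixed_norm p ?X \<alpha> \<beta> g"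
    if "r \<in> rapid_sequences \<and> t \<in> rapid_sequences" for r t \<alpha> \<beta> and g :: "'a \<Rightarrow> 'b \<Rightarrow> real ^ 'n"
  proof -
    let ?d = "fact (mi_order \<beta>) * fact (mi_order \<alpha>) * M (mi_order \<beta>) * M (mi_order \<alpha>)"
    have nonneg: "0 \<le> t (mi_order \<beta>) * r (mi_order \<alpha>)" using that by (simp add: rapid_sequences_def less_imp_le)
    have d: "0 < ?d" using M_pos by simp
    have "ennreal (t (mi_order \<beta>) * r (mi_order \<alpha>)) * (mixed_norm p ?X \<alpha> \<beta> g / ennreal ?d) =
        ennreal (t (mi_order \<beta>) * r (mi_order \<alpha>)) * ennreal (1 / ?d) * mixed_norm p ?X \<alpha> \<beta> g"
      unfolding ennreal_divide_eq[OF d] by (rule mult.assoc[symmetric])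
    also have "ennreal (t (mi_order \<beta>) * r (mi_order \<alpha>)) * ennreal (1 / ?d) =
        ennreal (t (mi_order \<beta>) * r (mi_order \<alpha>) * (1 / ?d))"
      using nonneg d by (intro ennreal_mult[symmetric]) auto
    also have "t (mi_order \<beta>) * r (mi_order \<alpha>) * (1 / ?d) =
        r (mi_order \<alpha>) / N (mi_order \<alpha>) * (t (mi_order \<beta>) / N (mi_order \<beta>))"
      by (simp add: mult_ac)
    finally show ?thesis .
  qed
  then have "{\<lambda>g :: 'a \<Rightarrow> 'b \<Rightarrow> real ^ 'n. enn2real (SUP (\<alpha>, \<beta>). ennreal (t (mi_order \<beta>) * r (mi_order \<alpha>)) *
            (mixed_norm p ?X \<alpha> \<beta> g /
             ennreal (fact (mi_order \<beta>) * fact (mi_order \<alpha>) * M (mi_order \<beta>) * M (mi_order \<alpha>))))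
         | r t. r \<in> rapid_sequences \<and> t \<in> rapid_sequences} = mixed_seminorms p roumieu_weights ?X"
    unfolding mixed_seminorms_def roumieu_weights_def setcompr2_image
    by (intro setcompr2_cong) simp
  then show ?thesis unfolding WW_roumieu_def Let_def LW_roumieu_eq by simp
qed

text \<open>A form of regularity of the inductive limit: a set bounded for all Roumieu weights lies,
  coordinate by coordinate, in a single step and is bounded there, so every seminorm of the limit is
  bounded on it.\<close>

lemma vn_bounded_roumieu_iff:
  fixes B :: "('a::euclidean_space \<Rightarrow> real ^ 'n) set"
  assumes p: "1 \<le> p"
  shows "vn_bounded (vec_valued (W_roumieu M p)) B \<longleftrightarrow>
    vn_bounded (vec_valued (seminorm_topology (wspace p roumieu_weights) (wseminorms p roumieu_weights))) B"
proof -
  have fam: "seminorm_family (wspace p roumieu_weights) (roumieu_seminorms p :: (('a \<Rightarrow> real) \<Rightarrow> real) set)"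
    "seminorm_family (wspace p roumieu_weights) (wseminorms p roumieu_weights :: (('a \<Rightarrow> real) \<Rightarrow> real) set)"
    using admissible_roumieu[OF p] seminorm_family_wspace[OF p] by (auto simp: admissible_def)
  let ?V = "vspace (wspace p roumieu_weights) :: ('a \<Rightarrow> real ^ 'n) set"
  have "(\<forall>q\<in>roumieu_seminorms p. \<forall>i. \<exists>C. \<forall>f\<in>B. q (vcoord i f) \<le> C) \<longleftrightarrow>
      (\<forall>q\<in>wseminorms p roumieu_weights. \<forall>i. \<exists>C. \<forall>f\<in>B. q (vcoord i f) \<le> C)" if B: "B \<subseteq> ?V"
  proof
    assume "\<forall>q\<in>roumieu_seminorms p. \<forall>i. \<exists>C. \<forall>f\<in>B. q (vcoord i f) \<le> C"
    then show "\<forall>q\<in>wseminorms p roumieu_weights. \<forall>i. \<exists>C. \<forall>f\<in>B. q (vcoord i f) \<le> C"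
      using wseminorms_subset_roumieu_seminorms[OF p] by blast
  next
    assume bdd: "\<forall>q\<in>wseminorms p roumieu_weights. \<forall>i. \<exists>C. \<forall>f\<in>B. q (vcoord i f) \<le> C"
    show "\<forall>q\<in>roumieu_seminorms p. \<forall>i. \<exists>C. \<forall>f\<in>B. q (vcoord i f) \<le> C"
    proof (intro ballI allI)
      fix s :: "('a \<Rightarrow> real) \<Rightarrow> real" and i assume s: "s \<in> roumieu_seminorms p"
      \<comment> \<open>Including \<open>B\<close> in the index set yields one \<open>m\<close> for
        all its members.\<close>
      let ?I = "B \<times> {bs :: 'a list. set bs \<subseteq> Basis}"
      let ?a = "\<lambda>(f :: 'a \<Rightarrow> real ^ 'n, bs). eLp_norm p (pderivs euclidean bs (vcoord i f))"
      let ?S = "\<lambda>w. SUP j\<in>?I. ennreal (w (length (snd j))) * ?a j"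
      have "?S w < \<infinity>" if w: "w \<in> roumieu_weights" for w
      proof -
        obtain C where C: "\<And>f. f \<in> B \<Longrightarrow> enn2real (wnorm w p (vcoord i f)) \<le> C"
          using bspec[OF bdd wseminormsI[OF w]] by blast
        have "ennreal (w (length (snd j))) * ?a j \<le> ennreal C" if "j \<in> ?I" for j
        proof -
          obtain f bs where j: "j = (f, bs)" "f \<in> B" "set bs \<subseteq> Basis" using \<open>j \<in> ?I\<close> by blast
          have "ennreal (w (length (snd j))) * ?a j \<le> wnorm w p (vcoord i f)"
            using le_wnorm[OF j(3)] by (simp add: j(1))
          also have "\<dots> = ennreal (enn2real (wnorm w p (vcoord i f)))"
            using vspace_wspaceD(2)[OF subsetD[OF B j(2)] w] by (simp add: ennreal_enn2real)
          also have "\<dots> \<le> ennreal C" by (rule ennreal_leI[OF C[OF j(2)]])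
          finally show ?thesis .
        qed
        then have "?S w \<le> ennreal C" by (rule SUP_least)
        then show ?thesis by (rule le_less_trans) simp
      qed
      then obtain m :: nat where m: "1 \<le> m" "?S (ultra_weight M (real m)) < \<infinity>"
        using roumieu_iff_ultra_weight[where I = ?I and ord = "\<lambda>j. length (snd j)" and a = ?a] by blast
      have le: "wnorm (ultra_weight M (real m)) p (vcoord i f) \<le> ?S (ultra_weight M (real m))" if "f \<in> B" for f
        using that by (intro wnorm_leI SUP_upper2[of "(f, _)"]) auto
      obtain C where C: "0 \<le> C" "\<And>u. u \<in> wspace p {ultra_weight M (real m)} \<Longrightarrow>
          s u \<le> C * enn2real (wnorm (ultra_weight M (real m)) p u)"
        by (rule roumieu_seminorm_bound[OF p s m(1)]) blast
      have "s (vcoord i f) \<le> C * enn2real (?S (ultra_weight M (real m)))" if f: "f \<in> B" for f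
      proof -
        have "vcoord i f \<in> wspace p {ultra_weight M (real m)}"
          using le_less_trans[OF le[OF f] m(2)] vspace_wspaceD(1)[OF subsetD[OF B f]] by (simp add: wspace_def)
        then have "s (vcoord i f) \<le> C * enn2real (wnorm (ultra_weight M (real m)) p (vcoord i f))" by (rule C(2))
        also have "\<dots> \<le> C * enn2real (?S (ultra_weight M (real m)))"
          using m(2) by (intro mult_left_mono[OF enn2real_mono[OF le[OF f]] C(1)]) simp
        finally show ?thesis .
      qed
      then show "\<exists>C. \<forall>f\<in>B. s (vcoord i f) \<le> C" by blast
    qed
  qed
  then show ?thesis
    unfolding W_roumieu_eq[OF p] vec_valued_eq[OF fam(1)] vec_valued_eq[OF fam(2)]
      vn_bounded_seminorm_topology[OF seminorm_family_vspace[OF fam(1)]]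
      vn_bounded_seminorm_topology[OF seminorm_family_vspace[OF fam(2)]] ball_vseminorms
    by blast
qed

section \<open>The exponential law for the three classes\<close>

lemma curry_isomorphism_inf:
  assumes p: "1 \<le> p"
  shows "bornological_isomorphism (vec_valued (W_inf p) :: ('a::euclidean_space \<times> 'b::euclidean_space \<Rightarrow> real ^ 'n) topology)
      (WW_inf p) curry"
    and "homeomorphic_map (vec_valued (W_inf p) :: ('a \<times> 'b \<Rightarrow> real ^ 'n) topology) (WW_inf p) curry"
  unfolding WW_inf_eq[OF p] W_inf_eq[OF p]
  by (intro curry_isomorphism weight_system_inf p admissible_wseminorms[OF p]
        controlled_vcoord_wseminorms[OF weight_system_inf]; assumption)+

lemma curry_isomorphism_beurling:
  assumes p: "1 \<le> p"
  shows "bornological_isomorphism (vec_valued (W_beurling M p) :: ('a::euclidean_space \<times> 'b::euclidean_space \<Rightarrow> real ^ 'n) topology)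
      (WW_beurling M p) curry"
    and "homeomorphic_map (vec_valued (W_beurling M p) :: ('a \<times> 'b \<Rightarrow> real ^ 'n) topology) (WW_beurling M p) curry"
  unfolding WW_beurling_eq W_beurling_eq[OF p]
  by (intro curry_isomorphism weight_system_beurling p admissible_wseminorms[OF p]
        controlled_vcoord_wseminorms[OF weight_system_beurling]; assumption)+

text \<open>\<open>curry_isomorphism\<close> starts from the topology \<open>?T\<close> of the
  weights. It has the same underlying set and the same bounded sets as the inductive limit, and a
  bornological isomorphism is determined by these data and linearity.\<close>

lemma curry_isomorphism_roumieu:
  assumes p: "1 \<le> p"
  shows "bornological_isomorphism (vec_valued (W_roumieu M p) :: ('a::euclidean_space \<times> 'b::euclidean_space \<Rightarrow> real ^ 'n) topology)
    (WW_roumieu M p) curry"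
proof -
  let ?W = roumieu_weights
  let ?T = "vec_valued (seminorm_topology (wspace p ?W) (wseminorms p ?W)) :: ('a \<times> 'b \<Rightarrow> real ^ 'n) topology"
  have ctrl: "controlled p ?W (roumieu_seminorms p) (vcoord i f)"
    if "f \<in> (vspace (wspace p ?W) :: ('a \<times> 'b \<Rightarrow> real ^ 'n) set)" for f i
    using that by (intro controlled_roumieu[OF p]) (simp add: vspace_def)
  have iso: "bornological_isomorphism ?T (WW_roumieu M p) curry"
    unfolding WW_roumieu_eq W_roumieu_eq[OF p]
    by (rule curry_isomorphism(1)[OF weight_system_roumieu p admissible_roumieu[OF p] ctrl])
  have "topspace (vec_valued (W_roumieu M p) :: ('a \<times> 'b \<Rightarrow> real ^ 'n) topology) = topspace ?T"
    by (simp add: topspace_vec_valued W_roumieu_eq[OF p])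
  with iso show ?thesis
    unfolding bornological_isomorphism_def linear_on_space_def vn_bounded_roumieu_iff[OF p] by simp
qed

end

theorem theorem6p10:
  fixes M :: "nat \<Rightarrow> real" and p :: real
  assumes "weight_sequence M" and "weakly_log_convex M" and "moderate_growth M"
    and "1 \<le> p"
  shows
    "bornological_isomorphism
       (vec_valued (W_inf p) :: ((real ^ 'l) \<times> (real ^ 'm) \<Rightarrow> real ^ 'n) topology)
       (WW_inf p) curry \<and>
     homeomorphic_map
       (vec_valued (W_inf p) :: ((real ^ 'l) \<times> (real ^ 'm) \<Rightarrow> real ^ 'n) topology)
       (WW_inf p) curry \<and>
     bornological_isomorphism
       (vec_valued (W_beurling M p) :: ((real ^ 'l) \<times> (real ^ 'm) \<Rightarrow> real ^ 'n) topology)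
       (WW_beurling M p) curry \<and>
     homeomorphic_map
       (vec_valued (W_beurling M p) :: ((real ^ 'l) \<times> (real ^ 'm) \<Rightarrow> real ^ 'n) topology)
       (WW_beurling M p) curry \<and>
     bornological_isomorphism
       (vec_valued (W_roumieu M p) :: ((real ^ 'l) \<times> (real ^ 'm) \<Rightarrow> real ^ 'n) topology)
       (WW_roumieu M p) curry"
proof -
  interpret weight_seq M by unfold_locales (rule assms)+
  show ?thesis
    by (intro conjI curry_isomorphism_inf curry_isomorphism_beurling curry_isomorphism_roumieu assms(4))
qed

end
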